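(* Let $\mathcal C$ be a strong bar category in which every object has a left dual, and let $F:\mathcal C\to\mathbf{Vect}_{\mathbb C}$ be a representable functor of bar categories, with reconstructed Hopf algebra $H$ acting on each $F(X)$, reconstructed antipode $S$ and reconstructed antilinear map $T:H\to H$. Define $*$ by $h^*=T(S^{-1}(h))$. Then for all $a,b,h\in H$: (1) $(ab)^*=b^*a^*$; (2) $a^{**}=a$; (3) $\Delta(h^* )=\Delta(h)^{*\otimes *}$; (4) $S(h)^*=S^{-1}(h^* )$. That is, this $*$ makes $H$ into a $*$-Hopf algebra.
   Context: Monoidal conventions: $\Phi_{X,Y,Z}:(X\otimes Y)\otimes Z\to X\otimes(Y\otimes Z)$, $l_X:X\to X\otimes 1$, $r_X:X\to 1\otimes X$. A bar category is a monoidal category with a functor $X\mapsto\overline X$, a natural isomorphism $\mathrm{bb}_X:X\to\overline{\overline X}$, an invertible $\star:1\to\overline 1$ and a natural isomorphism $\Upsilon_{X,Y}:\overline{X\otimes Y}\to\overline Y\otimes\overline X$ with (a) $(\star^{-1}\otimes\mathrm{id})\Upsilon_{X,1}\overline{l_X}=r_{\overline X}$, $(\mathrm{id}\otimes\star^{-1})\Upsilon_{1,X}\overline{r_X}=l_{\overline X}$; (b) $\Phi_{\overline Z,\overline Y,\overline X}(\Upsilon_{Y,Z}\otimes\mathrm{id})\Upsilon_{X,Y\otimes Z}\overline{\Phi_{X,Y,Z}}=(\mathrm{id}\otimes\Upsilon_{X,Y})\Upsilon_{X\otimes Y,Z}$; (c) $\overline\star\,\star=\mathrm{bb}_1$; (d)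 $\overline{\mathrm{bb}_X}=\mathrm{bb}_{\overline X}$. It is strong if $\Upsilon_{\overline Y,\overline X}\overline{\Upsilon_{X,Y}}\mathrm{bb}_{X\otimes Y}=\mathrm{bb}_X\otimes\mathrm{bb}_Y$. In $\mathbf{Vect}_{\mathbb C}$: $\overline V$ is the conjugate space (elements $\overline v$, $\lambda\overline v=\overline{\overline\lambda v}$), $\mathrm{bb}(v)=\overline{\overline v}$, $\Upsilon(\overline{v\otimes w})=\overline w\otimes\overline v$, $\star$ complex conjugation. A functor of bar categories is a monoidal functor $(F,f)$, $f_{X,Y}:F(X)\otimes F(Y)\to F(X\otimes Y)$, with a natural isomorphism $\mathrm{fb}_Y:\overline{F(Y)}\to F(\overline Y)$ such that $F(\overline 1)=\overline{F(1)}$, $F(\star)=\star$; $F(\mathrm{bb}_Y)=\mathrm{fb}_{\overline Y}\overline{\mathrm{fb}_Y}\mathrm{bb}_{F(Y)}$; $(\mathrm{fb}_Y\otimes\mathrm{fb}_X)\Upsilon_{F(X),F(Y)}\overline{f_{X,Y}^{-1}}=f_{\overline Y,\overline X}^{-1}F(\Upsilon_{X,Y})\mathrm{fb}_{X\otimes Y}$. Left duals: a contravariant functor $X\mapsto X'$ with $\mathrm{ev}^L_X:X'\otimes X\to 1$, $\mathrm{coev}^L_X:1\to X\otimes X'$ obeying the usual zig-zag identities. Then $\mathcal C$ also has right duals $X^\circ=\overline{(\overline X)'}$, with $\mathrm{ev}^R_X:X\otimes X^\circ\to 1$ and $\mathrm{coev}^R_X:1\to X^\circ\otimes X$ given by $\mathrm{ev}^R_X=\star^{-1}\overline{\mathrm{ev}^L_{\overline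 X}}\Upsilon^{-1}(\mathrm{bb}\otimes\mathrm{id})$, $\mathrm{coev}^R_X=(\mathrm{id}\otimes\mathrm{bb}^{-1})\Upsilon\,\overline{\mathrm{coev}^L_{\overline X}}\,\star$. Representable: there is a vector space $H$ with linear maps $\mathrm{Lin}(V,H)$ in natural 1-1 correspondence with natural transformations $V\otimes F\to F$, for every vector space $V$ (where $V\otimes F$ maps $X$ to $V\otimes F(X)$); let $\alpha_X:H\otimes F(X)\to F(X)$, $h\otimes x\mapsto h\triangleright x$, correspond to $\mathrm{id}_H$. Thus $h,h'\in H$ are equal if and only if $h\triangleright$ and $h'\triangleright$ agree on all objects. Reconstructed structure on $H$: product and unit make all $\triangleright$ module actions; the coproduct is reconstructed from $f^{-1}_{X,Y}\circ(h\triangleright)=(h_{(1)}\triangleright\otimes h_{(2)}\triangleright)\circ f^{-1}_{X,Y}$ on $F(X\otimes Y)$; the counit is the action on $F(1)=\mathbb C$; $S(h)\triangleright:F(X)\to F(X)$ is the composite $$F(X)\to F(X\otimes X')\otimes F(X)\to F(X)\otimes F(X')\otimes F(X)\to F(X)\otimes F(X')\otimes F(X)\to F(X)\otimes F(X'\otimes X)\to F(X)$$ of $F(\mathrm{coev}^L_X)\otimes\mathrm{id}$, $f^{-1}\otimes\mathrm{id}$, $\mathrm{id}\otimes h\triangleright\otimes\mathrm{id}$, $\mathrm{id}\otimes f$, $\mathrm{id}\otimes F(\mathrm{ev}^L_X)$. Its inverse $S^{-1}(h)\triangleright$ is the composite of $\mathrm{id}\otimes F(\mathrm{coev}^R_X)$,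 $\mathrm{id}\otimes f^{-1}$, $\mathrm{id}\otimes h\triangleright\otimes\mathrm{id}$ (on $F(X)\otimes F(X^\circ)\otimes F(X)$), $f\otimes\mathrm{id}$, $F(\mathrm{ev}^R_X)\otimes\mathrm{id}$. The antilinear map $T:H\to H$ is determined by $$T(h)\triangleright=\mathrm{bb}^{-1}_{F(X)}\circ\overline{\mathrm{fb}_X^{-1}}\circ\overline{h\triangleright}\circ\overline{\mathrm{fb}_X}\circ\mathrm{bb}_{F(X)}:F(X)\to F(X),$$ where $h\triangleright$ acts on $F(\overline X)$. A $*$-Hopf algebra is a Hopf algebra over $\mathbb C$ with an antilinear order-reversing involution $*$ satisfying $\Delta\circ *=( *\otimes * )\circ\Delta$. *)

theory Defs
  imports Complex_Main "HOL-Algebra.AbelCoset" "HOL-Algebra.Module"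
begin

section \<open>Complex vector spaces\<close>

definition complex_ring :: "complex ring" where
  "complex_ring = \<lparr>carrier = UNIV, mult = times, one = 1, zero = 0, add = (+)\<rparr>"

text \<open>Complex vector spaces are modules over \<^const>\<open>complex_ring\<close>.  The record fields for a
  multiplication and a unit carry no information unless an algebra is meant.\<close>

type_synonym 'v cvs = "(complex, 'v) module"

abbreviation cspace :: "'v cvs \<Rightarrow> bool" where
  "cspace V \<equiv> module complex_ring V"

definition lin :: "'a cvs \<Rightarrow> 'b cvs \<Rightarrow> ('a \<Rightarrow> 'b) set" where
  "lin V W = {g \<in> carrier V \<rightarrow> carrier W.
     (\<forall>x\<in>carrier V. \<forall>y\<in>carrier V. g (x \<oplus>\<^bsub>V\<^esub> y) = g x \<oplus>\<^bsub>W\<^esub> g y) \<and>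
     (\<forall>c. \<forall>x\<in>carrier V. g (c \<odot>\<^bsub>V\<^esub> x) = c \<odot>\<^bsub>W\<^esub> g x)}"

text \<open>Functions that agree on the carrier are the same linear map; \<open>Lin V W\<close> contains exactly one
  function for every linear map.\<close>

definition Lin :: "'a cvs \<Rightarrow> 'b cvs \<Rightarrow> ('a \<Rightarrow> 'b) set" where
  "Lin V W = lin V W \<inter> extensional (carrier V)"

abbreviation inv_on :: "'a cvs \<Rightarrow> ('a \<Rightarrow> 'b) \<Rightarrow> 'b \<Rightarrow> 'a" where
  "inv_on V g \<equiv> inv_into (carrier V) g"

definition cunit :: "complex cvs" where
  "cunit = \<lparr>carrier = UNIV, mult = times, one = 1, zero = 0, add = (+), smult = times\<rparr>"

text \<open>The conjugate space has the same underlying abelian group: the element written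
  \<open>v\<close> with a bar is represented by \<open>v\<close> itself, and only scalar multiplication changes.
  Hence a linear map and its conjugate are the same function, and \<open>bb\<close> is the identity
  function.  An antilinear map from \<open>V\<close> to \<open>W\<close> is an element of \<open>lin V (conj_space W)\<close>.\<close>

definition conj_space :: "'v cvs \<Rightarrow> 'v cvs" where
  "conj_space V = V\<lparr>smult := (\<lambda>c v. cnj c \<odot>\<^bsub>V\<^esub> v)\<rparr>"

definition conj_map :: "('a \<Rightarrow> 'b) \<Rightarrow> 'a \<Rightarrow> 'b" where
  "conj_map g = g"

definition vbb :: "'a \<Rightarrow> 'a" where
  "vbb v = v"

definition vstar :: "complex \<Rightarrow> complex" where
  "vstar z = cnj z"

section \<open>Tensor products\<close>

type_synonym ('a, 'b) tensor = "('a \<times> 'b \<Rightarrow> complex) set"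

definition free_space :: "'s set \<Rightarrow> ('s \<Rightarrow> complex) cvs" where
  "free_space S = \<lparr>carrier = {f. finite {s. f s \<noteq> 0} \<and> {s. f s \<noteq> 0} \<subseteq> S},
     mult = undefined, one = undefined, zero = (\<lambda>_. 0), add = (\<lambda>f g s. f s + g s),
     smult = (\<lambda>c f s. c * f s)\<rparr>"

definition delta :: "'s \<Rightarrow> 's \<Rightarrow> complex" where
  "delta s t = (if t = s then 1 else 0)"

definition tensor_generators :: "'a cvs \<Rightarrow> 'b cvs \<Rightarrow> ('a \<times> 'b \<Rightarrow> complex) set" where
  "tensor_generators V W =
     {(\<lambda>p. delta (v \<oplus>\<^bsub>V\<^esub> v', w) p - delta (v, w) p - delta (v', w) p) | v v' w.
        v \<in> carrier V \<and> v' \<in> carrier V \<and> w \<in> carrier W}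
   \<union> {(\<lambda>p. delta (v, w \<oplus>\<^bsub>W\<^esub> w') p - delta (v, w) p - delta (v, w') p) | v w w'.
        v \<in> carrier V \<and> w \<in> carrier W \<and> w' \<in> carrier W}
   \<union> {(\<lambda>p. delta (c \<odot>\<^bsub>V\<^esub> v, w) p - c * delta (v, w) p) | c v w.
        v \<in> carrier V \<and> w \<in> carrier W}
   \<union> {(\<lambda>p. delta (v, c \<odot>\<^bsub>W\<^esub> w) p - c * delta (v, w) p) | c v w.
        v \<in> carrier V \<and> w \<in> carrier W}"

definition tensor_relations :: "'a cvs \<Rightarrow> 'b cvs \<Rightarrow> ('a \<times> 'b \<Rightarrow> complex) set" where
  "tensor_relations V W = \<Inter>{N. submodule N complex_ring (free_space (carrier V \<times> carrier W)) \<and>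
     tensor_generators V W \<subseteq> N}"

text \<open>In the quotient space, \<open>N <+> (c \<odot>) ` A\<close> is the coset \<open>c A + N\<close>.\<close>

definition tensor :: "'a cvs \<Rightarrow> 'b cvs \<Rightarrow> ('a, 'b) tensor cvs" (infixr \<open>\<otimes>\<^sub>v\<close> 75) where
  "V \<otimes>\<^sub>v W = (let E = free_space (carrier V \<times> carrier W); N = tensor_relations V W in
     \<lparr>carrier = a_rcosets\<^bsub>E\<^esub> N, mult = undefined, one = undefined, zero = N, add = set_add E,
      smult = (\<lambda>c A. N <+>\<^bsub>E\<^esub> (\<lambda>f. c \<odot>\<^bsub>E\<^esub> f) ` A)\<rparr>)"

definition tens :: "'a cvs \<Rightarrow> 'b cvs \<Rightarrow> 'a \<Rightarrow> 'b \<Rightarrow> ('a, 'b) tensor" where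
  "tens V W v w = tensor_relations V W +>\<^bsub>free_space (carrier V \<times> carrier W)\<^esub> delta (v, w)"

lemma complex_ring_simps [simp]:
  "carrier complex_ring = UNIV" "\<zero>\<^bsub>complex_ring\<^esub> = 0" "\<one>\<^bsub>complex_ring\<^esub> = 1"
  "x \<oplus>\<^bsub>complex_ring\<^esub> y = x + y" "x \<otimes>\<^bsub>complex_ring\<^esub> y = x * y"
  by (simp_all add: complex_ring_def)

lemma complex_ring_cring: "cring complex_ring"
proof (rule cringI)
  show "abelian_group complex_ring"
  proof (rule abelian_groupI)
    fix x assume "x \<in> carrier complex_ring"
    show "\<exists>y\<in>carrier complex_ring. y \<oplus>\<^bsub>complex_ring\<^esub> x = \<zero>\<^bsub>complex_ring\<^esub>"
      by (rule bexI[of _ "- x"]) simp_all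
  qed simp_all
  show "comm_monoid complex_ring"
    by (rule comm_monoidI) simp_all
qed (simp add: distrib_right)

lemma cspaceI:
  assumes "abelian_group V"
    and "\<And>c x. x \<in> carrier V \<Longrightarrow> c \<odot>\<^bsub>V\<^esub> x \<in> carrier V"
    and "\<And>a b x. x \<in> carrier V \<Longrightarrow> (a + b) \<odot>\<^bsub>V\<^esub> x = (a \<odot>\<^bsub>V\<^esub> x) \<oplus>\<^bsub>V\<^esub> (b \<odot>\<^bsub>V\<^esub> x)"
    and "\<And>a x y. \<lbrakk>x \<in> carrier V; y \<in> carrier V\<rbrakk> \<Longrightarrow>
      a \<odot>\<^bsub>V\<^esub> (x \<oplus>\<^bsub>V\<^esub> y) = (a \<odot>\<^bsub>V\<^esub> x) \<oplus>\<^bsub>V\<^esub> (a \<odot>\<^bsub>V\<^esub> y)"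
    and "\<And>a b x. x \<in> carrier V \<Longrightarrow> (a * b) \<odot>\<^bsub>V\<^esub> x = a \<odot>\<^bsub>V\<^esub> (b \<odot>\<^bsub>V\<^esub> x)"
    and "\<And>x. x \<in> carrier V \<Longrightarrow> 1 \<odot>\<^bsub>V\<^esub> x = x"
  shows "cspace V"
  by (rule moduleI) (use assms complex_ring_cring in simp_all)

lemma cspaceD:
  assumes "cspace V"
  shows "abelian_group V"
    and "\<And>c x. x \<in> carrier V \<Longrightarrow> c \<odot>\<^bsub>V\<^esub> x \<in> carrier V"
    and "\<And>a b x. x \<in> carrier V \<Longrightarrow> (a + b) \<odot>\<^bsub>V\<^esub> x = (a \<odot>\<^bsub>V\<^esub> x) \<oplus>\<^bsub>V\<^esub> (b \<odot>\<^bsub>V\<^esub> x)"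
    and "\<And>a x y. \<lbrakk>x \<in> carrier V; y \<in> carrier V\<rbrakk> \<Longrightarrow>
      a \<odot>\<^bsub>V\<^esub> (x \<oplus>\<^bsub>V\<^esub> y) = (a \<odot>\<^bsub>V\<^esub> x) \<oplus>\<^bsub>V\<^esub> (a \<odot>\<^bsub>V\<^esub> y)"
    and "\<And>a b x. x \<in> carrier V \<Longrightarrow> (a * b) \<odot>\<^bsub>V\<^esub> x = a \<odot>\<^bsub>V\<^esub> (b \<odot>\<^bsub>V\<^esub> x)"
    and "\<And>x. x \<in> carrier V \<Longrightarrow> 1 \<odot>\<^bsub>V\<^esub> x = x"
proof -
  interpret module complex_ring V by fact
  show "abelian_group V" by (rule M.abelian_group_axioms)
  show "c \<odot>\<^bsub>V\<^esub> x \<in> carrier V" if "x \<in> carrier V" for c x using that by simp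
  show "(a + b) \<odot>\<^bsub>V\<^esub> x = (a \<odot>\<^bsub>V\<^esub> x) \<oplus>\<^bsub>V\<^esub> (b \<odot>\<^bsub>V\<^esub> x)" if "x \<in> carrier V" for a b x
    using smult_l_distr[of a b x] that by simp
  show "a \<odot>\<^bsub>V\<^esub> (x \<oplus>\<^bsub>V\<^esub> y) = (a \<odot>\<^bsub>V\<^esub> x) \<oplus>\<^bsub>V\<^esub> (a \<odot>\<^bsub>V\<^esub> y)"
    if "x \<in> carrier V" "y \<in> carrier V" for a x y
    using smult_r_distr[of a x y] that by simp
  show "(a * b) \<odot>\<^bsub>V\<^esub> x = a \<odot>\<^bsub>V\<^esub> (b \<odot>\<^bsub>V\<^esub> x)" if "x \<in> carrier V" for a b x
    using smult_assoc1[of a b x] that by simp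
  show "1 \<odot>\<^bsub>V\<^esub> x = x" if "x \<in> carrier V" for x using smult_one[of x] that by simp
qed

lemma cspace_cunit: "cspace cunit"
proof (rule cspaceI)
  show "abelian_group cunit"
  proof (rule abelian_groupI)
    fix x assume "x \<in> carrier cunit"
    show "\<exists>y\<in>carrier cunit. y \<oplus>\<^bsub>cunit\<^esub> x = \<zero>\<^bsub>cunit\<^esub>"
      by (rule bexI[of _ "- x"]) (simp_all add: cunit_def)
  qed (simp_all add: cunit_def)
qed (simp_all add: cunit_def algebra_simps)

lemma cspace_conj_space:
  assumes "cspace V" shows "cspace (conj_space V)"
proof (rule cspaceI)
  have "abelian_group V" using assms by (rule cspaceD)
  then show "abelian_group (conj_space V)"
    unfolding abelian_group_def abelian_group_axioms_def abelian_monoid_def conj_space_def by simp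
qed (use cspaceD(2-6)[OF assms] in \<open>simp_all add: conj_space_def\<close>)

lemma free_space_cspace: "cspace (free_space S)"
proof (rule cspaceI)
  have fin: "finite {s. f s + g s \<noteq> (0::complex)} \<and> {s. f s + g s \<noteq> 0} \<subseteq> S"
    if "finite {s. f s \<noteq> 0}" "{s. f s \<noteq> 0} \<subseteq> S" "finite {s. g s \<noteq> 0}" "{s. g s \<noteq> 0} \<subseteq> S" for f g
  proof -
    have sub: "{s. f s + g s \<noteq> 0} \<subseteq> {s. f s \<noteq> 0} \<union> {s. g s \<noteq> 0}" by auto
    then show ?thesis
      using that by (meson finite_UnI finite_subset le_sup_iff order_trans)
  qed
  show "abelian_group (free_space S)"
  proof (rule abelian_groupI)
    fix f assume f: "f \<in> carrier (free_space S)"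
    show "\<exists>g\<in>carrier (free_space S). g \<oplus>\<^bsub>free_space S\<^esub> f = \<zero>\<^bsub>free_space S\<^esub>"
      by (rule bexI[of _ "\<lambda>s. - f s"]) (use f in \<open>simp_all add: free_space_def\<close>)
  qed (use fin in \<open>simp_all add: free_space_def algebra_simps\<close>)
  show "c \<odot>\<^bsub>free_space S\<^esub> f \<in> carrier (free_space S)" if f: "f \<in> carrier (free_space S)" for c f
  proof -
    have sub: "{s. c * f s \<noteq> 0} \<subseteq> {s. f s \<noteq> 0}" by auto
    show ?thesis
      using f sub finite_subset[OF sub] unfolding free_space_def by simp blast
  qed
qed (simp_all add: free_space_def algebra_simps)

lemma quotient_cspace:
  assumes E: "cspace E" and N: "submodule N complex_ring E"
  defines "Q \<equiv> \<lparr>carrier = a_rcosets\<^bsub>E\<^esub> N, mult = undefined, one = undefined, zero = N,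
      add = set_add E, smult = (\<lambda>c A. N <+>\<^bsub>E\<^esub> (\<lambda>f. c \<odot>\<^bsub>E\<^esub> f) ` A)\<rparr> :: ('a set) cvs"
  shows "cspace Q" and "(\<lambda>x. N +>\<^bsub>E\<^esub> x) \<in> lin E Q"
    and "carrier Q = (\<lambda>x. N +>\<^bsub>E\<^esub> x) ` carrier E"
    and "\<And>x y. \<lbrakk>x \<in> carrier E; y \<in> carrier E\<rbrakk> \<Longrightarrow>
      N +>\<^bsub>E\<^esub> x = N +>\<^bsub>E\<^esub> y \<longleftrightarrow> x \<ominus>\<^bsub>E\<^esub> y \<in> N"
proof -
  interpret E: module complex_ring E by fact
  interpret N: submodule N complex_ring E by fact
  interpret S: abelian_subgroup N E
    by (rule abelian_subgroupI3[OF additive_subgroupI[OF N.subgroup_axioms] E.M.abelian_group_axioms])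
  have NE: "N \<subseteq> carrier E" by (rule S.a_subset)
  have memc: "y \<in> N +>\<^bsub>E\<^esub> x \<longleftrightarrow> (\<exists>n\<in>N. y = n \<oplus>\<^bsub>E\<^esub> x)" for x y
    by (auto simp: a_r_coset_def')
  show carrQ: "carrier Q = (\<lambda>x. N +>\<^bsub>E\<^esub> x) ` carrier E"
    by (auto simp: Q_def A_RCOSETS_def')
  have addQ: "(N +>\<^bsub>E\<^esub> x) \<oplus>\<^bsub>Q\<^esub> (N +>\<^bsub>E\<^esub> y) = N +>\<^bsub>E\<^esub> (x \<oplus>\<^bsub>E\<^esub> y)"
    if "x \<in> carrier E" "y \<in> carrier E" for x y
    using S.a_rcos_sum[OF that] by (simp add: Q_def)
  have smQ: "c \<odot>\<^bsub>Q\<^esub> (N +>\<^bsub>E\<^esub> x) = N +>\<^bsub>E\<^esub> (c \<odot>\<^bsub>E\<^esub> x)" if x: "x \<in> carrier E" for c x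
  proof -
    have "c \<odot>\<^bsub>Q\<^esub> (N +>\<^bsub>E\<^esub> x) = {n \<oplus>\<^bsub>E\<^esub> c \<odot>\<^bsub>E\<^esub> (m \<oplus>\<^bsub>E\<^esub> x) | n m. n \<in> N \<and> m \<in> N}"
      by (auto simp: Q_def set_add_def' a_r_coset_def')
    also have "\<dots> = {(n \<oplus>\<^bsub>E\<^esub> c \<odot>\<^bsub>E\<^esub> m) \<oplus>\<^bsub>E\<^esub> c \<odot>\<^bsub>E\<^esub> x | n m. n \<in> N \<and> m \<in> N}"
    proof -
      have "n \<oplus>\<^bsub>E\<^esub> c \<odot>\<^bsub>E\<^esub> (m \<oplus>\<^bsub>E\<^esub> x) = (n \<oplus>\<^bsub>E\<^esub> c \<odot>\<^bsub>E\<^esub> m) \<oplus>\<^bsub>E\<^esub> c \<odot>\<^bsub>E\<^esub> x" if "n \<in> N" "m \<in> N" for n m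
      proof -
        have nm: "n \<in> carrier E" "m \<in> carrier E" using that NE by auto
        show ?thesis
          using nm x cspaceD(2,4)[OF E] by (simp add: E.M.a_assoc)
      qed
      then show ?thesis by (intro Collect_cong) metis
    qed
    also have "\<dots> = N +>\<^bsub>E\<^esub> (c \<odot>\<^bsub>E\<^esub> x)"
    proof -
      have "n \<oplus>\<^bsub>E\<^esub> c \<odot>\<^bsub>E\<^esub> m \<in> N" if "n \<in> N" "m \<in> N" for n m
        using that by (simp add: S.a_closed)
      moreover have "n = n \<oplus>\<^bsub>E\<^esub> c \<odot>\<^bsub>E\<^esub> \<zero>\<^bsub>E\<^esub>" if "n \<in> N" for n
        using that NE by (simp add: subsetD)
      ultimately show ?thesis
        unfolding a_r_coset_def' using S.zero_closed by (auto; metis)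
    qed
    finally show ?thesis .
  qed
  have zeroQ: "\<zero>\<^bsub>Q\<^esub> = N +>\<^bsub>E\<^esub> \<zero>\<^bsub>E\<^esub>"
    using E.M.a_coset_add_zero[OF NE] by (simp add: Q_def)
  have "abelian_group Q"
  proof (rule abelian_groupI)
    fix A assume "A \<in> carrier Q"
    then obtain x where x: "x \<in> carrier E" "A = N +>\<^bsub>E\<^esub> x" by (auto simp: carrQ)
    show "\<exists>B\<in>carrier Q. B \<oplus>\<^bsub>Q\<^esub> A = \<zero>\<^bsub>Q\<^esub>"
      by (rule bexI[of _ "N +>\<^bsub>E\<^esub> (\<ominus>\<^bsub>E\<^esub> x)"])
        (use x in \<open>auto simp: addQ zeroQ E.M.l_neg carrQ\<close>)
  qed (auto simp: carrQ addQ zeroQ E.M.a_ac)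
  then show "cspace Q"
    using cspaceD(2-6)[OF E] by (intro cspaceI) (auto simp: carrQ addQ smQ)
  show "(\<lambda>x. N +>\<^bsub>E\<^esub> x) \<in> lin E Q"
    by (auto simp: lin_def carrQ addQ smQ)
  show "N +>\<^bsub>E\<^esub> x = N +>\<^bsub>E\<^esub> y \<longleftrightarrow> x \<ominus>\<^bsub>E\<^esub> y \<in> N" if xy: "x \<in> carrier E" "y \<in> carrier E" for x y
    using S.a_rcos_module[OF xy(2,1)] S.a_repr_independenceD[OF xy(1), of y]
      S.a_repr_independence'[of x y] xy
    unfolding a_minus_def by metis
qed

lemma delta_carrier: "s \<in> S \<Longrightarrow> delta s \<in> carrier (free_space S)"
  by (simp add: free_space_def delta_def)

lemma tensor_generators_carrier:
  assumes "cspace V" "cspace W"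
  shows "tensor_generators V W \<subseteq> carrier (free_space (carrier V \<times> carrier W))"
proof -
  interpret V: module complex_ring V by fact
  interpret W: module complex_ring W by fact
  have 3: "(\<lambda>p. delta a p - delta b p - delta c p) \<in> carrier (free_space S)"
    if "a \<in> S" "b \<in> S" "c \<in> S" for a b c :: "'a \<times> 'b" and S
  proof -
    have "{p. delta a p - delta b p - delta c p \<noteq> 0} \<subseteq> {a, b, c}" by (auto simp: delta_def)
    then have "finite {p. delta a p - delta b p - delta c p \<noteq> 0} \<and>
        {p. delta a p - delta b p - delta c p \<noteq> 0} \<subseteq> S"
      using that by (meson finite.simps empty_subsetI insert_subset finite_subset order_trans)
    then show ?thesis by (simp add: free_space_def)
  qed
  have 2: "(\<lambda>p. delta a p - k * delta b p) \<in> carrier (free_space S)"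
    if "a \<in> S" "b \<in> S" for a b :: "'a \<times> 'b" and k S
  proof -
    have "{p. delta a p - k * delta b p \<noteq> 0} \<subseteq> {a, b}" by (auto simp: delta_def)
    then have "finite {p. delta a p - k * delta b p \<noteq> 0} \<and> {p. delta a p - k * delta b p \<noteq> 0} \<subseteq> S"
      using that by (meson finite.simps empty_subsetI insert_subset finite_subset order_trans)
    then show ?thesis by (simp add: free_space_def)
  qed
  show ?thesis
    using cspaceD(2)[OF assms(1)] cspaceD(2)[OF assms(2)]
    unfolding tensor_generators_def by (auto intro!: 2 3)
qed

lemma tensor_relations_submodule:
  assumes "cspace V" "cspace W"
  shows "submodule (tensor_relations V W) complex_ring (free_space (carrier V \<times> carrier W))"
    and "tensor_generators V W \<subseteq> tensor_relations V W"
proof -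
  let ?E = "free_space (carrier V \<times> carrier W)"
  let ?NN = "{N. submodule N complex_ring ?E \<and> tensor_generators V W \<subseteq> N}"
  interpret E: module complex_ring ?E by (rule free_space_cspace)
  have ne: "carrier ?E \<in> ?NN"
    using E.carrier_is_submodule tensor_generators_carrier[OF assms] by blast
  note D = E.submoduleE
  show "submodule (tensor_relations V W) complex_ring ?E"
  proof (rule E.submoduleI)
    show "tensor_relations V W \<subseteq> carrier ?E"
      unfolding tensor_relations_def using ne by blast
    have "\<zero>\<^bsub>?E\<^esub> \<in> N" if N: "submodule N complex_ring ?E" for N
      using subgroup.one_closed[OF submodule.axioms(1)[OF N]] by simp
    then show "\<zero>\<^bsub>?E\<^esub> \<in> tensor_relations V W"
      unfolding tensor_relations_def by blast
  qed (use D in \<open>auto simp: tensor_relations_def\<close>)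
  show "tensor_generators V W \<subseteq> tensor_relations V W"
    unfolding tensor_relations_def by blast
qed

lemma free_space_simps [simp]:
  "\<zero>\<^bsub>free_space S\<^esub> = (\<lambda>_. 0)" "f \<oplus>\<^bsub>free_space S\<^esub> g = (\<lambda>s. f s + g s)"
  "c \<odot>\<^bsub>free_space S\<^esub> f = (\<lambda>s. c * f s)"
  by (simp_all add: free_space_def)

lemma free_space_minus:
  assumes "f \<in> carrier (free_space S)" "g \<in> carrier (free_space S)"
  shows "f \<ominus>\<^bsub>free_space S\<^esub> g = (\<lambda>s. f s - g s)"
proof -
  interpret module complex_ring "free_space S" by (rule free_space_cspace)
  have g: "(\<lambda>s. - g s) \<in> carrier (free_space S)"
    using assms(2) by (simp add: free_space_def)
  have "\<ominus>\<^bsub>free_space S\<^esub> g = (\<lambda>s. - g s)"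
    by (rule M.minus_equality) (use g assms in simp_all)
  then show ?thesis by (simp add: a_minus_def)
qed

lemma cspace_tensor:
  assumes "cspace V" "cspace W" shows "cspace (V \<otimes>\<^sub>v W)"
  unfolding tensor_def Let_def
  by (rule quotient_cspace(1)[OF free_space_cspace tensor_relations_submodule(1)[OF assms]])

lemma tensor_proj:
  assumes "cspace V" "cspace W"
  defines "E \<equiv> free_space (carrier V \<times> carrier W)"
  shows "(\<lambda>x. tensor_relations V W +>\<^bsub>E\<^esub> x) \<in> lin E (V \<otimes>\<^sub>v W)"
    and "carrier (V \<otimes>\<^sub>v W) = (\<lambda>x. tensor_relations V W +>\<^bsub>E\<^esub> x) ` carrier E"
    and "\<And>x y. \<lbrakk>x \<in> carrier E; y \<in> carrier E\<rbrakk> \<Longrightarrow> tensor_relations V W +>\<^bsub>E\<^esub> x =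
      tensor_relations V W +>\<^bsub>E\<^esub> y \<longleftrightarrow> (\<lambda>s. x s - y s) \<in> tensor_relations V W"
  unfolding tensor_def Let_def E_def
  using quotient_cspace(2-4)[OF free_space_cspace tensor_relations_submodule(1)[OF assms(1,2)]]
  by (simp_all add: free_space_minus)

lemma tens_closed:
  assumes "cspace V" "cspace W" "v \<in> carrier V" "w \<in> carrier W"
  shows "tens V W v w \<in> carrier (V \<otimes>\<^sub>v W)"
  unfolding tensor_proj(2)[OF assms(1,2)] tens_def
  by (rule imageI, rule delta_carrier) (use assms in simp)

lemma tens_bilinear:
  assumes V: "cspace V" and W: "cspace W" and v: "v \<in> carrier V" and w: "w \<in> carrier W"
  shows "v' \<in> carrier V \<Longrightarrow> tens V W (v \<oplus>\<^bsub>V\<^esub> v') w = tens V W v w \<oplus>\<^bsub>V \<otimes>\<^sub>v W\<^esub> tens V W v' w"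
    and "w' \<in> carrier W \<Longrightarrow> tens V W v (w \<oplus>\<^bsub>W\<^esub> w') = tens V W v w \<oplus>\<^bsub>V \<otimes>\<^sub>v W\<^esub> tens V W v w'"
    and "tens V W (c \<odot>\<^bsub>V\<^esub> v) w = c \<odot>\<^bsub>V \<otimes>\<^sub>v W\<^esub> tens V W v w"
    and "tens V W v (c \<odot>\<^bsub>W\<^esub> w) = c \<odot>\<^bsub>V \<otimes>\<^sub>v W\<^esub> tens V W v w"
proof -
  interpret V: module complex_ring V by fact
  interpret W: module complex_ring W by fact
  let ?S = "carrier V \<times> carrier W"
  let ?E = "free_space ?S"
  interpret E: module complex_ring ?E by (rule free_space_cspace)
  note P = tensor_proj[OF V W]
  note G = tensor_relations_submodule(2)[OF V W]
  have d: "delta (x, y) \<in> carrier ?E" if "x \<in> carrier V" "y \<in> carrier W" for x y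
    using that by (intro delta_carrier) simp
  have a: "tens V W x y = tens V W x' y' \<oplus>\<^bsub>V \<otimes>\<^sub>v W\<^esub> tens V W x'' y''"
    if "x \<in> carrier V" "y \<in> carrier W" "x' \<in> carrier V" "y' \<in> carrier W" "x'' \<in> carrier V"
      "y'' \<in> carrier W" and r: "(\<lambda>p. delta (x, y) p - delta (x', y') p - delta (x'', y'') p) \<in> tensor_generators V W"
    for x y x' y' x'' y''
  proof -
    have c: "(\<lambda>s. delta (x', y') s + delta (x'', y'') s) \<in> carrier ?E"
      using E.M.a_closed[OF d d, of x' y' x'' y''] that by simp
    have "tens V W x' y' \<oplus>\<^bsub>V \<otimes>\<^sub>v W\<^esub> tens V W x'' y'' =
        tensor_relations V W +>\<^bsub>?E\<^esub> (delta (x', y') \<oplus>\<^bsub>?E\<^esub> delta (x'', y''))"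
      using P(1) d that unfolding lin_def tens_def by (simp del: free_space_simps)
    also have "\<dots> = tens V W x y"
      unfolding tens_def
      using P(3)[OF d c, of x y] r G that by (auto simp: diff_diff_eq)
    finally show ?thesis ..
  qed
  have s: "tens V W x y = c \<odot>\<^bsub>V \<otimes>\<^sub>v W\<^esub> tens V W x' y'"
    if "x \<in> carrier V" "y \<in> carrier W" "x' \<in> carrier V" "y' \<in> carrier W"
      and r: "(\<lambda>p. delta (x, y) p - c * delta (x', y') p) \<in> tensor_generators V W"
    for x y x' y' c
  proof -
    have c: "(\<lambda>s. c * delta (x', y') s) \<in> carrier ?E"
      using cspaceD(2)[OF free_space_cspace d, of x' y' c] that by simp
    have "c \<odot>\<^bsub>V \<otimes>\<^sub>v W\<^esub> tens V W x' y' = tensor_relations V W +>\<^bsub>?E\<^esub> (c \<odot>\<^bsub>?E\<^esub> delta (x', y'))"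
      using P(1) d that unfolding lin_def tens_def by (simp del: free_space_simps)
    also have "\<dots> = tens V W x y"
      unfolding tens_def using P(3)[OF d c, of x y] r G that by auto
    finally show ?thesis ..
  qed
  show "tens V W (v \<oplus>\<^bsub>V\<^esub> v') w = tens V W v w \<oplus>\<^bsub>V \<otimes>\<^sub>v W\<^esub> tens V W v' w" if "v' \<in> carrier V"
    by (rule a) (use v w that in \<open>auto simp: tensor_generators_def\<close>)
  show "tens V W v (w \<oplus>\<^bsub>W\<^esub> w') = tens V W v w \<oplus>\<^bsub>V \<otimes>\<^sub>v W\<^esub> tens V W v w'" if "w' \<in> carrier W"
    by (rule a) (use v w that in \<open>auto simp: tensor_generators_def\<close>)
  show "tens V W (c \<odot>\<^bsub>V\<^esub> v) w = c \<odot>\<^bsub>V \<otimes>\<^sub>v W\<^esub> tens V W v w"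
    by (rule s) (use v w cspaceD(2)[OF V] in \<open>auto simp: tensor_generators_def\<close>)
  show "tens V W v (c \<odot>\<^bsub>W\<^esub> w) = c \<odot>\<^bsub>V \<otimes>\<^sub>v W\<^esub> tens V W v w"
    by (rule s) (use v w cspaceD(2)[OF W] in \<open>auto simp: tensor_generators_def\<close>)
qed

definition bilinear_maps :: "'a cvs \<Rightarrow> 'b cvs \<Rightarrow> 'c cvs \<Rightarrow> ('a \<Rightarrow> 'b \<Rightarrow> 'c) set" where
  "bilinear_maps V W U = {\<beta>. (\<forall>v\<in>carrier V. \<beta> v \<in> lin W U) \<and> (\<forall>w\<in>carrier W. (\<lambda>v. \<beta> v w) \<in> lin V U)}"

text \<open>The linear map out of \<open>V \<otimes>\<^sub>v W\<close> induced by a bilinear map \<open>\<beta>\<close>; existence and uniqueness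
  are proved below.\<close>

definition tensor_lift ::
    "'a cvs \<Rightarrow> 'b cvs \<Rightarrow> 'c cvs \<Rightarrow> ('a \<Rightarrow> 'b \<Rightarrow> 'c) \<Rightarrow> ('a, 'b) tensor \<Rightarrow> 'c" where
  "tensor_lift V W U \<beta> = (SOME g. g \<in> lin (V \<otimes>\<^sub>v W) U \<and>
     (\<forall>v\<in>carrier V. \<forall>w\<in>carrier W. g (tens V W v w) = \<beta> v w))"

definition free_lift :: "'c cvs \<Rightarrow> ('s \<Rightarrow> 'c) \<Rightarrow> ('s \<Rightarrow> complex) \<Rightarrow> 'c" where
  "free_lift U b f = finsum U (\<lambda>s. f s \<odot>\<^bsub>U\<^esub> b s) {s. f s \<noteq> 0}"

lemma free_lift:
  assumes U: "cspace U" and b: "b \<in> S \<rightarrow> carrier U"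
  shows "free_lift U b \<in> lin (free_space S) U"
    and "s \<in> S \<Longrightarrow> free_lift U b (delta s) = b s"
proof -
  interpret U: module complex_ring U by fact
  note D = cspaceD(2-6)[OF U]
  have z: "0 \<odot>\<^bsub>U\<^esub> x = \<zero>\<^bsub>U\<^esub>" if "x \<in> carrier U" for x
    using U.smult_l_null[OF that] by simp
  have bc: "b s \<in> carrier U" if "s \<in> S" for s using b that by auto
  have ext: "free_lift U b f = finsum U (\<lambda>s. f s \<odot>\<^bsub>U\<^esub> b s) T"
    if "finite T" "{s. f s \<noteq> 0} \<subseteq> T" "T \<subseteq> S" for f T
    unfolding free_lift_def
    by (rule U.M.add.finprod_mono_neutral_cong_left) (use that bc D(1) z in auto)
  have cl: "free_lift U b f \<in> carrier U" if "f \<in> carrier (free_space S)" for f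
    unfolding free_lift_def
    by (rule U.M.finsum_closed) (use that bc D(1) in \<open>auto simp: free_space_def\<close>)
  have add: "free_lift U b (\<lambda>s. f s + g s) = free_lift U b f \<oplus>\<^bsub>U\<^esub> free_lift U b g"
    if f: "f \<in> carrier (free_space S)" and g: "g \<in> carrier (free_space S)" for f g
  proof -
    define T where "T = {s. f s \<noteq> 0} \<union> {s. g s \<noteq> 0}"
    have T: "finite T" "T \<subseteq> S" using f g by (auto simp: T_def free_space_def)
    have "free_lift U b (\<lambda>s. f s + g s) = finsum U (\<lambda>s. (f s + g s) \<odot>\<^bsub>U\<^esub> b s) T"
      by (rule ext) (use T in \<open>auto simp: T_def\<close>)
    also have "\<dots> = finsum U (\<lambda>s. f s \<odot>\<^bsub>U\<^esub> b s \<oplus>\<^bsub>U\<^esub> g s \<odot>\<^bsub>U\<^esub> b s) T"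
      by (rule U.M.finsum_cong') (use T bc D in auto)
    also have "\<dots> = finsum U (\<lambda>s. f s \<odot>\<^bsub>U\<^esub> b s) T \<oplus>\<^bsub>U\<^esub> finsum U (\<lambda>s. g s \<odot>\<^bsub>U\<^esub> b s) T"
      by (rule U.M.finsum_addf) (use T bc D in auto)
    also have "finsum U (\<lambda>s. f s \<odot>\<^bsub>U\<^esub> b s) T = free_lift U b f"
      by (rule ext[symmetric]) (use T in \<open>auto simp: T_def\<close>)
    also have "finsum U (\<lambda>s. g s \<odot>\<^bsub>U\<^esub> b s) T = free_lift U b g"
      by (rule ext[symmetric]) (use T in \<open>auto simp: T_def\<close>)
    finally show ?thesis .
  qed
  have sm: "free_lift U b (\<lambda>s. c * f s) = c \<odot>\<^bsub>U\<^esub> free_lift U b f"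
    if f: "f \<in> carrier (free_space S)" for c f
  proof -
    define T where "T = {s. f s \<noteq> 0}"
    have T: "finite T" "T \<subseteq> S" using f by (auto simp: T_def free_space_def)
    have "free_lift U b (\<lambda>s. c * f s) = finsum U (\<lambda>s. (c * f s) \<odot>\<^bsub>U\<^esub> b s) T"
      by (rule ext) (use T in \<open>auto simp: T_def\<close>)
    also have "\<dots> = finsum U (\<lambda>s. c \<odot>\<^bsub>U\<^esub> (f s \<odot>\<^bsub>U\<^esub> b s)) T"
      by (rule U.M.finsum_cong') (use T bc D in auto)
    also have "\<dots> = c \<odot>\<^bsub>U\<^esub> finsum U (\<lambda>s. f s \<odot>\<^bsub>U\<^esub> b s) T"
      by (rule U.finsum_smult_ldistr[symmetric]) (use T bc D in auto)
    finally show ?thesis by (simp add: free_lift_def T_def)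
  qed
  show "free_lift U b \<in> lin (free_space S) U"
    using cl add sm by (auto simp: lin_def)
  show "free_lift U b (delta s) = b s" if s: "s \<in> S"
  proof -
    have "{t. delta s t \<noteq> 0} = {s}" by (auto simp: delta_def)
    moreover have "delta s s = 1" by (simp add: delta_def)
    ultimately show ?thesis
      using bc[OF s] D by (simp add: free_lift_def)
  qed
qed

lemma lin_free_space_eqI:
  assumes g: "g \<in> lin (free_space S) U" and k: "k \<in> lin (free_space S) U" and U: "cspace U"
    and eq: "\<And>s. s \<in> S \<Longrightarrow> g (delta s) = k (delta s)" and f: "f \<in> carrier (free_space S)"
  shows "g f = k f"
proof -
  interpret U: module complex_ring U by fact
  have main: "g f = k f" if "finite T" "T \<subseteq> S" "{s. f s \<noteq> 0} \<subseteq> T" for T f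
    using that
  proof (induction T arbitrary: f rule: finite_induct)
    case empty
    have zc: "(\<lambda>_. 0) \<in> carrier (free_space S)" by (simp add: free_space_def)
    have "f = (\<lambda>_. 0)" using empty by auto
    moreover have "g (\<lambda>_. 0) = \<zero>\<^bsub>U\<^esub>" "k (\<lambda>_. 0) = \<zero>\<^bsub>U\<^esub>"
    proof -
      have "h (\<lambda>_. 0) = \<zero>\<^bsub>U\<^esub>" if "h \<in> lin (free_space S) U" for h
      proof -
        have "\<forall>c. h (c \<odot>\<^bsub>free_space S\<^esub> (\<lambda>_. 0)) = c \<odot>\<^bsub>U\<^esub> h (\<lambda>_. 0)"
          using that zc unfolding lin_def by blast
        from spec[OF this, of 0] have "h (\<lambda>_. 0) = 0 \<odot>\<^bsub>U\<^esub> h (\<lambda>_. 0)" by simp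
        moreover have "h (\<lambda>_. 0) \<in> carrier U" using that zc unfolding lin_def by blast
        then have "0 \<odot>\<^bsub>U\<^esub> h (\<lambda>_. 0) = \<zero>\<^bsub>U\<^esub>" using U.smult_l_null by simp
        ultimately show ?thesis by simp
      qed
      then show "g (\<lambda>_. 0) = \<zero>\<^bsub>U\<^esub>" "k (\<lambda>_. 0) = \<zero>\<^bsub>U\<^esub>" using g k by blast+
    qed
    ultimately show ?case by simp
  next
    case (insert x T)
    define f' where "f' = f(x := 0)"
    have f'T: "{s. f' s \<noteq> 0} \<subseteq> T" using insert.prems by (auto simp: f'_def)
    then have f': "f' \<in> carrier (free_space S)"
      using insert.prems insert.hyps finite_subset[OF f'T] by (auto simp: free_space_def)
    have dx: "delta x \<in> carrier (free_space S)" using insert by (intro delta_carrier) auto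
    have cdx: "(\<lambda>s. f x * delta x s) \<in> carrier (free_space S)"
      using cspaceD(2)[OF free_space_cspace dx, of "f x"] by simp
    have dec: "f = (\<lambda>s. f x * delta x s) \<oplus>\<^bsub>free_space S\<^esub> f'"
      by (auto simp: f'_def delta_def)
    have lin: "h f = f x \<odot>\<^bsub>U\<^esub> h (delta x) \<oplus>\<^bsub>U\<^esub> h f'" if h: "h \<in> lin (free_space S) U" for h
    proof -
      have "h f = h (\<lambda>s. f x * delta x s) \<oplus>\<^bsub>U\<^esub> h f'"
        using h f' cdx unfolding lin_def by (subst dec) blast
      also have "h (\<lambda>s. f x * delta x s) = h (f x \<odot>\<^bsub>free_space S\<^esub> delta x)" by simp
      also have "\<dots> = f x \<odot>\<^bsub>U\<^esub> h (delta x)"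
        using h dx unfolding lin_def by blast
      finally show ?thesis .
    qed
    have "g f' = k f'" using insert.IH[of f'] insert.prems f'T by auto
    then show ?case using lin[OF g] lin[OF k] eq[of x] insert.prems by simp
  qed
  show ?thesis by (rule main[of "{s. f s \<noteq> 0}"]) (use f in \<open>auto simp: free_space_def\<close>)
qed

lemma lin_comp: "\<lbrakk>g \<in> lin V W; k \<in> lin W U\<rbrakk> \<Longrightarrow> (\<lambda>x. k (g x)) \<in> lin V U"
  unfolding lin_def by (auto simp: Pi_def)

lemma tensor_unique:
  assumes V: "cspace V" and W: "cspace W" and U: "cspace U"
    and g: "g \<in> lin (V \<otimes>\<^sub>v W) U" and k: "k \<in> lin (V \<otimes>\<^sub>v W) U"
    and eq: "\<And>v w. \<lbrakk>v \<in> carrier V; w \<in> carrier W\<rbrakk> \<Longrightarrow> g (tens V W v w) = k (tens V W v w)"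
    and t: "t \<in> carrier (V \<otimes>\<^sub>v W)"
  shows "g t = k t"
proof -
  note P = tensor_proj[OF V W]
  obtain f where f: "f \<in> carrier (free_space (carrier V \<times> carrier W))"
    "t = tensor_relations V W +>\<^bsub>free_space (carrier V \<times> carrier W)\<^esub> f"
    using t P(2) by auto
  show ?thesis
    unfolding f(2)
    by (rule lin_free_space_eqI[OF lin_comp[OF P(1) g] lin_comp[OF P(1) k] U _ f(1)])
      (use eq in \<open>auto simp: tens_def\<close>)
qed

lemma tensor_lift_exists:
  assumes V: "cspace V" and W: "cspace W" and U: "cspace U" and \<beta>: "\<beta> \<in> bilinear_maps V W U"
  shows "\<exists>g\<in>lin (V \<otimes>\<^sub>v W) U. \<forall>v\<in>carrier V. \<forall>w\<in>carrier W. g (tens V W v w) = \<beta> v w"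
proof -
  interpret V: module complex_ring V by fact
  interpret W: module complex_ring W by fact
  interpret U: module complex_ring U by fact
  let ?S = "carrier V \<times> carrier W"
  let ?E = "free_space ?S"
  interpret E: module complex_ring ?E by (rule free_space_cspace)
  let ?N = "tensor_relations V W"
  note P = tensor_proj[OF V W]
  define L where "L = free_lift U (\<lambda>p. \<beta> (fst p) (snd p))"
  have \<beta>c: "\<beta> v w \<in> carrier U" if "v \<in> carrier V" "w \<in> carrier W" for v w
    using \<beta> that unfolding bilinear_maps_def lin_def by auto
  have L: "L \<in> lin ?E U" and Ld: "\<And>v w. \<lbrakk>v \<in> carrier V; w \<in> carrier W\<rbrakk> \<Longrightarrow> L (delta (v, w)) = \<beta> v w"
  proof -
    have b: "(\<lambda>p. \<beta> (fst p) (snd p)) \<in> ?S \<rightarrow> carrier U" using \<beta>c by auto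
    show "L \<in> lin ?E U" unfolding L_def by (rule free_lift(1)[OF U b])
    show "L (delta (v, w)) = \<beta> v w" if "v \<in> carrier V" "w \<in> carrier W" for v w
      using free_lift(2)[OF U b, of "(v, w)"] that unfolding L_def by simp
  qed
  have Lc: "L f \<in> carrier U" if "f \<in> carrier ?E" for f
    using L that unfolding lin_def by auto
  have La: "L (\<lambda>s. f s + g s) = L f \<oplus>\<^bsub>U\<^esub> L g" if "f \<in> carrier ?E" "g \<in> carrier ?E" for f g
    using L that unfolding lin_def by simp
  have Ls: "L (\<lambda>s. c * f s) = c \<odot>\<^bsub>U\<^esub> L f" if "f \<in> carrier ?E" for c f
    using L that unfolding lin_def by simp
  have neg: "(\<lambda>s. - f s) \<in> carrier ?E" if "f \<in> carrier ?E" for f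
    using that by (simp add: free_space_def)
  have U1: "(- 1) \<odot>\<^bsub>U\<^esub> x = \<ominus>\<^bsub>U\<^esub> x" if x: "x \<in> carrier U" for x
  proof -
    have "(- 1) \<odot>\<^bsub>U\<^esub> x \<oplus>\<^bsub>U\<^esub> x = (- 1 + 1) \<odot>\<^bsub>U\<^esub> x"
      using cspaceD(3)[OF U x, of "-1" 1] cspaceD(6)[OF U x] by simp
    also have "\<dots> = \<zero>\<^bsub>U\<^esub>" using U.smult_l_null[OF x] by simp
    finally show ?thesis
      using U.M.minus_equality[of "(- 1) \<odot>\<^bsub>U\<^esub> x" x] x cspaceD(2)[OF U x] by simp
  qed
  have Lm: "L (\<lambda>s. f s - g s) = L f \<ominus>\<^bsub>U\<^esub> L g" if "f \<in> carrier ?E" "g \<in> carrier ?E" for f g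
    using La[OF that(1) neg[OF that(2)]] Ls[OF that(2), of "-1"] U1[OF Lc[OF that(2)]]
    by (simp add: a_minus_def)
  define K where "K = {f \<in> carrier ?E. L f = \<zero>\<^bsub>U\<^esub>}"
  have "L (\<lambda>_. 0) = \<zero>\<^bsub>U\<^esub>"
    using Ls[of "\<lambda>_. 0" 0] Lc[of "\<lambda>_. 0"] U.smult_l_null[of "L (\<lambda>_. 0)"] E.M.zero_closed by simp
  moreover have "L (\<lambda>s. - f s) = \<zero>\<^bsub>U\<^esub>" if "f \<in> carrier ?E" "L f = \<zero>\<^bsub>U\<^esub>" for f
    using Ls[of f "-1"] that U1[of "\<zero>\<^bsub>U\<^esub>"] by simp
  moreover have "\<ominus>\<^bsub>?E\<^esub> f = (\<lambda>s. - f s)" if "f \<in> carrier ?E" for f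
    using free_space_minus[of "\<zero>\<^bsub>?E\<^esub>" ?S f] that E.M.zero_closed
    by (simp add: a_minus_def)
  ultimately have sub: "submodule K complex_ring ?E"
    using E.M.zero_closed E.M.a_closed cspaceD(2)[OF free_space_cspace]
    by (intro E.submoduleI) (auto simp: K_def neg La Ls U.smult_r_null[simplified])
  have dc: "delta (v, w) \<in> carrier ?E" if "v \<in> carrier V" "w \<in> carrier W" for v w
    using that by (intro delta_carrier) simp
  have dcm: "(\<lambda>s. delta p s - delta q s) \<in> carrier ?E" if "p \<in> ?S" "q \<in> ?S" for p q
    using E.M.minus_closed[of "delta p" "delta q"] that
    by (simp add: free_space_minus delta_carrier)
  have cdc: "(\<lambda>s. c * f s) \<in> carrier ?E" if "f \<in> carrier ?E" for f c
    using cspaceD(2)[OF free_space_cspace that] by simp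
  have cancel: "a \<oplus>\<^bsub>U\<^esub> b \<ominus>\<^bsub>U\<^esub> a \<ominus>\<^bsub>U\<^esub> b = \<zero>\<^bsub>U\<^esub>" if "a \<in> carrier U" "b \<in> carrier U" for a b
    using U.M.r_neg[of "a \<oplus>\<^bsub>U\<^esub> b"] that by (simp add: a_minus_def U.M.a_ac U.M.minus_add)
  have cancel2: "a \<ominus>\<^bsub>U\<^esub> a = \<zero>\<^bsub>U\<^esub>" if "a \<in> carrier U" for a
    using that by (simp add: a_minus_def U.M.r_neg)
  have \<beta>a: "\<beta> (v \<oplus>\<^bsub>V\<^esub> v') w = \<beta> v w \<oplus>\<^bsub>U\<^esub> \<beta> v' w" "\<beta> (c \<odot>\<^bsub>V\<^esub> v) w = c \<odot>\<^bsub>U\<^esub> \<beta> v w"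
    if "v \<in> carrier V" "v' \<in> carrier V" "w \<in> carrier W" for v v' w c
    using \<beta> that unfolding bilinear_maps_def lin_def by auto
  have \<beta>b: "\<beta> v (w \<oplus>\<^bsub>W\<^esub> w') = \<beta> v w \<oplus>\<^bsub>U\<^esub> \<beta> v w'" "\<beta> v (c \<odot>\<^bsub>W\<^esub> w) = c \<odot>\<^bsub>U\<^esub> \<beta> v w"
    if "v \<in> carrier V" "w \<in> carrier W" "w' \<in> carrier W" for v w w' c
    using \<beta> that unfolding bilinear_maps_def lin_def by auto
  have "L f = \<zero>\<^bsub>U\<^esub>" if "f \<in> tensor_generators V W" for f
    using that unfolding tensor_generators_def
    by (auto simp: Lm La Ls dc dcm cdc Ld \<beta>a \<beta>b cancel cancel2 \<beta>c cspaceD(2)[OF V]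
        cspaceD(2)[OF W] cspaceD(2)[OF U])
  then have "tensor_generators V W \<subseteq> K"
    using tensor_generators_carrier[OF V W] by (auto simp: K_def)
  then have NK: "?N \<subseteq> K" unfolding tensor_relations_def using sub by blast
  define g where "g A = L (SOME f. f \<in> carrier ?E \<and> A = ?N +>\<^bsub>?E\<^esub> f)" for A
  have gL: "g (?N +>\<^bsub>?E\<^esub> f) = L f" if f: "f \<in> carrier ?E" for f
  proof -
    define f' where "f' = (SOME f'. f' \<in> carrier ?E \<and> ?N +>\<^bsub>?E\<^esub> f = ?N +>\<^bsub>?E\<^esub> f')"
    have f': "f' \<in> carrier ?E \<and> ?N +>\<^bsub>?E\<^esub> f = ?N +>\<^bsub>?E\<^esub> f'"
      unfolding f'_def by (rule someI[of _ f]) (use f in simp)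
    then have "(\<lambda>s. f s - f' s) \<in> K" using P(3)[OF f, of f'] NK by auto
    then have "(\<lambda>s. f s - f' s) \<in> carrier ?E" "L (\<lambda>s. f s - f' s) = \<zero>\<^bsub>U\<^esub>" by (simp_all add: K_def)
    then have "L f = L f'" using La[of "\<lambda>s. f s - f' s" f'] f' Lc by simp
    then show ?thesis by (simp add: g_def f'_def)
  qed
  have "g \<in> lin (V \<otimes>\<^sub>v W) U"
  proof -
    have "g (A \<oplus>\<^bsub>V \<otimes>\<^sub>v W\<^esub> B) = g A \<oplus>\<^bsub>U\<^esub> g B \<and> g A \<in> carrier U \<and> g (c \<odot>\<^bsub>V \<otimes>\<^sub>v W\<^esub> A) = c \<odot>\<^bsub>U\<^esub> g A"
      if AB: "A \<in> carrier (V \<otimes>\<^sub>v W)" "B \<in> carrier (V \<otimes>\<^sub>v W)" for A B c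
    proof -
      obtain a b where ab: "a \<in> carrier ?E" "A = ?N +>\<^bsub>?E\<^esub> a" "b \<in> carrier ?E" "B = ?N +>\<^bsub>?E\<^esub> b"
        using AB P(2) by auto
      have "A \<oplus>\<^bsub>V \<otimes>\<^sub>v W\<^esub> B = ?N +>\<^bsub>?E\<^esub> (a \<oplus>\<^bsub>?E\<^esub> b)" "c \<odot>\<^bsub>V \<otimes>\<^sub>v W\<^esub> A = ?N +>\<^bsub>?E\<^esub> (c \<odot>\<^bsub>?E\<^esub> a)"
        using P(1) ab unfolding lin_def by (simp_all del: free_space_simps)
      then show ?thesis
        using gL ab E.M.a_closed[of a b] cspaceD(2)[OF free_space_cspace, of a _ c]
        by (simp add: La Ls Lc)
    qed
    then show ?thesis unfolding lin_def by blast
  qed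
  moreover have "\<forall>v\<in>carrier V. \<forall>w\<in>carrier W. g (tens V W v w) = \<beta> v w"
    using gL[OF dc] Ld by (simp add: tens_def)
  ultimately show ?thesis by blast
qed

lemma tensor_lift:
  assumes "cspace V" "cspace W" "cspace U" "\<beta> \<in> bilinear_maps V W U"
  shows "tensor_lift V W U \<beta> \<in> lin (V \<otimes>\<^sub>v W) U"
    and "\<And>v w. \<lbrakk>v \<in> carrier V; w \<in> carrier W\<rbrakk> \<Longrightarrow> tensor_lift V W U \<beta> (tens V W v w) = \<beta> v w"
proof -
  have ex: "\<exists>g. g \<in> lin (V \<otimes>\<^sub>v W) U \<and>
      (\<forall>v\<in>carrier V. \<forall>w\<in>carrier W. g (tens V W v w) = \<beta> v w)"
    using tensor_lift_exists[OF assms] by blast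
  have "tensor_lift V W U \<beta> \<in> lin (V \<otimes>\<^sub>v W) U \<and>
      (\<forall>v\<in>carrier V. \<forall>w\<in>carrier W. tensor_lift V W U \<beta> (tens V W v w) = \<beta> v w)"
    unfolding tensor_lift_def by (rule someI_ex[OF ex])
  then show "tensor_lift V W U \<beta> \<in> lin (V \<otimes>\<^sub>v W) U"
    and "\<And>v w. \<lbrakk>v \<in> carrier V; w \<in> carrier W\<rbrakk> \<Longrightarrow> tensor_lift V W U \<beta> (tens V W v w) = \<beta> v w"
    by blast+
qed

lemma tens_bilinear_maps:
  assumes "cspace V" "cspace W"
  shows "tens V W \<in> bilinear_maps V W (V \<otimes>\<^sub>v W)"
  using tens_bilinear[OF assms] tens_closed[OF assms]
  unfolding bilinear_maps_def lin_def by auto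

definition tensor_map :: "'a cvs \<Rightarrow> 'b cvs \<Rightarrow> 'c cvs \<Rightarrow> 'd cvs \<Rightarrow> ('a \<Rightarrow> 'c) \<Rightarrow> ('b \<Rightarrow> 'd) \<Rightarrow>
    ('a, 'b) tensor \<Rightarrow> ('c, 'd) tensor" where
  "tensor_map V W V' W' g k = tensor_lift V W (V' \<otimes>\<^sub>v W') (\<lambda>v w. tens V' W' (g v) (k w))"

definition vassoc :: "'a cvs \<Rightarrow> 'b cvs \<Rightarrow> 'c cvs \<Rightarrow>
    (('a, 'b) tensor, 'c) tensor \<Rightarrow> ('a, ('b, 'c) tensor) tensor" where
  "vassoc V W U = tensor_lift (V \<otimes>\<^sub>v W) U (V \<otimes>\<^sub>v (W \<otimes>\<^sub>v U))
     (\<lambda>t u. tensor_lift V W (V \<otimes>\<^sub>v (W \<otimes>\<^sub>v U)) (\<lambda>v w. tens V (W \<otimes>\<^sub>v U) v (tens W U w u)) t)"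

text \<open>\<open>vups V W\<close> maps the conjugate of \<open>V \<otimes>\<^sub>v W\<close> to the tensor product of the conjugates in the
  opposite order; as a map on \<open>V \<otimes>\<^sub>v W\<close> it is antilinear.\<close>

definition vups :: "'a cvs \<Rightarrow> 'b cvs \<Rightarrow> ('a, 'b) tensor \<Rightarrow> ('b, 'a) tensor" where
  "vups V W = tensor_lift V W (conj_space (conj_space W \<otimes>\<^sub>v conj_space V))
     (\<lambda>v w. tens (conj_space W) (conj_space V) w v)"

lemma tensor_map:
  assumes "cspace V" "cspace W" "cspace V'" "cspace W'" and g: "g \<in> lin V V'" and k: "k \<in> lin W W'"
  shows "tensor_map V W V' W' g k \<in> lin (V \<otimes>\<^sub>v W) (V' \<otimes>\<^sub>v W')"
    and "\<And>v w. \<lbrakk>v \<in> carrier V; w \<in> carrier W\<rbrakk> \<Longrightarrow>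
      tensor_map V W V' W' g k (tens V W v w) = tens V' W' (g v) (k w)"
proof -
  have b: "(\<lambda>v w. tens V' W' (g v) (k w)) \<in> bilinear_maps V W (V' \<otimes>\<^sub>v W')"
    using tens_bilinear[OF assms(3,4)] tens_closed[OF assms(3,4)] g k
    unfolding bilinear_maps_def lin_def by (auto simp: Pi_def)
  show "tensor_map V W V' W' g k \<in> lin (V \<otimes>\<^sub>v W) (V' \<otimes>\<^sub>v W')"
    and "\<And>v w. \<lbrakk>v \<in> carrier V; w \<in> carrier W\<rbrakk> \<Longrightarrow>
      tensor_map V W V' W' g k (tens V W v w) = tens V' W' (g v) (k w)"
    unfolding tensor_map_def
    using tensor_lift[OF assms(1,2) cspace_tensor[OF assms(3,4)] b] by auto
qed

lemma vups:
  assumes V: "cspace V" and W: "cspace W"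
  shows "vups V W \<in> lin (conj_space (V \<otimes>\<^sub>v W)) (conj_space W \<otimes>\<^sub>v conj_space V)"
    and "\<And>v w. \<lbrakk>v \<in> carrier V; w \<in> carrier W\<rbrakk> \<Longrightarrow>
      vups V W (tens V W v w) = tens (conj_space W) (conj_space V) w v"
proof -
  note C = cspace_conj_space[OF W] cspace_conj_space[OF V]
  note T = cspace_conj_space[OF cspace_tensor[OF C]]
  have b: "(\<lambda>v w. tens (conj_space W) (conj_space V) w v)
      \<in> bilinear_maps V W (conj_space (conj_space W \<otimes>\<^sub>v conj_space V))"
  proof -
    have V': "carrier (conj_space V) = carrier V" "x \<oplus>\<^bsub>conj_space V\<^esub> y = x \<oplus>\<^bsub>V\<^esub> y"
      "c \<odot>\<^bsub>V\<^esub> x = cnj c \<odot>\<^bsub>conj_space V\<^esub> x" for c x y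
      by (simp_all add: conj_space_def)
    have W': "carrier (conj_space W) = carrier W" "x \<oplus>\<^bsub>conj_space W\<^esub> y = x \<oplus>\<^bsub>W\<^esub> y"
      "c \<odot>\<^bsub>W\<^esub> x = cnj c \<odot>\<^bsub>conj_space W\<^esub> x" for c x y
      by (simp_all add: conj_space_def)
    note B = tens_bilinear[OF C, unfolded V'(1,2) W'(1,2)]
    show ?thesis
      using B tens_closed[OF C, unfolded V'(1) W'(1)]
      unfolding bilinear_maps_def lin_def V'(3) W'(3)
      by (auto simp: conj_space_def[of "_ \<otimes>\<^sub>v _"])
  qed
  have "vups V W \<in> lin (V \<otimes>\<^sub>v W) (conj_space (conj_space W \<otimes>\<^sub>v conj_space V))"
    unfolding vups_def by (rule tensor_lift(1)[OF V W T b])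
  then have *: "vups V W t \<in> carrier (conj_space W \<otimes>\<^sub>v conj_space V)"
      "vups V W (t \<oplus>\<^bsub>V \<otimes>\<^sub>v W\<^esub> s) = vups V W t \<oplus>\<^bsub>conj_space W \<otimes>\<^sub>v conj_space V\<^esub> vups V W s"
      "vups V W (c \<odot>\<^bsub>V \<otimes>\<^sub>v W\<^esub> t) = cnj c \<odot>\<^bsub>conj_space W \<otimes>\<^sub>v conj_space V\<^esub> vups V W t"
    if "t \<in> carrier (V \<otimes>\<^sub>v W)" "s \<in> carrier (V \<otimes>\<^sub>v W)" for s t c
    using that unfolding lin_def by (auto simp: conj_space_def[of "_ \<otimes>\<^sub>v _"])
  then show "vups V W \<in> lin (conj_space (V \<otimes>\<^sub>v W)) (conj_space W \<otimes>\<^sub>v conj_space V)"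
    unfolding lin_def by (auto simp: conj_space_def[of "V \<otimes>\<^sub>v W"])
  show "\<And>v w. \<lbrakk>v \<in> carrier V; w \<in> carrier W\<rbrakk> \<Longrightarrow>
      vups V W (tens V W v w) = tens (conj_space W) (conj_space V) w v"
    unfolding vups_def by (rule tensor_lift(2)[OF V W T b])
qed

lemma vassoc:
  assumes V: "cspace V" and W: "cspace W" and U: "cspace U"
  shows "vassoc V W U \<in> lin ((V \<otimes>\<^sub>v W) \<otimes>\<^sub>v U) (V \<otimes>\<^sub>v (W \<otimes>\<^sub>v U))"
    and "\<And>v w u. \<lbrakk>v \<in> carrier V; w \<in> carrier W; u \<in> carrier U\<rbrakk> \<Longrightarrow>
      vassoc V W U (tens (V \<otimes>\<^sub>v W) U (tens V W v w) u) = tens V (W \<otimes>\<^sub>v U) v (tens W U w u)"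
proof -
  let ?T = "V \<otimes>\<^sub>v (W \<otimes>\<^sub>v U)"
  note WU = cspace_tensor[OF W U]
  note VW = cspace_tensor[OF V W]
  note T = cspace_tensor[OF V WU]
  interpret T: module complex_ring ?T by (rule T)
  let ?b = "\<lambda>u v w. tens V (W \<otimes>\<^sub>v U) v (tens W U w u)"
  let ?g = "\<lambda>t u. tensor_lift V W ?T (?b u) t"
  note cl = tens_closed[OF V WU] tens_closed[OF W U]
  have b: "?b u \<in> bilinear_maps V W ?T" if "u \<in> carrier U" for u
    using tens_bilinear[OF V WU] tens_bilinear[OF W U] cl that
    unfolding bilinear_maps_def lin_def by auto
  note L = tensor_lift[OF V W T b]
  have Lc: "?g t u \<in> carrier ?T" if "u \<in> carrier U" "t \<in> carrier (V \<otimes>\<^sub>v W)" for t u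
    using L(1)[OF that(1)] that(2) unfolding lin_def by auto
  have add: "?g t (u \<oplus>\<^bsub>U\<^esub> u') = ?g t u \<oplus>\<^bsub>?T\<^esub> ?g t u'"
    if u: "u \<in> carrier U" "u' \<in> carrier U" and t: "t \<in> carrier (V \<otimes>\<^sub>v W)" for t u u'
  proof -
    interpret U: module complex_ring U by (rule U)
    have uu: "u \<oplus>\<^bsub>U\<^esub> u' \<in> carrier U" using u by simp
    have "(\<lambda>t. ?g t u \<oplus>\<^bsub>?T\<^esub> ?g t u') \<in> lin (V \<otimes>\<^sub>v W) ?T"
    proof -
      have 1: "?g (x \<oplus>\<^bsub>V \<otimes>\<^sub>v W\<^esub> y) z = ?g x z \<oplus>\<^bsub>?T\<^esub> ?g y z" "?g (c \<odot>\<^bsub>V \<otimes>\<^sub>v W\<^esub> x) z = c \<odot>\<^bsub>?T\<^esub> ?g x z"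
        if "z \<in> carrier U" "x \<in> carrier (V \<otimes>\<^sub>v W)" "y \<in> carrier (V \<otimes>\<^sub>v W)" for x y z c
        using L(1)[OF that(1)] that unfolding lin_def by auto
      show ?thesis
        using u Lc by (auto simp: lin_def 1 T.M.a_ac cspaceD(4)[OF T])
    qed
    from tensor_unique[OF V W T L(1)[OF uu] this _ t] show ?thesis
      using u uu by (auto simp: L(2) tens_bilinear[OF W U] tens_bilinear[OF V WU] cl)
  qed
  have sm: "?g t (c \<odot>\<^bsub>U\<^esub> u) = c \<odot>\<^bsub>?T\<^esub> ?g t u"
    if u: "u \<in> carrier U" and t: "t \<in> carrier (V \<otimes>\<^sub>v W)" for t u c
  proof -
    have uu: "c \<odot>\<^bsub>U\<^esub> u \<in> carrier U" using u by (rule cspaceD(2)[OF U])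
    have "(\<lambda>t. c \<odot>\<^bsub>?T\<^esub> ?g t u) \<in> lin (V \<otimes>\<^sub>v W) ?T"
    proof -
      have 1: "?g (x \<oplus>\<^bsub>V \<otimes>\<^sub>v W\<^esub> y) u = ?g x u \<oplus>\<^bsub>?T\<^esub> ?g y u" "?g (d \<odot>\<^bsub>V \<otimes>\<^sub>v W\<^esub> x) u = d \<odot>\<^bsub>?T\<^esub> ?g x u"
        if "x \<in> carrier (V \<otimes>\<^sub>v W)" "y \<in> carrier (V \<otimes>\<^sub>v W)" for x y d
        using L(1)[OF u] that unfolding lin_def by auto
      show ?thesis
        using u Lc
        by (auto simp: lin_def 1 cspaceD(2,4)[OF T] cspaceD(5)[OF T, symmetric] mult.commute)
    qed
    from tensor_unique[OF V W T L(1)[OF uu] this _ t] show ?thesis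
      using u uu by (auto simp: L(2) tens_bilinear[OF W U] tens_bilinear[OF V WU] cl)
  qed
  have g: "?g \<in> bilinear_maps (V \<otimes>\<^sub>v W) U ?T"
    using L(1) Lc add sm unfolding bilinear_maps_def by (auto simp: lin_def)
  show "vassoc V W U \<in> lin ((V \<otimes>\<^sub>v W) \<otimes>\<^sub>v U) ?T"
    unfolding vassoc_def by (rule tensor_lift(1)[OF VW U T g])
  show "vassoc V W U (tens (V \<otimes>\<^sub>v W) U (tens V W v w) u) = tens V (W \<otimes>\<^sub>v U) v (tens W U w u)"
    if "v \<in> carrier V" "w \<in> carrier W" "u \<in> carrier U" for v w u
    unfolding vassoc_def using that by (simp add: tensor_lift(2)[OF VW U T g] tens_closed[OF V W] L(2))
qed

definition vlunit :: "'a cvs \<Rightarrow> 'a \<Rightarrow> ('a, complex) tensor" where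
  "vlunit V v = tens V cunit v 1"

definition vrunit :: "'a cvs \<Rightarrow> 'a \<Rightarrow> (complex, 'a) tensor" where
  "vrunit V v = tens cunit V 1 v"

section \<open>Bar categories\<close>

record ('o, 'm) category =
  Obj :: "'o set"
  Arr :: "'m set"
  Dom :: "'m \<Rightarrow> 'o"
  Cod :: "'m \<Rightarrow> 'o"
  Id :: "'o \<Rightarrow> 'm"
  Comp :: "'m \<Rightarrow> 'm \<Rightarrow> 'm" (infixl \<open>\<cdot>\<index>\<close> 60)

record ('o, 'm) monoidal = "('o, 'm) category" +
  TensO :: "'o \<Rightarrow> 'o \<Rightarrow> 'o" (infixl \<open>\<boxtimes>\<index>\<close> 75)
  TensA :: "'m \<Rightarrow> 'm \<Rightarrow> 'm" (infixl \<open>\<boxdot>\<index>\<close> 70)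
  Unit :: 'o
  Assoc :: "'o \<Rightarrow> 'o \<Rightarrow> 'o \<Rightarrow> 'm"
  LUnit :: "'o \<Rightarrow> 'm"
  RUnit :: "'o \<Rightarrow> 'm"

record ('o, 'm) bar = "('o, 'm) monoidal" +
  BarO :: "'o \<Rightarrow> 'o"
  BarA :: "'m \<Rightarrow> 'm"
  BB :: "'o \<Rightarrow> 'm"
  Star :: 'm
  Ups :: "'o \<Rightarrow> 'o \<Rightarrow> 'm"

definition Hom :: "('o, 'm, 'z) category_scheme \<Rightarrow> 'o \<Rightarrow> 'o \<Rightarrow> 'm set" where
  "Hom C X Y = {u \<in> Arr C. Dom C u = X \<and> Cod C u = Y}"

definition inverse_arrows :: "('o, 'm, 'z) category_scheme \<Rightarrow> 'm \<Rightarrow> 'm \<Rightarrow> bool" where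
  "inverse_arrows C u w \<longleftrightarrow> w \<in> Hom C (Cod C u) (Dom C u) \<and>
     Comp C w u = Id C (Dom C u) \<and> Comp C u w = Id C (Cod C u)"

definition Iso :: "('o, 'm, 'z) category_scheme \<Rightarrow> 'o \<Rightarrow> 'o \<Rightarrow> 'm set" where
  "Iso C X Y = {u \<in> Hom C X Y. \<exists>w. inverse_arrows C u w}"

definition Inv :: "('o, 'm, 'z) category_scheme \<Rightarrow> 'm \<Rightarrow> 'm" where
  "Inv C u = (THE w. inverse_arrows C u w)"

locale category =
  fixes C :: "('o, 'm, 'z) category_scheme" (structure)
  assumes Dom_obj: "u \<in> Arr C \<Longrightarrow> Dom C u \<in> Obj C"
    and Cod_obj: "u \<in> Arr C \<Longrightarrow> Cod C u \<in> Obj C"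
    and Id_hom: "X \<in> Obj C \<Longrightarrow> Id C X \<in> Hom C X X"
    and Comp_hom: "\<lbrakk>u \<in> Hom C X Y; w \<in> Hom C Y Z\<rbrakk> \<Longrightarrow> w \<cdot> u \<in> Hom C X Z"
    and Id_right: "u \<in> Hom C X Y \<Longrightarrow> u \<cdot> Id C X = u"
    and Id_left: "u \<in> Hom C X Y \<Longrightarrow> Id C Y \<cdot> u = u"
    and Comp_assoc: "\<lbrakk>u \<in> Hom C X Y; v \<in> Hom C Y Z; w \<in> Hom C Z Z'\<rbrakk> \<Longrightarrow>
      (w \<cdot> v) \<cdot> u = w \<cdot> (v \<cdot> u)"

locale monoidal_category = category C
  for C :: "('o, 'm, 'z) monoidal_scheme" (structure) +
  assumes Unit_obj: "Unit C \<in> Obj C"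
    and TensO_obj: "\<lbrakk>X \<in> Obj C; Y \<in> Obj C\<rbrakk> \<Longrightarrow> X \<boxtimes> Y \<in> Obj C"
    and TensA_hom: "\<lbrakk>u \<in> Hom C X X'; w \<in> Hom C Y Y'\<rbrakk> \<Longrightarrow> u \<boxdot> w \<in> Hom C (X \<boxtimes> Y) (X' \<boxtimes> Y')"
    and TensA_Id: "\<lbrakk>X \<in> Obj C; Y \<in> Obj C\<rbrakk> \<Longrightarrow> Id C X \<boxdot> Id C Y = Id C (X \<boxtimes> Y)"
    and TensA_Comp: "\<lbrakk>u \<in> Hom C X X'; u' \<in> Hom C X' X''; w \<in> Hom C Y Y'; w' \<in> Hom C Y' Y''\<rbrakk> \<Longrightarrow>
      (u' \<cdot> u) \<boxdot> (w' \<cdot> w) = (u' \<boxdot> w') \<cdot> (u \<boxdot> w)"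
    and Assoc_iso: "\<lbrakk>X \<in> Obj C; Y \<in> Obj C; Z \<in> Obj C\<rbrakk> \<Longrightarrow>
      Assoc C X Y Z \<in> Iso C ((X \<boxtimes> Y) \<boxtimes> Z) (X \<boxtimes> (Y \<boxtimes> Z))"
    and Assoc_nat: "\<lbrakk>u \<in> Hom C X X'; v \<in> Hom C Y Y'; w \<in> Hom C Z Z'\<rbrakk> \<Longrightarrow>
      Assoc C X' Y' Z' \<cdot> ((u \<boxdot> v) \<boxdot> w) = (u \<boxdot> (v \<boxdot> w)) \<cdot> Assoc C X Y Z"
    and LUnit_iso: "X \<in> Obj C \<Longrightarrow> LUnit C X \<in> Iso C X (X \<boxtimes> Unit C)"
    and LUnit_nat: "u \<in> Hom C X Y \<Longrightarrow> LUnit C Y \<cdot> u = (u \<boxdot> Id C (Unit C)) \<cdot> LUnit C X"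
    and RUnit_iso: "X \<in> Obj C \<Longrightarrow> RUnit C X \<in> Iso C X (Unit C \<boxtimes> X)"
    and RUnit_nat: "u \<in> Hom C X Y \<Longrightarrow> RUnit C Y \<cdot> u = (Id C (Unit C) \<boxdot> u) \<cdot> RUnit C X"
    and pentagon: "\<lbrakk>X \<in> Obj C; Y \<in> Obj C; Z \<in> Obj C; Z' \<in> Obj C\<rbrakk> \<Longrightarrow>
      Assoc C X Y (Z \<boxtimes> Z') \<cdot> Assoc C (X \<boxtimes> Y) Z Z' =
      (Id C X \<boxdot> Assoc C Y Z Z') \<cdot> Assoc C X (Y \<boxtimes> Z) Z' \<cdot> (Assoc C X Y Z \<boxdot> Id C Z')"
    and triangle: "\<lbrakk>X \<in> Obj C; Y \<in> Obj C\<rbrakk> \<Longrightarrow>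
      Assoc C X (Unit C) Y \<cdot> (LUnit C X \<boxdot> Id C Y) = Id C X \<boxdot> RUnit C Y"

locale bar_category = monoidal_category C
  for C :: "('o, 'm, 'z) bar_scheme" (structure) +
  assumes BarO_obj: "X \<in> Obj C \<Longrightarrow> BarO C X \<in> Obj C"
    and BarA_hom: "u \<in> Hom C X Y \<Longrightarrow> BarA C u \<in> Hom C (BarO C X) (BarO C Y)"
    and BarA_Id: "X \<in> Obj C \<Longrightarrow> BarA C (Id C X) = Id C (BarO C X)"
    and BarA_Comp: "\<lbrakk>u \<in> Hom C X Y; w \<in> Hom C Y Z\<rbrakk> \<Longrightarrow> BarA C (w \<cdot> u) = BarA C w \<cdot> BarA C u"
    and BB_iso: "X \<in> Obj C \<Longrightarrow> BB C X \<in> Iso C X (BarO C (BarO C X))"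
    and BB_nat: "u \<in> Hom C X Y \<Longrightarrow> BB C Y \<cdot> u = BarA C (BarA C u) \<cdot> BB C X"
    and Star_iso: "Star C \<in> Iso C (Unit C) (BarO C (Unit C))"
    and Ups_iso: "\<lbrakk>X \<in> Obj C; Y \<in> Obj C\<rbrakk> \<Longrightarrow>
      Ups C X Y \<in> Iso C (BarO C (X \<boxtimes> Y)) (BarO C Y \<boxtimes> BarO C X)"
    and Ups_nat: "\<lbrakk>u \<in> Hom C X X'; w \<in> Hom C Y Y'\<rbrakk> \<Longrightarrow>
      Ups C X' Y' \<cdot> BarA C (u \<boxdot> w) = (BarA C w \<boxdot> BarA C u) \<cdot> Ups C X Y"
    and Ups_LUnit: "X \<in> Obj C \<Longrightarrow>
      (Inv C (Star C) \<boxdot> Id C (BarO C X)) \<cdot> Ups C X (Unit C) \<cdot> BarA C (LUnit C X) =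
      RUnit C (BarO C X)"
    and Ups_RUnit: "X \<in> Obj C \<Longrightarrow>
      (Id C (BarO C X) \<boxdot> Inv C (Star C)) \<cdot> Ups C (Unit C) X \<cdot> BarA C (RUnit C X) =
      LUnit C (BarO C X)"
    and Ups_Assoc: "\<lbrakk>X \<in> Obj C; Y \<in> Obj C; Z \<in> Obj C\<rbrakk> \<Longrightarrow>
      Assoc C (BarO C Z) (BarO C Y) (BarO C X) \<cdot> (Ups C Y Z \<boxdot> Id C (BarO C X))
        \<cdot> Ups C X (Y \<boxtimes> Z) \<cdot> BarA C (Assoc C X Y Z) =
      (Id C (BarO C Z) \<boxdot> Ups C X Y) \<cdot> Ups C (X \<boxtimes> Y) Z"
    and Star_BB: "BarA C (Star C) \<cdot> Star C = BB C (Unit C)"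
    and Bar_BB: "X \<in> Obj C \<Longrightarrow> BarA C (BB C X) = BB C (BarO C X)"

locale strong_bar_category = bar_category +
  assumes strong: "\<lbrakk>X \<in> Obj C; Y \<in> Obj C\<rbrakk> \<Longrightarrow>
    Ups C (BarO C Y) (BarO C X) \<cdot> BarA C (Ups C X Y) \<cdot> BB C (X \<boxtimes> Y) = BB C X \<boxdot> BB C Y"

section \<open>Duals\<close>

record ('o, 'm) duals =
  DualO :: "'o \<Rightarrow> 'o"
  DualA :: "'m \<Rightarrow> 'm"
  EvL :: "'o \<Rightarrow> 'm"
  CoevL :: "'o \<Rightarrow> 'm"

locale left_duals = monoidal_category C
  for C :: "('o, 'm, 'z) monoidal_scheme" (structure) +
  fixes D :: "('o, 'm) duals"
  assumes DualO_obj: "X \<in> Obj C \<Longrightarrow> DualO D X \<in> Obj C"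
    and DualA_hom: "u \<in> Hom C X Y \<Longrightarrow> DualA D u \<in> Hom C (DualO D Y) (DualO D X)"
    and DualA_Id: "X \<in> Obj C \<Longrightarrow> DualA D (Id C X) = Id C (DualO D X)"
    and DualA_Comp: "\<lbrakk>u \<in> Hom C X Y; w \<in> Hom C Y Z\<rbrakk> \<Longrightarrow> DualA D (w \<cdot> u) = DualA D u \<cdot> DualA D w"
    and EvL_hom: "X \<in> Obj C \<Longrightarrow> EvL D X \<in> Hom C (DualO D X \<boxtimes> X) (Unit C)"
    and CoevL_hom: "X \<in> Obj C \<Longrightarrow> CoevL D X \<in> Hom C (Unit C) (X \<boxtimes> DualO D X)"
    and zigzag: "X \<in> Obj C \<Longrightarrow>
      (Id C X \<boxdot> EvL D X) \<cdot> Assoc C X (DualO D X) X \<cdot> (CoevL D X \<boxdot> Id C X) \<cdot> RUnit C X = LUnit C X"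
    and zigzag_dual: "X \<in> Obj C \<Longrightarrow>
      (EvL D X \<boxdot> Id C (DualO D X)) \<cdot> Inv C (Assoc C (DualO D X) X (DualO D X))
        \<cdot> (Id C (DualO D X) \<boxdot> CoevL D X) \<cdot> LUnit C (DualO D X) = RUnit C (DualO D X)"

definition RDualO :: "('o, 'm, 'z) bar_scheme \<Rightarrow> ('o, 'm) duals \<Rightarrow> 'o \<Rightarrow> 'o" where
  "RDualO C D X = BarO C (DualO D (BarO C X))"

definition EvR :: "('o, 'm, 'z) bar_scheme \<Rightarrow> ('o, 'm) duals \<Rightarrow> 'o \<Rightarrow> 'm" where
  "EvR C D X = Inv C (Star C) \<cdot>\<^bsub>C\<^esub> BarA C (EvL D (BarO C X))
     \<cdot>\<^bsub>C\<^esub> Inv C (Ups C (DualO D (BarO C X)) (BarO C X)) \<cdot>\<^bsub>C\<^esub> (BB C X \<boxdot>\<^bsub>C\<^esub> Id C (RDualO C D X))"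

definition CoevR :: "('o, 'm, 'z) bar_scheme \<Rightarrow> ('o, 'm) duals \<Rightarrow> 'o \<Rightarrow> 'm" where
  "CoevR C D X = (Id C (RDualO C D X) \<boxdot>\<^bsub>C\<^esub> Inv C (BB C X))
     \<cdot>\<^bsub>C\<^esub> Ups C (BarO C X) (DualO D (BarO C X)) \<cdot>\<^bsub>C\<^esub> BarA C (CoevL D (BarO C X)) \<cdot>\<^bsub>C\<^esub> Star C"

section \<open>Functors of bar categories to complex vector spaces\<close>

text \<open>All objects of the target category are complex vector spaces carried by subsets of one type
  \<open>'v\<close>.  The identification of \<open>F(1)\<close> with the complex numbers is the linear isomorphism
  \<open>FU\<close>.\<close>

record ('o, 'm, 'v) vfunctor =
  FO :: "'o \<Rightarrow> 'v cvs"
  FA :: "'m \<Rightarrow> 'v \<Rightarrow> 'v"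
  FT :: "'o \<Rightarrow> 'o \<Rightarrow> ('v, 'v) tensor \<Rightarrow> 'v"
  FU :: "complex \<Rightarrow> 'v"
  FB :: "'o \<Rightarrow> 'v \<Rightarrow> 'v"

definition FTinv :: "('o, 'm, 'v) vfunctor \<Rightarrow> 'o \<Rightarrow> 'o \<Rightarrow> 'v \<Rightarrow> ('v, 'v) tensor" where
  "FTinv F X Y = inv_on (FO F X \<otimes>\<^sub>v FO F Y) (FT F X Y)"

definition FBinv :: "('o, 'm, 'v) vfunctor \<Rightarrow> 'o \<Rightarrow> 'v \<Rightarrow> 'v" where
  "FBinv F X = inv_on (conj_space (FO F X)) (FB F X)"

locale monoidal_vfunctor = monoidal_category C
  for C :: "('o, 'm, 'z) monoidal_scheme" (structure) +
  fixes F :: "('o, 'm, 'v) vfunctor"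
  assumes FO_cspace: "X \<in> Obj C \<Longrightarrow> cspace (FO F X)"
    and FA_lin: "u \<in> Hom C X Y \<Longrightarrow> FA F u \<in> lin (FO F X) (FO F Y)"
    and FA_Id: "\<lbrakk>X \<in> Obj C; x \<in> carrier (FO F X)\<rbrakk> \<Longrightarrow> FA F (Id C X) x = x"
    and FA_Comp: "\<lbrakk>u \<in> Hom C X Y; w \<in> Hom C Y Z; x \<in> carrier (FO F X)\<rbrakk> \<Longrightarrow>
      FA F (w \<cdot> u) x = FA F w (FA F u x)"
    and FT_lin: "\<lbrakk>X \<in> Obj C; Y \<in> Obj C\<rbrakk> \<Longrightarrow> FT F X Y \<in> lin (FO F X \<otimes>\<^sub>v FO F Y) (FO F (X \<boxtimes> Y))"
    and FT_bij: "\<lbrakk>X \<in> Obj C; Y \<in> Obj C\<rbrakk> \<Longrightarrow>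
      bij_betw (FT F X Y) (carrier (FO F X \<otimes>\<^sub>v FO F Y)) (carrier (FO F (X \<boxtimes> Y)))"
    and FT_nat: "\<lbrakk>u \<in> Hom C X X'; w \<in> Hom C Y Y'; t \<in> carrier (FO F X \<otimes>\<^sub>v FO F Y)\<rbrakk> \<Longrightarrow>
      FT F X' Y' (tensor_map (FO F X) (FO F Y) (FO F X') (FO F Y') (FA F u) (FA F w) t) =
      FA F (u \<boxdot> w) (FT F X Y t)"
    and FT_Assoc: "\<lbrakk>X \<in> Obj C; Y \<in> Obj C; Z \<in> Obj C;
        s \<in> carrier ((FO F X \<otimes>\<^sub>v FO F Y) \<otimes>\<^sub>v FO F Z)\<rbrakk> \<Longrightarrow>
      FT F X (Y \<boxtimes> Z) (tensor_map (FO F X) (FO F Y \<otimes>\<^sub>v FO F Z) (FO F X) (FO F (Y \<boxtimes> Z))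
        (\<lambda>x. x) (FT F Y Z) (vassoc (FO F X) (FO F Y) (FO F Z) s)) =
      FA F (Assoc C X Y Z) (FT F (X \<boxtimes> Y) Z
        (tensor_map (FO F X \<otimes>\<^sub>v FO F Y) (FO F Z) (FO F (X \<boxtimes> Y)) (FO F Z) (FT F X Y) (\<lambda>z. z) s))"
    and FU_lin: "FU F \<in> lin cunit (FO F (Unit C))"
    and FU_bij: "bij_betw (FU F) (carrier cunit) (carrier (FO F (Unit C)))"
    and FA_LUnit: "\<lbrakk>X \<in> Obj C; x \<in> carrier (FO F X)\<rbrakk> \<Longrightarrow>
      FA F (LUnit C X) x = FT F X (Unit C)
        (tensor_map (FO F X) cunit (FO F X) (FO F (Unit C)) (\<lambda>x. x) (FU F) (vlunit (FO F X) x))"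
    and FA_RUnit: "\<lbrakk>X \<in> Obj C; x \<in> carrier (FO F X)\<rbrakk> \<Longrightarrow>
      FA F (RUnit C X) x = FT F (Unit C) X
        (tensor_map cunit (FO F X) (FO F (Unit C)) (FO F X) (FU F) (\<lambda>x. x) (vrunit (FO F X) x))"

locale bar_vfunctor = bar_category C + monoidal_vfunctor C F
  for C :: "('o, 'm, 'z) bar_scheme" (structure) and F :: "('o, 'm, 'v) vfunctor" +
  assumes FB_lin: "Y \<in> Obj C \<Longrightarrow> FB F Y \<in> lin (conj_space (FO F Y)) (FO F (BarO C Y))"
    and FB_bij: "Y \<in> Obj C \<Longrightarrow>
      bij_betw (FB F Y) (carrier (conj_space (FO F Y))) (carrier (FO F (BarO C Y)))"
    and FB_nat: "\<lbrakk>u \<in> Hom C X Y; x \<in> carrier (conj_space (FO F X))\<rbrakk> \<Longrightarrow>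
      FB F Y (conj_map (FA F u) x) = FA F (BarA C u) (FB F X x)"
    and FO_Bar_Unit: "FO F (BarO C (Unit C)) = conj_space (FO F (Unit C))"
    and FA_Star: "c \<in> carrier cunit \<Longrightarrow> FA F (Star C) (FU F c) = conj_map (FU F) (vstar c)"
    and FA_BB: "\<lbrakk>Y \<in> Obj C; y \<in> carrier (FO F Y)\<rbrakk> \<Longrightarrow>
      FA F (BB C Y) y = FB F (BarO C Y) (conj_map (FB F Y) (vbb y))"
    and FB_Ups: "\<lbrakk>X \<in> Obj C; Y \<in> Obj C; z \<in> carrier (conj_space (FO F (X \<boxtimes> Y)))\<rbrakk> \<Longrightarrow>
      tensor_map (conj_space (FO F Y)) (conj_space (FO F X)) (FO F (BarO C Y)) (FO F (BarO C X))
        (FB F Y) (FB F X) (vups (FO F X) (FO F Y) (conj_map (FTinv F X Y) z)) =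
      FTinv F (BarO C Y) (BarO C X) (FA F (Ups C X Y) (FB F (X \<boxtimes> Y) z))"

section \<open>Representability and the reconstructed structure\<close>

definition Nat_trans :: "('o, 'm, 'z) category_scheme \<Rightarrow> ('o, 'm, 'v) vfunctor \<Rightarrow> 'v cvs \<Rightarrow>
    ('o \<Rightarrow> ('v, 'v) tensor \<Rightarrow> 'v) set" where
  "Nat_trans C F V = {\<eta> \<in> (\<Pi>\<^sub>E X\<in>Obj C. Lin (V \<otimes>\<^sub>v FO F X) (FO F X)).
     \<forall>X\<in>Obj C. \<forall>Y\<in>Obj C. \<forall>u\<in>Hom C X Y. \<forall>t\<in>carrier (V \<otimes>\<^sub>v FO F X).
       \<eta> Y (tensor_map V (FO F X) V (FO F Y) (\<lambda>v. v) (FA F u) t) = FA F u (\<eta> X t)}"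

text \<open>The spaces \<open>V\<close> range over all complex vector spaces carried by subsets of \<open>'v\<close>; this
  includes \<open>H\<close> and, up to isomorphism, the complex numbers.\<close>

locale represents =
  fixes C :: "('o, 'm, 'z) category_scheme" and F :: "('o, 'm, 'v) vfunctor"
    and H :: "'v cvs" and \<theta> :: "'v cvs \<Rightarrow> ('v \<Rightarrow> 'v) \<Rightarrow> 'o \<Rightarrow> ('v, 'v) tensor \<Rightarrow> 'v"
  assumes H_cspace: "cspace H"
    and \<theta>_bij: "cspace V \<Longrightarrow> bij_betw (\<theta> V) (Lin V H) (Nat_trans C F V)"
    and \<theta>_nat: "\<lbrakk>cspace U; cspace V; g \<in> Lin U V; \<phi> \<in> Lin V H; X \<in> Obj C;
        t \<in> carrier (U \<otimes>\<^sub>v FO F X)\<rbrakk> \<Longrightarrow>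
      \<theta> U (compose (carrier U) \<phi> g) X t =
      \<theta> V \<phi> X (tensor_map U (FO F X) V (FO F X) g (\<lambda>x. x) t)"

definition act :: "('o, 'm, 'v) vfunctor \<Rightarrow> 'v cvs \<Rightarrow> ('v cvs \<Rightarrow> ('v \<Rightarrow> 'v) \<Rightarrow> 'o \<Rightarrow> ('v, 'v) tensor \<Rightarrow> 'v) \<Rightarrow>
    'o \<Rightarrow> 'v \<Rightarrow> 'v \<Rightarrow> 'v" where
  "act F H \<theta> X h x = \<theta> H (\<lambda>k\<in>carrier H. k) X (tens H (FO F X) h x)"

text \<open>The element of \<open>H\<close> that acts as a given natural endomorphism of \<open>F\<close>.\<close>

definition rep_elt :: "('o, 'm, 'z) category_scheme \<Rightarrow> ('o, 'm, 'v) vfunctor \<Rightarrow> 'v cvs \<Rightarrow>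
    ('v cvs \<Rightarrow> ('v \<Rightarrow> 'v) \<Rightarrow> 'o \<Rightarrow> ('v, 'v) tensor \<Rightarrow> 'v) \<Rightarrow> ('o \<Rightarrow> 'v \<Rightarrow> 'v) \<Rightarrow> 'v" where
  "rep_elt C F H \<theta> \<eta> = (THE h. h \<in> carrier H \<and>
     (\<forall>X\<in>Obj C. \<forall>x\<in>carrier (FO F X). act F H \<theta> X h x = \<eta> X x))"

definition rep_algebra :: "('o, 'm, 'z) category_scheme \<Rightarrow> ('o, 'm, 'v) vfunctor \<Rightarrow> 'v cvs \<Rightarrow>
    ('v cvs \<Rightarrow> ('v \<Rightarrow> 'v) \<Rightarrow> 'o \<Rightarrow> ('v, 'v) tensor \<Rightarrow> 'v) \<Rightarrow> 'v cvs" where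
  "rep_algebra C F H \<theta> = H\<lparr>
     mult := (\<lambda>a b. rep_elt C F H \<theta> (\<lambda>X x. act F H \<theta> X a (act F H \<theta> X b x))),
     one := rep_elt C F H \<theta> (\<lambda>X x. x)\<rparr>"

definition act2 :: "('o, 'm, 'v) vfunctor \<Rightarrow> 'v cvs \<Rightarrow> ('v cvs \<Rightarrow> ('v \<Rightarrow> 'v) \<Rightarrow> 'o \<Rightarrow> ('v, 'v) tensor \<Rightarrow> 'v) \<Rightarrow>
    'o \<Rightarrow> 'o \<Rightarrow> ('v, 'v) tensor \<Rightarrow> ('v, 'v) tensor \<Rightarrow> ('v, 'v) tensor" where
  "act2 F H \<theta> X Y t s = tensor_lift H H (FO F X \<otimes>\<^sub>v FO F Y) (\<lambda>a b.
     tensor_map (FO F X) (FO F Y) (FO F X) (FO F Y) (act F H \<theta> X a) (act F H \<theta> Y b) s) t"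

definition is_coproduct :: "('o, 'm, 'z) monoidal_scheme \<Rightarrow> ('o, 'm, 'v) vfunctor \<Rightarrow> 'v cvs \<Rightarrow>
    ('v cvs \<Rightarrow> ('v \<Rightarrow> 'v) \<Rightarrow> 'o \<Rightarrow> ('v, 'v) tensor \<Rightarrow> 'v) \<Rightarrow> 'v \<Rightarrow> ('v, 'v) tensor \<Rightarrow> bool" where
  "is_coproduct C F H \<theta> h t \<longleftrightarrow> t \<in> carrier (H \<otimes>\<^sub>v H) \<and>
     (\<forall>X\<in>Obj C. \<forall>Y\<in>Obj C. \<forall>z\<in>carrier (FO F (X \<boxtimes>\<^bsub>C\<^esub> Y)).
        FTinv F X Y (act F H \<theta> (X \<boxtimes>\<^bsub>C\<^esub> Y) h z) = act2 F H \<theta> X Y t (FTinv F X Y z))"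

text \<open>Representability on one variable alone does not force the natural transformation
  \<open>f\<inverse> \<circ> (h \<triangleright>) \<circ> f\<close> of \<open>F \<otimes> F\<close> to come from the algebraic tensor product \<open>H \<otimes> H\<close>
  (it may lie in a completion); that it does is what the existence of the reconstructed
  coproduct means.\<close>

definition has_coproduct :: "('o, 'm, 'z) monoidal_scheme \<Rightarrow> ('o, 'm, 'v) vfunctor \<Rightarrow> 'v cvs \<Rightarrow>
    ('v cvs \<Rightarrow> ('v \<Rightarrow> 'v) \<Rightarrow> 'o \<Rightarrow> ('v, 'v) tensor \<Rightarrow> 'v) \<Rightarrow> bool" where
  "has_coproduct C F H \<theta> \<longleftrightarrow> (\<forall>h\<in>carrier H. \<exists>t. is_coproduct C F H \<theta> h t)"

definition rep_coproduct :: "('o, 'm, 'z) monoidal_scheme \<Rightarrow> ('o, 'm, 'v) vfunctor \<Rightarrow> 'v cvs \<Rightarrow>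
    ('v cvs \<Rightarrow> ('v \<Rightarrow> 'v) \<Rightarrow> 'o \<Rightarrow> ('v, 'v) tensor \<Rightarrow> 'v) \<Rightarrow> 'v \<Rightarrow> ('v, 'v) tensor" where
  "rep_coproduct C F H \<theta> h = (THE t. is_coproduct C F H \<theta> h t)"

definition rep_counit :: "('o, 'm, 'z) monoidal_scheme \<Rightarrow> ('o, 'm, 'v) vfunctor \<Rightarrow> 'v cvs \<Rightarrow>
    ('v cvs \<Rightarrow> ('v \<Rightarrow> 'v) \<Rightarrow> 'o \<Rightarrow> ('v, 'v) tensor \<Rightarrow> 'v) \<Rightarrow> 'v \<Rightarrow> complex" where
  "rep_counit C F H \<theta> h = inv_on cunit (FU F) (act F H \<theta> (Unit C) h (FU F 1))"

definition rep_antipode :: "('o, 'm, 'z) monoidal_scheme \<Rightarrow> ('o, 'm) duals \<Rightarrow> ('o, 'm, 'v) vfunctor \<Rightarrow>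
    'v cvs \<Rightarrow> ('v cvs \<Rightarrow> ('v \<Rightarrow> 'v) \<Rightarrow> 'o \<Rightarrow> ('v, 'v) tensor \<Rightarrow> 'v) \<Rightarrow> 'v \<Rightarrow> 'v" where
  "rep_antipode C D F H \<theta> h = rep_elt C F H \<theta> (\<lambda>X x.
     let X' = DualO D X; V = FO F X; V' = FO F X'; U = FO F (Unit C);
         x1 = tensor_map cunit V U V (FU F) (\<lambda>v. v) (vrunit V x);
         x2 = tensor_map U V (FO F (X \<boxtimes>\<^bsub>C\<^esub> X')) V (FA F (CoevL D X)) (\<lambda>v. v) x1;
         x3 = tensor_map (FO F (X \<boxtimes>\<^bsub>C\<^esub> X')) V (V \<otimes>\<^sub>v V') V (FTinv F X X') (\<lambda>v. v) x2;
         x4 = vassoc V V' V x3;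
         x5 = tensor_map V (V' \<otimes>\<^sub>v V) V (V' \<otimes>\<^sub>v V) (\<lambda>v. v)
                (tensor_map V' V V' V (act F H \<theta> X' h) (\<lambda>v. v)) x4;
         x6 = tensor_map V (V' \<otimes>\<^sub>v V) V (FO F (X' \<boxtimes>\<^bsub>C\<^esub> X)) (\<lambda>v. v) (FT F X' X) x5;
         x7 = tensor_map V (FO F (X' \<boxtimes>\<^bsub>C\<^esub> X)) V U (\<lambda>v. v) (FA F (EvL D X)) x6;
         x8 = tensor_map V U V cunit (\<lambda>v. v) (inv_on cunit (FU F)) x7
     in inv_on V (vlunit V) x8)"

definition rep_antipode_inv :: "('o, 'm, 'z) bar_scheme \<Rightarrow> ('o, 'm) duals \<Rightarrow> ('o, 'm, 'v) vfunctor \<Rightarrow>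
    'v cvs \<Rightarrow> ('v cvs \<Rightarrow> ('v \<Rightarrow> 'v) \<Rightarrow> 'o \<Rightarrow> ('v, 'v) tensor \<Rightarrow> 'v) \<Rightarrow> 'v \<Rightarrow> 'v" where
  "rep_antipode_inv C D F H \<theta> h = rep_elt C F H \<theta> (\<lambda>X x.
     let X' = RDualO C D X; V = FO F X; V' = FO F X'; U = FO F (Unit C);
         x1 = tensor_map V cunit V U (\<lambda>v. v) (FU F) (vlunit V x);
         x2 = tensor_map V U V (FO F (X' \<boxtimes>\<^bsub>C\<^esub> X)) (\<lambda>v. v) (FA F (CoevR C D X)) x1;
         x3 = tensor_map V (FO F (X' \<boxtimes>\<^bsub>C\<^esub> X)) V (V' \<otimes>\<^sub>v V) (\<lambda>v. v) (FTinv F X' X) x2;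
         x4 = tensor_map V (V' \<otimes>\<^sub>v V) V (V' \<otimes>\<^sub>v V) (\<lambda>v. v)
                (tensor_map V' V V' V (act F H \<theta> X' h) (\<lambda>v. v)) x3;
         x5 = inv_on ((V \<otimes>\<^sub>v V') \<otimes>\<^sub>v V) (vassoc V V' V) x4;
         x6 = tensor_map (V \<otimes>\<^sub>v V') V (FO F (X \<boxtimes>\<^bsub>C\<^esub> X')) V (FT F X X') (\<lambda>v. v) x5;
         x7 = tensor_map (FO F (X \<boxtimes>\<^bsub>C\<^esub> X')) V U V (FA F (EvR C D X)) (\<lambda>v. v) x6;
         x8 = tensor_map U V cunit V (inv_on cunit (FU F)) (\<lambda>v. v) x7
     in inv_on V (vrunit V) x8)"

definition rep_T :: "('o, 'm, 'z) bar_scheme \<Rightarrow> ('o, 'm, 'v) vfunctor \<Rightarrow> 'v cvs \<Rightarrow>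
    ('v cvs \<Rightarrow> ('v \<Rightarrow> 'v) \<Rightarrow> 'o \<Rightarrow> ('v, 'v) tensor \<Rightarrow> 'v) \<Rightarrow> 'v \<Rightarrow> 'v" where
  "rep_T C F H \<theta> h = rep_elt C F H \<theta> (\<lambda>X x.
     inv_into UNIV vbb (conj_map (FBinv F X) (conj_map (act F H \<theta> (BarO C X) h) (conj_map (FB F X) (vbb x)))))"

definition rep_star :: "('o, 'm, 'z) bar_scheme \<Rightarrow> ('o, 'm) duals \<Rightarrow> ('o, 'm, 'v) vfunctor \<Rightarrow>
    'v cvs \<Rightarrow> ('v cvs \<Rightarrow> ('v \<Rightarrow> 'v) \<Rightarrow> 'o \<Rightarrow> ('v, 'v) tensor \<Rightarrow> 'v) \<Rightarrow> 'v \<Rightarrow> 'v" where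
  "rep_star C D F H \<theta> h = rep_T C F H \<theta> (rep_antipode_inv C D F H \<theta> h)"

section \<open>Hopf algebras with a star structure\<close>

definition tensor_mult :: "'a cvs \<Rightarrow> ('a, 'a) tensor \<Rightarrow> ('a, 'a) tensor \<Rightarrow> ('a, 'a) tensor" where
  "tensor_mult A s t = tensor_lift A A (A \<otimes>\<^sub>v A) (\<lambda>a b.
     tensor_lift A A (A \<otimes>\<^sub>v A) (\<lambda>c d. tens A A (a \<otimes>\<^bsub>A\<^esub> c) (b \<otimes>\<^bsub>A\<^esub> d)) t) s"

locale hopf_algebra =
  fixes A :: "'a cvs" (structure) and \<Delta> :: "'a \<Rightarrow> ('a, 'a) tensor" and \<epsilon> :: "'a \<Rightarrow> complex"
    and S :: "'a \<Rightarrow> 'a"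
  assumes cspace: "cspace A"
    and ring: "ring A"
    and smult_mult_left: "\<lbrakk>a \<in> carrier A; b \<in> carrier A\<rbrakk> \<Longrightarrow> (c \<odot> a) \<otimes> b = c \<odot> (a \<otimes> b)"
    and smult_mult_right: "\<lbrakk>a \<in> carrier A; b \<in> carrier A\<rbrakk> \<Longrightarrow> a \<otimes> (c \<odot> b) = c \<odot> (a \<otimes> b)"
    and coproduct_lin: "\<Delta> \<in> lin A (A \<otimes>\<^sub>v A)"
    and counit_lin: "\<epsilon> \<in> lin A cunit"
    and coassociative: "h \<in> carrier A \<Longrightarrow>
      vassoc A A A (tensor_map A A (A \<otimes>\<^sub>v A) A \<Delta> (\<lambda>x. x) (\<Delta> h)) =
      tensor_map A A A (A \<otimes>\<^sub>v A) (\<lambda>x. x) \<Delta> (\<Delta> h)"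
    and counit_left: "h \<in> carrier A \<Longrightarrow> tensor_lift A A A (\<lambda>a b. \<epsilon> a \<odot> b) (\<Delta> h) = h"
    and counit_right: "h \<in> carrier A \<Longrightarrow> tensor_lift A A A (\<lambda>a b. \<epsilon> b \<odot> a) (\<Delta> h) = h"
    and coproduct_mult: "\<lbrakk>a \<in> carrier A; b \<in> carrier A\<rbrakk> \<Longrightarrow>
      \<Delta> (a \<otimes> b) = tensor_mult A (\<Delta> a) (\<Delta> b)"
    and coproduct_one: "\<Delta> \<one> = tens A A \<one> \<one>"
    and counit_mult: "\<lbrakk>a \<in> carrier A; b \<in> carrier A\<rbrakk> \<Longrightarrow> \<epsilon> (a \<otimes> b) = \<epsilon> a * \<epsilon> b"
    and counit_one: "\<epsilon> \<one> = 1"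
    and antipode_lin: "S \<in> lin A A"
    and antipode_left: "h \<in> carrier A \<Longrightarrow> tensor_lift A A A (\<lambda>a b. S a \<otimes> b) (\<Delta> h) = \<epsilon> h \<odot> \<one>"
    and antipode_right: "h \<in> carrier A \<Longrightarrow> tensor_lift A A A (\<lambda>a b. a \<otimes> S b) (\<Delta> h) = \<epsilon> h \<odot> \<one>"

definition tensor_star :: "'a cvs \<Rightarrow> ('a \<Rightarrow> 'a) \<Rightarrow> ('a, 'a) tensor \<Rightarrow> ('a, 'a) tensor" where
  "tensor_star A star = tensor_lift A A (conj_space (A \<otimes>\<^sub>v A)) (\<lambda>a b. tens A A (star a) (star b))"

locale star_hopf_algebra = hopf_algebra A \<Delta> \<epsilon> S
  for A :: "'a cvs" (structure) and \<Delta> \<epsilon> S +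
  fixes star :: "'a \<Rightarrow> 'a"
  assumes star_antilinear: "star \<in> lin A (conj_space A)"
    and star_mult: "\<lbrakk>a \<in> carrier A; b \<in> carrier A\<rbrakk> \<Longrightarrow> star (a \<otimes> b) = star b \<otimes> star a"
    and star_star: "a \<in> carrier A \<Longrightarrow> star (star a) = a"
    and star_coproduct: "h \<in> carrier A \<Longrightarrow> \<Delta> (star h) = tensor_star A star (\<Delta> h)"

end

(* Through the evaluation X' (x) X -> 1, each F(X') pairs nondegenerately with F(X), and S(h) is the
   transpose of the action of h: <phi, S(h) x> = <h phi, x>.  Any morphism P (x) X -> 1 of C factors
   through a morphism P -> X', on whose image under F the action of h can be moved; this gives the
   naturality of S(h) and, from the nested evaluation (Y' (x) X') (x) (X (x) Y) -> 1,
   Delta(S(h)) = S(h_(2)) (x) S(h_(1)).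

   Under fb the right evaluation of X is the complex conjugate of the left evaluation of bar X, so
   S^-1 = T S T.  Since T T = id, this gives h^* = T(S^-1(h)) = S(T(h)).  As the right evaluation makes
   X a left dual of its right dual, T S T S = id, which yields both h^** = h and (S h)^* = S^-1(h^* ).
   S reverses products and T preserves them; S and T both reverse coproducts.

   A coproduct is determined by its action on the spaces F(X) (x) F(Y) because linear functionals
   separate the points of a tensor product. *)
theory Submission
  imports Defs
begin

section \<open>Linear algebra\<close>

text \<open>The structure on \<open>H\<close> is given by composites of coherence maps, while the
  claims are about elements. The passage rests on the vectors \<open>pr X Y x y\<close>, the images
  of x \<otimes> y under f: they span F(X \<otimes> Y), so coherence diagrams turn into equations of
  vectors. The coevaluation of X, read through the inverse of f, is a finite sum of p i \<otimes> q
  i, and the zigzag identities say that x is the sum of <q i, x> p i. Hence each F(X) is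
  finite-dimensional, transposes exist, and the long composites defining S and its inverse collapse
  to finite sums. Representability concerns F alone: it produces elements of H from natural
  endomorphisms of F, but no elements of H \<otimes> H. The coproduct exists by hypothesis and is
  identified only through uniqueness; this governs the Hopf algebra axioms, which are part of the
  claim, as much as the behaviour of S and T. On underlying functions conjugation is invisible, so
  the reversal of coproducts by T comes from \<Upsilon> alone. One constant must be controlled: the
  scalar by which fb acts at the unit object.\<close>

lemma lin_closed: "g \<in> lin V W \<Longrightarrow> x \<in> carrier V \<Longrightarrow> g x \<in> carrier W"
  unfolding lin_def by auto

lemma lin_add: "g \<in> lin V W \<Longrightarrow> x \<in> carrier V \<Longrightarrow> y \<in> carrier V \<Longrightarrow>
    g (x \<oplus>\<^bsub>V\<^esub> y) = g x \<oplus>\<^bsub>W\<^esub> g y"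
  unfolding lin_def by auto

lemma lin_smult: "g \<in> lin V W \<Longrightarrow> x \<in> carrier V \<Longrightarrow> g (c \<odot>\<^bsub>V\<^esub> x) = c \<odot>\<^bsub>W\<^esub> g x"
  unfolding lin_def by auto

lemma linI:
  assumes "\<And>x. x \<in> carrier V \<Longrightarrow> g x \<in> carrier W"
    and "\<And>x y. x \<in> carrier V \<Longrightarrow> y \<in> carrier V \<Longrightarrow> g (x \<oplus>\<^bsub>V\<^esub> y) = g x \<oplus>\<^bsub>W\<^esub> g y"
    and "\<And>c x. x \<in> carrier V \<Longrightarrow> g (c \<odot>\<^bsub>V\<^esub> x) = c \<odot>\<^bsub>W\<^esub> g x"
  shows "g \<in> lin V W"
  unfolding lin_def using assms by auto

lemma smult_zero_left: "cspace V \<Longrightarrow> x \<in> carrier V \<Longrightarrow> 0 \<odot>\<^bsub>V\<^esub> x = \<zero>\<^bsub>V\<^esub>"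
  using module.smult_l_null[of complex_ring V x] by simp

lemma smult_zero_right: "cspace V \<Longrightarrow> c \<odot>\<^bsub>V\<^esub> \<zero>\<^bsub>V\<^esub> = \<zero>\<^bsub>V\<^esub>"
  using module.smult_r_null[of complex_ring V c] by simp

lemma cspace_zero: "cspace V \<Longrightarrow> \<zero>\<^bsub>V\<^esub> \<in> carrier V"
  by (rule abelian_monoid.zero_closed[OF abelian_group.axioms(1)[OF cspaceD(1)]])

lemma cspace_add: "cspace V \<Longrightarrow> x \<in> carrier V \<Longrightarrow> y \<in> carrier V \<Longrightarrow> x \<oplus>\<^bsub>V\<^esub> y \<in> carrier V"
  by (rule abelian_monoid.a_closed[OF abelian_group.axioms(1)[OF cspaceD(1)]])

lemma cspace_abelian_monoid: "cspace V \<Longrightarrow> abelian_monoid V"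
  by (rule abelian_group.axioms(1)[OF cspaceD(1)])

lemma finsum_in: "cspace V \<Longrightarrow> f \<in> I \<rightarrow> carrier V \<Longrightarrow> finsum V f I \<in> carrier V"
  by (rule abelian_monoid.finsum_closed[OF cspace_abelian_monoid])

lemma lin_zero:
  assumes "cspace V" "cspace W" "g \<in> lin V W" shows "g \<zero>\<^bsub>V\<^esub> = \<zero>\<^bsub>W\<^esub>"
  using lin_smult[OF assms(3) cspace_zero[OF assms(1)], of 0]
  by (simp add: smult_zero_left assms cspace_zero lin_closed[OF assms(3)])

lemma lin_finsum:
  assumes V: "cspace V" and W: "cspace W" and g: "g \<in> lin V W"
    and I: "finite I" and f: "f \<in> I \<rightarrow> carrier V"
  shows "g (finsum V f I) = finsum W (\<lambda>i. g (f i)) I"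
proof -
  interpret V: module complex_ring V by fact
  interpret W: module complex_ring W by fact
  show ?thesis
    using I f
  proof (induction I rule: finite_induct)
    case empty
    then show ?case by (simp add: lin_zero[OF V W g])
  next
    case (insert i I)
    have "(\<lambda>i. g (f i)) \<in> I \<rightarrow> carrier W" using insert lin_closed[OF g] by auto
    then show ?case
      using insert lin_closed[OF g] by (simp add: lin_add[OF g] V.M.finsum_closed)
  qed
qed

lemma finsum_cong_on:
  assumes "cspace V" "\<And>i. i \<in> I \<Longrightarrow> f i = g i" "g \<in> I \<rightarrow> carrier V"
  shows "finsum V f I = finsum V g I"
proof -
  interpret module complex_ring V by fact
  show ?thesis by (rule M.finsum_cong') (use assms in auto)
qed

lemma lin_id: "cspace V \<Longrightarrow> (\<lambda>x. x) \<in> lin V V"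
  by (rule linI) auto

text \<open>\<open>lin\<close> looks at values on the carrier only, while several maps below are
  restricted functions or are known as finite sums only there; this transfers linearity to
  them.\<close>

lemma lin_cong: "g \<in> lin V W \<Longrightarrow> cspace V \<Longrightarrow> (\<And>x. x \<in> carrier V \<Longrightarrow> k x = g x) \<Longrightarrow> k \<in> lin V W"
  unfolding lin_def using cspaceD(2)[of V] cspace_add[of V] by (simp add: Pi_def)

lemma lin_inv_on:
  assumes V: "cspace V" and g: "g \<in> lin V W" and b: "bij_betw g (carrier V) (carrier W)"
  shows "inv_on V g \<in> lin W V"
proof (rule linI)
  have inj: "inj_on g (carrier V)" and im: "g ` carrier V = carrier W"
    using b by (auto simp: bij_betw_def)
  have mem: "inv_on V g y \<in> carrier V" and gi: "g (inv_on V g y) = y" if "y \<in> carrier W" for y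
    using that im by (auto intro: inv_into_into f_inv_into_f)
  fix x assume x: "x \<in> carrier W"
  show "inv_on V g x \<in> carrier V" by (rule mem[OF x])
  show "inv_on V g (c \<odot>\<^bsub>W\<^esub> x) = c \<odot>\<^bsub>V\<^esub> inv_on V g x" for c
    by (rule inv_into_f_eq[OF inj])
      (use x mem gi in \<open>auto simp: lin_smult[OF g] cspaceD(2)[OF V]\<close>)
  show "inv_on V g (x \<oplus>\<^bsub>W\<^esub> y) = inv_on V g x \<oplus>\<^bsub>V\<^esub> inv_on V g y" if y: "y \<in> carrier W" for y
    by (rule inv_into_f_eq[OF inj])
      (use x y mem gi in \<open>auto simp: lin_add[OF g] cspace_add[OF V]\<close>)
qed

lemma inv_on_left: "bij_betw g (carrier V) A \<Longrightarrow> x \<in> carrier V \<Longrightarrow> inv_on V g (g x) = x"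
  by (simp add: bij_betw_def)

lemma inv_on_right: "bij_betw g (carrier V) A \<Longrightarrow> y \<in> A \<Longrightarrow> g (inv_on V g y) = y"
  by (auto simp: bij_betw_def intro: f_inv_into_f)

text \<open>Conjugation alters \<open>smult\<close> alone and \<open>cnj\<close> is an involution,
  so conjugating twice returns the very same record. Composites of two antilinear maps are therefore
  linear without any transport along bb.\<close>

lemma conj_space_simps [simp]:
  "carrier (conj_space V) = carrier V" "\<zero>\<^bsub>conj_space V\<^esub> = \<zero>\<^bsub>V\<^esub>"
  "x \<oplus>\<^bsub>conj_space V\<^esub> y = x \<oplus>\<^bsub>V\<^esub> y" "c \<odot>\<^bsub>conj_space V\<^esub> x = cnj c \<odot>\<^bsub>V\<^esub> x"
  "conj_space (conj_space V) = V"
  by (simp_all add: conj_space_def)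

text \<open>Sums depend on the additive group, which a space shares with its conjugate; hence
  antilinear maps such as \<open>FB\<close> pass through the same \<open>finsum\<close>.\<close>

lemma finsum_conj_space [simp]: "finsum (conj_space V) = finsum V"
  by (intro ext) (simp add: finsum_def conj_space_def)

lemma cunit_simps [simp]:
  "carrier cunit = UNIV" "\<zero>\<^bsub>cunit\<^esub> = 0" "\<one>\<^bsub>cunit\<^esub> = 1" "x \<oplus>\<^bsub>cunit\<^esub> y = x + y"
  "c \<odot>\<^bsub>cunit\<^esub> x = c * x"
  by (simp_all add: cunit_def)

lemma lin_conj_space: "g \<in> lin V W \<Longrightarrow> g \<in> lin (conj_space V) (conj_space W)"
  unfolding lin_def by auto

section \<open>Subspaces and separating functionals\<close>

lemma submodule_cspaceD:
  assumes "cspace V" "submodule M complex_ring V"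
  shows "M \<subseteq> carrier V" "\<zero>\<^bsub>V\<^esub> \<in> M" "\<And>x y. x \<in> M \<Longrightarrow> y \<in> M \<Longrightarrow> x \<oplus>\<^bsub>V\<^esub> y \<in> M"
    "\<And>c x. x \<in> M \<Longrightarrow> c \<odot>\<^bsub>V\<^esub> x \<in> M"
proof -
  interpret module complex_ring V by fact
  note E = submoduleE[OF assms(2)]
  show "M \<subseteq> carrier V" "\<And>x y. x \<in> M \<Longrightarrow> y \<in> M \<Longrightarrow> x \<oplus>\<^bsub>V\<^esub> y \<in> M"
    using E by auto
  show s: "\<And>c x. x \<in> M \<Longrightarrow> c \<odot>\<^bsub>V\<^esub> x \<in> M" using E by auto
  obtain x where x: "x \<in> M" using E(2) by auto
  then show "\<zero>\<^bsub>V\<^esub> \<in> M" using s[OF x, of 0] smult_zero_left[OF assms(1)] E(1) by auto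
qed

lemma submodule_cspaceI:
  assumes V: "cspace V" and "M \<subseteq> carrier V" "\<zero>\<^bsub>V\<^esub> \<in> M" "\<And>x y. x \<in> M \<Longrightarrow> y \<in> M \<Longrightarrow> x \<oplus>\<^bsub>V\<^esub> y \<in> M"
    "\<And>c x. x \<in> M \<Longrightarrow> c \<odot>\<^bsub>V\<^esub> x \<in> M"
  shows "submodule M complex_ring V"
proof -
  interpret V: module complex_ring V by fact
  have "(- 1) \<odot>\<^bsub>V\<^esub> x = \<ominus>\<^bsub>V\<^esub> x" if x: "x \<in> carrier V" for x
  proof -
    have "(- 1) \<odot>\<^bsub>V\<^esub> x \<oplus>\<^bsub>V\<^esub> x = (- 1 + 1) \<odot>\<^bsub>V\<^esub> x"
      using cspaceD(3)[OF V x, of "-1" 1] cspaceD(6)[OF V x] by simp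
    then show ?thesis
      using V.M.minus_equality[of "(- 1) \<odot>\<^bsub>V\<^esub> x" x] x cspaceD(2)[OF V x] smult_zero_left[OF V x]
      by simp
  qed
  then have "\<ominus>\<^bsub>V\<^esub> x \<in> M" if "x \<in> M" for x
    using assms(2) assms(5)[OF that, of "-1"] that by auto
  then show ?thesis
    by (intro V.submoduleI) (use assms in auto)
qed

text \<open>Zorn's lemma gives a subspace M maximal among those that contain N and avoid b.
  Maximality forces every vector into the sum of M and the line of b, and the coefficient of b is
  the functional. No basis is chosen.\<close>

lemma separating_functional:
  assumes V: "cspace V" and N: "submodule N complex_ring V" and b: "b \<in> carrier V" "b \<notin> N"
  obtains \<zeta> where "\<zeta> \<in> lin V cunit" "\<zeta> b = 1" "\<And>x. x \<in> N \<Longrightarrow> \<zeta> x = 0"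
proof -
  interpret V: module complex_ring V by fact
  note D = cspaceD(2-6)[OF V] and Z = smult_zero_left[OF V]
  let ?A = "{M. submodule M complex_ring V \<and> N \<subseteq> M \<and> b \<notin> M}"
  have "\<exists>M\<in>?A. \<forall>X\<in>?A. M \<subseteq> X \<longrightarrow> X = M"
  proof (rule subset_Zorn_nonempty)
    show "?A \<noteq> {}" using N b by auto
    fix \<C> assume ne: "\<C> \<noteq> {}" and ch: "subset.chain ?A \<C>"
    have sub: "submodule M complex_ring V" "N \<subseteq> M" "b \<notin> M" if "M \<in> \<C>" for M
      using ch that by (auto simp: subset.chain_def)
    note SD = submodule_cspaceD[OF V sub(1)]
    have "submodule (\<Union>\<C>) complex_ring V"
    proof (rule submodule_cspaceI[OF V])
      show "\<Union>\<C> \<subseteq> carrier V" using SD by blast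
      show "\<zero>\<^bsub>V\<^esub> \<in> \<Union>\<C>" using SD(2) ne by blast
      show "x \<oplus>\<^bsub>V\<^esub> y \<in> \<Union>\<C>" if xy: "x \<in> \<Union>\<C>" "y \<in> \<Union>\<C>" for x y
      proof -
        obtain M M' where M: "M \<in> \<C>" "x \<in> M" "M' \<in> \<C>" "y \<in> M'" using xy by auto
        have "M \<subseteq> M' \<or> M' \<subseteq> M" using ch M by (auto simp: subset.chain_def)
        then show ?thesis using SD(3) M by blast
      qed
      show "c \<odot>\<^bsub>V\<^esub> x \<in> \<Union>\<C>" if "x \<in> \<Union>\<C>" for c x using that SD(4) by blast
    qed
    then show "\<Union>\<C> \<in> ?A" using sub ne by blast
  qed
  then obtain M where "M \<in> ?A" "\<forall>X\<in>?A. M \<subseteq> X \<longrightarrow> X = M"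
    by (elim bexE)
  then have M: "submodule M complex_ring V" "N \<subseteq> M" "b \<notin> M"
    and max: "\<And>X. submodule X complex_ring V \<Longrightarrow> N \<subseteq> X \<Longrightarrow> b \<notin> X \<Longrightarrow> M \<subseteq> X \<Longrightarrow> X = M"
    by simp_all
  note S = submodule_cspaceD[OF V M(1)]
  have Mc: "x \<in> carrier V" if "x \<in> M" for x using S(1) that by auto
  have ex: "\<exists>c. \<exists>m\<in>M. v = m \<oplus>\<^bsub>V\<^esub> c \<odot>\<^bsub>V\<^esub> b" if v: "v \<in> carrier V" for v
  proof (cases "v \<in> M")
    case True
    then show ?thesis by (intro exI[of _ 0] bexI[of _ v]) (simp_all add: Z b v)
  next
    case False
    \<comment> \<open>The span of M and v is larger than M, so by maximality it contains b. Solving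
      b = m + d v for v requires d \<noteq> 0, which holds because b is not in M.\<close>
    let ?X = "{m \<oplus>\<^bsub>V\<^esub> c \<odot>\<^bsub>V\<^esub> v | m c. m \<in> M}"
    have X: "submodule ?X complex_ring V"
    proof (rule submodule_cspaceI[OF V])
      show "?X \<subseteq> carrier V" using Mc D(1) v by auto
      show "\<zero>\<^bsub>V\<^esub> \<in> ?X"
        by (rule CollectI, intro exI[of _ "\<zero>\<^bsub>V\<^esub>"] exI[of _ 0]) (simp add: S(2) Z v)
      show "x \<oplus>\<^bsub>V\<^esub> y \<in> ?X" if xy: "x \<in> ?X" "y \<in> ?X" for x y
      proof -
        obtain m c m' c' where *: "m \<in> M" "m' \<in> M" "x = m \<oplus>\<^bsub>V\<^esub> c \<odot>\<^bsub>V\<^esub> v" "y = m' \<oplus>\<^bsub>V\<^esub> c' \<odot>\<^bsub>V\<^esub> v"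
          using xy by blast
        then have "x \<oplus>\<^bsub>V\<^esub> y = (m \<oplus>\<^bsub>V\<^esub> m') \<oplus>\<^bsub>V\<^esub> (c + c') \<odot>\<^bsub>V\<^esub> v"
          using v by (simp add: D Mc V.M.a_ac)
        then show ?thesis using S(3) * by blast
      qed
      show "c \<odot>\<^bsub>V\<^esub> x \<in> ?X" if x: "x \<in> ?X" for c x
      proof -
        obtain m d where *: "m \<in> M" "x = m \<oplus>\<^bsub>V\<^esub> d \<odot>\<^bsub>V\<^esub> v" using x by blast
        then have "c \<odot>\<^bsub>V\<^esub> x = c \<odot>\<^bsub>V\<^esub> m \<oplus>\<^bsub>V\<^esub> (c * d) \<odot>\<^bsub>V\<^esub> v" using v by (simp add: D Mc)
        then show ?thesis using S(4) * by blast
      qed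
    qed
    have MX: "M \<subseteq> ?X"
    proof
      fix m assume "m \<in> M"
      then show "m \<in> ?X" by (intro CollectI exI[of _ m] exI[of _ 0]) (simp add: Z v Mc)
    qed
    have "v \<in> ?X" by (intro CollectI exI[of _ "\<zero>\<^bsub>V\<^esub>"] exI[of _ 1]) (simp add: S(2) v D)
    then have "?X \<noteq> M" using False by blast
    moreover have "N \<subseteq> ?X" using M(2) MX by (rule subset_trans)
    ultimately have "b \<in> ?X" using max[OF X _ _ MX] by metis
    then obtain m d where md: "m \<in> M" "b = m \<oplus>\<^bsub>V\<^esub> d \<odot>\<^bsub>V\<^esub> v" by blast
    have d: "d \<noteq> 0" using md M(3) Z[OF v] by (auto simp: Mc)
    have "v = (- 1 / d) \<odot>\<^bsub>V\<^esub> m \<oplus>\<^bsub>V\<^esub> (1 / d) \<odot>\<^bsub>V\<^esub> b"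
    proof -
      have "(- 1 / d) \<odot>\<^bsub>V\<^esub> m \<oplus>\<^bsub>V\<^esub> (1 / d) \<odot>\<^bsub>V\<^esub> b =
          (- 1 / d) \<odot>\<^bsub>V\<^esub> m \<oplus>\<^bsub>V\<^esub> ((1 / d) \<odot>\<^bsub>V\<^esub> m \<oplus>\<^bsub>V\<^esub> (1 / d * d) \<odot>\<^bsub>V\<^esub> v)"
        using md v by (simp add: D(1,3) D(4)[symmetric] Mc)
      also have "\<dots> = ((- 1 / d) + 1 / d) \<odot>\<^bsub>V\<^esub> m \<oplus>\<^bsub>V\<^esub> v"
        using md v d by (simp only: D(2) Mc) (simp add: D Mc V.M.a_assoc)
      finally show ?thesis using md v by (simp add: Z Mc)
    qed
    then show ?thesis using S(4)[OF md(1)] by blast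
  qed
  \<comment> \<open>Two different coefficients would put a nonzero multiple of b, hence b itself,
    into M.\<close>
  have uniq: "c = c'" if m: "m \<in> M" "m' \<in> M" and e: "m \<oplus>\<^bsub>V\<^esub> c \<odot>\<^bsub>V\<^esub> b = m' \<oplus>\<^bsub>V\<^esub> c' \<odot>\<^bsub>V\<^esub> b"
    for m m' c c'
  proof (rule ccontr)
    assume ne: "c \<noteq> c'"
    have "(c - c') \<odot>\<^bsub>V\<^esub> b = m' \<oplus>\<^bsub>V\<^esub> (- 1) \<odot>\<^bsub>V\<^esub> m"
    proof -
      have "(c - c') \<odot>\<^bsub>V\<^esub> b = (- 1) \<odot>\<^bsub>V\<^esub> m \<oplus>\<^bsub>V\<^esub> (m \<oplus>\<^bsub>V\<^esub> c \<odot>\<^bsub>V\<^esub> b) \<oplus>\<^bsub>V\<^esub> (- c') \<odot>\<^bsub>V\<^esub> b"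
      proof -
        have "(- 1) \<odot>\<^bsub>V\<^esub> m \<oplus>\<^bsub>V\<^esub> m = \<zero>\<^bsub>V\<^esub>"
          using D(2)[of m "-1" 1] m by (simp add: Mc D Z)
        then have "(- 1) \<odot>\<^bsub>V\<^esub> m \<oplus>\<^bsub>V\<^esub> (m \<oplus>\<^bsub>V\<^esub> c \<odot>\<^bsub>V\<^esub> b) = c \<odot>\<^bsub>V\<^esub> b"
          using m b by (simp add: Mc D(1) V.M.a_assoc[symmetric])
        then show ?thesis using D(2)[OF b(1), of c "- c'"] by simp
      qed
      also have "\<dots> = (- 1) \<odot>\<^bsub>V\<^esub> m \<oplus>\<^bsub>V\<^esub> (m' \<oplus>\<^bsub>V\<^esub> (c' \<odot>\<^bsub>V\<^esub> b \<oplus>\<^bsub>V\<^esub> (- c') \<odot>\<^bsub>V\<^esub> b))"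
        unfolding e using m b by (simp add: Mc D(1) V.M.a_assoc)
      also have "c' \<odot>\<^bsub>V\<^esub> b \<oplus>\<^bsub>V\<^esub> (- c') \<odot>\<^bsub>V\<^esub> b = \<zero>\<^bsub>V\<^esub>"
        using D(2)[OF b(1), of c' "- c'"] Z[OF b(1)] by simp
      finally show ?thesis using m by (simp add: Mc D(1) V.M.a_comm)
    qed
    then have "(c - c') \<odot>\<^bsub>V\<^esub> b \<in> M" using S m by simp
    then have "(1 / (c - c')) \<odot>\<^bsub>V\<^esub> ((c - c') \<odot>\<^bsub>V\<^esub> b) \<in> M" using S by blast
    then show False using ne M(3) b by (simp add: D(4)[symmetric] D(5))
  qed
  define \<zeta> where "\<zeta> v = (THE c. \<exists>m\<in>M. v = m \<oplus>\<^bsub>V\<^esub> c \<odot>\<^bsub>V\<^esub> b)" for v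
  have \<zeta>: "\<zeta> v = c" if "m \<in> M" "v = m \<oplus>\<^bsub>V\<^esub> c \<odot>\<^bsub>V\<^esub> b" for v m c
    unfolding \<zeta>_def
    by (rule the_equality) (use that uniq in blast)+
  show thesis
  proof (rule that)
    show "\<zeta> \<in> lin V cunit"
    proof (rule linI)
      fix x assume x: "x \<in> carrier V"
      obtain m c where mc: "m \<in> M" "x = m \<oplus>\<^bsub>V\<^esub> c \<odot>\<^bsub>V\<^esub> b" using ex[OF x] by blast
      show "\<zeta> (d \<odot>\<^bsub>V\<^esub> x) = d \<odot>\<^bsub>cunit\<^esub> \<zeta> x" for d
        using \<zeta>[OF mc] \<zeta>[OF S(4)[OF mc(1), of d], of "d \<odot>\<^bsub>V\<^esub> x" "d * c"] mc b by (simp add: D Mc)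
      show "\<zeta> (x \<oplus>\<^bsub>V\<^esub> y) = \<zeta> x \<oplus>\<^bsub>cunit\<^esub> \<zeta> y" if y: "y \<in> carrier V" for y
      proof -
        obtain m' c' where mc': "m' \<in> M" "y = m' \<oplus>\<^bsub>V\<^esub> c' \<odot>\<^bsub>V\<^esub> b" using ex[OF y] by blast
        show ?thesis
          using \<zeta>[OF mc] \<zeta>[OF mc'] \<zeta>[OF S(3)[OF mc(1) mc'(1)], of "x \<oplus>\<^bsub>V\<^esub> y" "c + c'"] mc mc' b
          by (simp add: D Mc V.M.a_ac)
      qed
    qed simp
    show "\<zeta> b = 1" by (rule \<zeta>[OF S(2)]) (simp add: D b)
    show "\<zeta> x = 0" if "x \<in> N" for x
      by (rule \<zeta>[of x]) (use that M Mc in \<open>auto simp: Z b\<close>)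
  qed
qed

section \<open>Tensor products\<close>

lemma bilinear_mapsI:
  assumes "\<And>v w. v \<in> carrier V \<Longrightarrow> w \<in> carrier W \<Longrightarrow> \<beta> v w \<in> carrier U"
    and "\<And>v v' w. \<lbrakk>v \<in> carrier V; v' \<in> carrier V; w \<in> carrier W\<rbrakk> \<Longrightarrow> \<beta> (v \<oplus>\<^bsub>V\<^esub> v') w = \<beta> v w \<oplus>\<^bsub>U\<^esub> \<beta> v' w"
    and "\<And>v w w'. \<lbrakk>v \<in> carrier V; w \<in> carrier W; w' \<in> carrier W\<rbrakk> \<Longrightarrow> \<beta> v (w \<oplus>\<^bsub>W\<^esub> w') = \<beta> v w \<oplus>\<^bsub>U\<^esub> \<beta> v w'"
    and "\<And>c v w. \<lbrakk>v \<in> carrier V; w \<in> carrier W\<rbrakk> \<Longrightarrow> \<beta> (c \<odot>\<^bsub>V\<^esub> v) w = c \<odot>\<^bsub>U\<^esub> \<beta> v w"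
    and "\<And>c v w. \<lbrakk>v \<in> carrier V; w \<in> carrier W\<rbrakk> \<Longrightarrow> \<beta> v (c \<odot>\<^bsub>W\<^esub> w) = c \<odot>\<^bsub>U\<^esub> \<beta> v w"
  shows "\<beta> \<in> bilinear_maps V W U"
  unfolding bilinear_maps_def lin_def using assms by auto

lemma bilinear_mapsD:
  assumes "\<beta> \<in> bilinear_maps V W U"
  shows "v \<in> carrier V \<Longrightarrow> \<beta> v \<in> lin W U" "w \<in> carrier W \<Longrightarrow> (\<lambda>v. \<beta> v w) \<in> lin V U"
  using assms unfolding bilinear_maps_def by auto

text \<open>Induction over the support of a formal sum that represents t. The coefficient of a
  generator is absorbed into its first entry, so the step only ever adds a pure tensor.\<close>

lemma tensor_induct:
  assumes V: "cspace V" and W: "cspace W" and t: "t \<in> carrier (V \<otimes>\<^sub>v W)"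
    and P0: "P \<zero>\<^bsub>V \<otimes>\<^sub>v W\<^esub>"
    and PS: "\<And>v w s. \<lbrakk>v \<in> carrier V; w \<in> carrier W; s \<in> carrier (V \<otimes>\<^sub>v W); P s\<rbrakk> \<Longrightarrow>
      P (tens V W v w \<oplus>\<^bsub>V \<otimes>\<^sub>v W\<^esub> s)"
  shows "P t"
proof -
  let ?S = "carrier V \<times> carrier W"
  let ?\<pi> = "\<lambda>x. tensor_relations V W +>\<^bsub>free_space ?S\<^esub> x"
  note pr = tensor_proj[OF V W]
  have main: "P (?\<pi> f)" if "finite T" "T \<subseteq> ?S" "{s. f s \<noteq> 0} \<subseteq> T" for T f
    using that
  proof (induction T arbitrary: f rule: finite_induct)
    case empty
    then have "f = (\<lambda>_. 0)" by auto
    then show ?case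
      using lin_zero[OF free_space_cspace cspace_tensor[OF V W] pr(1)] P0 by simp
  next
    case (insert x T)
    define f' where "f' = f(x := 0)"
    have f'T: "{s. f' s \<noteq> 0} \<subseteq> T" using insert.prems by (auto simp: f'_def)
    have f': "f' \<in> carrier (free_space ?S)"
      using insert.prems insert.hyps finite_subset[OF f'T] f'T by (auto simp: free_space_def)
    obtain v w where x: "x = (v, w)" "v \<in> carrier V" "w \<in> carrier W" using insert.prems by auto
    have dx: "delta x \<in> carrier (free_space ?S)" using x by (intro delta_carrier) simp
    have dec: "f = (f x \<odot>\<^bsub>free_space ?S\<^esub> delta x) \<oplus>\<^bsub>free_space ?S\<^esub> f'"
      by (auto simp: f'_def delta_def)
    have "?\<pi> f = f x \<odot>\<^bsub>V \<otimes>\<^sub>v W\<^esub> ?\<pi> (delta x) \<oplus>\<^bsub>V \<otimes>\<^sub>v W\<^esub> ?\<pi> f'"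
      by (subst dec, subst lin_add[OF pr(1) cspaceD(2)[OF free_space_cspace dx] f'],
          subst lin_smult[OF pr(1) dx]) (rule refl)
    also have "f x \<odot>\<^bsub>V \<otimes>\<^sub>v W\<^esub> ?\<pi> (delta x) = tens V W (f x \<odot>\<^bsub>V\<^esub> v) w"
      using tens_bilinear(3)[OF V W x(2,3)] x(1) by (simp add: tens_def)
    finally show ?case
      using PS[OF cspaceD(2)[OF V x(2)] x(3) _ insert.IH[of f']] insert.prems f'T
        lin_closed[OF pr(1) f'] by simp
  qed
  obtain f where f: "f \<in> carrier (free_space ?S)" "t = ?\<pi> f" using t pr(2) by auto
  show ?thesis
    unfolding f(2) by (rule main[of "{s. f s \<noteq> 0}"]) (use f(1) in \<open>auto simp: free_space_def\<close>)
qed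

lemma tensor_finsum:
  assumes V: "cspace V" and W: "cspace W" and t: "t \<in> carrier (V \<otimes>\<^sub>v W)"
  obtains n :: nat and p q where "p \<in> {..<n} \<rightarrow> carrier V" "q \<in> {..<n} \<rightarrow> carrier W"
    "t = finsum (V \<otimes>\<^sub>v W) (\<lambda>i. tens V W (p i) (q i)) {..<n}"
proof -
  interpret T: module complex_ring "V \<otimes>\<^sub>v W" by (rule cspace_tensor[OF V W])
  have "\<exists>(n::nat) p q. p \<in> {..<n} \<rightarrow> carrier V \<and> q \<in> {..<n} \<rightarrow> carrier W \<and>
    t = finsum (V \<otimes>\<^sub>v W) (\<lambda>i. tens V W (p i) (q i)) {..<n}"
  proof (rule tensor_induct[OF V W t])
    show "\<exists>(n::nat) p q. p \<in> {..<n} \<rightarrow> carrier V \<and> q \<in> {..<n} \<rightarrow> carrier W \<and>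
      \<zero>\<^bsub>V \<otimes>\<^sub>v W\<^esub> = finsum (V \<otimes>\<^sub>v W) (\<lambda>i. tens V W (p i) (q i)) {..<n}"
      by (rule exI[of _ 0]) simp
    fix v w s
    assume v: "v \<in> carrier V" "w \<in> carrier W" and s: "s \<in> carrier (V \<otimes>\<^sub>v W)"
      and ex: "\<exists>(n::nat) p q. p \<in> {..<n} \<rightarrow> carrier V \<and> q \<in> {..<n} \<rightarrow> carrier W \<and>
        s = finsum (V \<otimes>\<^sub>v W) (\<lambda>i. tens V W (p i) (q i)) {..<n}"
    then obtain n :: nat and p q where pq: "p \<in> {..<n} \<rightarrow> carrier V" "q \<in> {..<n} \<rightarrow> carrier W"
      "s = finsum (V \<otimes>\<^sub>v W) (\<lambda>i. tens V W (p i) (q i)) {..<n}" by blast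
    \<comment> \<open>The new pure tensor is stored at index n, so the old summands keep their
      indices.\<close>
    let ?p = "p(n := v)" and ?q = "q(n := w)"
    have cl: "(\<lambda>i. tens V W (p i) (q i)) \<in> {..<n} \<rightarrow> carrier (V \<otimes>\<^sub>v W)"
      using pq tens_closed[OF V W] by auto
    have "finsum (V \<otimes>\<^sub>v W) (\<lambda>i. tens V W (?p i) (?q i)) {..<n} = s"
      unfolding pq(3) by (rule finsum_cong_on[OF cspace_tensor[OF V W] _ cl]) auto
    moreover have "(\<lambda>i. tens V W (?p i) (?q i)) \<in> {..<n} \<rightarrow> carrier (V \<otimes>\<^sub>v W)"
      using cl by auto
    ultimately have eq: "finsum (V \<otimes>\<^sub>v W) (\<lambda>i. tens V W (?p i) (?q i)) {..<Suc n} = tens V W v w \<oplus>\<^bsub>V \<otimes>\<^sub>v W\<^esub> s"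
      by (simp add: lessThan_Suc tens_closed[OF V W] v Pi_iff)
    have "?p \<in> {..<Suc n} \<rightarrow> carrier V" "?q \<in> {..<Suc n} \<rightarrow> carrier W"
      using pq v by (auto simp: less_Suc_eq)
    then show "\<exists>(n::nat) p q. p \<in> {..<n} \<rightarrow> carrier V \<and> q \<in> {..<n} \<rightarrow> carrier W \<and>
        tens V W v w \<oplus>\<^bsub>V \<otimes>\<^sub>v W\<^esub> s = finsum (V \<otimes>\<^sub>v W) (\<lambda>i. tens V W (p i) (q i)) {..<n}"
      by (intro exI[of _ "Suc n"] exI[of _ ?p] exI[of _ ?q] conjI eq[symmetric])
  qed
  then show ?thesis using that by blast
qed

lemma tens_zero:
  assumes "cspace V" "cspace W"
  shows "v \<in> carrier V \<Longrightarrow> tens V W v \<zero>\<^bsub>W\<^esub> = \<zero>\<^bsub>V \<otimes>\<^sub>v W\<^esub>"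
    and "w \<in> carrier W \<Longrightarrow> tens V W \<zero>\<^bsub>V\<^esub> w = \<zero>\<^bsub>V \<otimes>\<^sub>v W\<^esub>"
  using bilinear_mapsD[OF tens_bilinear_maps[OF assms]] lin_zero[OF _ cspace_tensor[OF assms]] assms
  by metis+

lemma tens_finsum:
  assumes V: "cspace V" and W: "cspace W" and I: "finite I"
  shows "v \<in> carrier V \<Longrightarrow> f \<in> I \<rightarrow> carrier W \<Longrightarrow>
      tens V W v (finsum W f I) = finsum (V \<otimes>\<^sub>v W) (\<lambda>i. tens V W v (f i)) I"
    and "w \<in> carrier W \<Longrightarrow> g \<in> I \<rightarrow> carrier V \<Longrightarrow>
      tens V W (finsum V g I) w = finsum (V \<otimes>\<^sub>v W) (\<lambda>i. tens V W (g i) w) I"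
  using lin_finsum[OF W cspace_tensor[OF V W] bilinear_mapsD(1)[OF tens_bilinear_maps[OF V W]] I, of v f]
    lin_finsum[OF V cspace_tensor[OF V W] bilinear_mapsD(2)[OF tens_bilinear_maps[OF V W]] I, of w g]
  by auto

text \<open>Uniqueness in the universal property, in the form that replaces Sweedler notation below:
  an identity about a lift evaluated at a coproduct is reduced to pure tensors a \<otimes>
  b.\<close>

lemma lin_comp_lift:
  assumes "cspace V" "cspace W" "cspace U" "cspace U'" "\<beta> \<in> bilinear_maps V W U" "g \<in> lin U U'"
    and "k \<in> lin (V \<otimes>\<^sub>v W) U'" and "t \<in> carrier (V \<otimes>\<^sub>v W)"
    and "\<And>v w. v \<in> carrier V \<Longrightarrow> w \<in> carrier W \<Longrightarrow> g (\<beta> v w) = k (tens V W v w)"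
  shows "g (tensor_lift V W U \<beta> t) = k t"
  by (rule tensor_unique[OF assms(1,2,4) lin_comp[OF tensor_lift(1)[OF assms(1-3,5)] assms(6)]])
    (use assms tensor_lift(2)[OF assms(1-3,5)] in auto)

lemma tensor_lift_finsum:
  assumes V: "cspace V" and W: "cspace W" and U: "cspace U" and b: "\<beta> \<in> bilinear_maps V W U"
    and I: "finite I" and p: "p \<in> I \<rightarrow> carrier V" and q: "q \<in> I \<rightarrow> carrier W"
  shows "tensor_lift V W U \<beta> (finsum (V \<otimes>\<^sub>v W) (\<lambda>i. tens V W (p i) (q i)) I) =
    finsum U (\<lambda>i. \<beta> (p i) (q i)) I"
proof -
  have \<beta>: "\<beta> v w \<in> carrier U" if "v \<in> carrier V" "w \<in> carrier W" for v w
    by (rule lin_closed[OF bilinear_mapsD(1)[OF b that(1)] that(2)])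
  have "tensor_lift V W U \<beta> (finsum (V \<otimes>\<^sub>v W) (\<lambda>i. tens V W (p i) (q i)) I) =
    finsum U (\<lambda>i. tensor_lift V W U \<beta> (tens V W (p i) (q i))) I"
    by (rule lin_finsum[OF cspace_tensor[OF V W] U tensor_lift(1)[OF V W U b] I])
      (use p q tens_closed[OF V W] in auto)
  also have "\<dots> = finsum U (\<lambda>i. \<beta> (p i) (q i)) I"
    by (rule finsum_cong_on[OF U]) (use tensor_lift(2)[OF V W U b] p q \<beta> in \<open>auto simp: Pi_iff\<close>)
  finally show ?thesis .
qed

lemma tensor_map_finsum:
  assumes V: "cspace V" and W: "cspace W" and V': "cspace V'" and W': "cspace W'"
    and g: "g \<in> lin V V'" and k: "k \<in> lin W W'"
    and I: "finite I" and p: "p \<in> I \<rightarrow> carrier V" and q: "q \<in> I \<rightarrow> carrier W"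
  shows "tensor_map V W V' W' g k (finsum (V \<otimes>\<^sub>v W) (\<lambda>i. tens V W (p i) (q i)) I) =
    finsum (V' \<otimes>\<^sub>v W') (\<lambda>i. tens V' W' (g (p i)) (k (q i))) I"
proof -
  have b: "(\<lambda>v w. tens V' W' (g v) (k w)) \<in> bilinear_maps V W (V' \<otimes>\<^sub>v W')"
    by (rule bilinear_mapsI)
      (simp_all add: tens_bilinear[OF V' W'] tens_closed[OF V' W'] lin_add[OF g] lin_add[OF k]
        lin_smult[OF g] lin_smult[OF k] lin_closed[OF g] lin_closed[OF k])
  show ?thesis
    unfolding tensor_map_def by (rule tensor_lift_finsum[OF V W cspace_tensor[OF V' W'] b I p q])
qed

section \<open>Slices by functionals and the separation of tensors\<close>

lemma smult_bilinear:
  assumes V: "cspace V" and W: "cspace W"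
  shows "\<zeta> \<in> lin W cunit \<Longrightarrow> (\<lambda>v w. \<zeta> w \<odot>\<^bsub>V\<^esub> v) \<in> bilinear_maps V W V"
    and "\<xi> \<in> lin V cunit \<Longrightarrow> (\<lambda>v w. \<xi> v \<odot>\<^bsub>W\<^esub> w) \<in> bilinear_maps V W W"
  by (rule bilinear_mapsI; simp add: cspaceD(2-4,6)[OF V] cspaceD(2-4,6)[OF W] lin_add lin_smult
    lin_closed
    cspaceD(5)[OF V, symmetric] cspaceD(5)[OF W, symmetric] mult.commute)+

text \<open>Induction on the number \<open>n\<close> of summands \<open>p i \<otimes> q i\<close>: either the last \<open>q i\<close> lies in the span of
  the others, which shortens the sum, or a functional that kills the others gives \<open>p i = 0\<close>.\<close>

lemma tensor_eq_zeroI_right: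
  assumes V: "cspace V" and W: "cspace W" and t: "t \<in> carrier (V \<otimes>\<^sub>v W)"
    and z: "\<And>\<zeta>. \<zeta> \<in> lin W cunit \<Longrightarrow> tensor_lift V W V (\<lambda>v w. \<zeta> w \<odot>\<^bsub>V\<^esub> v) t = \<zero>\<^bsub>V\<^esub>"
  shows "t = \<zero>\<^bsub>V \<otimes>\<^sub>v W\<^esub>"
proof -
  interpret V: module complex_ring V by fact
  interpret W: module complex_ring W by fact
  interpret T: module complex_ring "V \<otimes>\<^sub>v W" by (rule cspace_tensor[OF V W])
  note L = tensor_lift_finsum[OF V W V smult_bilinear(1)[OF V W]]
  have main: "finsum (V \<otimes>\<^sub>v W) (\<lambda>i. tens V W (p i) (q i)) {..<n} = \<zero>\<^bsub>V \<otimes>\<^sub>v W\<^esub>"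
    if "p \<in> {..<n} \<rightarrow> carrier V" "q \<in> {..<n} \<rightarrow> carrier W"
      "\<And>\<zeta>. \<zeta> \<in> lin W cunit \<Longrightarrow> finsum V (\<lambda>i. \<zeta> (q i) \<odot>\<^bsub>V\<^esub> p i) {..<n} = \<zero>\<^bsub>V\<^esub>"
    for p q and n :: nat
    using that
  proof (induction n arbitrary: p q)
    case 0
    then show ?case by simp
  next
    case (Suc n)
    have p: "p n \<in> carrier V" "p \<in> {..<n} \<rightarrow> carrier V" and q: "q n \<in> carrier W" "q \<in> {..<n} \<rightarrow> carrier W"
      using Suc.prems by auto
    have pc: "p i \<in> carrier V" "q i \<in> carrier W" if "i < n" for i using p q that by auto
    have cl: "(\<lambda>i. tens V W (p i) (q i)) \<in> {..<n} \<rightarrow> carrier (V \<otimes>\<^sub>v W)"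
      using p q by (auto intro: tens_closed[OF V W])
    define N where "N = {finsum W (\<lambda>i. c i \<odot>\<^bsub>W\<^esub> q i) {..<n} | c. True}"
    have N: "submodule N complex_ring W"
    proof (rule submodule_cspaceI[OF W])
      show "N \<subseteq> carrier W" unfolding N_def using q cspaceD(2)[OF W] by (auto intro!: W.M.finsum_closed)
      have "finsum W (\<lambda>i. 0 \<odot>\<^bsub>W\<^esub> q i) {..<n} = finsum W (\<lambda>i. \<zero>\<^bsub>W\<^esub>) {..<n}"
        by (rule finsum_cong_on[OF W]) (use pc in \<open>auto simp: smult_zero_left[OF W]\<close>)
      then show "\<zero>\<^bsub>W\<^esub> \<in> N" unfolding N_def by (intro CollectI exI[of _ "\<lambda>_. 0"]) simp
      show "x \<oplus>\<^bsub>W\<^esub> y \<in> N" if xy: "x \<in> N" "y \<in> N" for x y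
      proof -
        obtain c d where cd: "x = finsum W (\<lambda>i. c i \<odot>\<^bsub>W\<^esub> q i) {..<n}" "y = finsum W (\<lambda>i. d i \<odot>\<^bsub>W\<^esub> q i) {..<n}"
          using xy unfolding N_def by blast
        have "x \<oplus>\<^bsub>W\<^esub> y = finsum W (\<lambda>i. c i \<odot>\<^bsub>W\<^esub> q i \<oplus>\<^bsub>W\<^esub> d i \<odot>\<^bsub>W\<^esub> q i) {..<n}"
          unfolding cd by (rule W.M.finsum_addf[symmetric]) (use pc cspaceD(2)[OF W] in auto)
        also have "\<dots> = finsum W (\<lambda>i. (c i + d i) \<odot>\<^bsub>W\<^esub> q i) {..<n}"
          by (rule finsum_cong_on[OF W]) (use pc cspaceD(2,3)[OF W] in auto)
        finally show ?thesis unfolding N_def by (intro CollectI exI[of _ "\<lambda>i. c i + d i"]) simp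
      qed
      show "a \<odot>\<^bsub>W\<^esub> x \<in> N" if x: "x \<in> N" for a x
      proof -
        obtain c where c: "x = finsum W (\<lambda>i. c i \<odot>\<^bsub>W\<^esub> q i) {..<n}" using x unfolding N_def by blast
        have "a \<odot>\<^bsub>W\<^esub> x = finsum W (\<lambda>i. a \<odot>\<^bsub>W\<^esub> (c i \<odot>\<^bsub>W\<^esub> q i)) {..<n}"
          unfolding c by (rule W.finsum_smult_ldistr) (use pc cspaceD(2)[OF W] in auto)
        also have "\<dots> = finsum W (\<lambda>i. (a * c i) \<odot>\<^bsub>W\<^esub> q i) {..<n}"
          by (rule finsum_cong_on[OF W]) (use pc cspaceD(2,5)[OF W] in auto)
        finally show ?thesis unfolding N_def by (intro CollectI exI[of _ "\<lambda>i. a * c i"]) simp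
      qed
    qed
    have split: "finsum (V \<otimes>\<^sub>v W) (\<lambda>i. tens V W (p i) (q i)) {..<Suc n} =
        tens V W (p n) (q n) \<oplus>\<^bsub>V \<otimes>\<^sub>v W\<^esub> finsum (V \<otimes>\<^sub>v W) (\<lambda>i. tens V W (p i) (q i)) {..<n}"
      using cl p q by (simp add: lessThan_Suc tens_closed[OF V W])
    have zs: "\<zeta> (q n) \<odot>\<^bsub>V\<^esub> p n \<oplus>\<^bsub>V\<^esub> finsum V (\<lambda>i. \<zeta> (q i) \<odot>\<^bsub>V\<^esub> p i) {..<n} = \<zero>\<^bsub>V\<^esub>"
      if "\<zeta> \<in> lin W cunit" for \<zeta>
    proof -
      have "(\<lambda>i. \<zeta> (q i) \<odot>\<^bsub>V\<^esub> p i) \<in> {..<n} \<rightarrow> carrier V" using pc cspaceD(2)[OF V] by auto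
      then show ?thesis
        using Suc.prems(3)[OF that] p cspaceD(2)[OF V] by (simp add: lessThan_Suc)
    qed
    show ?case
    proof (cases "q n \<in> N")
      case True
      then obtain c where c: "q n = finsum W (\<lambda>i. c i \<odot>\<^bsub>W\<^esub> q i) {..<n}" unfolding N_def by blast
      \<comment> \<open>Substituting the expansion of q n turns p n \<otimes> q n into the sum of (c
        i p n) \<otimes> q i, which merges with the remaining summands.\<close>
      define p' where "p' i = c i \<odot>\<^bsub>V\<^esub> p n \<oplus>\<^bsub>V\<^esub> p i" for i
      have p': "p' \<in> {..<n} \<rightarrow> carrier V"
        using pc p cspaceD(2)[OF V] by (auto simp: p'_def)
      have *: "tens V W (p n) (q n) = finsum (V \<otimes>\<^sub>v W) (\<lambda>i. tens V W (c i \<odot>\<^bsub>V\<^esub> p n) (q i)) {..<n}"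
      proof -
        have "tens V W (p n) (q n) = finsum (V \<otimes>\<^sub>v W) (\<lambda>i. tens V W (p n) (c i \<odot>\<^bsub>W\<^esub> q i)) {..<n}"
          unfolding c by (rule tens_finsum(1)[OF V W]) (use pc p cspaceD(2)[OF W] in auto)
        also have "\<dots> = finsum (V \<otimes>\<^sub>v W) (\<lambda>i. tens V W (c i \<odot>\<^bsub>V\<^esub> p n) (q i)) {..<n}"
        proof (rule finsum_cong_on[OF cspace_tensor[OF V W]])
          show "tens V W (p n) (c i \<odot>\<^bsub>W\<^esub> q i) = tens V W (c i \<odot>\<^bsub>V\<^esub> p n) (q i)" if "i \<in> {..<n}" for i
            using tens_bilinear(3,4)[OF V W p(1) pc(2)[of i], of "c i"] that by simp
          show "(\<lambda>i. tens V W (c i \<odot>\<^bsub>V\<^esub> p n) (q i)) \<in> {..<n} \<rightarrow> carrier (V \<otimes>\<^sub>v W)"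
            by (rule Pi_I, rule tens_closed[OF V W cspaceD(2)[OF V p(1)] pc(2)]) simp
        qed
        finally show ?thesis .
      qed
      have cl2: "(\<lambda>i. tens V W (c i \<odot>\<^bsub>V\<^esub> p n) (q i)) \<in> {..<n} \<rightarrow> carrier (V \<otimes>\<^sub>v W)"
        by (rule Pi_I, rule tens_closed[OF V W cspaceD(2)[OF V p(1)] pc(2)]) simp
      have "finsum (V \<otimes>\<^sub>v W) (\<lambda>i. tens V W (p i) (q i)) {..<Suc n} =
          finsum (V \<otimes>\<^sub>v W) (\<lambda>i. tens V W (c i \<odot>\<^bsub>V\<^esub> p n) (q i) \<oplus>\<^bsub>V \<otimes>\<^sub>v W\<^esub> tens V W (p i) (q i)) {..<n}"
        by (simp only: split * T.M.finsum_addf[OF cl2 cl])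
      also have "\<dots> = finsum (V \<otimes>\<^sub>v W) (\<lambda>i. tens V W (p' i) (q i)) {..<n}"
      proof (rule finsum_cong_on[OF cspace_tensor[OF V W]])
        show "tens V W (c i \<odot>\<^bsub>V\<^esub> p n) (q i) \<oplus>\<^bsub>V \<otimes>\<^sub>v W\<^esub> tens V W (p i) (q i) = tens V W (p' i) (q i)"
          if "i \<in> {..<n}" for i
          using tens_bilinear(1)[OF V W cspaceD(2)[OF V p(1)], of "q i" "p i" "c i"] pc that
          by (simp add: p'_def)
        show "(\<lambda>i. tens V W (p' i) (q i)) \<in> {..<n} \<rightarrow> carrier (V \<otimes>\<^sub>v W)"
          using p' pc by (intro Pi_I tens_closed[OF V W]) auto
      qed
      also have "\<dots> = \<zero>\<^bsub>V \<otimes>\<^sub>v W\<^esub>"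
      proof (rule Suc.IH[OF p' q(2)])
        fix \<zeta> assume \<zeta>: "\<zeta> \<in> lin W cunit"
        interpret K: module complex_ring cunit by (rule cspace_cunit)
        have "\<zeta> (q n) = finsum cunit (\<lambda>i. c i * \<zeta> (q i)) {..<n}"
        proof -
          have "\<zeta> (q n) = finsum cunit (\<lambda>i. \<zeta> (c i \<odot>\<^bsub>W\<^esub> q i)) {..<n}"
            unfolding c by (rule lin_finsum[OF W cspace_cunit \<zeta>]) (use pc cspaceD(2)[OF W] in auto)
          also have "\<dots> = finsum cunit (\<lambda>i. c i * \<zeta> (q i)) {..<n}"
            by (rule finsum_cong_on[OF cspace_cunit]) (use pc in \<open>auto simp: lin_smult[OF \<zeta>]\<close>)
          finally show ?thesis .
        qed
        moreover have "(\<lambda>x. x \<odot>\<^bsub>V\<^esub> p n) \<in> lin cunit V"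
          by (rule linI) (use p cspaceD[OF V] in auto)
        from lin_finsum[OF cspace_cunit V this, of "{..<n}" "\<lambda>i. c i * \<zeta> (q i)"]
        have "finsum cunit (\<lambda>i. c i * \<zeta> (q i)) {..<n} \<odot>\<^bsub>V\<^esub> p n = finsum V (\<lambda>i. (c i * \<zeta> (q i)) \<odot>\<^bsub>V\<^esub> p n) {..<n}"
          by simp
        ultimately have 1: "\<zeta> (q n) \<odot>\<^bsub>V\<^esub> p n = finsum V (\<lambda>i. (c i * \<zeta> (q i)) \<odot>\<^bsub>V\<^esub> p n) {..<n}" by simp
        \<comment> \<open>A slice of the shortened sum equals the slice of the original sum, so the
          induction hypothesis applies to the new family.\<close>
        have "finsum V (\<lambda>i. \<zeta> (q i) \<odot>\<^bsub>V\<^esub> p' i) {..<n} =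
            finsum V (\<lambda>i. (c i * \<zeta> (q i)) \<odot>\<^bsub>V\<^esub> p n \<oplus>\<^bsub>V\<^esub> \<zeta> (q i) \<odot>\<^bsub>V\<^esub> p i) {..<n}"
          by (rule finsum_cong_on[OF V])
            (use pc p cspaceD(2,4)[OF V] cspaceD(5)[OF V, symmetric] in \<open>auto simp: p'_def mult.commute\<close>)
        also have "\<dots> = \<zeta> (q n) \<odot>\<^bsub>V\<^esub> p n \<oplus>\<^bsub>V\<^esub> finsum V (\<lambda>i. \<zeta> (q i) \<odot>\<^bsub>V\<^esub> p i) {..<n}"
          unfolding 1 by (rule V.M.finsum_addf) (use pc p cspaceD(2)[OF V] in auto)
        also have "\<dots> = \<zero>\<^bsub>V\<^esub>" by (rule zs[OF \<zeta>])
        finally show "finsum V (\<lambda>i. \<zeta> (q i) \<odot>\<^bsub>V\<^esub> p' i) {..<n} = \<zero>\<^bsub>V\<^esub>" .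
      qed
      finally show ?thesis .
    next
      case False
      then obtain \<zeta> where \<zeta>: "\<zeta> \<in> lin W cunit" "\<zeta> (q n) = 1" "\<And>x. x \<in> N \<Longrightarrow> \<zeta> x = 0"
        using separating_functional[OF W N q(1)] by blast
      have qN: "q j \<in> N" if j: "j < n" for j
      proof -
        have "finsum W (\<lambda>i. (if i = j then 1 else 0) \<odot>\<^bsub>W\<^esub> q i) {..<n} = finsum W (\<lambda>i. if j = i then q i else \<zero>\<^bsub>W\<^esub>) {..<n}"
          by (rule finsum_cong_on[OF W]) (use pc in \<open>auto simp: smult_zero_left[OF W] cspaceD(6)[OF W]\<close>)
        also have "\<dots> = q j" by (rule W.M.finsum_singleton) (use j q in auto)
        finally show ?thesis unfolding N_def by (intro CollectI exI[of _ "\<lambda>i. if i = j then 1 else 0"]) simp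
      qed
      have "finsum V (\<lambda>i. \<zeta> (q i) \<odot>\<^bsub>V\<^esub> p i) {..<n} = finsum V (\<lambda>i. \<zero>\<^bsub>V\<^esub>) {..<n}"
        by (rule finsum_cong_on[OF V]) (use \<zeta>(3) qN pc in \<open>auto simp: smult_zero_left[OF V]\<close>)
      \<comment> \<open>All summands but the last are killed by \<zeta>, and \<zeta> takes the value
        1 on q n, so the slice of the whole sum is p n.\<close>
      then have pn: "p n = \<zero>\<^bsub>V\<^esub>" using zs[OF \<zeta>(1)] p by (simp add: \<zeta>(2) cspaceD(6)[OF V])
      have "finsum (V \<otimes>\<^sub>v W) (\<lambda>i. tens V W (p i) (q i)) {..<n} = \<zero>\<^bsub>V \<otimes>\<^sub>v W\<^esub>"
      proof (rule Suc.IH[OF p(2) q(2)])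
        fix \<chi> assume \<chi>: "\<chi> \<in> lin W cunit"
        have "finsum V (\<lambda>i. \<chi> (q i) \<odot>\<^bsub>V\<^esub> p i) {..<n} \<in> carrier V"
          by (rule V.M.finsum_closed) (use pc cspaceD(2)[OF V] in auto)
        then show "finsum V (\<lambda>i. \<chi> (q i) \<odot>\<^bsub>V\<^esub> p i) {..<n} = \<zero>\<^bsub>V\<^esub>"
          using zs[OF \<chi>] by (simp add: pn smult_zero_right[OF V])
      qed
      then show ?thesis unfolding split by (simp add: pn tens_zero[OF V W] q)
    qed
  qed
  obtain n :: nat and p q where pq: "p \<in> {..<n} \<rightarrow> carrier V" "q \<in> {..<n} \<rightarrow> carrier W"
    "t = finsum (V \<otimes>\<^sub>v W) (\<lambda>i. tens V W (p i) (q i)) {..<n}"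
    using tensor_finsum[OF V W t] by blast
  show ?thesis unfolding pq(3)
    by (rule main[OF pq(1,2)]) (use z L[OF _ _ pq(1,2)] pq(3) in auto)
qed

text \<open>Carried over from the right-hand version by the flip of the two factors. It is enough
  that \<open>?g\<close> undoes \<open>?f\<close>, since then \<open>?f t\<close> being zero forces
  t to be zero.\<close>

lemma tensor_eq_zeroI_left:
  assumes V: "cspace V" and W: "cspace W" and t: "t \<in> carrier (V \<otimes>\<^sub>v W)"
    and z: "\<And>\<xi>. \<xi> \<in> lin V cunit \<Longrightarrow> tensor_lift V W W (\<lambda>v w. \<xi> v \<odot>\<^bsub>W\<^esub> w) t = \<zero>\<^bsub>W\<^esub>"
  shows "t = \<zero>\<^bsub>V \<otimes>\<^sub>v W\<^esub>"
proof -
  note VW = cspace_tensor[OF V W] and WV = cspace_tensor[OF W V]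
  let ?f = "tensor_lift V W (W \<otimes>\<^sub>v V) (\<lambda>v w. tens W V w v)"
  let ?g = "tensor_lift W V (V \<otimes>\<^sub>v W) (\<lambda>w v. tens V W v w)"
  have bf: "(\<lambda>v w. tens W V w v) \<in> bilinear_maps V W (W \<otimes>\<^sub>v V)"
    by (rule bilinear_mapsI) (simp_all add: tens_bilinear[OF W V] tens_closed[OF W V])
  have bg: "(\<lambda>w v. tens V W v w) \<in> bilinear_maps W V (V \<otimes>\<^sub>v W)"
    by (rule bilinear_mapsI) (simp_all add: tens_bilinear[OF V W] tens_closed[OF V W])
  note f = tensor_lift[OF V W WV bf] and g = tensor_lift[OF W V VW bg]
  have "?f t = \<zero>\<^bsub>W \<otimes>\<^sub>v V\<^esub>"
  proof (rule tensor_eq_zeroI_right[OF W V lin_closed[OF f(1) t]])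
    fix \<xi> assume \<xi>: "\<xi> \<in> lin V cunit"
    note b = tensor_lift[OF W V W smult_bilinear(1)[OF W V \<xi>]] and
      b' = tensor_lift[OF V W W smult_bilinear(2)[OF V W \<xi>]]
    have "tensor_lift W V W (\<lambda>v w. \<xi> w \<odot>\<^bsub>W\<^esub> v) (?f t) = tensor_lift V W W (\<lambda>v w. \<xi> v \<odot>\<^bsub>W\<^esub> w) t"
      by (rule lin_comp_lift[OF V W WV W bf b(1) b'(1) t]) (simp add: b b')
    then show "tensor_lift W V W (\<lambda>v w. \<xi> w \<odot>\<^bsub>W\<^esub> v) (?f t) = \<zero>\<^bsub>W\<^esub>" using z[OF \<xi>] by simp
  qed
  moreover have "?g (?f t) = t"
    by (rule lin_comp_lift[OF V W WV VW bf g(1) lin_id[OF VW] t]) (simp add: g)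
  ultimately show ?thesis using lin_zero[OF WV VW g(1)] by simp
qed

text \<open>Tensoring over a field preserves joint injectivity, for families of any size. Slicing t
  by a functional on V commutes with the maps g j, so every g j kills the slice and the slice
  vanishes; a tensor whose slices all vanish is zero.\<close>

lemma tensor_jointly_injective_right:
  assumes V: "cspace V" and W: "cspace W" and t: "t \<in> carrier (V \<otimes>\<^sub>v W)"
    and U: "\<And>j. j \<in> J \<Longrightarrow> cspace (U j)" and g: "\<And>j. j \<in> J \<Longrightarrow> g j \<in> lin W (U j)"
    and inj: "\<And>w. w \<in> carrier W \<Longrightarrow> (\<And>j. j \<in> J \<Longrightarrow> g j w = \<zero>\<^bsub>U j\<^esub>) \<Longrightarrow> w = \<zero>\<^bsub>W\<^esub>"
    and z: "\<And>j. j \<in> J \<Longrightarrow> tensor_map V W V (U j) (\<lambda>x. x) (g j) t = \<zero>\<^bsub>V \<otimes>\<^sub>v U j\<^esub>"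
  shows "t = \<zero>\<^bsub>V \<otimes>\<^sub>v W\<^esub>"
proof (rule tensor_eq_zeroI_left[OF V W t])
  fix \<xi> assume \<xi>: "\<xi> \<in> lin V cunit"
  note b = smult_bilinear(2)[OF V W \<xi>]
  show "tensor_lift V W W (\<lambda>v w. \<xi> v \<odot>\<^bsub>W\<^esub> w) t = \<zero>\<^bsub>W\<^esub>"
  proof (rule inj)
    show "tensor_lift V W W (\<lambda>v w. \<xi> v \<odot>\<^bsub>W\<^esub> w) t \<in> carrier W"
      by (rule lin_closed[OF tensor_lift(1)[OF V W W b] t])
    fix j assume j: "j \<in> J"
    note Uj = U[OF j] and gj = g[OF j]
    note b' = tensor_lift[OF V Uj Uj smult_bilinear(2)[OF V Uj \<xi>]]
    note m = tensor_map[OF V W V Uj lin_id[OF V] gj]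
    have "g j (tensor_lift V W W (\<lambda>v w. \<xi> v \<odot>\<^bsub>W\<^esub> w) t) =
        tensor_lift V (U j) (U j) (\<lambda>v w. \<xi> v \<odot>\<^bsub>U j\<^esub> w) (tensor_map V W V (U j) (\<lambda>x. x) (g j) t)"
      by (rule lin_comp_lift[OF V W W Uj b gj lin_comp[OF m(1) b'(1)] t])
        (simp add: m b' lin_smult[OF gj] lin_closed[OF gj])
    then show "g j (tensor_lift V W W (\<lambda>v w. \<xi> v \<odot>\<^bsub>W\<^esub> w) t) = \<zero>\<^bsub>U j\<^esub>"
      using z[OF j] lin_zero[OF cspace_tensor[OF V Uj] Uj b'(1)] by simp
  qed
qed

text \<open>The same argument with slices taken along W.\<close>

lemma tensor_jointly_injective_left:
  assumes V: "cspace V" and W: "cspace W" and t: "t \<in> carrier (V \<otimes>\<^sub>v W)"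
    and U: "\<And>j. j \<in> J \<Longrightarrow> cspace (U j)" and g: "\<And>j. j \<in> J \<Longrightarrow> g j \<in> lin V (U j)"
    and inj: "\<And>v. v \<in> carrier V \<Longrightarrow> (\<And>j. j \<in> J \<Longrightarrow> g j v = \<zero>\<^bsub>U j\<^esub>) \<Longrightarrow> v = \<zero>\<^bsub>V\<^esub>"
    and z: "\<And>j. j \<in> J \<Longrightarrow> tensor_map V W (U j) W (g j) (\<lambda>x. x) t = \<zero>\<^bsub>U j \<otimes>\<^sub>v W\<^esub>"
  shows "t = \<zero>\<^bsub>V \<otimes>\<^sub>v W\<^esub>"
proof (rule tensor_eq_zeroI_right[OF V W t])
  fix \<xi> assume \<xi>: "\<xi> \<in> lin W cunit"
  note b = smult_bilinear(1)[OF V W \<xi>]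
  show "tensor_lift V W V (\<lambda>v w. \<xi> w \<odot>\<^bsub>V\<^esub> v) t = \<zero>\<^bsub>V\<^esub>"
  proof (rule inj)
    show "tensor_lift V W V (\<lambda>v w. \<xi> w \<odot>\<^bsub>V\<^esub> v) t \<in> carrier V"
      by (rule lin_closed[OF tensor_lift(1)[OF V W V b] t])
    fix j assume j: "j \<in> J"
    note Uj = U[OF j] and gj = g[OF j]
    note b' = tensor_lift[OF Uj W Uj smult_bilinear(1)[OF Uj W \<xi>]]
    note m = tensor_map[OF V W Uj W gj lin_id[OF W]]
    have "g j (tensor_lift V W V (\<lambda>v w. \<xi> w \<odot>\<^bsub>V\<^esub> v) t) =
        tensor_lift (U j) W (U j) (\<lambda>v w. \<xi> w \<odot>\<^bsub>U j\<^esub> v) (tensor_map V W (U j) W (g j) (\<lambda>x. x) t)"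
      by (rule lin_comp_lift[OF V W V Uj b gj lin_comp[OF m(1) b'(1)] t])
        (simp add: m b' lin_smult[OF gj] lin_closed[OF gj])
    then show "g j (tensor_lift V W V (\<lambda>v w. \<xi> w \<odot>\<^bsub>V\<^esub> v) t) = \<zero>\<^bsub>U j\<^esub>"
      using z[OF j] lin_zero[OF cspace_tensor[OF Uj W] Uj b'(1)] by simp
  qed
qed

lemma tensor_map_comp:
  assumes V: "cspace V" "cspace V'" "cspace V''" and W: "cspace W" "cspace W'" "cspace W''"
    and g: "g \<in> lin V V'" "g' \<in> lin V' V''" and k: "k \<in> lin W W'" "k' \<in> lin W' W''"
    and t: "t \<in> carrier (V \<otimes>\<^sub>v W)"
  shows "tensor_map V' W' V'' W'' g' k' (tensor_map V W V' W' g k t) =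
    tensor_map V W V'' W'' (\<lambda>v. g' (g v)) (\<lambda>w. k' (k w)) t"
proof -
  note 1 = tensor_map[OF V(1) W(1) V(2) W(2) g(1) k(1)]
    and 2 = tensor_map[OF V(2) W(2) V(3) W(3) g(2) k(2)]
    and 3 = tensor_map[OF V(1) W(1) V(3) W(3) lin_comp[OF g] lin_comp[OF k]]
  show ?thesis
    by (rule tensor_unique[OF V(1) W(1) cspace_tensor[OF V(3) W(3)] lin_comp[OF 1(1) 2(1)] 3(1) _ t])
      (simp add: 1 2 3 lin_closed[OF g(1)] lin_closed[OF k(1)])
qed

section \<open>Equality tests, and sums of linear and bilinear maps\<close>

lemma cspace_eqI_diff:
  assumes V: "cspace V" and x: "x \<in> carrier V" and y: "y \<in> carrier V"
    and z: "x \<oplus>\<^bsub>V\<^esub> (- 1) \<odot>\<^bsub>V\<^esub> y = \<zero>\<^bsub>V\<^esub>"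
  shows "x = y"
proof -
  interpret module complex_ring V by fact
  have c: "(- 1) \<odot>\<^bsub>V\<^esub> y \<in> carrier V" by (rule cspaceD(2)[OF V y])
  have "(- 1) \<odot>\<^bsub>V\<^esub> y \<oplus>\<^bsub>V\<^esub> y = \<zero>\<^bsub>V\<^esub>"
    using cspaceD(3)[OF V y, of "-1" 1] cspaceD(6)[OF V y] smult_zero_left[OF V y] by simp
  then have "x \<oplus>\<^bsub>V\<^esub> ((- 1) \<odot>\<^bsub>V\<^esub> y \<oplus>\<^bsub>V\<^esub> y) = x" using x by simp
  then show ?thesis using z x y c by (simp add: M.a_assoc[symmetric])
qed

lemma lin_eq_diff:
  assumes V: "cspace V" and W: "cspace W" and g: "g \<in> lin V W" and x: "x \<in> carrier V" and y: "y \<in> carrier V"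
    and eq: "g x = g y"
  shows "g (x \<oplus>\<^bsub>V\<^esub> (- 1) \<odot>\<^bsub>V\<^esub> y) = \<zero>\<^bsub>W\<^esub>"
proof -
  note gy = lin_closed[OF g y]
  have "g (x \<oplus>\<^bsub>V\<^esub> (- 1) \<odot>\<^bsub>V\<^esub> y) = 1 \<odot>\<^bsub>W\<^esub> g y \<oplus>\<^bsub>W\<^esub> (- 1) \<odot>\<^bsub>W\<^esub> g y"
    using eq cspaceD(6)[OF W gy] by (simp add: lin_add[OF g x cspaceD(2)[OF V y]] lin_smult[OF g y])
  also have "\<dots> = \<zero>\<^bsub>W\<^esub>"
    using cspaceD(3)[OF W gy, of 1 "-1"] smult_zero_left[OF W gy] by simp
  finally show ?thesis .
qed

text \<open>The separation results test for zero; linearity of the g j, applied to the difference of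
  x and y, converts them into tests for equality.\<close>

lemma jointly_injective_eqI:
  assumes V: "cspace V" and x: "x \<in> carrier V" and y: "y \<in> carrier V"
    and U: "\<And>j. j \<in> J \<Longrightarrow> cspace (U j)" and g: "\<And>j. j \<in> J \<Longrightarrow> g j \<in> lin V (U j)"
    and inj: "\<And>v. v \<in> carrier V \<Longrightarrow> (\<And>j. j \<in> J \<Longrightarrow> g j v = \<zero>\<^bsub>U j\<^esub>) \<Longrightarrow> v = \<zero>\<^bsub>V\<^esub>"
    and eq: "\<And>j. j \<in> J \<Longrightarrow> g j x = g j y"
  shows "x = y"
  by (rule cspace_eqI_diff[OF V x y], rule inj)
    (use lin_eq_diff[OF V U g x y eq] cspace_add[OF V x cspaceD(2)[OF V y]] in auto)

lemma finsum_lin: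
  assumes V: "cspace V" and U: "cspace U" and I: "finite I" and f: "\<And>i. i \<in> I \<Longrightarrow> f i \<in> lin V U"
  shows "(\<lambda>v. finsum U (\<lambda>i. f i v) I) \<in> lin V U"
proof (rule linI)
  interpret U: module complex_ring U by fact
  note cl = lin_closed[OF f]
  fix x assume x: "x \<in> carrier V"
  show "finsum U (\<lambda>i. f i x) I \<in> carrier U" using cl x by (intro U.M.finsum_closed) auto
  show "finsum U (\<lambda>i. f i (x \<oplus>\<^bsub>V\<^esub> y)) I = finsum U (\<lambda>i. f i x) I \<oplus>\<^bsub>U\<^esub> finsum U (\<lambda>i. f i y) I"
    if y: "y \<in> carrier V" for y
  proof -
    have "finsum U (\<lambda>i. f i (x \<oplus>\<^bsub>V\<^esub> y)) I = finsum U (\<lambda>i. f i x \<oplus>\<^bsub>U\<^esub> f i y) I"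
      by (rule finsum_cong_on[OF U]) (use cl x y lin_add[OF f] in auto)
    also have "\<dots> = finsum U (\<lambda>i. f i x) I \<oplus>\<^bsub>U\<^esub> finsum U (\<lambda>i. f i y) I"
      by (rule U.M.finsum_addf) (use cl x y in auto)
    finally show ?thesis .
  qed
  show "finsum U (\<lambda>i. f i (c \<odot>\<^bsub>V\<^esub> x)) I = c \<odot>\<^bsub>U\<^esub> finsum U (\<lambda>i. f i x) I" for c
  proof -
    have "finsum U (\<lambda>i. f i (c \<odot>\<^bsub>V\<^esub> x)) I = finsum U (\<lambda>i. c \<odot>\<^bsub>U\<^esub> f i x) I"
      by (rule finsum_cong_on[OF U]) (use cl x lin_smult[OF f] cspaceD(2)[OF U] in auto)
    also have "\<dots> = c \<odot>\<^bsub>U\<^esub> finsum U (\<lambda>i. f i x) I"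
      by (rule U.finsum_smult_ldistr[symmetric]) (use cl x I in auto)
    finally show ?thesis .
  qed
qed

lemma finsum_bilinear:
  assumes "cspace V" "cspace W" "cspace U" "finite I" "\<And>i. i \<in> I \<Longrightarrow> \<beta> i \<in> bilinear_maps V W U"
  shows "(\<lambda>v w. finsum U (\<lambda>i. \<beta> i v w) I) \<in> bilinear_maps V W U"
  unfolding bilinear_maps_def
  using finsum_lin[OF assms(2,3,4), of "\<lambda>i. \<beta> i v" for v] finsum_lin[OF assms(1,3,4), of "\<lambda>i v. \<beta> i v w" for w]
    bilinear_mapsD[OF assms(5)] by simp

lemma bilinear_comp:
  assumes "\<beta> \<in> bilinear_maps V W U" "g \<in> lin V' V" "k \<in> lin W' W" "f \<in> lin U U'"
  shows "(\<lambda>v w. f (\<beta> (g v) (k w))) \<in> bilinear_maps V' W' U'"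
  unfolding bilinear_maps_def
  using lin_comp[OF lin_comp[OF assms(3) bilinear_mapsD(1)[OF assms(1)]] assms(4)]
    lin_comp[OF lin_comp[OF assms(2) bilinear_mapsD(2)[OF assms(1)]] assms(4)]
    lin_closed[OF assms(2)] lin_closed[OF assms(3)] by auto

lemma bilinear_cong:
  assumes "\<beta> \<in> bilinear_maps V W U" "cspace V" "cspace W"
    "\<And>v w. v \<in> carrier V \<Longrightarrow> w \<in> carrier W \<Longrightarrow> \<gamma> v w = \<beta> v w"
  shows "\<gamma> \<in> bilinear_maps V W U"
proof -
  have "\<gamma> v \<in> lin W U" if "v \<in> carrier V" for v
    by (rule lin_cong[OF bilinear_mapsD(1)[OF assms(1) that] assms(3)]) (rule assms(4)[OF that])
  moreover have "(\<lambda>v. \<gamma> v w) \<in> lin V U" if "w \<in> carrier W" for w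
    by (rule lin_cong[OF bilinear_mapsD(2)[OF assms(1) that] assms(2)]) (rule assms(4)[OF _ that])
  ultimately show ?thesis unfolding bilinear_maps_def by blast
qed

text \<open>The inverse is only ever applied to a value of \<open>vassoc\<close>, so injectivity
  suffices, and that follows from a left inverse. It sends v \<otimes> (w \<otimes> u) to (v
  \<otimes> w) \<otimes> u and is built from two nested lifts, checked on pure tensors in two
  stages.\<close>

lemma vassoc_inverse:
  assumes V: "cspace V" and W: "cspace W" and U: "cspace U" and t: "t \<in> carrier ((V \<otimes>\<^sub>v W) \<otimes>\<^sub>v U)"
  shows "inv_on ((V \<otimes>\<^sub>v W) \<otimes>\<^sub>v U) (vassoc V W U) (vassoc V W U t) = t"
proof (rule inv_into_f_f[OF _ t])
  note VW = cspace_tensor[OF V W] and WU = cspace_tensor[OF W U]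
  note T = cspace_tensor[OF VW U]
  let ?b = "\<lambda>v w u. tens (V \<otimes>\<^sub>v W) U (tens V W v w) u"
  note tb = tens_bilinear_maps[OF V W] tens_bilinear_maps[OF VW U]
  have b: "?b v \<in> bilinear_maps W U ((V \<otimes>\<^sub>v W) \<otimes>\<^sub>v U)" if "v \<in> carrier V" for v
    by (rule bilinear_comp[OF tb(2) bilinear_mapsD(1)[OF tb(1) that] lin_id[OF U] lin_id[OF T]])
  note L = tensor_lift[OF W U T b]
  let ?g = "\<lambda>v s. tensor_lift W U ((V \<otimes>\<^sub>v W) \<otimes>\<^sub>v U) (?b v) s"
  \<comment> \<open>\<open>tensor_lift\<close> is chosen separately for each v, so linearity in v
    becomes visible only after s is written as a finite sum of pure tensors.\<close>
  have "(\<lambda>v. ?g v s) \<in> lin V ((V \<otimes>\<^sub>v W) \<otimes>\<^sub>v U)" if s: "s \<in> carrier (W \<otimes>\<^sub>v U)" for s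
  proof -
    obtain n :: nat and p q where p: "p \<in> {..<n} \<rightarrow> carrier W" and q: "q \<in> {..<n} \<rightarrow> carrier U"
      and e: "s = finsum (W \<otimes>\<^sub>v U) (\<lambda>i. tens W U (p i) (q i)) {..<n}"
      by (rule tensor_finsum[OF W U s])
    show ?thesis
    proof (rule lin_cong[OF finsum_lin[OF V T] V])
      show "?g v s = finsum ((V \<otimes>\<^sub>v W) \<otimes>\<^sub>v U) (\<lambda>i. ?b v (p i) (q i)) {..<n}" if "v \<in> carrier V" for v
        unfolding e by (rule tensor_lift_finsum[OF W U T b[OF that] _ p q]) simp
      show "(\<lambda>v. ?b v (p i) (q i)) \<in> lin V ((V \<otimes>\<^sub>v W) \<otimes>\<^sub>v U)" if "i \<in> {..<n}" for i
        by (rule lin_comp[OF bilinear_mapsD(2)[OF tb(1)] bilinear_mapsD(2)[OF tb(2)]]) (use p q that in auto)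
    qed simp
  qed
  then have gb: "?g \<in> bilinear_maps V (W \<otimes>\<^sub>v U) ((V \<otimes>\<^sub>v W) \<otimes>\<^sub>v U)"
    using L(1) unfolding bilinear_maps_def by auto
  note G = tensor_lift[OF V WU T gb] and A = vassoc[OF V W U]
  show "inj_on (vassoc V W U) (carrier ((V \<otimes>\<^sub>v W) \<otimes>\<^sub>v U))"
  proof (rule inj_on_inverseI)
    fix s assume s: "s \<in> carrier ((V \<otimes>\<^sub>v W) \<otimes>\<^sub>v U)"
    have 1: "tensor_lift V (W \<otimes>\<^sub>v U) ((V \<otimes>\<^sub>v W) \<otimes>\<^sub>v U) ?g (vassoc V W U (tens (V \<otimes>\<^sub>v W) U r u)) = tens (V \<otimes>\<^sub>v W) U r u"
      if r: "r \<in> carrier (V \<otimes>\<^sub>v W)" and u: "u \<in> carrier U" for r u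
      by (rule tensor_unique[OF V W T lin_comp[OF bilinear_mapsD(2)[OF tb(2) u] lin_comp[OF A(1) G(1)]]
            bilinear_mapsD(2)[OF tb(2) u] _ r])
        (simp add: A u G tens_closed[OF W U] L)
    show "tensor_lift V (W \<otimes>\<^sub>v U) ((V \<otimes>\<^sub>v W) \<otimes>\<^sub>v U) ?g (vassoc V W U s) = s"
      by (rule tensor_unique[OF VW U T lin_comp[OF A(1) G(1)] lin_id[OF T] 1 s])
  qed
qed

text \<open>The left inverse of v \<mapsto> v \<otimes> 1 is the slice by the identity functional of
  the complex numbers.\<close>

lemma vlunit_inverse:
  assumes V: "cspace V" and v: "v \<in> carrier V"
  shows "inv_on V (vlunit V) (vlunit V v) = v"
proof (rule inv_into_f_f[OF _ v])
  note L = tensor_lift(2)[OF V cspace_cunit V smult_bilinear(1)[OF V cspace_cunit lin_id[OF cspace_cunit]]]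
  show "inj_on (vlunit V) (carrier V)"
  proof (rule inj_on_inverseI)
    show "tensor_lift V cunit V (\<lambda>v w. w \<odot>\<^bsub>V\<^esub> v) (vlunit V x) = x" if "x \<in> carrier V" for x
      unfolding vlunit_def using L[OF that, of 1] cspaceD(6)[OF V that] by simp
  qed
qed

lemma vrunit_inverse:
  assumes V: "cspace V" and v: "v \<in> carrier V"
  shows "inv_on V (vrunit V) (vrunit V v) = v"
proof (rule inv_into_f_f[OF _ v])
  note L = tensor_lift(2)[OF cspace_cunit V V smult_bilinear(2)[OF cspace_cunit V lin_id[OF cspace_cunit]]]
  show "inj_on (vrunit V) (carrier V)"
  proof (rule inj_on_inverseI)
    show "tensor_lift cunit V V (\<lambda>w v. w \<odot>\<^bsub>V\<^esub> v) (vrunit V x) = x" if "x \<in> carrier V" for x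
      unfolding vrunit_def using L[OF _ that, of 1] cspaceD(6)[OF V that] by simp
  qed
qed

section \<open>Functor calculus\<close>

context category
begin

lemma HomD: "u \<in> Hom C X Y \<Longrightarrow> X \<in> Obj C" "u \<in> Hom C X Y \<Longrightarrow> Y \<in> Obj C"
  using Dom_obj[of u] Cod_obj[of u] by (auto simp: Hom_def)

text \<open>\<open>Inv\<close> is a definite description; it denotes because two-sided inverses are
  unique: w' = w' (u w) = (w' u) w = w.\<close>

lemma Iso_Inv:
  assumes "u \<in> Iso C X Y"
  shows "u \<in> Hom C X Y" "Inv C u \<in> Hom C Y X" "Inv C u \<cdot> u = Id C X" "u \<cdot> Inv C u = Id C Y"
proof -
  show u: "u \<in> Hom C X Y" using assms by (simp add: Iso_def)
  then have DC: "Dom C u = X" "Cod C u = Y" by (auto simp: Hom_def)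
  obtain w where w: "inverse_arrows C u w" using assms by (auto simp: Iso_def)
  have "w' = w" if "inverse_arrows C u w'" for w'
  proof -
    have a: "w \<in> Hom C Y X" "w' \<in> Hom C Y X" "w' \<cdot> u = Id C X" "u \<cdot> w = Id C Y"
      using w that DC by (auto simp: inverse_arrows_def)
    show ?thesis
      using Comp_assoc[OF a(1) u a(2)] a Id_left[OF a(1)] Id_right[OF a(2)] by simp
  qed
  then have "Inv C u = w" unfolding Inv_def using w by blast
  then show "Inv C u \<in> Hom C Y X" "Inv C u \<cdot> u = Id C X" "u \<cdot> Inv C u = Id C Y"
    using w DC by (auto simp: inverse_arrows_def)
qed

end

section \<open>The functor on product vectors\<close>

context monoidal_vfunctor
begin

text \<open>The vector f(x \<otimes> y). On such vectors, which span F(X \<otimes> Y), naturality of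
  f and its coherence with associator and units become the plain equations \<open>FA_pr\<close>,
  \<open>FA_Assoc_pr\<close>, \<open>FA_LUnit_pr\<close> and \<open>FA_RUnit_pr\<close>.\<close>

definition pr :: "'o \<Rightarrow> 'o \<Rightarrow> 'v \<Rightarrow> 'v \<Rightarrow> 'v" where
  "pr X Y x y = FT F X Y (tens (FO F X) (FO F Y) x y)"

definition scal :: "'v \<Rightarrow> complex" where
  "scal = inv_on cunit (FU F)"

lemma pr_bilinear:
  assumes X: "X \<in> Obj C" and Y: "Y \<in> Obj C"
  shows "pr X Y \<in> bilinear_maps (FO F X) (FO F Y) (FO F (X \<boxtimes> Y))"
proof -
  note t = bilinear_mapsD[OF tens_bilinear_maps[OF FO_cspace[OF X] FO_cspace[OF Y]]]
  show ?thesis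
    unfolding bilinear_maps_def pr_def using lin_comp[OF t(1) FT_lin[OF X Y]] lin_comp[OF t(2) FT_lin[OF X Y]]
    by auto
qed

lemmas pr_lin = bilinear_mapsD[OF pr_bilinear]

lemma pr_closed:
  "\<lbrakk>X \<in> Obj C; Y \<in> Obj C; x \<in> carrier (FO F X); y \<in> carrier (FO F Y)\<rbrakk> \<Longrightarrow>
    pr X Y x y \<in> carrier (FO F (X \<boxtimes> Y))"
  by (rule lin_closed[OF pr_lin(1)])

lemma pr_smult:
  assumes "X \<in> Obj C" "Y \<in> Obj C" "x \<in> carrier (FO F X)" "y \<in> carrier (FO F Y)"
  shows "pr X Y (c \<odot>\<^bsub>FO F X\<^esub> x) y = c \<odot>\<^bsub>FO F (X \<boxtimes> Y)\<^esub> pr X Y x y"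
    and "pr X Y x (c \<odot>\<^bsub>FO F Y\<^esub> y) = c \<odot>\<^bsub>FO F (X \<boxtimes> Y)\<^esub> pr X Y x y"
  using lin_smult[OF pr_lin(1)[OF assms(1-3)] assms(4)] lin_smult[OF pr_lin(2)[OF assms(1,2,4)] assms(3)]
  by auto

lemma pr_finsum:
  assumes X: "X \<in> Obj C" and Y: "Y \<in> Obj C" and I: "finite I"
  shows "x \<in> carrier (FO F X) \<Longrightarrow> g \<in> I \<rightarrow> carrier (FO F Y) \<Longrightarrow>
      pr X Y x (finsum (FO F Y) g I) = finsum (FO F (X \<boxtimes> Y)) (\<lambda>i. pr X Y x (g i)) I"
    and "y \<in> carrier (FO F Y) \<Longrightarrow> f \<in> I \<rightarrow> carrier (FO F X) \<Longrightarrow>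
      pr X Y (finsum (FO F X) f I) y = finsum (FO F (X \<boxtimes> Y)) (\<lambda>i. pr X Y (f i) y) I"
proof -
  note XY = FO_cspace[OF TensO_obj[OF X Y]]
  show "pr X Y x (finsum (FO F Y) g I) = finsum (FO F (X \<boxtimes> Y)) (\<lambda>i. pr X Y x (g i)) I"
    if "x \<in> carrier (FO F X)" "g \<in> I \<rightarrow> carrier (FO F Y)"
    by (rule lin_finsum[OF FO_cspace[OF Y] XY pr_lin(1)[OF X Y that(1)] I that(2)])
  show "pr X Y (finsum (FO F X) f I) y = finsum (FO F (X \<boxtimes> Y)) (\<lambda>i. pr X Y (f i) y) I"
    if "y \<in> carrier (FO F Y)" "f \<in> I \<rightarrow> carrier (FO F X)"
    using lin_finsum[OF FO_cspace[OF X] XY pr_lin(2)[OF X Y that(1)] I that(2)] .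
qed

lemma FA_closed: "u \<in> Hom C X Y \<Longrightarrow> x \<in> carrier (FO F X) \<Longrightarrow> FA F u x \<in> carrier (FO F Y)"
  by (rule lin_closed[OF FA_lin])

lemma FA_finsum:
  assumes u: "u \<in> Hom C X Y" and "finite I" "f \<in> I \<rightarrow> carrier (FO F X)"
  shows "FA F u (finsum (FO F X) f I) = finsum (FO F Y) (\<lambda>i. FA F u (f i)) I"
  by (rule lin_finsum[OF FO_cspace[OF HomD(1)[OF u]] FO_cspace[OF HomD(2)[OF u]] FA_lin[OF u] assms(2,3)])

lemma FA_pr:
  assumes u: "u \<in> Hom C X X'" and w: "w \<in> Hom C Y Y'"
    and x: "x \<in> carrier (FO F X)" and y: "y \<in> carrier (FO F Y)"
  shows "FA F (u \<boxdot> w) (pr X Y x y) = pr X' Y' (FA F u x) (FA F w y)"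
proof -
  note c = FO_cspace[OF HomD(1)[OF u]] FO_cspace[OF HomD(1)[OF w]] FO_cspace[OF HomD(2)[OF u]]
    FO_cspace[OF HomD(2)[OF w]]
  show ?thesis
    using FT_nat[OF u w tens_closed[OF c(1,2) x y]] tensor_map(2)[OF c FA_lin[OF u] FA_lin[OF w] x y]
    by (simp add: pr_def)
qed

lemma FA_Assoc_pr:
  assumes X: "X \<in> Obj C" and Y: "Y \<in> Obj C" and Z: "Z \<in> Obj C"
    and x: "x \<in> carrier (FO F X)" and y: "y \<in> carrier (FO F Y)" and z: "z \<in> carrier (FO F Z)"
  shows "FA F (Assoc C X Y Z) (pr (X \<boxtimes> Y) Z (pr X Y x y) z) = pr X (Y \<boxtimes> Z) x (pr Y Z y z)"
proof -
  note c = FO_cspace[OF X] FO_cspace[OF Y] FO_cspace[OF Z]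
  note cc = cspace_tensor[OF c(1,2)] cspace_tensor[OF c(2,3)]
  note t = tens_closed[OF c(1,2) x y] tens_closed[OF c(2,3) y z]
  show ?thesis
    using FT_Assoc[OF X Y Z tens_closed[OF cc(1) c(3) t(1) z]]
      tensor_map(2)[OF cc(1) c(3) FO_cspace[OF TensO_obj[OF X Y]] c(3) FT_lin[OF X Y] lin_id[OF c(3)] t(1) z]
      tensor_map(2)[OF c(1) cc(2) c(1) FO_cspace[OF TensO_obj[OF Y Z]] lin_id[OF c(1)] FT_lin[OF Y Z] x t(2)]
      vassoc(2)[OF c x y z]
    by (simp add: pr_def)
qed

lemma FU_closed: "FU F c \<in> carrier (FO F (Unit C))"
  using lin_closed[OF FU_lin] by simp

lemma scal_lin: "scal \<in> lin (FO F (Unit C)) cunit"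
  unfolding scal_def by (rule lin_inv_on[OF cspace_cunit FU_lin FU_bij])

lemma scal_FU: "scal (FU F c) = c"
  unfolding scal_def by (rule inv_on_left[OF FU_bij]) simp

lemma FU_scal: "v \<in> carrier (FO F (Unit C)) \<Longrightarrow> FU F (scal v) = v"
  unfolding scal_def by (rule inv_on_right[OF FU_bij])

lemma FU_eq: "FU F c = c \<odot>\<^bsub>FO F (Unit C)\<^esub> FU F 1"
  using lin_smult[OF FU_lin, of 1 c] by simp

lemma FA_LUnit_pr:
  assumes X: "X \<in> Obj C" and x: "x \<in> carrier (FO F X)"
  shows "FA F (LUnit C X) x = pr X (Unit C) x (FU F 1)"
  using FA_LUnit[OF X x] tensor_map(2)[OF FO_cspace[OF X] cspace_cunit FO_cspace[OF X] FO_cspace[OF Unit_obj]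
      lin_id[OF FO_cspace[OF X]] FU_lin x, of 1]
  by (simp add: pr_def vlunit_def)

lemma FA_RUnit_pr:
  assumes X: "X \<in> Obj C" and x: "x \<in> carrier (FO F X)"
  shows "FA F (RUnit C X) x = pr (Unit C) X (FU F 1) x"
  using FA_RUnit[OF X x] tensor_map(2)[OF cspace_cunit FO_cspace[OF X] FO_cspace[OF Unit_obj] FO_cspace[OF X]
      FU_lin lin_id[OF FO_cspace[OF X]] _ x, of 1]
  by (simp add: pr_def vrunit_def)

lemma FA_Inv:
  assumes u: "u \<in> Iso C X Y"
  shows "x \<in> carrier (FO F X) \<Longrightarrow> FA F (Inv C u) (FA F u x) = x"
    and "y \<in> carrier (FO F Y) \<Longrightarrow> FA F u (FA F (Inv C u) y) = y"
  using FA_Comp[OF Iso_Inv(1,2)[OF u], of x] FA_Comp[OF Iso_Inv(2,1)[OF u], of y]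
    FA_Id[OF HomD(1)[OF Iso_Inv(1)[OF u]]] FA_Id[OF HomD(2)[OF Iso_Inv(1)[OF u]]]
  by (simp_all add: Iso_Inv[OF u])

lemma FA_Inv_Assoc_pr:
  assumes "X \<in> Obj C" "Y \<in> Obj C" "Z \<in> Obj C" "x \<in> carrier (FO F X)" "y \<in> carrier (FO F Y)" "z \<in> carrier (FO F Z)"
  shows "FA F (Inv C (Assoc C X Y Z)) (pr X (Y \<boxtimes> Z) x (pr Y Z y z)) = pr (X \<boxtimes> Y) Z (pr X Y x y) z"
  using FA_Inv(1)[OF Assoc_iso[OF assms(1-3)], of "pr (X \<boxtimes> Y) Z (pr X Y x y) z"]
  by (simp add: FA_Assoc_pr assms pr_closed TensO_obj)

lemma FA_Inv_LUnit_pr: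
  assumes X: "X \<in> Obj C" and x: "x \<in> carrier (FO F X)"
  shows "FA F (Inv C (LUnit C X)) (pr X (Unit C) x (FU F 1)) = x"
  using FA_Inv(1)[OF LUnit_iso[OF X] x] by (simp add: FA_LUnit_pr X x)

lemma FA_Inv_RUnit_pr:
  assumes X: "X \<in> Obj C" and x: "x \<in> carrier (FO F X)"
  shows "FA F (Inv C (RUnit C X)) (pr (Unit C) X (FU F 1) x) = x"
  using FA_Inv(1)[OF RUnit_iso[OF X] x] by (simp add: FA_RUnit_pr X x)

text \<open>F maps the unit isomorphisms to bijections. Zigzag composites end in F(X \<otimes> 1) or
  F(1 \<otimes> X), and this brings the resulting identities back to F(X).\<close>

lemma pr_unit_cancel:
  assumes "X \<in> Obj C" "x \<in> carrier (FO F X)" "y \<in> carrier (FO F X)"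
  shows "pr X (Unit C) x (FU F 1) = pr X (Unit C) y (FU F 1) \<Longrightarrow> x = y"
    and "pr (Unit C) X (FU F 1) x = pr (Unit C) X (FU F 1) y \<Longrightarrow> x = y"
  using FA_Inv_LUnit_pr[OF assms(1)] FA_Inv_RUnit_pr[OF assms(1)] assms(2,3) by metis+

lemma FTinv_pr:
  assumes "X \<in> Obj C" "Y \<in> Obj C" "x \<in> carrier (FO F X)" "y \<in> carrier (FO F Y)"
  shows "FTinv F X Y (pr X Y x y) = tens (FO F X) (FO F Y) x y"
  unfolding FTinv_def pr_def
  by (rule inv_on_left[OF FT_bij[OF assms(1,2)] tens_closed[OF FO_cspace FO_cspace]]) (use assms in auto)

lemma FTinv_lin:
  assumes "X \<in> Obj C" "Y \<in> Obj C"
  shows "FTinv F X Y \<in> lin (FO F (X \<boxtimes> Y)) (FO F X \<otimes>\<^sub>v FO F Y)"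
  unfolding FTinv_def
  by (rule lin_inv_on[OF cspace_tensor[OF FO_cspace FO_cspace] FT_lin FT_bij]) (use assms in auto)

lemma FT_FTinv: "\<lbrakk>X \<in> Obj C; Y \<in> Obj C; z \<in> carrier (FO F (X \<boxtimes> Y))\<rbrakk> \<Longrightarrow> FT F X Y (FTinv F X Y z) = z"
  unfolding FTinv_def by (rule inv_on_right[OF FT_bij])

lemma FTinv_FT: "\<lbrakk>X \<in> Obj C; Y \<in> Obj C; z \<in> carrier (FO F X \<otimes>\<^sub>v FO F Y)\<rbrakk> \<Longrightarrow> FTinv F X Y (FT F X Y z) = z"
  unfolding FTinv_def by (rule inv_on_left[OF FT_bij])

text \<open>One choice of p and q serves both expansions: calculations with pairings use the sum of
  \<open>pr\<close> vectors, while the composite that defines the antipode applies the inverse of f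
  and needs the sum of tensors.\<close>

lemma pr_decompose:
  assumes X: "X \<in> Obj C" and Y: "Y \<in> Obj C" and z: "z \<in> carrier (FO F (X \<boxtimes> Y))"
  obtains n :: nat and p q where "p \<in> {..<n} \<rightarrow> carrier (FO F X)" "q \<in> {..<n} \<rightarrow> carrier (FO F Y)"
    "z = finsum (FO F (X \<boxtimes> Y)) (\<lambda>i. pr X Y (p i) (q i)) {..<n}"
    "FTinv F X Y z = finsum (FO F X \<otimes>\<^sub>v FO F Y) (\<lambda>i. tens (FO F X) (FO F Y) (p i) (q i)) {..<n}"
proof -
  note c = FO_cspace[OF X] FO_cspace[OF Y]
  obtain n :: nat and p q where pq: "p \<in> {..<n} \<rightarrow> carrier (FO F X)" "q \<in> {..<n} \<rightarrow> carrier (FO F Y)"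
    and e: "FTinv F X Y z = finsum (FO F X \<otimes>\<^sub>v FO F Y) (\<lambda>i. tens (FO F X) (FO F Y) (p i) (q i)) {..<n}"
    by (rule tensor_finsum[OF c lin_closed[OF FTinv_lin[OF X Y] z]])
  have "z = FT F X Y (FTinv F X Y z)" using FT_FTinv[OF X Y z] by simp
  also have "\<dots> = finsum (FO F (X \<boxtimes> Y)) (\<lambda>i. pr X Y (p i) (q i)) {..<n}"
    unfolding e pr_def
    by (rule lin_finsum[OF cspace_tensor[OF c] FO_cspace[OF TensO_obj[OF X Y]] FT_lin[OF X Y]])
      (use pq tens_closed[OF c] in \<open>auto simp: Pi_iff\<close>)
  finally show thesis by (rule that[OF pq _ e])
qed

lemma pr_unique:
  assumes X: "X \<in> Obj C" and Y: "Y \<in> Obj C" and U: "cspace U"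
    and g: "g \<in> lin (FO F (X \<boxtimes> Y)) U" and k: "k \<in> lin (FO F (X \<boxtimes> Y)) U"
    and eq: "\<And>x y. x \<in> carrier (FO F X) \<Longrightarrow> y \<in> carrier (FO F Y) \<Longrightarrow> g (pr X Y x y) = k (pr X Y x y)"
    and z: "z \<in> carrier (FO F (X \<boxtimes> Y))"
  shows "g z = k z"
proof -
  have "g (FT F X Y (FTinv F X Y z)) = k (FT F X Y (FTinv F X Y z))"
    by (rule tensor_unique[OF FO_cspace[OF X] FO_cspace[OF Y] U lin_comp[OF FT_lin[OF X Y] g]
          lin_comp[OF FT_lin[OF X Y] k]])
      (use eq lin_closed[OF FTinv_lin[OF X Y] z] in \<open>auto simp: pr_def\<close>)
  then show ?thesis by (simp add: FT_FTinv X Y z)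
qed

end

section \<open>The representing space\<close>

locale representable_vfunctor = monoidal_vfunctor C F + represents C F H \<theta>
  for C :: "('o, 'm, 'z) monoidal_scheme" (structure) and F :: "('o, 'm, 'v) vfunctor"
    and H :: "'v cvs" and \<theta>
begin

abbreviation ac :: "'o \<Rightarrow> 'v \<Rightarrow> 'v \<Rightarrow> 'v" where "ac \<equiv> act F H \<theta>"

lemma Nat_transD:
  assumes "\<eta> \<in> Nat_trans C F V" "X \<in> Obj C"
  shows "\<eta> X \<in> Lin (V \<otimes>\<^sub>v FO F X) (FO F X)"
    and "\<lbrakk>u \<in> Hom C X Y; t \<in> carrier (V \<otimes>\<^sub>v FO F X)\<rbrakk> \<Longrightarrow>
       \<eta> Y (tensor_map V (FO F X) V (FO F Y) (\<lambda>v. v) (FA F u) t) = FA F u (\<eta> X t)"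
  using assms HomD(2) unfolding Nat_trans_def by blast+

lemma Lin_H_id: "(\<lambda>k\<in>carrier H. k) \<in> Lin H H"
  unfolding Lin_def by (rule IntI[OF lin_cong[OF lin_id[OF H_cspace] H_cspace]]) auto

lemma \<theta>_Nat_trans: "cspace V \<Longrightarrow> \<phi> \<in> Lin V H \<Longrightarrow> \<theta> V \<phi> \<in> Nat_trans C F V"
  using \<theta>_bij by (auto simp: bij_betw_def)

lemma \<theta>_lin: "cspace V \<Longrightarrow> \<phi> \<in> Lin V H \<Longrightarrow> X \<in> Obj C \<Longrightarrow> \<theta> V \<phi> X \<in> lin (V \<otimes>\<^sub>v FO F X) (FO F X)"
  using Nat_transD(1)[OF \<theta>_Nat_trans] by (auto simp: Lin_def)

lemma act_bilinear:
  assumes X: "X \<in> Obj C" shows "ac X \<in> bilinear_maps H (FO F X) (FO F X)"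
proof -
  note t = bilinear_mapsD[OF tens_bilinear_maps[OF H_cspace FO_cspace[OF X]]]
  note l = \<theta>_lin[OF H_cspace Lin_H_id X]
  show ?thesis
    unfolding bilinear_maps_def act_def using lin_comp[OF t(1) l] lin_comp[OF t(2) l] by auto
qed

lemmas act_lin = bilinear_mapsD[OF act_bilinear]

lemma act_closed: "\<lbrakk>X \<in> Obj C; h \<in> carrier H; x \<in> carrier (FO F X)\<rbrakk> \<Longrightarrow> ac X h x \<in> carrier (FO F X)"
  by (rule lin_closed[OF act_lin(1)])

lemma act_nat:
  assumes u: "u \<in> Hom C X Y" and h: "h \<in> carrier H" and x: "x \<in> carrier (FO F X)"
  shows "ac Y h (FA F u x) = FA F u (ac X h x)"
proof -
  note c = FO_cspace[OF HomD(1)[OF u]] FO_cspace[OF HomD(2)[OF u]]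
  show ?thesis
    unfolding act_def
    using Nat_transD(2)[OF \<theta>_Nat_trans[OF H_cspace Lin_H_id] HomD(1)[OF u] u tens_closed[OF H_cspace c(1) h x]]
      tensor_map(2)[OF H_cspace c(1) H_cspace c(2) lin_id[OF H_cspace] FA_lin[OF u] h x]
    by simp
qed

text \<open>The Yoneda step: \<phi> is the identity of H composed with \<phi>, so naturality of
  \<theta> in the space V exhibits every natural transformation as the pullback of the universal
  one, the action.\<close>

lemma \<theta>_tens:
  assumes V: "cspace V" and \<phi>: "\<phi> \<in> Lin V H" and X: "X \<in> Obj C" and v: "v \<in> carrier V" and x: "x \<in> carrier (FO F X)"
  shows "\<theta> V \<phi> X (tens V (FO F X) v x) = ac X (\<phi> v) x"
proof -
  have \<phi>l: "\<phi> \<in> lin V H" and \<phi>e: "\<phi> \<in> extensional (carrier V)" using \<phi> by (auto simp: Lin_def)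
  have "compose (carrier V) (\<lambda>k\<in>carrier H. k) \<phi> = \<phi>"
    by (rule extensionalityI[OF _ \<phi>e]) (use lin_closed[OF \<phi>l] in \<open>auto simp: compose_def\<close>)
  then show ?thesis
    unfolding act_def
    using \<theta>_nat[OF V H_cspace \<phi> Lin_H_id X tens_closed[OF V FO_cspace[OF X] v x]]
      tensor_map(2)[OF V FO_cspace[OF X] H_cspace FO_cspace[OF X] \<phi>l lin_id[OF FO_cspace[OF X]] v x]
    by simp
qed

text \<open>An element k of H is encoded as the linear map from the line F(1) to H that sends
  \<open>FU F 1\<close> to k. Injectivity of \<theta> on such maps is faithfulness of the
  action.\<close>

lemma act_eqI:
  assumes h: "h \<in> carrier H" and h': "h' \<in> carrier H"
    and eq: "\<And>X x. X \<in> Obj C \<Longrightarrow> x \<in> carrier (FO F X) \<Longrightarrow> ac X h x = ac X h' x"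
  shows "h = h'"
proof -
  let ?U = "FO F (Unit C)"
  note U = FO_cspace[OF Unit_obj]
  define \<phi> where "\<phi> k = (\<lambda>u\<in>carrier ?U. scal u \<odot>\<^bsub>H\<^esub> k)" for k
  have \<phi>: "\<phi> k \<in> Lin ?U H" if k: "k \<in> carrier H" for k
  proof -
    have "(\<lambda>u. scal u \<odot>\<^bsub>H\<^esub> k) \<in> lin ?U H"
      by (rule linI) (simp_all add: cspaceD(2-5)[OF H_cspace] k lin_add[OF scal_lin] lin_smult[OF scal_lin])
    then have "\<phi> k \<in> lin ?U H" by (rule lin_cong[OF _ U]) (simp add: \<phi>_def)
    then show ?thesis by (simp add: Lin_def \<phi>_def)
  qed
  have "\<theta> ?U (\<phi> h) = \<theta> ?U (\<phi> h')"
  proof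
    fix X
    note n = \<theta>_Nat_trans[OF U \<phi>[OF h]] \<theta>_Nat_trans[OF U \<phi>[OF h']]
    show "\<theta> ?U (\<phi> h) X = \<theta> ?U (\<phi> h') X"
    proof (cases "X \<in> Obj C")
      case True
      note X = FO_cspace[OF True]
      have e: "\<theta> ?U (\<phi> h) X \<in> extensional (carrier (?U \<otimes>\<^sub>v FO F X))"
        "\<theta> ?U (\<phi> h') X \<in> extensional (carrier (?U \<otimes>\<^sub>v FO F X))"
        using Nat_transD(1)[OF n(1) True] Nat_transD(1)[OF n(2) True] by (auto simp: Lin_def)
      show ?thesis
      proof (rule extensionalityI[OF e])
        fix t assume t: "t \<in> carrier (?U \<otimes>\<^sub>v FO F X)"
        show "\<theta> ?U (\<phi> h) X t = \<theta> ?U (\<phi> h') X t"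
          by (rule tensor_unique[OF U X X \<theta>_lin[OF U \<phi>[OF h] True] \<theta>_lin[OF U \<phi>[OF h'] True] _ t])
            (simp add: \<theta>_tens U \<phi> h h' True, simp add: \<phi>_def lin_smult[OF act_lin(2)] h h' True eq)
      qed
    next
      \<comment> \<open>\<open>Nat_trans\<close> consists of extensional families, so away from the
        objects both sides are \<open>undefined\<close>.\<close>
      case False
      have "\<eta> X = undefined" if "\<eta> \<in> Nat_trans C F ?U" for \<eta>
        using that False unfolding Nat_trans_def by (blast dest: PiE_arb)
      then show ?thesis using n by metis
    qed
  qed
  then have "\<phi> h = \<phi> h'" using \<theta>_bij[OF U] \<phi> h h' by (auto simp: bij_betw_def inj_on_def)
  then have "\<phi> h (FU F 1) = \<phi> h' (FU F 1)" by simp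
  then show ?thesis by (simp add: \<phi>_def FU_closed scal_FU cspaceD(6)[OF H_cspace] h h')
qed

text \<open>A natural endomorphism of \<open>F\<close> is a natural transformation \<open>F(1) \<otimes> F \<rightarrow> F\<close>, where
  \<open>F(1)\<close> is the copy of the complex numbers available among the spaces carried by \<^typ>\<open>'v\<close>.\<close>

lemma act_exists:
  assumes lin: "\<And>X. X \<in> Obj C \<Longrightarrow> \<eta> X \<in> lin (FO F X) (FO F X)"
    and nat: "\<And>X Y u x. u \<in> Hom C X Y \<Longrightarrow> x \<in> carrier (FO F X) \<Longrightarrow> \<eta> Y (FA F u x) = FA F u (\<eta> X x)"
  shows "\<exists>h\<in>carrier H. \<forall>X\<in>Obj C. \<forall>x\<in>carrier (FO F X). ac X h x = \<eta> X x"
proof -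
  let ?U = "FO F (Unit C)"
  note U = FO_cspace[OF Unit_obj]
  let ?b = "\<lambda>X u x. scal u \<odot>\<^bsub>FO F X\<^esub> \<eta> X x"
  have b: "?b X \<in> bilinear_maps ?U (FO F X) (FO F X)" if X: "X \<in> Obj C" for X
    using lin_closed[OF lin[OF X]] FO_cspace[OF X]
    by (intro bilinear_mapsI)
      (simp_all add: cspaceD(2-4) lin_add[OF lin[OF X]] lin_smult[OF lin[OF X]] lin_add[OF scal_lin]
        lin_smult[OF scal_lin] cspaceD(5)[symmetric] mult.commute)
  \<comment> \<open>Both restrictions are required: \<open>Nat_trans\<close> asks for a family
    extensional in the object, whose members are extensional on the tensor product.\<close>
  define N where "N = (\<lambda>X\<in>Obj C. \<lambda>t\<in>carrier (?U \<otimes>\<^sub>v FO F X). tensor_lift ?U (FO F X) (FO F X) (?b X) t)"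
  note L = tensor_lift[OF U FO_cspace FO_cspace b]
  have NL: "N X \<in> lin (?U \<otimes>\<^sub>v FO F X) (FO F X)" if X: "X \<in> Obj C" for X
    by (rule lin_cong[OF L(1) cspace_tensor[OF U FO_cspace]]) (use X in \<open>auto simp: N_def\<close>)
  have Nt: "N X (tens ?U (FO F X) u x) = ?b X u x"
    if "X \<in> Obj C" "u \<in> carrier ?U" "x \<in> carrier (FO F X)" for X u x
    using that by (simp add: N_def tens_closed U FO_cspace L(2))
  have "N \<in> Nat_trans C F ?U"
    unfolding Nat_trans_def
  proof (intro CollectI conjI ballI)
    show "N \<in> (\<Pi>\<^sub>E X\<in>Obj C. Lin (?U \<otimes>\<^sub>v FO F X) (FO F X))"
    proof (rule PiE_I)
      show "N X \<in> Lin (?U \<otimes>\<^sub>v FO F X) (FO F X)" if "X \<in> Obj C" for X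
        unfolding Lin_def by (rule IntI[OF NL[OF that]]) (simp add: N_def that)
    qed (simp add: N_def)
    fix X Y u t
    assume X: "X \<in> Obj C" and Y: "Y \<in> Obj C" and u: "u \<in> Hom C X Y" and t: "t \<in> carrier (?U \<otimes>\<^sub>v FO F X)"
    note m = tensor_map[OF U FO_cspace[OF X] U FO_cspace[OF Y] lin_id[OF U] FA_lin[OF u]]
    show "N Y (tensor_map ?U (FO F X) ?U (FO F Y) (\<lambda>v. v) (FA F u) t) = FA F u (N X t)"
    proof (rule tensor_unique[OF U FO_cspace[OF X] FO_cspace[OF Y] lin_comp[OF m(1) NL[OF Y]]
          lin_comp[OF NL[OF X] FA_lin[OF u]] _ t])
      fix v w assume v: "v \<in> carrier ?U" and w: "w \<in> carrier (FO F X)"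
      show "N Y (tensor_map ?U (FO F X) ?U (FO F Y) (\<lambda>v. v) (FA F u) (tens ?U (FO F X) v w)) =
          FA F u (N X (tens ?U (FO F X) v w))"
        by (simp add: m v w Nt X Y FA_closed[OF u] nat[OF u] lin_smult[OF FA_lin[OF u]] lin_closed[OF lin[OF X]])
    qed
  qed
  then obtain \<phi> where \<phi>: "\<phi> \<in> Lin ?U H" "\<theta> ?U \<phi> = N"
    using bij_betw_imp_surj_on[OF \<theta>_bij[OF U]] by (metis imageE)
  \<comment> \<open>\<open>FU F 1\<close> has coordinate 1, so the value of \<phi> there is the
    element that acts as \<eta>.\<close>
  have "ac X (\<phi> (FU F 1)) x = \<eta> X x" if X: "X \<in> Obj C" and x: "x \<in> carrier (FO F X)" for X x
    using \<theta>_tens[OF U \<phi>(1) X FU_closed x, of 1] Nt[OF X FU_closed x, of 1]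
    by (simp add: \<phi>(2) scal_FU cspaceD(6)[OF FO_cspace[OF X]] lin_closed[OF lin[OF X]] x)
  moreover have "\<phi> (FU F 1) \<in> carrier H"
    using \<phi>(1) by (auto simp: Lin_def intro: lin_closed FU_closed)
  ultimately show ?thesis by blast
qed

lemma rep_elt_eqI:
  assumes "h \<in> carrier H" "\<And>X x. X \<in> Obj C \<Longrightarrow> x \<in> carrier (FO F X) \<Longrightarrow> ac X h x = \<eta> X x"
  shows "rep_elt C F H \<theta> \<eta> = h"
  unfolding rep_elt_def
proof (rule the_equality)
  fix k assume "k \<in> carrier H \<and> (\<forall>X\<in>Obj C. \<forall>x\<in>carrier (FO F X). ac X k x = \<eta> X x)"
  then show "k = h" using assms by - (rule act_eqI, simp_all)
qed (use assms in simp)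

lemma rep_elt:
  assumes "\<And>X. X \<in> Obj C \<Longrightarrow> \<eta> X \<in> lin (FO F X) (FO F X)"
    and "\<And>X Y u x. u \<in> Hom C X Y \<Longrightarrow> x \<in> carrier (FO F X) \<Longrightarrow> \<eta> Y (FA F u x) = FA F u (\<eta> X x)"
  shows "rep_elt C F H \<theta> \<eta> \<in> carrier H"
    and "\<And>X x. X \<in> Obj C \<Longrightarrow> x \<in> carrier (FO F X) \<Longrightarrow> ac X (rep_elt C F H \<theta> \<eta>) x = \<eta> X x"
proof -
  obtain h where h: "h \<in> carrier H" "\<And>X x. X \<in> Obj C \<Longrightarrow> x \<in> carrier (FO F X) \<Longrightarrow> ac X h x = \<eta> X x"
    using act_exists[of \<eta>, OF assms] by blast
  then have "rep_elt C F H \<theta> \<eta> = h" by (rule rep_elt_eqI)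
  then show "rep_elt C F H \<theta> \<eta> \<in> carrier H"
    "\<And>X x. X \<in> Obj C \<Longrightarrow> x \<in> carrier (FO F X) \<Longrightarrow> ac X (rep_elt C F H \<theta> \<eta>) x = \<eta> X x"
    using h by auto
qed

end

section \<open>The reconstructed bialgebra\<close>

context representable_vfunctor
begin

abbreviation A where "A \<equiv> rep_algebra C F H \<theta>"

abbreviation HH where "HH \<equiv> H \<otimes>\<^sub>v H"

lemma A_simps [simp]:
  "carrier A = carrier H" "x \<oplus>\<^bsub>A\<^esub> y = x \<oplus>\<^bsub>H\<^esub> y" "\<zero>\<^bsub>A\<^esub> = \<zero>\<^bsub>H\<^esub>" "c \<odot>\<^bsub>A\<^esub> x = c \<odot>\<^bsub>H\<^esub> x"
  by (simp_all add: rep_algebra_def)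

lemma act_finsum:
  assumes X: "X \<in> Obj C" and I: "finite I"
  shows "h \<in> carrier H \<Longrightarrow> f \<in> I \<rightarrow> carrier (FO F X) \<Longrightarrow>
      ac X h (finsum (FO F X) f I) = finsum (FO F X) (\<lambda>i. ac X h (f i)) I"
    and "x \<in> carrier (FO F X) \<Longrightarrow> g \<in> I \<rightarrow> carrier H \<Longrightarrow>
      ac X (finsum H g I) x = finsum (FO F X) (\<lambda>i. ac X (g i) x) I"
  using lin_finsum[OF FO_cspace[OF X] FO_cspace[OF X] act_lin(1)[OF X] I, of h f]
    lin_finsum[OF H_cspace FO_cspace[OF X] act_lin(2)[OF X] I, of x g] by auto

lemma mult_A:
  assumes a: "a \<in> carrier H" and b: "b \<in> carrier H"
  shows "a \<otimes>\<^bsub>A\<^esub> b \<in> carrier H"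
    and "X \<in> Obj C \<Longrightarrow> x \<in> carrier (FO F X) \<Longrightarrow> ac X (a \<otimes>\<^bsub>A\<^esub> b) x = ac X a (ac X b x)"
proof -
  have m: "a \<otimes>\<^bsub>A\<^esub> b = rep_elt C F H \<theta> (\<lambda>X x. ac X a (ac X b x))" by (simp add: rep_algebra_def)
  have 1: "(\<lambda>x. ac X a (ac X b x)) \<in> lin (FO F X) (FO F X)" if "X \<in> Obj C" for X
    by (rule lin_comp[OF act_lin(1)[OF that b] act_lin(1)[OF that a]])
  have 2: "ac Y a (ac Y b (FA F u x)) = FA F u (ac X a (ac X b x))"
    if "u \<in> Hom C X Y" "x \<in> carrier (FO F X)" for X Y u x
    using that by (simp add: act_nat a b act_closed HomD)
  note R = rep_elt[of "\<lambda>X x. ac X a (ac X b x)", OF 1 2]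
  show "a \<otimes>\<^bsub>A\<^esub> b \<in> carrier H" unfolding m by (rule R(1))
  show "ac X (a \<otimes>\<^bsub>A\<^esub> b) x = ac X a (ac X b x)" if "X \<in> Obj C" "x \<in> carrier (FO F X)"
    unfolding m using that by (intro R(2)) auto
qed

lemma one_A:
  shows "\<one>\<^bsub>A\<^esub> \<in> carrier H"
    and "X \<in> Obj C \<Longrightarrow> x \<in> carrier (FO F X) \<Longrightarrow> ac X \<one>\<^bsub>A\<^esub> x = x"
proof -
  have m: "\<one>\<^bsub>A\<^esub> = rep_elt C F H \<theta> (\<lambda>X x. x)" by (simp add: rep_algebra_def)
  note R = rep_elt[of "\<lambda>X x. x", OF lin_id[OF FO_cspace]]
  show "\<one>\<^bsub>A\<^esub> \<in> carrier H" unfolding m by (rule R(1)) auto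
  show "ac X \<one>\<^bsub>A\<^esub> x = x" if "X \<in> Obj C" "x \<in> carrier (FO F X)"
    unfolding m by (rule R(2)) (use that in auto)
qed

lemma act_add_smult:
  assumes "X \<in> Obj C" "x \<in> carrier (FO F X)" "a \<in> carrier H"
  shows "b \<in> carrier H \<Longrightarrow> ac X (a \<oplus>\<^bsub>H\<^esub> b) x = ac X a x \<oplus>\<^bsub>FO F X\<^esub> ac X b x"
    and "ac X (c \<odot>\<^bsub>H\<^esub> a) x = c \<odot>\<^bsub>FO F X\<^esub> ac X a x"
    and "y \<in> carrier (FO F X) \<Longrightarrow> ac X a (x \<oplus>\<^bsub>FO F X\<^esub> y) = ac X a x \<oplus>\<^bsub>FO F X\<^esub> ac X a y"
    and "ac X a (c \<odot>\<^bsub>FO F X\<^esub> x) = c \<odot>\<^bsub>FO F X\<^esub> ac X a x"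
  using assms lin_add[OF act_lin(2)] lin_smult[OF act_lin(2)] lin_add[OF act_lin(1)] lin_smult[OF act_lin(1)]
  by blast+

text \<open>Since elements are determined by their actions, identities in the algebra reduce to
  identities of operators, where the product is composition; the ring axioms are obtained by the
  same device.\<close>

lemma mult_A_bilinear: "(\<otimes>\<^bsub>A\<^esub>) \<in> bilinear_maps H H H"
  by (rule bilinear_mapsI; (rule act_eqI)?)
    (simp_all add: mult_A act_add_smult act_closed cspace_add[OF H_cspace] cspaceD(2)[OF H_cspace])

lemma act_H_separates:
  assumes "h \<in> carrier H" "\<And>X x. X \<in> Obj C \<Longrightarrow> x \<in> carrier (FO F X) \<Longrightarrow> ac X h x = \<zero>\<^bsub>FO F X\<^esub>"
  shows "h = \<zero>\<^bsub>H\<^esub>"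
  by (rule act_eqI[OF assms(1) cspace_zero[OF H_cspace]])
    (use assms lin_zero[OF H_cspace FO_cspace act_lin(2)] in auto)

text \<open>The linear extension to t of a \<otimes> b \<mapsto> f(a x \<otimes> b y). With x and y
  fixed it is a linear map in t, which is the shape the separation argument needs;
  \<open>act2\<close> is instead an operator on all of F(X) \<otimes> F(Y).\<close>

definition act_pr :: "'o \<Rightarrow> 'o \<Rightarrow> 'v \<Rightarrow> 'v \<Rightarrow> ('v, 'v) tensor \<Rightarrow> 'v" where
  "act_pr X Y x y t = FT F X Y (tensor_map H H (FO F X) (FO F Y) (\<lambda>a. ac X a x) (\<lambda>b. ac Y b y) t)"

context
  fixes X Y x y
  assumes X: "X \<in> Obj C" and Y: "Y \<in> Obj C" and x: "x \<in> carrier (FO F X)" and y: "y \<in> carrier (FO F Y)"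
begin

lemma act_pr_lin: "act_pr X Y x y \<in> lin HH (FO F (X \<boxtimes> Y))"
proof -
  note m = tensor_map[OF H_cspace H_cspace FO_cspace[OF X] FO_cspace[OF Y] act_lin(2)[OF X x] act_lin(2)[OF Y y]]
  show ?thesis unfolding act_pr_def[abs_def] by (rule lin_comp[OF m(1) FT_lin[OF X Y]])
qed

lemma act_pr_tens:
  "a \<in> carrier H \<Longrightarrow> b \<in> carrier H \<Longrightarrow> act_pr X Y x y (tens H H a b) = pr X Y (ac X a x) (ac Y b y)"
  unfolding act_pr_def pr_def
  using tensor_map(2)[OF H_cspace H_cspace FO_cspace[OF X] FO_cspace[OF Y] act_lin(2)[OF X x] act_lin(2)[OF Y y]]
  by simp

lemma act_pr_finsum:
  assumes "finite I" "a \<in> I \<rightarrow> carrier H" "b \<in> I \<rightarrow> carrier H"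
  shows "act_pr X Y x y (finsum HH (\<lambda>i. tens H H (a i) (b i)) I) =
    finsum (FO F (X \<boxtimes> Y)) (\<lambda>i. pr X Y (ac X (a i) x) (ac Y (b i) y)) I"
proof -
  note XY = FO_cspace[OF TensO_obj[OF X Y]]
  have "act_pr X Y x y (finsum HH (\<lambda>i. tens H H (a i) (b i)) I) =
      finsum (FO F (X \<boxtimes> Y)) (\<lambda>i. act_pr X Y x y (tens H H (a i) (b i))) I"
    by (rule lin_finsum[OF cspace_tensor[OF H_cspace H_cspace] XY act_pr_lin assms(1)])
      (use assms tens_closed[OF H_cspace H_cspace] in \<open>auto simp: Pi_iff\<close>)
  also have "\<dots> = finsum (FO F (X \<boxtimes> Y)) (\<lambda>i. pr X Y (ac X (a i) x) (ac Y (b i) y)) I"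
    by (rule finsum_cong_on[OF XY])
      (use assms x y in \<open>auto simp: act_pr_tens Pi_iff intro!: pr_closed act_closed X Y\<close>)
  finally show ?thesis .
qed

end

text \<open>Faithfulness says that the maps a \<mapsto> a x are jointly injective on H. Applied to
  one tensor factor after the other, this yields joint injectivity on H \<otimes> H, and with it the
  uniqueness of coproducts.\<close>

lemma act_pr_separates:
  assumes t: "t \<in> carrier HH"
    and z: "\<And>X Y x y. \<lbrakk>X \<in> Obj C; Y \<in> Obj C; x \<in> carrier (FO F X); y \<in> carrier (FO F Y)\<rbrakk> \<Longrightarrow>
      act_pr X Y x y t = \<zero>\<^bsub>FO F (X \<boxtimes> Y)\<^esub>"
  shows "t = \<zero>\<^bsub>HH\<^esub>"
proof (rule tensor_jointly_injective_left[OF H_cspace H_cspace t,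
      where J = "{(X, x). X \<in> Obj C \<and> x \<in> carrier (FO F X)}" and U = "\<lambda>j. FO F (fst j)"
      and g = "\<lambda>j a. ac (fst j) a (snd j)"])
  fix j assume j: "j \<in> {(X, x). X \<in> Obj C \<and> x \<in> carrier (FO F X)}"
  then obtain X x where jX: "j = (X, x)" and X: "X \<in> Obj C" and x: "x \<in> carrier (FO F X)" by auto
  show "cspace (FO F (fst j))" "(\<lambda>a. ac (fst j) a (snd j)) \<in> lin H (FO F (fst j))"
    using jX FO_cspace[OF X] act_lin(2)[OF X x] by auto
  note m = tensor_map[OF H_cspace H_cspace FO_cspace[OF X] H_cspace act_lin(2)[OF X x] lin_id[OF H_cspace]]
  let ?s = "tensor_map H H (FO F X) H (\<lambda>a. ac X a x) (\<lambda>x. x) t"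
  have "?s = \<zero>\<^bsub>FO F X \<otimes>\<^sub>v H\<^esub>"
  proof (rule tensor_jointly_injective_right[OF FO_cspace[OF X] H_cspace lin_closed[OF m(1) t],
      where J = "{(X, x). X \<in> Obj C \<and> x \<in> carrier (FO F X)}" and U = "\<lambda>j. FO F (fst j)"
      and g = "\<lambda>j a. ac (fst j) a (snd j)"])
    fix j assume j: "j \<in> {(X, x). X \<in> Obj C \<and> x \<in> carrier (FO F X)}"
    then obtain Y y where jY: "j = (Y, y)" and Y: "Y \<in> Obj C" and y: "y \<in> carrier (FO F Y)" by auto
    show "cspace (FO F (fst j))" "(\<lambda>a. ac (fst j) a (snd j)) \<in> lin H (FO F (fst j))"
      using jY FO_cspace[OF Y] act_lin(2)[OF Y y] by auto
    note m' = tensor_map[OF H_cspace H_cspace FO_cspace[OF X] FO_cspace[OF Y] act_lin(2)[OF X x] act_lin(2)[OF Y y]]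
    have e: "tensor_map (FO F X) H (FO F X) (FO F Y) (\<lambda>x. x) (\<lambda>b. ac Y b y) ?s =
        tensor_map H H (FO F X) (FO F Y) (\<lambda>a. ac X a x) (\<lambda>b. ac Y b y) t"
      by (rule tensor_map_comp[OF H_cspace FO_cspace[OF X] FO_cspace[OF X] H_cspace H_cspace FO_cspace[OF Y]
            act_lin(2)[OF X x] lin_id[OF FO_cspace[OF X]] lin_id[OF H_cspace] act_lin(2)[OF Y y] t])
    have "FT F X Y (tensor_map H H (FO F X) (FO F Y) (\<lambda>a. ac X a x) (\<lambda>b. ac Y b y) t) = \<zero>\<^bsub>FO F (X \<boxtimes> Y)\<^esub>"
      using z[OF X Y x y] by (simp add: act_pr_def)
    then have "tensor_map H H (FO F X) (FO F Y) (\<lambda>a. ac X a x) (\<lambda>b. ac Y b y) t =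
        FTinv F X Y \<zero>\<^bsub>FO F (X \<boxtimes> Y)\<^esub>"
      using FTinv_FT[OF X Y lin_closed[OF m'(1) t]] by simp
    also have "\<dots> = \<zero>\<^bsub>FO F X \<otimes>\<^sub>v FO F Y\<^esub>"
      by (rule lin_zero[OF FO_cspace[OF TensO_obj[OF X Y]] cspace_tensor[OF FO_cspace[OF X] FO_cspace[OF Y]] FTinv_lin[OF X Y]])
    finally show "tensor_map (FO F X) H (FO F X) (FO F (fst j)) (\<lambda>x. x) (\<lambda>a. ac (fst j) a (snd j)) ?s =
        \<zero>\<^bsub>FO F X \<otimes>\<^sub>v FO F (fst j)\<^esub>"
      using jY e by simp
  next
    fix w assume w: "w \<in> carrier H"
      and "\<And>j. j \<in> {(X, x). X \<in> Obj C \<and> x \<in> carrier (FO F X)} \<Longrightarrow> ac (fst j) w (snd j) = \<zero>\<^bsub>FO F (fst j)\<^esub>"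
    from this(2)[of "(X, x)" for X x] show "w = \<zero>\<^bsub>H\<^esub>"
      by (intro act_H_separates[OF w]) simp
  qed
  then show "tensor_map H H (FO F (fst j)) H (\<lambda>a. ac (fst j) a (snd j)) (\<lambda>x. x) t = \<zero>\<^bsub>FO F (fst j) \<otimes>\<^sub>v H\<^esub>"
    using jX by simp
next
  fix w assume w: "w \<in> carrier H"
    and "\<And>j. j \<in> {(X, x). X \<in> Obj C \<and> x \<in> carrier (FO F X)} \<Longrightarrow> ac (fst j) w (snd j) = \<zero>\<^bsub>FO F (fst j)\<^esub>"
  from this(2)[of "(X, x)" for X x] show "w = \<zero>\<^bsub>H\<^esub>"
    by (intro act_H_separates[OF w]) simp
qed

lemma act_pr_eqI:
  assumes t: "t \<in> carrier HH" and t': "t' \<in> carrier HH"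
    and eq: "\<And>X Y x y. \<lbrakk>X \<in> Obj C; Y \<in> Obj C; x \<in> carrier (FO F X); y \<in> carrier (FO F Y)\<rbrakk> \<Longrightarrow>
      act_pr X Y x y t = act_pr X Y x y t'"
  shows "t = t'"
proof (rule jointly_injective_eqI[OF cspace_tensor[OF H_cspace H_cspace] t t',
      where J = "{(X, Y, x, y). X \<in> Obj C \<and> Y \<in> Obj C \<and> x \<in> carrier (FO F X) \<and> y \<in> carrier (FO F Y)}"
        and U = "\<lambda>(X, Y, x, y). FO F (X \<boxtimes> Y)" and g = "\<lambda>(X, Y, x, y). act_pr X Y x y"])
  fix v assume "v \<in> carrier HH"
    and z: "\<And>j. j \<in> {(X, Y, x, y). X \<in> Obj C \<and> Y \<in> Obj C \<and> x \<in> carrier (FO F X) \<and> y \<in> carrier (FO F Y)} \<Longrightarrow>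
      (case j of (X, Y, x, y) \<Rightarrow> act_pr X Y x y) v = \<zero>\<^bsub>case j of (X, Y, x, y) \<Rightarrow> FO F (X \<boxtimes> Y)\<^esub>"
  show "v = \<zero>\<^bsub>HH\<^esub>"
    by (rule act_pr_separates[OF \<open>v \<in> carrier HH\<close>]) (use z[of "(X, Y, x, y)" for X Y x y] in simp)
qed (auto simp: eq FO_cspace TensO_obj act_pr_lin)

text \<open>\<open>act2\<close> is the lift of this map. Bilinearity at a general s is obtained from
  pure tensors by writing s as a finite sum.\<close>

lemma tensor_map_act_bilinear:
  assumes X: "X \<in> Obj C" and Y: "Y \<in> Obj C" and s: "s \<in> carrier (FO F X \<otimes>\<^sub>v FO F Y)"
  shows "(\<lambda>a b. tensor_map (FO F X) (FO F Y) (FO F X) (FO F Y) (ac X a) (ac Y b) s)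
    \<in> bilinear_maps H H (FO F X \<otimes>\<^sub>v FO F Y)"
proof -
  note c = FO_cspace[OF X] FO_cspace[OF Y]
  obtain n :: nat and p q where pq: "p \<in> {..<n} \<rightarrow> carrier (FO F X)" "q \<in> {..<n} \<rightarrow> carrier (FO F Y)"
    and e: "s = finsum (FO F X \<otimes>\<^sub>v FO F Y) (\<lambda>i. tens (FO F X) (FO F Y) (p i) (q i)) {..<n}"
    by (rule tensor_finsum[OF c s])
  have b: "(\<lambda>a b. finsum (FO F X \<otimes>\<^sub>v FO F Y) (\<lambda>i. tens (FO F X) (FO F Y) (ac X a (p i)) (ac Y b (q i))) {..<n})
      \<in> bilinear_maps H H (FO F X \<otimes>\<^sub>v FO F Y)"
    by (rule finsum_bilinear[OF H_cspace H_cspace cspace_tensor[OF c]])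
      (use pq act_lin(2)[OF X] act_lin(2)[OF Y] in
        \<open>auto intro!: bilinear_comp[OF tens_bilinear_maps[OF c] _ _ lin_id[OF cspace_tensor[OF c]]] simp: Pi_iff\<close>)
  show ?thesis
    by (rule bilinear_cong[OF b H_cspace H_cspace])
      (unfold e, rule tensor_map_finsum[OF c c act_lin(1)[OF X] act_lin(1)[OF Y] _ pq], auto)
qed

lemma act2_tens:
  assumes X: "X \<in> Obj C" and Y: "Y \<in> Obj C" and x: "x \<in> carrier (FO F X)" and y: "y \<in> carrier (FO F Y)"
    and t: "t \<in> carrier HH"
  shows "FT F X Y (act2 F H \<theta> X Y t (tens (FO F X) (FO F Y) x y)) = act_pr X Y x y t"
proof -
  note c = FO_cspace[OF X] FO_cspace[OF Y]
  show ?thesis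
    unfolding act2_def
    by (rule lin_comp_lift[OF H_cspace H_cspace cspace_tensor[OF c] FO_cspace[OF TensO_obj[OF X Y]]
          tensor_map_act_bilinear[OF X Y tens_closed[OF c x y]] FT_lin[OF X Y] act_pr_lin[OF X Y x y] t])
      (simp add: tensor_map(2)[OF c c act_lin(1)[OF X] act_lin(1)[OF Y] x y] act_pr_tens X Y x y pr_def)
qed

lemma act2_lin:
  assumes X: "X \<in> Obj C" and Y: "Y \<in> Obj C" and t: "t \<in> carrier HH"
  shows "act2 F H \<theta> X Y t \<in> lin (FO F X \<otimes>\<^sub>v FO F Y) (FO F X \<otimes>\<^sub>v FO F Y)"
proof -
  note c = FO_cspace[OF X] FO_cspace[OF Y]
  obtain n :: nat and a b where ab: "a \<in> {..<n} \<rightarrow> carrier H" "b \<in> {..<n} \<rightarrow> carrier H"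
    and e: "t = finsum HH (\<lambda>i. tens H H (a i) (b i)) {..<n}"
    by (rule tensor_finsum[OF H_cspace H_cspace t])
  show ?thesis
  proof (rule lin_cong[OF finsum_lin[OF cspace_tensor[OF c] cspace_tensor[OF c]] cspace_tensor[OF c]])
    show "tensor_map (FO F X) (FO F Y) (FO F X) (FO F Y) (ac X (a i)) (ac Y (b i)) \<in>
        lin (FO F X \<otimes>\<^sub>v FO F Y) (FO F X \<otimes>\<^sub>v FO F Y)" if "i \<in> {..<n}" for i
      by (rule tensor_map(1)[OF c c act_lin(1)[OF X] act_lin(1)[OF Y]]) (use ab that in auto)
    show "act2 F H \<theta> X Y t s = finsum (FO F X \<otimes>\<^sub>v FO F Y)
        (\<lambda>i. tensor_map (FO F X) (FO F Y) (FO F X) (FO F Y) (ac X (a i)) (ac Y (b i)) s) {..<n}"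
      if s: "s \<in> carrier (FO F X \<otimes>\<^sub>v FO F Y)" for s
      unfolding act2_def e
      by (rule tensor_lift_finsum[OF H_cspace H_cspace cspace_tensor[OF c] tensor_map_act_bilinear[OF X Y s] _ ab]) simp
  qed simp
qed

text \<open>Product vectors span F(X \<otimes> Y) and f is bijective, so the defining equation may
  be tested on them and freed of the inverse of f. Later work with the coproduct uses this
  form.\<close>

lemma is_coproduct_iff:
  assumes h: "h \<in> carrier H"
  shows "is_coproduct C F H \<theta> h t \<longleftrightarrow> t \<in> carrier HH \<and>
    (\<forall>X\<in>Obj C. \<forall>Y\<in>Obj C. \<forall>x\<in>carrier (FO F X). \<forall>y\<in>carrier (FO F Y).
      act_pr X Y x y t = ac (X \<boxtimes> Y) h (pr X Y x y))" (is "?L \<longleftrightarrow> ?R")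
proof
  assume L: ?L
  then have t: "t \<in> carrier HH" by (simp add: is_coproduct_def)
  show ?R
  proof (intro conjI ballI t)
    fix X Y x y assume o: "X \<in> Obj C" "Y \<in> Obj C" and x: "x \<in> carrier (FO F X)" "y \<in> carrier (FO F Y)"
    have "FTinv F X Y (ac (X \<boxtimes> Y) h (pr X Y x y)) = act2 F H \<theta> X Y t (tens (FO F X) (FO F Y) x y)"
      using L o x by (simp add: is_coproduct_def pr_closed FTinv_pr)
    then have "FT F X Y (FTinv F X Y (ac (X \<boxtimes> Y) h (pr X Y x y))) = act_pr X Y x y t"
      by (simp add: act2_tens o x t)
    then show "act_pr X Y x y t = ac (X \<boxtimes> Y) h (pr X Y x y)"
      by (simp add: FT_FTinv o x pr_closed act_closed h TensO_obj)
  qed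
next
  assume R: ?R
  then have t: "t \<in> carrier HH" by simp
  have "FTinv F X Y (ac (X \<boxtimes> Y) h z) = act2 F H \<theta> X Y t (FTinv F X Y z)"
    if X: "X \<in> Obj C" and Y: "Y \<in> Obj C" and z: "z \<in> carrier (FO F (X \<boxtimes> Y))" for X Y z
  proof (rule pr_unique[OF X Y cspace_tensor[OF FO_cspace[OF X] FO_cspace[OF Y]]
        lin_comp[OF act_lin(1)[OF TensO_obj[OF X Y] h] FTinv_lin[OF X Y]]
        lin_comp[OF FTinv_lin[OF X Y] act2_lin[OF X Y t]] _ z])
    fix x y assume x: "x \<in> carrier (FO F X)" and y: "y \<in> carrier (FO F Y)"
    have "ac (X \<boxtimes> Y) h (pr X Y x y) = FT F X Y (act2 F H \<theta> X Y t (tens (FO F X) (FO F Y) x y))"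
      using R X Y x y by (simp add: act2_tens)
    then show "FTinv F X Y (ac (X \<boxtimes> Y) h (pr X Y x y)) = act2 F H \<theta> X Y t (FTinv F X Y (pr X Y x y))"
      using X Y x y lin_closed[OF act2_lin[OF X Y t] tens_closed[OF FO_cspace[OF X] FO_cspace[OF Y] x y]]
      by (simp add: FTinv_FT FTinv_pr)
  qed
  then show ?L using t by (simp add: is_coproduct_def)
qed

end

section \<open>Existence and uniqueness of the coproduct\<close>

locale reconstructed_bialgebra = representable_vfunctor +
  assumes coproduct_exists: "has_coproduct C F H \<theta>"
begin

abbreviation \<Delta> where "\<Delta> \<equiv> rep_coproduct C F H \<theta>"

abbreviation \<epsilon> where "\<epsilon> \<equiv> rep_counit C F H \<theta>"

lemma coproduct_eqI:
  assumes h: "h \<in> carrier H" and t: "t \<in> carrier HH"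
    and s: "\<And>X Y x y. \<lbrakk>X \<in> Obj C; Y \<in> Obj C; x \<in> carrier (FO F X); y \<in> carrier (FO F Y)\<rbrakk> \<Longrightarrow>
      act_pr X Y x y t = ac (X \<boxtimes> Y) h (pr X Y x y)"
  shows "\<Delta> h = t"
  unfolding rep_coproduct_def
proof (rule the_equality)
  show "is_coproduct C F H \<theta> h t" using s t by (simp add: is_coproduct_iff[OF h])
  show "t' = t" if "is_coproduct C F H \<theta> h t'" for t'
    using that t s by - (rule act_pr_eqI, simp_all add: is_coproduct_iff[OF h])
qed

lemma coproduct:
  assumes h: "h \<in> carrier H"
  shows "\<Delta> h \<in> carrier HH"
    and "\<lbrakk>X \<in> Obj C; Y \<in> Obj C; x \<in> carrier (FO F X); y \<in> carrier (FO F Y)\<rbrakk> \<Longrightarrow>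
      act_pr X Y x y (\<Delta> h) = ac (X \<boxtimes> Y) h (pr X Y x y)"
proof -
  obtain t where t: "is_coproduct C F H \<theta> h t" using coproduct_exists h by (auto simp: has_coproduct_def)
  then have "\<Delta> h = t" by (intro coproduct_eqI[OF h]) (auto simp: is_coproduct_iff[OF h])
  then show "\<Delta> h \<in> carrier HH"
    "\<lbrakk>X \<in> Obj C; Y \<in> Obj C; x \<in> carrier (FO F X); y \<in> carrier (FO F Y)\<rbrakk> \<Longrightarrow>
      act_pr X Y x y (\<Delta> h) = ac (X \<boxtimes> Y) h (pr X Y x y)"
    using t by (auto simp: is_coproduct_iff[OF h])
qed

end

section \<open>Algebra axioms, counit, and separation of triple tensors\<close>

context representable_vfunctor
begin

text \<open>\<open>A\<close> and \<open>H\<close> share carrier, addition and scalar multiplication,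
  and the constructions of linear algebra depend on these only. The rewrite rules from here to
  \<open>vassoc_A\<close> bring the Hopf algebra axioms for \<open>A\<close> to statements about
  \<open>H\<close>.\<close>

lemma lin_A [simp]: "lin A U = lin H U" "lin U A = lin U H"
  by (simp_all add: lin_def)

lemma cspace_A: "cspace A"
proof (rule cspaceI)
  show "abelian_group A"
    using cspaceD(1)[OF H_cspace]
    unfolding abelian_group_def abelian_group_axioms_def abelian_monoid_def by (simp add: rep_algebra_def)
qed (simp_all add: cspaceD(2-6)[OF H_cspace])

lemma tensor_relations_A [simp]:
  "tensor_relations A W = tensor_relations H W" "tensor_relations W A = tensor_relations W H"
  by (simp_all add: tensor_relations_def tensor_generators_def)

lemma tensor_A [simp]: "A \<otimes>\<^sub>v W = H \<otimes>\<^sub>v W" "W \<otimes>\<^sub>v A = W \<otimes>\<^sub>v H"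
  by (simp_all add: tensor_def)

lemma tens_A [simp]: "tens A W = tens H W" "tens W A = tens W H"
  by (simp_all add: tens_def[abs_def])

lemma tensor_lift_A [simp]:
  "tensor_lift A W U = tensor_lift H W U" "tensor_lift W A U = tensor_lift W H U"
  "tensor_lift V W A = tensor_lift V W H"
  by (simp_all add: tensor_lift_def[abs_def])

lemma tensor_map_A [simp]:
  "tensor_map A V W U = tensor_map H V W U" "tensor_map V A W U = tensor_map V H W U"
  "tensor_map V W A U = tensor_map V W H U" "tensor_map V W U A = tensor_map V W U H"
  by (simp_all add: tensor_map_def[abs_def])

lemma vassoc_A [simp]: "vassoc A A A = vassoc H H H"
  by (simp add: vassoc_def)

lemma ring_A: "ring A"
proof (rule ringI)
  show "abelian_group A" by (rule cspaceD(1)[OF cspace_A])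
  show "Group.monoid A"
  proof (rule Group.monoidI)
    show "x \<otimes>\<^bsub>A\<^esub> y \<otimes>\<^bsub>A\<^esub> z = x \<otimes>\<^bsub>A\<^esub> (y \<otimes>\<^bsub>A\<^esub> z)"
      if "x \<in> carrier A" "y \<in> carrier A" "z \<in> carrier A" for x y z
      by (rule act_eqI) (use that in \<open>simp_all add: mult_A act_closed\<close>)
    show "\<one>\<^bsub>A\<^esub> \<otimes>\<^bsub>A\<^esub> x = x" "x \<otimes>\<^bsub>A\<^esub> \<one>\<^bsub>A\<^esub> = x" if "x \<in> carrier A" for x
      by (rule act_eqI; use that in \<open>simp add: mult_A one_A act_closed\<close>)+
  qed (simp_all add: mult_A one_A)
  show "(x \<oplus>\<^bsub>A\<^esub> y) \<otimes>\<^bsub>A\<^esub> z = x \<otimes>\<^bsub>A\<^esub> z \<oplus>\<^bsub>A\<^esub> y \<otimes>\<^bsub>A\<^esub> z"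
    "z \<otimes>\<^bsub>A\<^esub> (x \<oplus>\<^bsub>A\<^esub> y) = z \<otimes>\<^bsub>A\<^esub> x \<oplus>\<^bsub>A\<^esub> z \<otimes>\<^bsub>A\<^esub> y"
    if "x \<in> carrier A" "y \<in> carrier A" "z \<in> carrier A" for x y z
    using that lin_add[OF bilinear_mapsD(1)[OF mult_A_bilinear]] lin_add[OF bilinear_mapsD(2)[OF mult_A_bilinear]]
    by simp_all
qed

lemma smult_mult_A:
  assumes "a \<in> carrier H" "b \<in> carrier H"
  shows "(c \<odot>\<^bsub>H\<^esub> a) \<otimes>\<^bsub>A\<^esub> b = c \<odot>\<^bsub>H\<^esub> (a \<otimes>\<^bsub>A\<^esub> b)" "a \<otimes>\<^bsub>A\<^esub> (c \<odot>\<^bsub>H\<^esub> b) = c \<odot>\<^bsub>H\<^esub> (a \<otimes>\<^bsub>A\<^esub> b)"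
  using assms lin_smult[OF bilinear_mapsD(1)[OF mult_A_bilinear]] lin_smult[OF bilinear_mapsD(2)[OF mult_A_bilinear]]
  by simp_all

lemma rep_counit_scal: "rep_counit C F H \<theta> h = scal (ac (Unit C) h (FU F 1))"
  unfolding rep_counit_def scal_def ..

text \<open>F(1) is a line, so h acts on it by a scalar, and \<open>rep_counit\<close> reads this
  scalar off at \<open>FU F 1\<close>.\<close>

lemma counit_FU:
  assumes h: "h \<in> carrier H"
  shows "ac (Unit C) h (FU F c) = rep_counit C F H \<theta> h \<odot>\<^bsub>FO F (Unit C)\<^esub> FU F c"
proof -
  note U = FO_cspace[OF Unit_obj]
  have "rep_counit C F H \<theta> h \<odot>\<^bsub>FO F (Unit C)\<^esub> FU F 1 = ac (Unit C) h (FU F 1)"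
    using FU_scal[OF act_closed[OF Unit_obj h FU_closed], of 1]
    by (simp add: rep_counit_scal FU_eq[symmetric])
  then show ?thesis
    unfolding FU_eq[of c]
    by (simp add: act_add_smult Unit_obj FU_closed h cspaceD(5)[OF U, symmetric] mult.commute)
      (simp add: cspaceD(5)[OF U] FU_closed)
qed

lemma counit_lin: "rep_counit C F H \<theta> \<in> lin H cunit"
proof -
  have e: "rep_counit C F H \<theta> = (\<lambda>h. scal (ac (Unit C) h (FU F 1)))"
    by (intro ext) (rule rep_counit_scal)
  show ?thesis unfolding e by (rule lin_comp[OF act_lin(2)[OF Unit_obj FU_closed] scal_lin])
qed

lemma counit_eqI:
  assumes h: "h \<in> carrier H" and e: "ac (Unit C) h (FU F 1) = c \<odot>\<^bsub>FO F (Unit C)\<^esub> FU F 1"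
  shows "rep_counit C F H \<theta> h = c"
  using e scal_FU[of c] by (simp add: rep_counit_scal FU_eq[symmetric])

lemma counit_one: "rep_counit C F H \<theta> \<one>\<^bsub>A\<^esub> = 1"
  by (rule counit_eqI) (simp_all add: one_A Unit_obj FU_closed cspaceD(6)[OF FO_cspace])

lemma counit_mult:
  assumes "a \<in> carrier H" "b \<in> carrier H"
  shows "rep_counit C F H \<theta> (a \<otimes>\<^bsub>A\<^esub> b) = rep_counit C F H \<theta> a * rep_counit C F H \<theta> b"
  by (rule counit_eqI)
    (simp_all add: mult_A assms Unit_obj FU_closed counit_FU act_add_smult
      cspaceD(5)[OF FO_cspace, symmetric] mult.commute)

lemma act_RUnit: "X \<in> Obj C \<Longrightarrow> h \<in> carrier H \<Longrightarrow> x \<in> carrier (FO F X) \<Longrightarrow>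
    ac (Unit C \<boxtimes> X) h (pr (Unit C) X (FU F 1) x) = pr (Unit C) X (FU F 1) (ac X h x)"
  using act_nat[OF Iso_Inv(1)[OF RUnit_iso], of X h x] by (simp add: FA_RUnit_pr act_closed)

lemma act_LUnit: "X \<in> Obj C \<Longrightarrow> h \<in> carrier H \<Longrightarrow> x \<in> carrier (FO F X) \<Longrightarrow>
    ac (X \<boxtimes> Unit C) h (pr X (Unit C) x (FU F 1)) = pr X (Unit C) (ac X h x) (FU F 1)"
  using act_nat[OF Iso_Inv(1)[OF LUnit_iso], of X h x] by (simp add: FA_LUnit_pr act_closed)

text \<open>Coassociativity compares elements of a triple tensor product. The left factor is
  separated by the action, and the right factor H \<otimes> H by the maps
  \<open>act_pr\<close>.\<close>

lemma HHH_separates: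
  assumes t: "t \<in> carrier (H \<otimes>\<^sub>v HH)"
    and z: "\<And>X Y Z x y z. \<lbrakk>X \<in> Obj C; Y \<in> Obj C; Z \<in> Obj C; x \<in> carrier (FO F X); y \<in> carrier (FO F Y);
        z \<in> carrier (FO F Z)\<rbrakk> \<Longrightarrow>
      tensor_map H HH (FO F X) (FO F (Y \<boxtimes> Z)) (\<lambda>a. ac X a x) (act_pr Y Z y z) t = \<zero>\<^bsub>FO F X \<otimes>\<^sub>v FO F (Y \<boxtimes> Z)\<^esub>"
  shows "t = \<zero>\<^bsub>H \<otimes>\<^sub>v HH\<^esub>"
proof (rule tensor_jointly_injective_left[OF H_cspace cspace_tensor[OF H_cspace H_cspace] t,
      where J = "{(X, x). X \<in> Obj C \<and> x \<in> carrier (FO F X)}" and U = "\<lambda>j. FO F (fst j)"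
      and g = "\<lambda>j a. ac (fst j) a (snd j)"])
  note HH = cspace_tensor[OF H_cspace H_cspace]
  fix j assume j: "j \<in> {(X, x). X \<in> Obj C \<and> x \<in> carrier (FO F X)}"
  then obtain X x where jX: "j = (X, x)" and X: "X \<in> Obj C" and x: "x \<in> carrier (FO F X)" by auto
  show "cspace (FO F (fst j))" "(\<lambda>a. ac (fst j) a (snd j)) \<in> lin H (FO F (fst j))"
    using jX FO_cspace[OF X] act_lin(2)[OF X x] by auto
  note m = tensor_map[OF H_cspace HH FO_cspace[OF X] HH act_lin(2)[OF X x] lin_id[OF HH]]
  let ?s = "tensor_map H HH (FO F X) HH (\<lambda>a. ac X a x) (\<lambda>x. x) t"
  let ?J = "{(Y, Z, y, z). Y \<in> Obj C \<and> Z \<in> Obj C \<and> y \<in> carrier (FO F Y) \<and> z \<in> carrier (FO F Z)}"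
  have "?s = \<zero>\<^bsub>FO F X \<otimes>\<^sub>v HH\<^esub>"
  proof (rule tensor_jointly_injective_right[OF FO_cspace[OF X] HH lin_closed[OF m(1) t],
      where J = ?J and U = "\<lambda>(Y, Z, y, z). FO F (Y \<boxtimes> Z)" and g = "\<lambda>(Y, Z, y, z). act_pr Y Z y z"])
    fix j assume j: "j \<in> ?J"
    then obtain Y Z y z where jY: "j = (Y, Z, y, z)" and Y: "Y \<in> Obj C" and Z: "Z \<in> Obj C"
      and y: "y \<in> carrier (FO F Y)" and zz: "z \<in> carrier (FO F Z)" by auto
    note YZ = FO_cspace[OF TensO_obj[OF Y Z]] and l = act_pr_lin[OF Y Z y zz]
    show "cspace (case j of (Y, Z, y, z) \<Rightarrow> FO F (Y \<boxtimes> Z))"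
      "(case j of (Y, Z, y, z) \<Rightarrow> act_pr Y Z y z) \<in> lin HH (case j of (Y, Z, y, z) \<Rightarrow> FO F (Y \<boxtimes> Z))"
      using jY YZ l by auto
    have "tensor_map (FO F X) HH (FO F X) (FO F (Y \<boxtimes> Z)) (\<lambda>x. x) (act_pr Y Z y z) ?s =
        tensor_map H HH (FO F X) (FO F (Y \<boxtimes> Z)) (\<lambda>a. ac X a x) (\<lambda>w. act_pr Y Z y z w) t"
      by (rule tensor_map_comp[OF H_cspace FO_cspace[OF X] FO_cspace[OF X] HH HH YZ
            act_lin(2)[OF X x] lin_id[OF FO_cspace[OF X]] lin_id[OF HH] l t])
    also have "\<dots> = \<zero>\<^bsub>FO F X \<otimes>\<^sub>v FO F (Y \<boxtimes> Z)\<^esub>" by (rule z[OF X Y Z x y zz])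
    finally show "tensor_map (FO F X) HH (FO F X) (case j of (Y, Z, y, z) \<Rightarrow> FO F (Y \<boxtimes> Z)) (\<lambda>x. x)
        (case j of (Y, Z, y, z) \<Rightarrow> act_pr Y Z y z) ?s = \<zero>\<^bsub>FO F X \<otimes>\<^sub>v (case j of (Y, Z, y, z) \<Rightarrow> FO F (Y \<boxtimes> Z))\<^esub>"
      using jY by simp
  next
    fix w assume w: "w \<in> carrier HH"
      and 0: "\<And>j. j \<in> ?J \<Longrightarrow> (case j of (Y, Z, y, z) \<Rightarrow> act_pr Y Z y z) w = \<zero>\<^bsub>case j of (Y, Z, y, z) \<Rightarrow> FO F (Y \<boxtimes> Z)\<^esub>"
    show "w = \<zero>\<^bsub>HH\<^esub>"
      by (rule act_pr_separates[OF w]) (use 0[of "(Y, Z, y, z)" for Y Z y z] in simp)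
  qed
  then show "tensor_map H HH (FO F (fst j)) HH (\<lambda>a. ac (fst j) a (snd j)) (\<lambda>x. x) t = \<zero>\<^bsub>FO F (fst j) \<otimes>\<^sub>v HH\<^esub>"
    using jX by simp
next
  fix w assume w: "w \<in> carrier H"
    and "\<And>j. j \<in> {(X, x). X \<in> Obj C \<and> x \<in> carrier (FO F X)} \<Longrightarrow> ac (fst j) w (snd j) = \<zero>\<^bsub>FO F (fst j)\<^esub>"
  from this(2)[of "(X, x)" for X x] show "w = \<zero>\<^bsub>H\<^esub>"
    by (intro act_H_separates[OF w]) simp
qed

lemma HHH_eqI:
  assumes t: "t \<in> carrier (H \<otimes>\<^sub>v HH)" and t': "t' \<in> carrier (H \<otimes>\<^sub>v HH)"
    and eq: "\<And>X Y Z x y z. \<lbrakk>X \<in> Obj C; Y \<in> Obj C; Z \<in> Obj C; x \<in> carrier (FO F X); y \<in> carrier (FO F Y);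
        z \<in> carrier (FO F Z)\<rbrakk> \<Longrightarrow>
      FT F X (Y \<boxtimes> Z) (tensor_map H HH (FO F X) (FO F (Y \<boxtimes> Z)) (\<lambda>a. ac X a x) (act_pr Y Z y z) t) =
      FT F X (Y \<boxtimes> Z) (tensor_map H HH (FO F X) (FO F (Y \<boxtimes> Z)) (\<lambda>a. ac X a x) (act_pr Y Z y z) t')"
  shows "t = t'"
proof -
  note HH = cspace_tensor[OF H_cspace H_cspace]
  let ?J = "{(X, Y, Z, x, y, z). X \<in> Obj C \<and> Y \<in> Obj C \<and> Z \<in> Obj C \<and> x \<in> carrier (FO F X) \<and>
    y \<in> carrier (FO F Y) \<and> z \<in> carrier (FO F Z)}"
  let ?g = "\<lambda>(X, Y, Z, x, y, z). tensor_map H HH (FO F X) (FO F (Y \<boxtimes> Z)) (\<lambda>a. ac X a x) (act_pr Y Z y z)"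
  let ?U = "\<lambda>(X, Y, Z, x, y, z). FO F X \<otimes>\<^sub>v FO F (Y \<boxtimes> Z)"
  note m = tensor_map(1)[OF H_cspace HH FO_cspace FO_cspace[OF TensO_obj] act_lin(2) act_pr_lin]
  show ?thesis
  proof (rule jointly_injective_eqI[OF cspace_tensor[OF H_cspace HH] t t', where J = ?J and U = ?U and g = ?g])
    fix j assume j: "j \<in> ?J"
    then obtain X Y Z x y z where e: "j = (X, Y, Z, x, y, z)" and o: "X \<in> Obj C" "Y \<in> Obj C" "Z \<in> Obj C"
      and x: "x \<in> carrier (FO F X)" "y \<in> carrier (FO F Y)" "z \<in> carrier (FO F Z)" by auto
    note mm = m[OF o(1) o(2,3) o(1) x(1) o(2,3) x(2,3)]
    show "cspace (?U j)" using e o by (simp add: cspace_tensor FO_cspace TensO_obj)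
    show "?g j \<in> lin (H \<otimes>\<^sub>v HH) (?U j)" using e mm by simp
    have "?g (X, Y, Z, x, y, z) t = ?g (X, Y, Z, x, y, z) t'"
      using arg_cong[OF eq[OF o x], of "FTinv F X (Y \<boxtimes> Z)"]
      unfolding FTinv_FT[OF o(1) TensO_obj[OF o(2,3)] lin_closed[OF mm t]]
        FTinv_FT[OF o(1) TensO_obj[OF o(2,3)] lin_closed[OF mm t']] prod.case .
    then show "?g j t = ?g j t'" unfolding e .
  next
    fix v assume v: "v \<in> carrier (H \<otimes>\<^sub>v HH)" and 0: "\<And>j. j \<in> ?J \<Longrightarrow> ?g j v = \<zero>\<^bsub>?U j\<^esub>"
    show "v = \<zero>\<^bsub>H \<otimes>\<^sub>v HH\<^esub>"
      by (rule HHH_separates[OF v]) (use 0[of "(X, Y, Z, x, y, z)" for X Y Z x y z] in simp)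
  qed
qed

end

section \<open>Coalgebra axioms and multiplicativity of the coproduct\<close>

context reconstructed_bialgebra
begin

lemma coproduct_lin: "\<Delta> \<in> lin H HH"
proof (rule linI)
  note HH = cspace_tensor[OF H_cspace H_cspace]
  fix x assume x: "x \<in> carrier H"
  show "\<Delta> x \<in> carrier HH" by (rule coproduct(1)[OF x])
  show "\<Delta> (x \<oplus>\<^bsub>H\<^esub> y) = \<Delta> x \<oplus>\<^bsub>HH\<^esub> \<Delta> y" if y: "y \<in> carrier H" for y
    by (rule coproduct_eqI)
      (simp_all add: x y cspace_add[OF H_cspace] cspace_add[OF HH] coproduct lin_add[OF act_pr_lin]
        act_add_smult pr_closed TensO_obj)
  show "\<Delta> (c \<odot>\<^bsub>H\<^esub> x) = c \<odot>\<^bsub>HH\<^esub> \<Delta> x" for c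
    by (rule coproduct_eqI)
      (simp_all add: x cspaceD(2)[OF H_cspace] cspaceD(2)[OF HH] coproduct lin_smult[OF act_pr_lin]
        act_add_smult pr_closed TensO_obj)
qed

lemma coproduct_one: "\<Delta> \<one>\<^bsub>A\<^esub> = tens H H \<one>\<^bsub>A\<^esub> \<one>\<^bsub>A\<^esub>"
  by (rule coproduct_eqI) (simp_all add: one_A tens_closed H_cspace act_pr_tens pr_closed TensO_obj)

text \<open>The coproduct is evaluated on F(1 \<otimes> X): its first leg acts on F(1) by the
  counit, and naturality along \<open>RUnit\<close> turns the action on 1 \<otimes> X into the
  action on X.\<close>

lemma counit_left:
  assumes h: "h \<in> carrier H"
  shows "tensor_lift H H H (\<lambda>a b. \<epsilon> a \<odot>\<^bsub>H\<^esub> b) (\<Delta> h) = h"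
proof -
  note L = tensor_lift[OF H_cspace H_cspace H_cspace smult_bilinear(2)[OF H_cspace H_cspace counit_lin]]
  note D = coproduct(1)[OF h]
  show ?thesis
  proof (rule act_eqI[OF lin_closed[OF L(1) D] h], rule pr_unit_cancel(2))
    fix X x assume X: "X \<in> Obj C" and x: "x \<in> carrier (FO F X)"
    note UX = FO_cspace[OF TensO_obj[OF Unit_obj X]]
    show "pr (Unit C) X (FU F 1) (ac X (tensor_lift H H H (\<lambda>a b. \<epsilon> a \<odot>\<^bsub>H\<^esub> b) (\<Delta> h)) x) =
        pr (Unit C) X (FU F 1) (ac X h x)"
    proof -
      have "pr (Unit C) X (FU F 1) (ac X (tensor_lift H H H (\<lambda>a b. \<epsilon> a \<odot>\<^bsub>H\<^esub> b) (\<Delta> h)) x) =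
          act_pr (Unit C) X (FU F 1) x (\<Delta> h)"
        by (rule lin_comp_lift[OF H_cspace H_cspace H_cspace UX smult_bilinear(2)[OF H_cspace H_cspace counit_lin]
              lin_comp[OF act_lin(2)[OF X x] pr_lin(1)[OF Unit_obj X FU_closed]] act_pr_lin[OF Unit_obj X FU_closed x] D])
          (simp add: act_pr_tens Unit_obj X FU_closed x act_add_smult counit_FU pr_smult act_closed)
      then show ?thesis by (simp add: coproduct h Unit_obj X x FU_closed act_RUnit)
    qed
  qed (use lin_closed[OF L(1) D] h in \<open>simp_all add: act_closed\<close>)
qed

lemma counit_right:
  assumes h: "h \<in> carrier H"
  shows "tensor_lift H H H (\<lambda>a b. \<epsilon> b \<odot>\<^bsub>H\<^esub> a) (\<Delta> h) = h"
proof -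
  note L = tensor_lift[OF H_cspace H_cspace H_cspace smult_bilinear(1)[OF H_cspace H_cspace counit_lin]]
  note D = coproduct(1)[OF h]
  show ?thesis
  proof (rule act_eqI[OF lin_closed[OF L(1) D] h], rule pr_unit_cancel(1))
    fix X x assume X: "X \<in> Obj C" and x: "x \<in> carrier (FO F X)"
    note UX = FO_cspace[OF TensO_obj[OF X Unit_obj]]
    show "pr X (Unit C) (ac X (tensor_lift H H H (\<lambda>a b. \<epsilon> b \<odot>\<^bsub>H\<^esub> a) (\<Delta> h)) x) (FU F 1) =
        pr X (Unit C) (ac X h x) (FU F 1)"
    proof -
      have "pr X (Unit C) (ac X (tensor_lift H H H (\<lambda>a b. \<epsilon> b \<odot>\<^bsub>H\<^esub> a) (\<Delta> h)) x) (FU F 1) =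
          act_pr X (Unit C) x (FU F 1) (\<Delta> h)"
        by (rule lin_comp_lift[OF H_cspace H_cspace H_cspace UX smult_bilinear(1)[OF H_cspace H_cspace counit_lin]
              lin_comp[OF act_lin(2)[OF X x] pr_lin(2)[OF X Unit_obj FU_closed]] act_pr_lin[OF X Unit_obj x FU_closed] D])
          (simp add: act_pr_tens Unit_obj X FU_closed x act_add_smult counit_FU pr_smult act_closed)
      then show ?thesis by (simp add: coproduct h Unit_obj X x FU_closed act_LUnit)
    qed
  qed (use lin_closed[OF L(1) D] h in \<open>simp_all add: act_closed\<close>)
qed

text \<open>Tested on x, y and z, both sides give the action of h on F(X \<otimes> (Y \<otimes> Z)).
  The left-hand side arises on (X \<otimes> Y) \<otimes> Z and is moved across by naturality of the
  action along the associator.\<close>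

lemma coassociative:
  assumes h: "h \<in> carrier H"
  shows "vassoc H H H (tensor_map H H HH H \<Delta> (\<lambda>x. x) (\<Delta> h)) = tensor_map H H H HH (\<lambda>x. x) \<Delta> (\<Delta> h)"
proof -
  note HH = cspace_tensor[OF H_cspace H_cspace] and D = coproduct(1)[OF h]
  note l = tensor_map[OF H_cspace H_cspace HH H_cspace coproduct_lin lin_id[OF H_cspace]]
    and r = tensor_map[OF H_cspace H_cspace H_cspace HH lin_id[OF H_cspace] coproduct_lin]
    and as = vassoc[OF H_cspace H_cspace H_cspace]
  show ?thesis
  proof (rule HHH_eqI)
    show "vassoc H H H (tensor_map H H HH H \<Delta> (\<lambda>x. x) (\<Delta> h)) \<in> carrier (H \<otimes>\<^sub>v HH)"
      by (rule lin_closed[OF as(1) lin_closed[OF l(1) D]])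
    show "tensor_map H H H HH (\<lambda>x. x) \<Delta> (\<Delta> h) \<in> carrier (H \<otimes>\<^sub>v HH)" by (rule lin_closed[OF r(1) D])
    fix X Y Z x y z assume o: "X \<in> Obj C" "Y \<in> Obj C" "Z \<in> Obj C"
      and x: "x \<in> carrier (FO F X)" "y \<in> carrier (FO F Y)" "z \<in> carrier (FO F Z)"
    note YZ = TensO_obj[OF o(2,3)] and XY = TensO_obj[OF o(1,2)]
    note XYZ = FO_cspace[OF TensO_obj[OF o(1) YZ]] and XYZ' = FO_cspace[OF TensO_obj[OF XY o(3)]]
    note yz = pr_closed[OF o(2,3) x(2,3)] and xy = pr_closed[OF o(1,2) x(1,2)]
    note m = tensor_map[OF H_cspace HH FO_cspace[OF o(1)] FO_cspace[OF YZ] act_lin(2)[OF o(1) x(1)] act_pr_lin[OF o(2,3) x(2,3)]]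
    define \<Psi> where "\<Psi> t = FT F X (Y \<boxtimes> Z) (tensor_map H HH (FO F X) (FO F (Y \<boxtimes> Z)) (\<lambda>a. ac X a x) (act_pr Y Z y z) t)" for t
    have \<Psi>: "\<Psi> \<in> lin (H \<otimes>\<^sub>v HH) (FO F (X \<boxtimes> (Y \<boxtimes> Z)))"
      unfolding \<Psi>_def[abs_def] by (rule lin_comp[OF m(1) FT_lin[OF o(1) YZ]])
    have \<Psi>t: "\<Psi> (tens H HH a t) = pr X (Y \<boxtimes> Z) (ac X a x) (act_pr Y Z y z t)"
      if "a \<in> carrier H" "t \<in> carrier HH" for a t
      unfolding \<Psi>_def pr_def using m(2)[OF that] by simp
    have R: "\<Psi> (tensor_map H H H HH (\<lambda>x. x) \<Delta> (\<Delta> h)) = ac (X \<boxtimes> (Y \<boxtimes> Z)) h (pr X (Y \<boxtimes> Z) x (pr Y Z y z))"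
    proof -
      have "\<Psi> (tensor_map H H H HH (\<lambda>x. x) \<Delta> (\<Delta> h)) = act_pr X (Y \<boxtimes> Z) x (pr Y Z y z) (\<Delta> h)"
        by (rule tensor_unique[OF H_cspace H_cspace XYZ lin_comp[OF r(1) \<Psi>] act_pr_lin[OF o(1) YZ x(1) yz] _ D])
          (simp add: r \<Psi>t coproduct o x YZ yz act_pr_tens)
      then show ?thesis by (simp add: coproduct h o x YZ yz)
    qed
    note as_lin = FA_lin[OF Iso_Inv(1)[OF Assoc_iso[OF o]]]
    \<comment> \<open>The inner element t of H \<otimes> H is arbitrary here because it will be the
      coproduct of a leg of \<Delta> h.\<close>
    have 1: "\<Psi> (vassoc H H H (tens HH H t b)) = FA F (Assoc C X Y Z) (pr (X \<boxtimes> Y) Z (act_pr X Y x y t) (ac Z b z))"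
      if t: "t \<in> carrier HH" and b: "b \<in> carrier H" for t b
      by (rule tensor_unique[OF H_cspace H_cspace XYZ lin_comp[OF bilinear_mapsD(2)[OF tens_bilinear_maps[OF HH H_cspace] b] lin_comp[OF as(1) \<Psi>]]
          lin_comp[OF act_pr_lin[OF o(1,2) x(1,2)] lin_comp[OF pr_lin(2)[OF XY o(3) act_closed[OF o(3) b x(3)]] as_lin]] _ t])
        (simp add: as b \<Psi>t tens_closed H_cspace act_pr_tens o x FA_Assoc_pr act_closed)
    have "\<Psi> (vassoc H H H (tensor_map H H HH H \<Delta> (\<lambda>x. x) (\<Delta> h))) =
        FA F (Assoc C X Y Z) (act_pr (X \<boxtimes> Y) Z (pr X Y x y) z (\<Delta> h))"
      by (rule tensor_unique[OF H_cspace H_cspace XYZ lin_comp[OF l(1) lin_comp[OF as(1) \<Psi>]]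
            lin_comp[OF act_pr_lin[OF XY o(3) xy x(3)] as_lin] _ D])
        (simp add: l 1 coproduct o x XY xy act_pr_tens)
    also have "\<dots> = ac (X \<boxtimes> (Y \<boxtimes> Z)) h (pr X (Y \<boxtimes> Z) x (pr Y Z y z))"
      using act_nat[OF Iso_Inv(1)[OF Assoc_iso[OF o]] h pr_closed[OF XY o(3) xy x(3)]]
      by (simp add: coproduct h o x XY xy FA_Assoc_pr)
    finally show "FT F X (Y \<boxtimes> Z) (tensor_map H HH (FO F X) (FO F (Y \<boxtimes> Z)) (\<lambda>a. ac X a x) (act_pr Y Z y z)
          (vassoc H H H (tensor_map H H HH H \<Delta> (\<lambda>x. x) (\<Delta> h)))) =
        FT F X (Y \<boxtimes> Z) (tensor_map H HH (FO F X) (FO F (Y \<boxtimes> Z)) (\<lambda>a. ac X a x) (act_pr Y Z y z)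
          (tensor_map H H H HH (\<lambda>x. x) \<Delta> (\<Delta> h)))"
      using R by (simp add: \<Psi>_def)
  qed
qed

text \<open>Writing \<Delta> b as a finite sum makes b applied to a product vector a finite sum of
  product vectors, and on each of these a acts through \<Delta> a.\<close>

lemma coproduct_mult:
  assumes a: "a \<in> carrier H" and b: "b \<in> carrier H"
  shows "\<Delta> (a \<otimes>\<^bsub>A\<^esub> b) = tensor_mult A (\<Delta> a) (\<Delta> b)"
proof -
  note HH = cspace_tensor[OF H_cspace H_cspace]
  obtain n :: nat and c d where c: "c \<in> {..<n} \<rightarrow> carrier H" and d: "d \<in> {..<n} \<rightarrow> carrier H"
    and e: "\<Delta> b = finsum HH (\<lambda>i. tens H H (c i) (d i)) {..<n}"
    by (rule tensor_finsum[OF H_cspace H_cspace coproduct(1)[OF b]])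
  let ?M = "\<lambda>a' b'. tensor_lift H H HH (\<lambda>c d. tens H H (a' \<otimes>\<^bsub>A\<^esub> c) (b' \<otimes>\<^bsub>A\<^esub> d)) (\<Delta> b)"
  note ml = bilinear_mapsD[OF mult_A_bilinear]
  have M: "?M a' b' = finsum HH (\<lambda>i. tens H H (a' \<otimes>\<^bsub>A\<^esub> c i) (b' \<otimes>\<^bsub>A\<^esub> d i)) {..<n}"
    if "a' \<in> carrier H" "b' \<in> carrier H" for a' b'
    unfolding e
    by (rule tensor_lift_finsum[OF H_cspace H_cspace HH bilinear_comp[OF tens_bilinear_maps[OF H_cspace H_cspace]
            ml(1)[OF that(1)] ml(1)[OF that(2)] lin_id[OF HH]] _ c d]) simp
  have "(\<lambda>a' b'. finsum HH (\<lambda>i. tens H H (a' \<otimes>\<^bsub>A\<^esub> c i) (b' \<otimes>\<^bsub>A\<^esub> d i)) {..<n}) \<in> bilinear_maps H H HH"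
    by (rule finsum_bilinear[OF H_cspace H_cspace HH])
      (use c d in \<open>auto intro!: bilinear_comp[OF tens_bilinear_maps[OF H_cspace H_cspace] _ _ lin_id[OF HH]] ml(2) simp: Pi_iff\<close>)
  then have Mb: "?M \<in> bilinear_maps H H HH" by (rule bilinear_cong[OF _ H_cspace H_cspace M])
  note L = tensor_lift[OF H_cspace H_cspace HH Mb]
  have tm: "tensor_mult A s (\<Delta> b) = tensor_lift H H HH ?M s" for s by (simp add: tensor_mult_def)
  show ?thesis
  proof (rule coproduct_eqI)
    show "a \<otimes>\<^bsub>A\<^esub> b \<in> carrier H" by (rule mult_A(1)[OF a b])
    show "tensor_mult A (\<Delta> a) (\<Delta> b) \<in> carrier HH"
      unfolding tm by (rule lin_closed[OF L(1) coproduct(1)[OF a]])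
    fix X Y x y assume X: "X \<in> Obj C" and Y: "Y \<in> Obj C" and x: "x \<in> carrier (FO F X)" and y: "y \<in> carrier (FO F Y)"
    note XY = TensO_obj[OF X Y] and o = X Y
    have cx: "ac X (c i) x \<in> carrier (FO F X)" and dy: "ac Y (d i) y \<in> carrier (FO F Y)"
      and cH: "c i \<in> carrier H" and dH: "d i \<in> carrier H" if "i < n" for i
      using c d that X Y x y by (auto intro!: act_closed)
    have "act_pr X Y x y (tensor_mult A (\<Delta> a) (\<Delta> b)) =
        finsum (FO F (X \<boxtimes> Y)) (\<lambda>i. act_pr X Y (ac X (c i) x) (ac Y (d i) y) (\<Delta> a)) {..<n}"
      unfolding tm
    proof (rule lin_comp_lift[OF H_cspace H_cspace HH FO_cspace[OF XY] Mb act_pr_lin[OF X Y x y] _ coproduct(1)[OF a]])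
      show "(\<lambda>t. finsum (FO F (X \<boxtimes> Y)) (\<lambda>i. act_pr X Y (ac X (c i) x) (ac Y (d i) y) t) {..<n}) \<in> lin HH (FO F (X \<boxtimes> Y))"
        by (rule finsum_lin[OF HH FO_cspace[OF XY]]) (auto intro!: act_pr_lin X Y cx dy)
      fix v w assume v: "v \<in> carrier H" and w: "w \<in> carrier H"
      have "act_pr X Y x y (?M v w) = finsum (FO F (X \<boxtimes> Y))
          (\<lambda>i. pr X Y (ac X (v \<otimes>\<^bsub>A\<^esub> c i) x) (ac Y (w \<otimes>\<^bsub>A\<^esub> d i) y)) {..<n}"
        unfolding M[OF v w] by (rule act_pr_finsum[OF X Y x y]) (use v w cH dH in \<open>auto simp: mult_A\<close>)
      also have "\<dots> = finsum (FO F (X \<boxtimes> Y)) (\<lambda>i. act_pr X Y (ac X (c i) x) (ac Y (d i) y) (tens H H v w)) {..<n}"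
        by (rule finsum_cong_on[OF FO_cspace[OF XY]])
          (use v w cx dy cH dH x y in \<open>auto simp: act_pr_tens X Y mult_A intro!: pr_closed act_closed[OF _ v] act_closed[OF _ w]\<close>)
      finally show "act_pr X Y x y (?M v w) = \<dots>" .
    qed
    also have "\<dots> = finsum (FO F (X \<boxtimes> Y)) (\<lambda>i. ac (X \<boxtimes> Y) a (pr X Y (ac X (c i) x) (ac Y (d i) y))) {..<n}"
      by (rule finsum_cong_on[OF FO_cspace[OF XY]])
        (use cx dy in \<open>auto simp: coproduct a X Y intro!: act_closed[OF XY a] pr_closed\<close>)
    also have "\<dots> = ac (X \<boxtimes> Y) a (finsum (FO F (X \<boxtimes> Y)) (\<lambda>i. pr X Y (ac X (c i) x) (ac Y (d i) y)) {..<n})"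
      by (rule act_finsum(1)[OF XY _ a, symmetric]) (use cx dy in \<open>auto intro!: pr_closed X Y\<close>)
    also have "\<dots> = ac (X \<boxtimes> Y) a (act_pr X Y x y (\<Delta> b))"
      unfolding e by (subst act_pr_finsum[OF X Y x y _ c d]) auto
    also have "\<dots> = ac (X \<boxtimes> Y) (a \<otimes>\<^bsub>A\<^esub> b) (pr X Y x y)"
      by (simp add: coproduct a b X Y x y mult_A XY pr_closed)
    finally show "act_pr X Y x y (tensor_mult A (\<Delta> a) (\<Delta> b)) = ac (X \<boxtimes> Y) (a \<otimes>\<^bsub>A\<^esub> b) (pr X Y x y)" .
  qed
qed

end

section \<open>Duals and the antipode\<close>

context monoidal_vfunctor
begin

lemma FA_Comp3:
  assumes "u \<in> Hom C X Y" "v \<in> Hom C Y Z" "w \<in> Hom C Z W" "x \<in> carrier (FO F X)"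
  shows "FA F (w \<cdot> v \<cdot> u) x = FA F w (FA F v (FA F u x))"
  using FA_Comp[OF assms(1) Comp_hom[OF assms(2,3)] assms(4)]
    FA_Comp[OF assms(2,3) FA_closed[OF assms(1,4)]] by simp

lemma FA_Comp4:
  assumes "t \<in> Hom C X' X" "u \<in> Hom C X Y" "v \<in> Hom C Y Z" "w \<in> Hom C Z W" "x \<in> carrier (FO F X')"
  shows "FA F (w \<cdot> v \<cdot> u \<cdot> t) x = FA F w (FA F v (FA F u (FA F t x)))"
  using FA_Comp[OF assms(1) Comp_hom[OF assms(2) Comp_hom[OF assms(3,4)]] assms(5)]
    FA_Comp3[OF assms(2-4) FA_closed[OF assms(1,5)]] by simp

lemma pr_FU:
  assumes "X \<in> Obj C" "x \<in> carrier (FO F X)"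
  shows "pr X (Unit C) x (FU F c) = pr X (Unit C) (c \<odot>\<^bsub>FO F X\<^esub> x) (FU F 1)"
    and "pr (Unit C) X (FU F c) x = pr (Unit C) X (FU F 1) (c \<odot>\<^bsub>FO F X\<^esub> x)"
  unfolding FU_eq[of c] using assms by (simp_all add: pr_smult Unit_obj FU_closed)

lemma FA_m_FU: "m \<in> Hom C X (Unit C) \<Longrightarrow> x \<in> carrier (FO F X) \<Longrightarrow> FA F m x = FU F (scal (FA F m x))"
  using FU_scal[OF FA_closed] by simp

lemma scal_smult: "v \<in> carrier (FO F (Unit C)) \<Longrightarrow> scal (c \<odot>\<^bsub>FO F (Unit C)\<^esub> v) = c * scal v"
  using lin_smult[OF scal_lin] by simp

end

section \<open>Dual pairings obtained from the evaluations\<close>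

locale vfunctor_with_duals = monoidal_vfunctor C F + left_duals C D
  for C :: "('o, 'm, 'z) monoidal_scheme" (structure) and F :: "('o, 'm, 'v) vfunctor"
    and D :: "('o, 'm) duals"
begin

definition ev :: "'o \<Rightarrow> 'v \<Rightarrow> 'v \<Rightarrow> complex" where
  "ev X \<phi> x = scal (FA F (EvL D X) (pr (DualO D X) X \<phi> x))"

definition coev :: "'o \<Rightarrow> 'v" where
  "coev X = FA F (CoevL D X) (FU F 1)"

text \<open>The families are not claimed to be independent; what makes them dual are the expansions
  \<open>dual_bases_left\<close> and \<open>dual_bases_right\<close>. The coevaluation is recorded
  in both forms, the second one for the composite that defines the antipode.\<close>

definition dual_bases :: "'o \<Rightarrow> nat \<Rightarrow> (nat \<Rightarrow> 'v) \<Rightarrow> (nat \<Rightarrow> 'v) \<Rightarrow> bool" where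
  "dual_bases X n p q \<longleftrightarrow> (\<forall>i<n. p i \<in> carrier (FO F X) \<and> q i \<in> carrier (FO F (DualO D X))) \<and>
    coev X = finsum (FO F (X \<boxtimes> DualO D X)) (\<lambda>i. pr X (DualO D X) (p i) (q i)) {..<n} \<and>
    FTinv F X (DualO D X) (coev X) =
      finsum (FO F X \<otimes>\<^sub>v FO F (DualO D X)) (\<lambda>i. tens (FO F X) (FO F (DualO D X)) (p i) (q i)) {..<n}"

lemma coev_closed: "X \<in> Obj C \<Longrightarrow> coev X \<in> carrier (FO F (X \<boxtimes> DualO D X))"
  unfolding coev_def by (rule FA_closed[OF CoevL_hom FU_closed])

lemma dual_bases_exist:
  assumes X: "X \<in> Obj C" obtains n p q where "dual_bases X n p q"
proof -
  obtain n :: nat and p q where "p \<in> {..<n} \<rightarrow> carrier (FO F X)" "q \<in> {..<n} \<rightarrow> carrier (FO F (DualO D X))"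
    "coev X = finsum (FO F (X \<boxtimes> DualO D X)) (\<lambda>i. pr X (DualO D X) (p i) (q i)) {..<n}"
    "FTinv F X (DualO D X) (coev X) =
      finsum (FO F X \<otimes>\<^sub>v FO F (DualO D X)) (\<lambda>i. tens (FO F X) (FO F (DualO D X)) (p i) (q i)) {..<n}"
    by (rule pr_decompose[OF X DualO_obj[OF X] coev_closed[OF X]])
  then have "dual_bases X n p q" by (auto simp: dual_bases_def)
  then show thesis by (rule that)
qed

lemma ev_bilinear:
  assumes X: "X \<in> Obj C"
  shows "ev X \<in> bilinear_maps (FO F (DualO D X)) (FO F X) cunit"
  unfolding ev_def[abs_def]
  by (rule bilinear_comp[OF pr_bilinear[OF DualO_obj[OF X] X] lin_id lin_id lin_comp[OF FA_lin[OF EvL_hom[OF X]] scal_lin]])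
    (simp_all add: FO_cspace DualO_obj X)

lemmas ev_lin = bilinear_mapsD[OF ev_bilinear]

lemma ev_smult:
  assumes "X \<in> Obj C" "\<phi> \<in> carrier (FO F (DualO D X))" "x \<in> carrier (FO F X)"
  shows "ev X (c \<odot>\<^bsub>FO F (DualO D X)\<^esub> \<phi>) x = c * ev X \<phi> x" "ev X \<phi> (c \<odot>\<^bsub>FO F X\<^esub> x) = c * ev X \<phi> x"
  using lin_smult[OF ev_lin(1)[OF assms(1,2)] assms(3)] lin_smult[OF ev_lin(2)[OF assms(1,3)] assms(2)]
  by simp_all

lemma FA_EvL:
  assumes "X \<in> Obj C" "\<phi> \<in> carrier (FO F (DualO D X))" "x \<in> carrier (FO F X)"
  shows "FA F (EvL D X) (pr (DualO D X) X \<phi> x) = FU F (ev X \<phi> x)"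
  unfolding ev_def
  by (rule FA_m_FU[OF EvL_hom]) (use assms in \<open>auto intro: pr_closed DualO_obj\<close>)

context
  fixes X n p q
  assumes X: "X \<in> Obj C" and db: "dual_bases X n p q"
begin

lemma dual_bases_closed:
  "i < n \<Longrightarrow> p i \<in> carrier (FO F X)" "i < n \<Longrightarrow> q i \<in> carrier (FO F (DualO D X))"
  using db by (auto simp: dual_bases_def)

text \<open>The first zigzag identity evaluated at x: coevaluation inserts the sum of p i \<otimes>
  q i in front of x, the associator regroups, and evaluation contracts q i with x.\<close>

lemma dual_bases_left:
  assumes x: "x \<in> carrier (FO F X)"
  shows "finsum (FO F X) (\<lambda>i. ev X (q i) x \<odot>\<^bsub>FO F X\<^esub> p i) {..<n} = x"
proof (rule pr_unit_cancel(1)[OF X])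
  let ?X' = "DualO D X"
  note X' = DualO_obj[OF X] and cl = dual_bases_closed
  note XX' = TensO_obj[OF X X'] and X'X = TensO_obj[OF X' X]
  note Vc = cspaceD(2)[OF FO_cspace[OF X]]
  have c: "coev X = finsum (FO F (X \<boxtimes> ?X')) (\<lambda>i. pr X ?X' (p i) (q i)) {..<n}"
    using db by (simp add: dual_bases_def)
  show "finsum (FO F X) (\<lambda>i. ev X (q i) x \<odot>\<^bsub>FO F X\<^esub> p i) {..<n} \<in> carrier (FO F X)"
    by (rule finsum_in[OF FO_cspace[OF X]]) (use cl Vc in auto)
  show "x \<in> carrier (FO F X)" by fact
  have "pr X (Unit C) x (FU F 1) = FA F (LUnit C X) x" by (simp add: FA_LUnit_pr X x)
  also have "\<dots> = FA F (Id C X \<boxdot> EvL D X) (FA F (Assoc C X ?X' X)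
      (FA F (CoevL D X \<boxdot> Id C X) (FA F (RUnit C X) x)))"
    unfolding zigzag[OF X, symmetric]
    by (rule FA_Comp4[OF Iso_Inv(1)[OF RUnit_iso[OF X]] TensA_hom[OF CoevL_hom[OF X] Id_hom[OF X]]
          Iso_Inv(1)[OF Assoc_iso[OF X X' X]] TensA_hom[OF Id_hom[OF X] EvL_hom[OF X]] x])
  also have "FA F (CoevL D X \<boxdot> Id C X) (FA F (RUnit C X) x) = pr (X \<boxtimes> ?X') X (coev X) x"
    using FA_pr[OF CoevL_hom[OF X] Id_hom[OF X] FU_closed x] by (simp add: FA_RUnit_pr FA_Id X x coev_def)
  also have "\<dots> = finsum (FO F ((X \<boxtimes> ?X') \<boxtimes> X)) (\<lambda>i. pr (X \<boxtimes> ?X') X (pr X ?X' (p i) (q i)) x) {..<n}"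
    unfolding c by (rule pr_finsum(2)[OF XX' X _ x]) (use cl in \<open>auto intro!: pr_closed X X'\<close>)
  also have "FA F (Assoc C X ?X' X) \<dots> = finsum (FO F (X \<boxtimes> (?X' \<boxtimes> X)))
      (\<lambda>i. FA F (Assoc C X ?X' X) (pr (X \<boxtimes> ?X') X (pr X ?X' (p i) (q i)) x)) {..<n}"
    by (rule FA_finsum[OF Iso_Inv(1)[OF Assoc_iso[OF X X' X]]]) (use cl x in \<open>auto intro!: pr_closed X X' XX'\<close>)
  also have "FA F (Id C X \<boxdot> EvL D X) \<dots> = finsum (FO F (X \<boxtimes> Unit C))
      (\<lambda>i. FA F (Id C X \<boxdot> EvL D X) (FA F (Assoc C X ?X' X) (pr (X \<boxtimes> ?X') X (pr X ?X' (p i) (q i)) x))) {..<n}"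
    by (rule FA_finsum[OF TensA_hom[OF Id_hom[OF X] EvL_hom[OF X]]])
      (use cl x in \<open>auto simp: FA_Assoc_pr X X' intro!: pr_closed X X' X'X\<close>)
  also have "\<dots> = finsum (FO F (X \<boxtimes> Unit C)) (\<lambda>i. pr X (Unit C) (ev X (q i) x \<odot>\<^bsub>FO F X\<^esub> p i) (FU F 1)) {..<n}"
    by (rule finsum_cong_on[OF FO_cspace[OF TensO_obj[OF X Unit_obj]]])
      (use cl x Vc in \<open>auto simp: FA_Assoc_pr X X' FA_pr[OF Id_hom[OF X] EvL_hom[OF X]] pr_closed FA_Id FA_EvL
        pr_FU(1)[of _ _ "ev X _ x"] intro!: pr_closed X Unit_obj FU_closed\<close>)
  also have "\<dots> = pr X (Unit C) (finsum (FO F X) (\<lambda>i. ev X (q i) x \<odot>\<^bsub>FO F X\<^esub> p i) {..<n}) (FU F 1)"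
    by (rule pr_finsum(2)[OF X Unit_obj _ FU_closed, symmetric]) (use cl Vc in auto)
  finally show "pr X (Unit C) (finsum (FO F X) (\<lambda>i. ev X (q i) x \<odot>\<^bsub>FO F X\<^esub> p i) {..<n}) (FU F 1) =
      pr X (Unit C) x (FU F 1)" ..
qed

text \<open>The composite is the mate of m under the duality of X. For m = \<open>EvL D X\<close> it
  is the left side of the second zigzag identity; for general m it supplies the morphism from P to
  the dual of X through which m factors.\<close>

lemma FA_contract:
  assumes P: "P \<in> Obj C" and m: "m \<in> Hom C (P \<boxtimes> X) (Unit C)" and v: "v \<in> carrier (FO F P)"
  shows "FA F ((m \<boxdot> Id C (DualO D X)) \<cdot> Inv C (Assoc C P X (DualO D X)) \<cdot> (Id C P \<boxdot> CoevL D X) \<cdot> LUnit C P) v =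
    pr (Unit C) (DualO D X) (FU F 1)
      (finsum (FO F (DualO D X)) (\<lambda>i. scal (FA F m (pr P X v (p i))) \<odot>\<^bsub>FO F (DualO D X)\<^esub> q i) {..<n})"
proof -
  let ?X' = "DualO D X"
  note X' = DualO_obj[OF X] and cl = dual_bases_closed
  note XX' = TensO_obj[OF X X'] and PX = TensO_obj[OF P X]
  note Vc = cspaceD(2)[OF FO_cspace[OF X']]
  have c: "coev X = finsum (FO F (X \<boxtimes> ?X')) (\<lambda>i. pr X ?X' (p i) (q i)) {..<n}"
    using db by (simp add: dual_bases_def)
  have "FA F ((m \<boxdot> Id C ?X') \<cdot> Inv C (Assoc C P X ?X') \<cdot> (Id C P \<boxdot> CoevL D X) \<cdot> LUnit C P) v =
      FA F (m \<boxdot> Id C ?X') (FA F (Inv C (Assoc C P X ?X')) (FA F (Id C P \<boxdot> CoevL D X) (FA F (LUnit C P) v)))"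
    by (rule FA_Comp4[OF Iso_Inv(1)[OF LUnit_iso[OF P]] TensA_hom[OF Id_hom[OF P] CoevL_hom[OF X]]
          Iso_Inv(2)[OF Assoc_iso[OF P X X']] TensA_hom[OF m Id_hom[OF X']] v])
  also have "FA F (Id C P \<boxdot> CoevL D X) (FA F (LUnit C P) v) = pr P (X \<boxtimes> ?X') v (coev X)"
    using FA_pr[OF Id_hom[OF P] CoevL_hom[OF X] v FU_closed] by (simp add: FA_LUnit_pr FA_Id P v coev_def)
  also have "\<dots> = finsum (FO F (P \<boxtimes> (X \<boxtimes> ?X'))) (\<lambda>i. pr P (X \<boxtimes> ?X') v (pr X ?X' (p i) (q i))) {..<n}"
    unfolding c by (rule pr_finsum(1)[OF P XX' _ v]) (use cl in \<open>auto intro!: pr_closed X X'\<close>)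
  also have "FA F (Inv C (Assoc C P X ?X')) \<dots> = finsum (FO F ((P \<boxtimes> X) \<boxtimes> ?X'))
      (\<lambda>i. FA F (Inv C (Assoc C P X ?X')) (pr P (X \<boxtimes> ?X') v (pr X ?X' (p i) (q i)))) {..<n}"
    by (rule FA_finsum[OF Iso_Inv(2)[OF Assoc_iso[OF P X X']]]) (use cl v in \<open>auto intro!: pr_closed P X X' XX'\<close>)
  also have "FA F (m \<boxdot> Id C ?X') \<dots> = finsum (FO F (Unit C \<boxtimes> ?X'))
      (\<lambda>i. FA F (m \<boxdot> Id C ?X') (FA F (Inv C (Assoc C P X ?X')) (pr P (X \<boxtimes> ?X') v (pr X ?X' (p i) (q i))))) {..<n}"
    by (rule FA_finsum[OF TensA_hom[OF m Id_hom[OF X']]])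
      (use cl v in \<open>auto simp: FA_Inv_Assoc_pr P X X' intro!: pr_closed P X X' PX\<close>)
  also have "\<dots> = finsum (FO F (Unit C \<boxtimes> ?X'))
      (\<lambda>i. pr (Unit C) ?X' (FU F 1) (scal (FA F m (pr P X v (p i))) \<odot>\<^bsub>FO F ?X'\<^esub> q i)) {..<n}"
  proof (rule finsum_cong_on[OF FO_cspace[OF TensO_obj[OF Unit_obj X']]])
    fix i assume "i \<in> {..<n}"
    then have pq: "p i \<in> carrier (FO F X)" "q i \<in> carrier (FO F ?X')" using cl by auto
    have "FA F (m \<boxdot> Id C ?X') (FA F (Inv C (Assoc C P X ?X')) (pr P (X \<boxtimes> ?X') v (pr X ?X' (p i) (q i)))) =
        pr (Unit C) ?X' (FA F m (pr P X v (p i))) (q i)"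
      using pq v by (simp add: FA_Inv_Assoc_pr P X X' FA_pr[OF m Id_hom[OF X']] pr_closed FA_Id)
    also have "\<dots> = pr (Unit C) ?X' (FU F (scal (FA F m (pr P X v (p i))))) (q i)"
      using FA_m_FU[OF m pr_closed[OF P X v pq(1)]] by simp
    finally show "FA F (m \<boxdot> Id C ?X') (FA F (Inv C (Assoc C P X ?X')) (pr P (X \<boxtimes> ?X') v (pr X ?X' (p i) (q i)))) =
        pr (Unit C) ?X' (FU F 1) (scal (FA F m (pr P X v (p i))) \<odot>\<^bsub>FO F ?X'\<^esub> q i)"
      using pr_FU(2)[OF X' pq(2)] by simp
  qed (use cl Vc in \<open>auto intro!: pr_closed Unit_obj X' FU_closed\<close>)
  also have "\<dots> = pr (Unit C) ?X' (FU F 1)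
      (finsum (FO F ?X') (\<lambda>i. scal (FA F m (pr P X v (p i))) \<odot>\<^bsub>FO F ?X'\<^esub> q i) {..<n})"
    by (rule pr_finsum(1)[OF Unit_obj X' _ FU_closed, symmetric]) (use cl Vc in auto)
  finally show ?thesis .
qed

lemma dual_bases_right:
  assumes \<phi>: "\<phi> \<in> carrier (FO F (DualO D X))"
  shows "finsum (FO F (DualO D X)) (\<lambda>i. ev X \<phi> (p i) \<odot>\<^bsub>FO F (DualO D X)\<^esub> q i) {..<n} = \<phi>"
proof (rule pr_unit_cancel(2)[OF DualO_obj[OF X]])
  note X' = DualO_obj[OF X]
  show "finsum (FO F (DualO D X)) (\<lambda>i. ev X \<phi> (p i) \<odot>\<^bsub>FO F (DualO D X)\<^esub> q i) {..<n} \<in> carrier (FO F (DualO D X))"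
    by (rule finsum_in[OF FO_cspace[OF X']]) (use dual_bases_closed cspaceD(2)[OF FO_cspace[OF X']] in auto)
  show "\<phi> \<in> carrier (FO F (DualO D X))" by fact
  show "pr (Unit C) (DualO D X) (FU F 1) (finsum (FO F (DualO D X)) (\<lambda>i. ev X \<phi> (p i) \<odot>\<^bsub>FO F (DualO D X)\<^esub> q i) {..<n}) =
      pr (Unit C) (DualO D X) (FU F 1) \<phi>"
    using FA_contract[OF X' EvL_hom[OF X] \<phi>] zigzag_dual[OF X] FA_RUnit_pr[OF X' \<phi>] by (simp add: ev_def)
qed

lemma coev_finsum_lin:
  assumes "cspace W" "g \<in> lin (FO F (X \<boxtimes> DualO D X)) W"
  shows "g (coev X) = finsum W (\<lambda>i. g (pr X (DualO D X) (p i) (q i))) {..<n}"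
proof -
  have c: "coev X = finsum (FO F (X \<boxtimes> DualO D X)) (\<lambda>i. pr X (DualO D X) (p i) (q i)) {..<n}"
    using db by (simp add: dual_bases_def)
  show ?thesis
    unfolding c
    by (rule lin_finsum[OF FO_cspace[OF TensO_obj[OF X DualO_obj[OF X]]] assms])
      (use dual_bases_closed in \<open>auto intro!: pr_closed X DualO_obj\<close>)
qed

end

text \<open>By the expansion in dual families, x is recovered from its pairings with the q
  i.\<close>

lemma ev_nondegenerate:
  assumes X: "X \<in> Obj C" and x: "x \<in> carrier (FO F X)" and y: "y \<in> carrier (FO F X)"
    and eq: "\<And>\<phi>. \<phi> \<in> carrier (FO F (DualO D X)) \<Longrightarrow> ev X \<phi> x = ev X \<phi> y"
  shows "x = y"
proof -
  obtain n p q where db: "dual_bases X n p q" by (rule dual_bases_exist[OF X])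
  note cl = dual_bases_closed[OF X db]
  have "finsum (FO F X) (\<lambda>i. ev X (q i) x \<odot>\<^bsub>FO F X\<^esub> p i) {..<n} =
      finsum (FO F X) (\<lambda>i. ev X (q i) y \<odot>\<^bsub>FO F X\<^esub> p i) {..<n}"
    by (rule finsum_cong_on[OF FO_cspace[OF X]]) (use cl eq cspaceD(2)[OF FO_cspace[OF X]] in auto)
  then show ?thesis using dual_bases_left[OF X db x] dual_bases_left[OF X db y] by simp
qed

text \<open>The axioms do not make the chosen evaluations dinatural for \<open>DualA\<close>; every morphism between
  duals that is needed comes from this factorization.\<close>

lemma pairing_factors_through_dual:
  assumes P: "P \<in> Obj C" and X: "X \<in> Obj C" and m: "m \<in> Hom C (P \<boxtimes> X) (Unit C)"
  obtains w where "w \<in> Hom C P (DualO D X)"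
    "\<And>v x. v \<in> carrier (FO F P) \<Longrightarrow> x \<in> carrier (FO F X) \<Longrightarrow> ev X (FA F w v) x = scal (FA F m (pr P X v x))"
proof -
  let ?X' = "DualO D X"
  note X' = DualO_obj[OF X]
  let ?w' = "(m \<boxdot> Id C ?X') \<cdot> Inv C (Assoc C P X ?X') \<cdot> (Id C P \<boxdot> CoevL D X) \<cdot> LUnit C P"
  have w': "?w' \<in> Hom C P (Unit C \<boxtimes> ?X')"
    by (rule Comp_hom[OF Iso_Inv(1)[OF LUnit_iso[OF P]] Comp_hom[OF TensA_hom[OF Id_hom[OF P] CoevL_hom[OF X]]
          Comp_hom[OF Iso_Inv(2)[OF Assoc_iso[OF P X X']] TensA_hom[OF m Id_hom[OF X']]]]])
  note r = Iso_Inv(2)[OF RUnit_iso[OF X']]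
  show thesis
  proof (rule that[OF Comp_hom[OF w' r]])
    fix v x assume v: "v \<in> carrier (FO F P)" and x: "x \<in> carrier (FO F X)"
    obtain n p q where db: "dual_bases X n p q" by (rule dual_bases_exist[OF X])
    note cl = dual_bases_closed[OF X db]
    note Vc = cspaceD(2)[OF FO_cspace[OF X']] and Vc' = cspaceD(2)[OF FO_cspace[OF X]]
    let ?c = "\<lambda>i. scal (FA F m (pr P X v (p i)))"
    have in1: "finsum (FO F ?X') (\<lambda>i. ?c i \<odot>\<^bsub>FO F ?X'\<^esub> q i) {..<n} \<in> carrier (FO F ?X')"
      by (rule finsum_in[OF FO_cspace[OF X']]) (use cl Vc in auto)
    have "FA F (Inv C (RUnit C ?X') \<cdot> ?w') v = finsum (FO F ?X') (\<lambda>i. ?c i \<odot>\<^bsub>FO F ?X'\<^esub> q i) {..<n}"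
      unfolding FA_Comp[OF w' r v] FA_contract[OF X db P m v] by (rule FA_Inv_RUnit_pr[OF X' in1])
    then have "ev X (FA F (Inv C (RUnit C ?X') \<cdot> ?w') v) x =
        finsum cunit (\<lambda>i. ev X (?c i \<odot>\<^bsub>FO F ?X'\<^esub> q i) x) {..<n}"
      using lin_finsum[OF FO_cspace[OF X'] cspace_cunit ev_lin(2)[OF X x], of "{..<n}" "\<lambda>i. ?c i \<odot>\<^bsub>FO F ?X'\<^esub> q i"] cl Vc
      by (auto simp: Pi_iff)
    \<comment> \<open>The scalar <q i, x> is moved into the second argument of m, where the sum over
      i rebuilds x.\<close>
    also have "\<dots> = finsum cunit (\<lambda>i. scal (FA F m (pr P X v (ev X (q i) x \<odot>\<^bsub>FO F X\<^esub> p i)))) {..<n}"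
      by (rule finsum_cong_on[OF cspace_cunit])
        (use cl x v in \<open>auto simp: ev_smult X pr_smult P lin_smult[OF FA_lin[OF m]] pr_closed scal_smult FA_closed[OF m]\<close>)
    also have "\<dots> = scal (FA F m (pr P X v (finsum (FO F X) (\<lambda>i. ev X (q i) x \<odot>\<^bsub>FO F X\<^esub> p i) {..<n})))"
      by (rule lin_finsum[OF FO_cspace[OF X] cspace_cunit lin_comp[OF pr_lin(1)[OF P X v] lin_comp[OF FA_lin[OF m] scal_lin]], symmetric])
        (use cl Vc' in auto)
    finally show "ev X (FA F (Inv C (RUnit C ?X') \<cdot> ?w') v) x = scal (FA F m (pr P X v x))"
      by (simp only: dual_bases_left[OF X db x])
  qed
qed

text \<open>The factorization applied to the pairing of Y' with X given by u followed by the
  evaluation of Y.\<close>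

lemma transpose_exists:
  assumes u: "u \<in> Hom C X Y"
  obtains w where "w \<in> Hom C (DualO D Y) (DualO D X)"
    "\<And>\<phi> x. \<phi> \<in> carrier (FO F (DualO D Y)) \<Longrightarrow> x \<in> carrier (FO F X) \<Longrightarrow>
      ev X (FA F w \<phi>) x = ev Y \<phi> (FA F u x)"
proof -
  note X = HomD(1)[OF u] and Y = HomD(2)[OF u]
  note i = TensA_hom[OF Id_hom[OF DualO_obj[OF Y]] u]
  have e: "scal (FA F (EvL D Y \<cdot> (Id C (DualO D Y) \<boxdot> u)) (pr (DualO D Y) X \<phi> x)) = ev Y \<phi> (FA F u x)"
    if "\<phi> \<in> carrier (FO F (DualO D Y))" "x \<in> carrier (FO F X)" for \<phi> x
    using that
    by (simp add: FA_Comp[OF i EvL_hom[OF Y]] pr_closed DualO_obj X Y FA_pr[OF Id_hom u] FA_Id ev_def)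
  obtain w where w: "w \<in> Hom C (DualO D Y) (DualO D X)"
    "\<And>v x. v \<in> carrier (FO F (DualO D Y)) \<Longrightarrow> x \<in> carrier (FO F X) \<Longrightarrow>
      ev X (FA F w v) x = scal (FA F (EvL D Y \<cdot> (Id C (DualO D Y) \<boxdot> u)) (pr (DualO D Y) X v x))"
    by (rule pairing_factors_through_dual[OF DualO_obj[OF Y] X Comp_hom[OF i EvL_hom[OF Y]]], rule that) simp_all
  show thesis by (rule that[OF w(1)]) (simp add: w(2) e)
qed

end

section \<open>The antipode as a transpose\<close>

locale reconstructed_hopf_algebra =
  reconstructed_bialgebra C F H \<theta> + vfunctor_with_duals C F D
  for C :: "('o, 'm, 'z) monoidal_scheme" (structure) and F :: "('o, 'm, 'v) vfunctor"
    and H :: "'v cvs" and \<theta> and D :: "('o, 'm) duals"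
begin

abbreviation S where "S \<equiv> rep_antipode C D F H \<theta>"

text \<open>The family of endomorphisms inside \<open>rep_antipode\<close>, named so that linearity
  and naturality can be proved before the representing element is known to exist.\<close>

definition antipode_action :: "'v \<Rightarrow> 'o \<Rightarrow> 'v \<Rightarrow> 'v" where
  "antipode_action h = (\<lambda>X x.
     let X' = DualO D X; V = FO F X; V' = FO F X'; U = FO F (Unit C);
         x1 = tensor_map cunit V U V (FU F) (\<lambda>v. v) (vrunit V x);
         x2 = tensor_map U V (FO F (X \<boxtimes> X')) V (FA F (CoevL D X)) (\<lambda>v. v) x1;
         x3 = tensor_map (FO F (X \<boxtimes> X')) V (V \<otimes>\<^sub>v V') V (FTinv F X X') (\<lambda>v. v) x2;
         x4 = vassoc V V' V x3;
         x5 = tensor_map V (V' \<otimes>\<^sub>v V) V (V' \<otimes>\<^sub>v V) (\<lambda>v. v)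
                (tensor_map V' V V' V (ac X' h) (\<lambda>v. v)) x4;
         x6 = tensor_map V (V' \<otimes>\<^sub>v V) V (FO F (X' \<boxtimes> X)) (\<lambda>v. v) (FT F X' X) x5;
         x7 = tensor_map V (FO F (X' \<boxtimes> X)) V U (\<lambda>v. v) (FA F (EvL D X)) x6;
         x8 = tensor_map V U V cunit (\<lambda>v. v) (inv_on cunit (FU F)) x7
     in inv_on V (vlunit V) x8)"

text \<open>The composite inserts the sum of p i \<otimes> q i in front of x, lets h act on q i and
  pairs the result with x.\<close>

lemma antipode_action_sum:
  assumes X: "X \<in> Obj C" and db: "dual_bases X n p q" and h: "h \<in> carrier H" and x: "x \<in> carrier (FO F X)"
  shows "antipode_action h X x = finsum (FO F X) (\<lambda>i. ev X (ac (DualO D X) h (q i)) x \<odot>\<^bsub>FO F X\<^esub> p i) {..<n}"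
proof -
  define X' where "X' = DualO D X"
  define V V' U where VU: "V = FO F X" "V' = FO F X'" "U = FO F (Unit C)"
  have X': "X' \<in> Obj C" using DualO_obj[OF X] by (simp add: X'_def)
  have V: "cspace V" and V': "cspace V'" and U: "cspace U"
    unfolding VU by (rule FO_cspace X X' Unit_obj)+
  have XX': "cspace (FO F (X \<boxtimes> X'))" and X'X: "cspace (FO F (X' \<boxtimes> X))"
    by (simp_all add: FO_cspace TensO_obj X X')
  note VV' = cspace_tensor[OF V V'] and V'V = cspace_tensor[OF V' V]
  have xV: "x \<in> carrier V" using x by (simp add: VU)
  have pV: "p i \<in> carrier V" and qV: "q i \<in> carrier V'" if "i < n" for i
    using dual_bases_closed[OF X db that] by (auto simp: VU X'_def)
  then have pP: "p \<in> {..<n} \<rightarrow> carrier V" by auto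
  have c: "FTinv F X X' (coev X) = finsum (V \<otimes>\<^sub>v V') (\<lambda>i. tens V V' (p i) (q i)) {..<n}"
    using db unfolding dual_bases_def VU X'_def by blast
  have tl: "tens V' V (q i) x \<in> carrier (V' \<otimes>\<^sub>v V)" if "i < n" for i
    by (rule tens_closed[OF V' V qV[OF that] xV])
  let ?k1 = "tensor_map V' V V' V (ac X' h) (\<lambda>v. v)"
  have k1t: "?k1 (tens V' V (q i) x) = tens V' V (ac X' h (q i)) x" if "i < n" for i
    using tensor_map(2)[OF V' V V' V _ lin_id[OF V], of "ac X' h"] act_lin(1)[OF X' h] qV[OF that] xV by (auto simp: VU)
  have k1: "?k1 \<in> lin (V' \<otimes>\<^sub>v V) (V' \<otimes>\<^sub>v V)"
    using tensor_map(1)[OF V' V V' V _ lin_id[OF V], of "ac X' h"] act_lin(1)[OF X' h] by (auto simp: VU)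
  have k2: "FT F X' X \<in> lin (V' \<otimes>\<^sub>v V) (FO F (X' \<boxtimes> X))" unfolding VU by (rule FT_lin[OF X' X])
  have k3: "FA F (EvL D X) \<in> lin (FO F (X' \<boxtimes> X)) U" unfolding VU X'_def by (rule FA_lin[OF EvL_hom[OF X]])
  have k4: "inv_on cunit (FU F) \<in> lin U cunit" using scal_lin by (simp only: VU scal_def)
  have cV: "coev X \<in> carrier (FO F (X \<boxtimes> X'))" using coev_closed[OF X] by (simp add: X'_def)
  have U1: "FU F 1 \<in> carrier U" using FU_closed by (simp add: VU)
  note I = lin_id[OF V]
  note M = tensor_map_finsum[OF V _ V _ I]
  have fin: "finite {..<n}" by simp
  let ?r = "\<lambda>i. tens V' V (q i) x"
  have r0: "?r \<in> {..<n} \<rightarrow> carrier (V' \<otimes>\<^sub>v V)" using tl by auto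
  have r1: "(\<lambda>i. ?k1 (?r i)) \<in> {..<n} \<rightarrow> carrier (V' \<otimes>\<^sub>v V)" using tl lin_closed[OF k1] by auto
  have r2: "(\<lambda>i. FT F X' X (?k1 (?r i))) \<in> {..<n} \<rightarrow> carrier (FO F (X' \<boxtimes> X))"
    using tl lin_closed[OF lin_comp[OF k1 k2]] by auto
  have r3: "(\<lambda>i. FA F (EvL D X) (FT F X' X (?k1 (?r i)))) \<in> {..<n} \<rightarrow> carrier U"
    using tl lin_closed[OF lin_comp[OF lin_comp[OF k1 k2] k3]] by auto
  have val: "inv_on cunit (FU F) (FA F (EvL D X) (FT F X' X (?k1 (?r i)))) = ev X (ac X' h (q i)) x"
    if "i < n" for i
    using k1t[OF that] by (simp only: ev_def scal_def pr_def X'_def VU)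
  \<comment> \<open>The facts \<open>x1\<close> to \<open>x9\<close> evaluate the let-bindings of
    \<open>antipode_action\<close> in turn, each on the output of the previous one, so the final
    unfolding is a chain of rewrites. In between, \<open>x3'\<close> distributes the tensor over the
    sum; at the end \<open>x9\<close> recognizes a value of \<open>vlunit\<close>.\<close>
  have x1: "tensor_map cunit V U V (FU F) (\<lambda>v. v) (vrunit V x) = tens U V (FU F 1) x"
    unfolding vrunit_def by (rule tensor_map(2)[OF cspace_cunit V U V _ I _ xV]) (use FU_lin in \<open>auto simp: VU\<close>)
  have x2: "tensor_map U V (FO F (X \<boxtimes> X')) V (FA F (CoevL D X)) (\<lambda>v. v) (tens U V (FU F 1) x) =
      tens (FO F (X \<boxtimes> X')) V (coev X) x"
    unfolding coev_def by (rule tensor_map(2)[OF U V XX' V _ I U1 xV]) (use FA_lin[OF CoevL_hom[OF X]] in \<open>auto simp: VU X'_def\<close>)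
  have x3: "tensor_map (FO F (X \<boxtimes> X')) V (V \<otimes>\<^sub>v V') V (FTinv F X X') (\<lambda>v. v) (tens (FO F (X \<boxtimes> X')) V (coev X) x) =
      tens (V \<otimes>\<^sub>v V') V (finsum (V \<otimes>\<^sub>v V') (\<lambda>i. tens V V' (p i) (q i)) {..<n}) x"
    unfolding c[symmetric] by (rule tensor_map(2)[OF XX' V VV' V _ I cV xV]) (use FTinv_lin[OF X X'] in \<open>auto simp: VU\<close>)
  have x3': "\<dots> = finsum ((V \<otimes>\<^sub>v V') \<otimes>\<^sub>v V) (\<lambda>i. tens (V \<otimes>\<^sub>v V') V (tens V V' (p i) (q i)) x) {..<n}"
    by (rule tens_finsum(2)[OF VV' V fin xV]) (use pV qV tens_closed[OF V V'] in auto)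
  have x4: "vassoc V V' V \<dots> = finsum (V \<otimes>\<^sub>v (V' \<otimes>\<^sub>v V)) (\<lambda>i. tens V (V' \<otimes>\<^sub>v V) (p i) (?r i)) {..<n}"
  proof -
    have "vassoc V V' V (finsum ((V \<otimes>\<^sub>v V') \<otimes>\<^sub>v V) (\<lambda>i. tens (V \<otimes>\<^sub>v V') V (tens V V' (p i) (q i)) x) {..<n}) =
      finsum (V \<otimes>\<^sub>v (V' \<otimes>\<^sub>v V)) (\<lambda>i. vassoc V V' V (tens (V \<otimes>\<^sub>v V') V (tens V V' (p i) (q i)) x)) {..<n}"
      by (rule lin_finsum[OF cspace_tensor[OF VV' V] cspace_tensor[OF V V'V] vassoc(1)[OF V V' V] fin])
        (use pV qV xV tens_closed[OF V V'] tens_closed[OF VV' V] in auto)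
    also have "\<dots> = finsum (V \<otimes>\<^sub>v (V' \<otimes>\<^sub>v V)) (\<lambda>i. tens V (V' \<otimes>\<^sub>v V) (p i) (?r i)) {..<n}"
      by (rule finsum_cong_on[OF cspace_tensor[OF V V'V]])
        (use pV qV xV tl vassoc(2)[OF V V' V] tens_closed[OF V V'V] in auto)
    finally show ?thesis .
  qed
  have x5: "tensor_map V (V' \<otimes>\<^sub>v V) V (V' \<otimes>\<^sub>v V) (\<lambda>v. v) ?k1
      (finsum (V \<otimes>\<^sub>v (V' \<otimes>\<^sub>v V)) (\<lambda>i. tens V (V' \<otimes>\<^sub>v V) (p i) (?r i)) {..<n}) =
      finsum (V \<otimes>\<^sub>v (V' \<otimes>\<^sub>v V)) (\<lambda>i. tens V (V' \<otimes>\<^sub>v V) (p i) (?k1 (?r i))) {..<n}"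
    by (rule M[OF V'V V'V k1 fin pP r0])
  have x6: "tensor_map V (V' \<otimes>\<^sub>v V) V (FO F (X' \<boxtimes> X)) (\<lambda>v. v) (FT F X' X)
      (finsum (V \<otimes>\<^sub>v (V' \<otimes>\<^sub>v V)) (\<lambda>i. tens V (V' \<otimes>\<^sub>v V) (p i) (?k1 (?r i))) {..<n}) =
      finsum (V \<otimes>\<^sub>v FO F (X' \<boxtimes> X)) (\<lambda>i. tens V (FO F (X' \<boxtimes> X)) (p i) (FT F X' X (?k1 (?r i)))) {..<n}"
    by (rule M[OF V'V X'X k2 fin pP r1])
  have x7: "tensor_map V (FO F (X' \<boxtimes> X)) V U (\<lambda>v. v) (FA F (EvL D X))
      (finsum (V \<otimes>\<^sub>v FO F (X' \<boxtimes> X)) (\<lambda>i. tens V (FO F (X' \<boxtimes> X)) (p i) (FT F X' X (?k1 (?r i)))) {..<n}) =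
      finsum (V \<otimes>\<^sub>v U) (\<lambda>i. tens V U (p i) (FA F (EvL D X) (FT F X' X (?k1 (?r i))))) {..<n}"
    by (rule M[OF X'X U k3 fin pP r2])
  have x8: "tensor_map V U V cunit (\<lambda>v. v) (inv_on cunit (FU F))
      (finsum (V \<otimes>\<^sub>v U) (\<lambda>i. tens V U (p i) (FA F (EvL D X) (FT F X' X (?k1 (?r i))))) {..<n}) =
      finsum (V \<otimes>\<^sub>v cunit) (\<lambda>i. tens V cunit (p i) (inv_on cunit (FU F) (FA F (EvL D X) (FT F X' X (?k1 (?r i)))))) {..<n}"
    by (rule M[OF U cspace_cunit k4 fin pP r3])
  have x9: "\<dots> = vlunit V (finsum V (\<lambda>i. ev X (ac X' h (q i)) x \<odot>\<^bsub>V\<^esub> p i) {..<n})"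
  proof -
    have "finsum (V \<otimes>\<^sub>v cunit) (\<lambda>i. tens V cunit (p i) (inv_on cunit (FU F) (FA F (EvL D X) (FT F X' X (?k1 (?r i)))))) {..<n} =
        finsum (V \<otimes>\<^sub>v cunit) (\<lambda>i. tens V cunit (ev X (ac X' h (q i)) x \<odot>\<^bsub>V\<^esub> p i) 1) {..<n}"
    proof (rule finsum_cong_on[OF cspace_tensor[OF V cspace_cunit]])
      show "tens V cunit (p i) (inv_on cunit (FU F) (FA F (EvL D X) (FT F X' X (?k1 (?r i))))) =
          tens V cunit (ev X (ac X' h (q i)) x \<odot>\<^bsub>V\<^esub> p i) 1" if i: "i \<in> {..<n}" for i
        using tens_bilinear(3,4)[OF V cspace_cunit pV[of i], of 1 "ev X (ac X' h (q i)) x"] i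
        unfolding val[OF i[unfolded lessThan_iff]] by simp
    qed (use pV cspaceD(2)[OF V] tens_closed[OF V cspace_cunit] in auto)
    also have "\<dots> = vlunit V (finsum V (\<lambda>i. ev X (ac X' h (q i)) x \<odot>\<^bsub>V\<^esub> p i) {..<n})"
      unfolding vlunit_def
      by (rule tens_finsum(2)[OF V cspace_cunit fin, symmetric]) (use pV cspaceD(2)[OF V] in auto)
    finally show ?thesis .
  qed
  have "antipode_action h X x = inv_on V (vlunit V) (vlunit V (finsum V (\<lambda>i. ev X (ac X' h (q i)) x \<odot>\<^bsub>V\<^esub> p i) {..<n}))"
    unfolding antipode_action_def Let_def X'_def[symmetric] VU[symmetric] x1 x2 x3 x3' x4 x5 x6 x7 x8 x9 ..
  also have "\<dots> = finsum V (\<lambda>i. ev X (ac X' h (q i)) x \<odot>\<^bsub>V\<^esub> p i) {..<n}"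
    by (rule vlunit_inverse[OF V finsum_in[OF V]]) (use pV cspaceD(2)[OF V] in auto)
  finally show ?thesis by (simp only: VU X'_def)
qed

text \<open>Moving the scalar <\<phi>, p i> into the action of h turns the sum over i into the
  expansion of \<phi>, so the dual families disappear from the formula.\<close>

lemma antipode_action:
  assumes X: "X \<in> Obj C" and h: "h \<in> carrier H" and x: "x \<in> carrier (FO F X)"
  shows "antipode_action h X x \<in> carrier (FO F X)"
    and "\<phi> \<in> carrier (FO F (DualO D X)) \<Longrightarrow> ev X \<phi> (antipode_action h X x) = ev X (ac (DualO D X) h \<phi>) x"
proof -
  let ?X' = "DualO D X"
  note X' = DualO_obj[OF X]
  obtain n p q where db: "dual_bases X n p q" by (rule dual_bases_exist[OF X])
  note s = antipode_action_sum[OF X db h x] and cl = dual_bases_closed[OF X db]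
  note Vc = cspaceD(2)[OF FO_cspace[OF X]] and Vc' = cspaceD(2)[OF FO_cspace[OF X']]
  show "antipode_action h X x \<in> carrier (FO F X)"
    unfolding s by (rule finsum_in[OF FO_cspace[OF X]]) (use cl Vc in auto)
  show "ev X \<phi> (antipode_action h X x) = ev X (ac ?X' h \<phi>) x" if \<phi>: "\<phi> \<in> carrier (FO F ?X')"
  proof -
    have "ev X \<phi> (antipode_action h X x) = finsum cunit (\<lambda>i. ev X \<phi> (ev X (ac ?X' h (q i)) x \<odot>\<^bsub>FO F X\<^esub> p i)) {..<n}"
      unfolding s by (rule lin_finsum[OF FO_cspace[OF X] cspace_cunit ev_lin(1)[OF X \<phi>]]) (use cl Vc in auto)
    also have "\<dots> = finsum cunit (\<lambda>i. ev X (ac ?X' h (ev X \<phi> (p i) \<odot>\<^bsub>FO F ?X'\<^esub> q i)) x) {..<n}"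
      by (rule finsum_cong_on[OF cspace_cunit])
        (use cl \<phi> x in \<open>auto simp: ev_smult X X' act_add_smult h act_closed mult.commute\<close>)
    also have "\<dots> = ev X (ac ?X' h (finsum (FO F ?X') (\<lambda>i. ev X \<phi> (p i) \<odot>\<^bsub>FO F ?X'\<^esub> q i) {..<n})) x"
      by (rule lin_finsum[OF FO_cspace[OF X'] cspace_cunit lin_comp[OF act_lin(1)[OF X' h] ev_lin(2)[OF X x]], symmetric])
        (use cl Vc' in auto)
    finally show ?thesis by (simp only: dual_bases_right[OF X db \<phi>])
  qed
qed

lemma antipode:
  assumes h: "h \<in> carrier H"
  shows "S h \<in> carrier H"
    and "\<lbrakk>X \<in> Obj C; \<phi> \<in> carrier (FO F (DualO D X)); x \<in> carrier (FO F X)\<rbrakk> \<Longrightarrow>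
      ev X \<phi> (ac X (S h) x) = ev X (ac (DualO D X) h \<phi>) x"
proof -
  have Sr: "S h = rep_elt C F H \<theta> (antipode_action h)"
    by (simp add: rep_antipode_def antipode_action_def)
  have 1: "antipode_action h X \<in> lin (FO F X) (FO F X)" if X: "X \<in> Obj C" for X
  proof (rule linI)
    note a = antipode_action[OF X h] and V = FO_cspace[OF X]
    fix x assume x: "x \<in> carrier (FO F X)"
    show "antipode_action h X x \<in> carrier (FO F X)" by (rule a(1)[OF x])
    show "antipode_action h X (c \<odot>\<^bsub>FO F X\<^esub> x) = c \<odot>\<^bsub>FO F X\<^esub> antipode_action h X x" for c
      by (rule ev_nondegenerate[OF X])
        (simp_all add: a x cspaceD(2)[OF V] ev_smult X act_closed h DualO_obj)
    show "antipode_action h X (x \<oplus>\<^bsub>FO F X\<^esub> y) = antipode_action h X x \<oplus>\<^bsub>FO F X\<^esub> antipode_action h X y"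
      if y: "y \<in> carrier (FO F X)" for y
      by (rule ev_nondegenerate[OF X])
        (simp_all add: a x y cspace_add[OF V] lin_add[OF ev_lin(1)] X act_closed h DualO_obj)
  qed
  have 2: "antipode_action h Y (FA F u x) = FA F u (antipode_action h X x)"
    if u: "u \<in> Hom C X Y" and x: "x \<in> carrier (FO F X)" for X Y u x
  proof -
    note X = HomD(1)[OF u] and Y = HomD(2)[OF u]
    note a = antipode_action[OF X h x] and b = antipode_action[OF Y h FA_closed[OF u x]]
    obtain w where w: "w \<in> Hom C (DualO D Y) (DualO D X)"
      and ew: "\<And>\<phi> x. \<phi> \<in> carrier (FO F (DualO D Y)) \<Longrightarrow> x \<in> carrier (FO F X) \<Longrightarrow>
        ev X (FA F w \<phi>) x = ev Y \<phi> (FA F u x)"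
      by (rule transpose_exists[OF u]) (rule that)
    show ?thesis
    proof (rule ev_nondegenerate[OF Y b(1) FA_closed[OF u a(1)]])
      fix \<phi> assume \<phi>: "\<phi> \<in> carrier (FO F (DualO D Y))"
      have "ev Y \<phi> (antipode_action h Y (FA F u x)) = ev X (FA F w (ac (DualO D Y) h \<phi>)) x"
        by (simp add: b \<phi> ew x act_closed DualO_obj Y h)
      also have "\<dots> = ev X (ac (DualO D X) h (FA F w \<phi>)) x" by (simp add: act_nat[OF w h \<phi>])
      also have "\<dots> = ev Y \<phi> (FA F u (antipode_action h X x))"
        using a(2)[OF FA_closed[OF w \<phi>]] ew[OF \<phi> a(1)] by simp
      finally show "ev Y \<phi> (antipode_action h Y (FA F u x)) = \<dots>" .
    qed
  qed
  note R = rep_elt[of "antipode_action h", OF 1 2]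
  show "S h \<in> carrier H" unfolding Sr by (rule R(1))
  show "ev X \<phi> (ac X (S h) x) = ev X (ac (DualO D X) h \<phi>) x"
    if "X \<in> Obj C" "\<phi> \<in> carrier (FO F (DualO D X))" "x \<in> carrier (FO F X)"
    unfolding Sr using that by (subst R(2)) (simp_all add: antipode_action h)
qed

lemma antipode_eqI:
  assumes h: "h \<in> carrier H" and k: "k \<in> carrier H"
    and e: "\<And>X \<phi> x. \<lbrakk>X \<in> Obj C; \<phi> \<in> carrier (FO F (DualO D X)); x \<in> carrier (FO F X)\<rbrakk> \<Longrightarrow>
      ev X \<phi> (ac X k x) = ev X (ac (DualO D X) h \<phi>) x"
  shows "S h = k"
proof (rule act_eqI[OF antipode(1)[OF h] k])
  fix X x assume X: "X \<in> Obj C" and x: "x \<in> carrier (FO F X)"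
  show "ac X (S h) x = ac X k x"
    by (rule ev_nondegenerate[OF X act_closed[OF X antipode(1)[OF h] x] act_closed[OF X k x]])
      (simp only: antipode(2)[OF h X _ x] e[OF X _ x])
qed

lemma antipode_lin: "S \<in> lin H H"
proof (rule linI)
  fix x assume x: "x \<in> carrier H"
  show "S x \<in> carrier H" by (rule antipode(1)[OF x])
  show "S (x \<oplus>\<^bsub>H\<^esub> y) = S x \<oplus>\<^bsub>H\<^esub> S y" if y: "y \<in> carrier H" for y
    by (rule antipode_eqI)
      (simp_all add: x y antipode cspace_add[OF H_cspace] act_add_smult lin_add[OF ev_lin(1)] lin_add[OF ev_lin(2)]
        act_closed DualO_obj)
  show "S (c \<odot>\<^bsub>H\<^esub> x) = c \<odot>\<^bsub>H\<^esub> S x" for c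
    by (rule antipode_eqI)
      (simp_all add: x antipode cspaceD(2)[OF H_cspace] act_add_smult ev_smult act_closed DualO_obj)
qed

text \<open>Transposition reverses composition.\<close>

lemma antipode_mult:
  assumes "a \<in> carrier H" "b \<in> carrier H"
  shows "S (a \<otimes>\<^bsub>A\<^esub> b) = S b \<otimes>\<^bsub>A\<^esub> S a"
  by (rule antipode_eqI) (simp_all add: assms mult_A antipode act_closed DualO_obj)

text \<open>Naturality of the action along the evaluation: h acts on F(1) by the counit, while the
  legs of its coproduct act on \<phi> and on x. Testing against \<phi> replaces S of the first leg
  by its action on \<phi>.\<close>

lemma antipode_left:
  assumes h: "h \<in> carrier H"
  shows "tensor_lift H H H (\<lambda>a b. S a \<otimes>\<^bsub>A\<^esub> b) (\<Delta> h) = \<epsilon> h \<odot>\<^bsub>H\<^esub> \<one>\<^bsub>A\<^esub>"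
proof -
  note D = coproduct(1)[OF h]
  have b: "(\<lambda>a b. S a \<otimes>\<^bsub>A\<^esub> b) \<in> bilinear_maps H H H"
    by (rule bilinear_comp[OF mult_A_bilinear antipode_lin lin_id[OF H_cspace] lin_id[OF H_cspace]])
  note L = tensor_lift[OF H_cspace H_cspace H_cspace b]
  note cl = lin_closed[OF L(1) D] and cr = cspaceD(2)[OF H_cspace one_A(1), of "\<epsilon> h"]
  show ?thesis
  proof (rule act_eqI[OF cl cr], rule ev_nondegenerate)
    fix X x \<phi> assume X: "X \<in> Obj C" and x: "x \<in> carrier (FO F X)" and \<phi>: "\<phi> \<in> carrier (FO F (DualO D X))"
    note X' = DualO_obj[OF X]
    have "ev X \<phi> (ac X (tensor_lift H H H (\<lambda>a b. S a \<otimes>\<^bsub>A\<^esub> b) (\<Delta> h)) x) =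
        scal (FA F (EvL D X) (act_pr (DualO D X) X \<phi> x (\<Delta> h)))"
      by (rule lin_comp_lift[OF H_cspace H_cspace H_cspace cspace_cunit b
            lin_comp[OF act_lin(2)[OF X x] ev_lin(1)[OF X \<phi>]]
            lin_comp[OF act_pr_lin[OF X' X \<phi> x] lin_comp[OF FA_lin[OF EvL_hom[OF X]] scal_lin]] D])
        (simp add: mult_A antipode X X' x \<phi> act_closed act_pr_tens ev_def[symmetric])
    also have "\<dots> = scal (ac (Unit C) h (FU F (ev X \<phi> x)))"
      using act_nat[OF EvL_hom[OF X] h pr_closed[OF X' X \<phi> x]] by (simp add: coproduct h X X' x \<phi> FA_EvL)
    also have "\<dots> = \<epsilon> h * ev X \<phi> x"
      by (simp add: counit_FU h scal_smult FU_closed scal_FU)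
    also have "\<dots> = ev X \<phi> (ac X (\<epsilon> h \<odot>\<^bsub>H\<^esub> \<one>\<^bsub>A\<^esub>) x)"
      by (simp add: act_add_smult one_A X x ev_smult \<phi>)
    finally show "ev X \<phi> (ac X (tensor_lift H H H (\<lambda>a b. S a \<otimes>\<^bsub>A\<^esub> b) (\<Delta> h)) x) = \<dots>" .
  qed (use cl cr in \<open>simp_all add: act_closed\<close>)
qed

text \<open>Here x passes through S of the second leg first, so the coevaluation takes the place of
  the evaluation: h acts on it by the counit, and contracting its dual leg with x returns x.\<close>

lemma antipode_right:
  assumes h: "h \<in> carrier H"
  shows "tensor_lift H H H (\<lambda>a b. a \<otimes>\<^bsub>A\<^esub> S b) (\<Delta> h) = \<epsilon> h \<odot>\<^bsub>H\<^esub> \<one>\<^bsub>A\<^esub>"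
proof -
  note D = coproduct(1)[OF h] and HH = cspace_tensor[OF H_cspace H_cspace]
  have b: "(\<lambda>a b. a \<otimes>\<^bsub>A\<^esub> S b) \<in> bilinear_maps H H H"
    by (rule bilinear_comp[OF mult_A_bilinear lin_id[OF H_cspace] antipode_lin lin_id[OF H_cspace]])
  note L = tensor_lift[OF H_cspace H_cspace H_cspace b]
  note cl = lin_closed[OF L(1) D] and cr = cspaceD(2)[OF H_cspace one_A(1), of "\<epsilon> h"]
  show ?thesis
  proof (rule act_eqI[OF cl cr])
    fix X x assume X: "X \<in> Obj C" and x: "x \<in> carrier (FO F X)"
    let ?X' = "DualO D X"
    note X' = DualO_obj[OF X] and V = FO_cspace[OF X]
    note V' = FO_cspace[OF X'] and XX' = TensO_obj[OF X X']
    obtain n p q where db: "dual_bases X n p q" by (rule dual_bases_exist[OF X])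
    note dc = dual_bases_closed[OF X db]
    have kb: "(\<lambda>v \<phi>. ev X \<phi> x \<odot>\<^bsub>FO F X\<^esub> v) \<in> bilinear_maps (FO F X) (FO F ?X') (FO F X)"
      by (rule smult_bilinear(1)[OF V V' ev_lin(2)[OF X x]])
    \<comment> \<open>K contracts the dual leg with x; it sends the coevaluation to x by the first
      zigzag identity.\<close>
    define K where "K z = tensor_lift (FO F X) (FO F ?X') (FO F X) (\<lambda>v \<phi>. ev X \<phi> x \<odot>\<^bsub>FO F X\<^esub> v) (FTinv F X ?X' z)" for z
    have K: "K \<in> lin (FO F (X \<boxtimes> ?X')) (FO F X)"
      unfolding K_def[abs_def] by (rule lin_comp[OF FTinv_lin[OF X X'] tensor_lift(1)[OF V V' V kb]])
    have Kp: "K (pr X ?X' v \<phi>) = ev X \<phi> x \<odot>\<^bsub>FO F X\<^esub> v" if "v \<in> carrier (FO F X)" "\<phi> \<in> carrier (FO F ?X')" for v \<phi>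
      using tensor_lift(2)[OF V V' V kb that] by (simp add: K_def FTinv_pr X X' that)
    have Kc: "K (coev X) = x"
    proof -
      have "K (coev X) = finsum (FO F X) (\<lambda>i. K (pr X ?X' (p i) (q i))) {..<n}"
        by (rule coev_finsum_lin[OF X db V K])
      also have "\<dots> = finsum (FO F X) (\<lambda>i. ev X (q i) x \<odot>\<^bsub>FO F X\<^esub> p i) {..<n}"
        by (rule finsum_cong_on[OF V]) (use dc cspaceD(2)[OF V] in \<open>auto simp: Kp\<close>)
      finally show ?thesis by (simp add: dual_bases_left[OF X db x])
    qed
    have "ac X (tensor_lift H H H (\<lambda>a b. a \<otimes>\<^bsub>A\<^esub> S b) (\<Delta> h)) x =
        finsum (FO F X) (\<lambda>i. K (act_pr X ?X' (p i) (q i) (\<Delta> h))) {..<n}"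
    proof (rule lin_comp_lift[OF H_cspace H_cspace H_cspace V b act_lin(2)[OF X x] _ D])
      show "(\<lambda>t. finsum (FO F X) (\<lambda>i. K (act_pr X ?X' (p i) (q i) t)) {..<n}) \<in> lin HH (FO F X)"
        by (rule finsum_lin[OF HH V]) (use dc in \<open>auto intro!: lin_comp[OF act_pr_lin[OF X X'] K]\<close>)
      fix v w assume v: "v \<in> carrier H" and w: "w \<in> carrier H"
      note Sw = antipode(1)[OF w]
      note sx = act_closed[OF X Sw x]
      \<comment> \<open>Expanding the vector S w x in dual families lets S w be transposed onto each
        q i.\<close>
      have "ac X (v \<otimes>\<^bsub>A\<^esub> S w) x = ac X v (finsum (FO F X) (\<lambda>i. ev X (q i) (ac X (S w) x) \<odot>\<^bsub>FO F X\<^esub> p i) {..<n})"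
        by (simp add: mult_A v Sw X x dual_bases_left[OF X db sx])
      also have "\<dots> = finsum (FO F X) (\<lambda>i. ac X v (ev X (q i) (ac X (S w) x) \<odot>\<^bsub>FO F X\<^esub> p i)) {..<n}"
        by (rule act_finsum(1)[OF X _ v]) (use dc cspaceD(2)[OF V] in auto)
      also have "\<dots> = finsum (FO F X) (\<lambda>i. K (act_pr X ?X' (p i) (q i) (tens H H v w))) {..<n}"
        by (rule finsum_cong_on[OF V])
          (use dc in \<open>auto simp: act_add_smult X X' v w antipode x act_pr_tens Kp act_closed intro!: cspaceD(2)[OF V]\<close>)
      finally show "ac X (v \<otimes>\<^bsub>A\<^esub> S w) x = \<dots>" .
    qed
    also have "\<dots> = finsum (FO F X) (\<lambda>i. K (ac (X \<boxtimes> ?X') h (pr X ?X' (p i) (q i)))) {..<n}"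
      by (rule finsum_cong_on[OF V]) (use dc in \<open>auto simp: coproduct h X X' intro!: lin_closed[OF K] act_closed pr_closed XX'\<close>)
    also have "\<dots> = K (ac (X \<boxtimes> ?X') h (coev X))"
      by (rule coev_finsum_lin[OF X db V lin_comp[OF act_lin(1)[OF XX' h] K], symmetric])
    also have "ac (X \<boxtimes> ?X') h (coev X) = \<epsilon> h \<odot>\<^bsub>FO F (X \<boxtimes> ?X')\<^esub> coev X"
      using act_nat[OF CoevL_hom[OF X] h FU_closed[of 1]]
      by (simp add: coev_def counit_FU h lin_smult[OF FA_lin[OF CoevL_hom[OF X]]] FU_closed)
    also have "K (\<epsilon> h \<odot>\<^bsub>FO F (X \<boxtimes> ?X')\<^esub> coev X) = ac X (\<epsilon> h \<odot>\<^bsub>H\<^esub> \<one>\<^bsub>A\<^esub>) x"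
      by (simp add: lin_smult[OF K coev_closed[OF X]] Kc act_add_smult one_A X x)
    finally show "ac X (tensor_lift H H H (\<lambda>a b. a \<otimes>\<^bsub>A\<^esub> S b) (\<Delta> h)) x = ac X (\<epsilon> h \<odot>\<^bsub>H\<^esub> \<one>\<^bsub>A\<^esub>) x" .
  qed
qed

lemma hopf_algebra: "hopf_algebra A \<Delta> \<epsilon> S"
  by (rule hopf_algebra.intro)
    (simp_all add: cspace_A ring_A smult_mult_A coproduct_lin counit_lin coassociative counit_left counit_right
      coproduct_mult coproduct_one counit_mult counit_one antipode_lin antipode_left antipode_right)

section \<open>The antipode and the coproduct\<close>

lemma tensor_dual_pairing:
  assumes X: "X \<in> Obj C" and Y: "Y \<in> Obj C"
  obtains w where "w \<in> Hom C (DualO D Y \<boxtimes> DualO D X) (DualO D (X \<boxtimes> Y))"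
    "\<And>\<psi> \<phi> x y. \<lbrakk>\<psi> \<in> carrier (FO F (DualO D Y)); \<phi> \<in> carrier (FO F (DualO D X)); x \<in> carrier (FO F X);
      y \<in> carrier (FO F Y)\<rbrakk> \<Longrightarrow>
      ev (X \<boxtimes> Y) (FA F w (pr (DualO D Y) (DualO D X) \<psi> \<phi>)) (pr X Y x y) = ev X \<phi> x * ev Y \<psi> y"
proof -
  let ?X' = "DualO D X" and ?Y' = "DualO D Y"
  note X' = DualO_obj[OF X] and Y' = DualO_obj[OF Y] and XY = TensO_obj[OF X Y]
  note h1 = Iso_Inv(2)[OF Assoc_iso[OF X' X Y]] and h2 = TensA_hom[OF EvL_hom[OF X] Id_hom[OF Y]]
    and h3 = Iso_Inv(2)[OF RUnit_iso[OF Y]]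
  \<comment> \<open>The inner evaluation: X' is contracted with X, which leaves a map from X'
    \<otimes> (X \<otimes> Y) to Y. The outer one, \<open>?m\<close>, then pairs Y' with the
    result.\<close>
  let ?e = "Inv C (RUnit C Y) \<cdot> (EvL D X \<boxdot> Id C Y) \<cdot> Inv C (Assoc C ?X' X Y)"
  have e: "?e \<in> Hom C (?X' \<boxtimes> (X \<boxtimes> Y)) Y" by (rule Comp_hom[OF h1 Comp_hom[OF h2 h3]])
  have ee: "FA F ?e (pr ?X' (X \<boxtimes> Y) \<phi> (pr X Y x y)) = ev X \<phi> x \<odot>\<^bsub>FO F Y\<^esub> y"
    if "\<phi> \<in> carrier (FO F ?X')" "x \<in> carrier (FO F X)" "y \<in> carrier (FO F Y)" for \<phi> x y
    using that
    by (simp add: FA_Comp3[OF h1 h2 h3] pr_closed X' X Y XY FA_Inv_Assoc_pr FA_pr[OF EvL_hom[OF X] Id_hom[OF Y]]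
        FA_Id FA_EvL pr_FU(2)[of _ _ "ev X _ _"] FA_Inv_RUnit_pr cspaceD(2)[OF FO_cspace])
  note g1 = Iso_Inv(1)[OF Assoc_iso[OF Y' X' XY]] and g2 = TensA_hom[OF Id_hom[OF Y'] e]
  let ?m = "EvL D Y \<cdot> (Id C ?Y' \<boxdot> ?e) \<cdot> Assoc C ?Y' ?X' (X \<boxtimes> Y)"
  have m: "?m \<in> Hom C ((?Y' \<boxtimes> ?X') \<boxtimes> (X \<boxtimes> Y)) (Unit C)"
    by (rule Comp_hom[OF g1 Comp_hom[OF g2 EvL_hom[OF Y]]])
  have me: "scal (FA F ?m (pr (?Y' \<boxtimes> ?X') (X \<boxtimes> Y) (pr ?Y' ?X' \<psi> \<phi>) (pr X Y x y))) = ev X \<phi> x * ev Y \<psi> y"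
    if "\<psi> \<in> carrier (FO F ?Y')" "\<phi> \<in> carrier (FO F ?X')" "x \<in> carrier (FO F X)" "y \<in> carrier (FO F Y)" for \<psi> \<phi> x y
    using that
    by (simp add: FA_Comp3[OF g1 g2 EvL_hom[OF Y]] pr_closed X X' Y Y' XY TensO_obj FA_Assoc_pr
        FA_pr[OF Id_hom[OF Y'] e] FA_Id ee FA_EvL cspaceD(2)[OF FO_cspace] scal_FU ev_smult)
  obtain w where w: "w \<in> Hom C (?Y' \<boxtimes> ?X') (DualO D (X \<boxtimes> Y))"
    and ew: "\<And>v z. v \<in> carrier (FO F (?Y' \<boxtimes> ?X')) \<Longrightarrow> z \<in> carrier (FO F (X \<boxtimes> Y)) \<Longrightarrow>
      ev (X \<boxtimes> Y) (FA F w v) z = scal (FA F ?m (pr (?Y' \<boxtimes> ?X') (X \<boxtimes> Y) v z))"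
    by (rule pairing_factors_through_dual[OF TensO_obj[OF Y' X'] XY m], rule that) simp_all
  show thesis by (rule that[OF w]) (simp only: ew me pr_closed X X' Y Y')
qed

text \<open>Nondegeneracy on X \<otimes> Y offers all functionals from F((X \<otimes> Y)'), but only
  those coming from Y' \<otimes> X' through w have a product formula. These suffice: the dual
  families of X and Y rebuild z from its pairings with them.\<close>

lemma pr_eqI_ev:
  assumes X: "X \<in> Obj C" and Y: "Y \<in> Obj C" and w: "w \<in> Hom C (DualO D Y \<boxtimes> DualO D X) (DualO D (X \<boxtimes> Y))"
    and ew: "\<And>\<psi> \<phi> x y. \<lbrakk>\<psi> \<in> carrier (FO F (DualO D Y)); \<phi> \<in> carrier (FO F (DualO D X)); x \<in> carrier (FO F X);
      y \<in> carrier (FO F Y)\<rbrakk> \<Longrightarrow>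
      ev (X \<boxtimes> Y) (FA F w (pr (DualO D Y) (DualO D X) \<psi> \<phi>)) (pr X Y x y) = ev X \<phi> x * ev Y \<psi> y"
    and z: "z \<in> carrier (FO F (X \<boxtimes> Y))" and z': "z' \<in> carrier (FO F (X \<boxtimes> Y))"
    and eq: "\<And>\<psi> \<phi>. \<lbrakk>\<psi> \<in> carrier (FO F (DualO D Y)); \<phi> \<in> carrier (FO F (DualO D X))\<rbrakk> \<Longrightarrow>
      ev (X \<boxtimes> Y) (FA F w (pr (DualO D Y) (DualO D X) \<psi> \<phi>)) z =
      ev (X \<boxtimes> Y) (FA F w (pr (DualO D Y) (DualO D X) \<psi> \<phi>)) z'"
  shows "z = z'"
proof -
  let ?X' = "DualO D X" and ?Y' = "DualO D Y"
  note X' = DualO_obj[OF X] and Y' = DualO_obj[OF Y] and XY = TensO_obj[OF X Y]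
  note V = FO_cspace[OF XY]
  obtain n p q where db: "dual_bases X n p q" by (rule dual_bases_exist[OF X])
  obtain n' p' q' where db': "dual_bases Y n' p' q'" by (rule dual_bases_exist[OF Y])
  note dc = dual_bases_closed[OF X db] and dc' = dual_bases_closed[OF Y db']
  let ?E = "\<lambda>i j z. ev (X \<boxtimes> Y) (FA F w (pr ?Y' ?X' (q' j) (q i))) z"
  have wc: "FA F w (pr ?Y' ?X' (q' j) (q i)) \<in> carrier (FO F (DualO D (X \<boxtimes> Y)))" if "i < n" "j < n'" for i j
    by (rule FA_closed[OF w pr_closed[OF Y' X' dc'(2)[OF that(2)] dc(2)[OF that(1)]]])
  \<comment> \<open>G is the reconstruction formula. It is linear and fixes product vectors, hence
    is the identity, and its value depends only on the pairings assumed equal.\<close>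
  define G where "G z = finsum (FO F (X \<boxtimes> Y)) (\<lambda>i. finsum (FO F (X \<boxtimes> Y))
    (\<lambda>j. ?E i j z \<odot>\<^bsub>FO F (X \<boxtimes> Y)\<^esub> pr X Y (p i) (p' j)) {..<n'}) {..<n}" for z
  have t: "?E i j z \<odot>\<^bsub>FO F (X \<boxtimes> Y)\<^esub> pr X Y (p i) (p' j) \<in> carrier (FO F (X \<boxtimes> Y))" if "i < n" "j < n'" for i j z
    using dc dc' that by (auto intro!: cspaceD(2)[OF V] pr_closed X Y)
  have "(\<lambda>z. ?E i j z \<odot>\<^bsub>FO F (X \<boxtimes> Y)\<^esub> pr X Y (p i) (p' j)) \<in> lin (FO F (X \<boxtimes> Y)) (FO F (X \<boxtimes> Y))"
    if ij: "i < n" "j < n'" for i j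
  proof -
    have "(\<lambda>c. c \<odot>\<^bsub>FO F (X \<boxtimes> Y)\<^esub> pr X Y (p i) (p' j)) \<in> lin cunit (FO F (X \<boxtimes> Y))"
      using pr_closed[OF X Y dc(1)[OF ij(1)] dc'(1)[OF ij(2)]] by (intro linI) (simp_all add: cspaceD(2-5)[OF V])
    from lin_comp[OF ev_lin(1)[OF XY wc[OF ij]] this] show ?thesis .
  qed
  then have G: "G \<in> lin (FO F (X \<boxtimes> Y)) (FO F (X \<boxtimes> Y))"
    unfolding G_def[abs_def] by (intro finsum_lin[OF V V]) auto
  have Gid: "G z = z" if z: "z \<in> carrier (FO F (X \<boxtimes> Y))" for z
  proof (rule pr_unique[OF X Y V G lin_id[OF V] _ z])
    fix x y assume x: "x \<in> carrier (FO F X)" and y: "y \<in> carrier (FO F Y)"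
    have sy: "(\<lambda>j. ev Y (q' j) y \<odot>\<^bsub>FO F Y\<^esub> p' j) \<in> {..<n'} \<rightarrow> carrier (FO F Y)"
      using dc' cspaceD(2)[OF FO_cspace[OF Y]] by auto
    have sx: "(\<lambda>i. ev X (q i) x \<odot>\<^bsub>FO F X\<^esub> p i) \<in> {..<n} \<rightarrow> carrier (FO F X)"
      using dc cspaceD(2)[OF FO_cspace[OF X]] by auto
    have in1: "finsum (FO F (X \<boxtimes> Y)) (\<lambda>j. ?E i j (pr X Y x y) \<odot>\<^bsub>FO F (X \<boxtimes> Y)\<^esub> pr X Y (p i) (p' j)) {..<n'} =
        pr X Y (ev X (q i) x \<odot>\<^bsub>FO F X\<^esub> p i) y" if i: "i < n" for i
    proof -
      have pi: "ev X (q i) x \<odot>\<^bsub>FO F X\<^esub> p i \<in> carrier (FO F X)" using sx i by auto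
      have "finsum (FO F (X \<boxtimes> Y)) (\<lambda>j. ?E i j (pr X Y x y) \<odot>\<^bsub>FO F (X \<boxtimes> Y)\<^esub> pr X Y (p i) (p' j)) {..<n'} =
          finsum (FO F (X \<boxtimes> Y)) (\<lambda>j. pr X Y (ev X (q i) x \<odot>\<^bsub>FO F X\<^esub> p i) (ev Y (q' j) y \<odot>\<^bsub>FO F Y\<^esub> p' j)) {..<n'}"
      proof (rule finsum_cong_on[OF V])
        fix j assume "j \<in> {..<n'}"
        then have j: "p' j \<in> carrier (FO F Y)" "q' j \<in> carrier (FO F ?Y')" using dc' by auto
        show "?E i j (pr X Y x y) \<odot>\<^bsub>FO F (X \<boxtimes> Y)\<^esub> pr X Y (p i) (p' j) =
            pr X Y (ev X (q i) x \<odot>\<^bsub>FO F X\<^esub> p i) (ev Y (q' j) y \<odot>\<^bsub>FO F Y\<^esub> p' j)"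
          using dc[OF i] j x y pi
          by (simp add: ew pr_smult X Y cspaceD(2)[OF FO_cspace] cspaceD(5)[OF V, symmetric] pr_closed mult.commute)
      qed (use pi sy in \<open>auto intro!: pr_closed X Y\<close>)
      also have "\<dots> = pr X Y (ev X (q i) x \<odot>\<^bsub>FO F X\<^esub> p i)
          (finsum (FO F Y) (\<lambda>j. ev Y (q' j) y \<odot>\<^bsub>FO F Y\<^esub> p' j) {..<n'})"
        by (rule pr_finsum(1)[OF X Y _ pi sy, symmetric]) simp
      finally show ?thesis by (simp only: dual_bases_left[OF Y db' y])
    qed
    have "G (pr X Y x y) = finsum (FO F (X \<boxtimes> Y)) (\<lambda>i. pr X Y (ev X (q i) x \<odot>\<^bsub>FO F X\<^esub> p i) y) {..<n}"
      unfolding G_def by (rule finsum_cong_on[OF V]) (use in1 sx y in \<open>auto intro!: pr_closed X Y\<close>)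
    also have "\<dots> = pr X Y (finsum (FO F X) (\<lambda>i. ev X (q i) x \<odot>\<^bsub>FO F X\<^esub> p i) {..<n}) y"
      by (rule pr_finsum(2)[OF X Y _ y sx, symmetric]) simp
    finally show "G (pr X Y x y) = pr X Y x y" by (simp only: dual_bases_left[OF X db x])
  qed
  have "G z = G z'"
    unfolding G_def
  proof (rule finsum_cong_on[OF V])
    show "finsum (FO F (X \<boxtimes> Y)) (\<lambda>j. ?E i j z \<odot>\<^bsub>FO F (X \<boxtimes> Y)\<^esub> pr X Y (p i) (p' j)) {..<n'} =
        finsum (FO F (X \<boxtimes> Y)) (\<lambda>j. ?E i j z' \<odot>\<^bsub>FO F (X \<boxtimes> Y)\<^esub> pr X Y (p i) (p' j)) {..<n'}" if "i \<in> {..<n}" for i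
      by (rule finsum_cong_on[OF V]) (use eq dc dc' t that in auto)
  qed (auto intro!: finsum_in[OF V] t)
  then show ?thesis using Gid z z' by simp
qed

lemma flip_map_bilinear:
  assumes "f \<in> lin H H"
  shows "(\<lambda>a b. tens H H (f b) (f a)) \<in> bilinear_maps H H HH"
  by (rule bilinear_mapsI)
    (simp_all add: lin_add[OF assms] lin_smult[OF assms] lin_closed[OF assms] tens_bilinear[OF H_cspace H_cspace]
      tens_closed[OF H_cspace H_cspace])

lemma coproduct_antipode:
  assumes h: "h \<in> carrier H"
  shows "\<Delta> (S h) = tensor_lift H H HH (\<lambda>a b. tens H H (S b) (S a)) (\<Delta> h)"
proof -
  note HH = cspace_tensor[OF H_cspace H_cspace] and D = coproduct(1)[OF h] and Sh = antipode(1)[OF h]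
  note b = flip_map_bilinear[OF antipode_lin]
  note L = tensor_lift[OF H_cspace H_cspace HH b]
  show ?thesis
  proof (rule coproduct_eqI[OF Sh lin_closed[OF L(1) D]])
    fix X Y x y assume X: "X \<in> Obj C" and Y: "Y \<in> Obj C" and x: "x \<in> carrier (FO F X)" and y: "y \<in> carrier (FO F Y)"
    let ?X' = "DualO D X" and ?Y' = "DualO D Y"
    note X' = DualO_obj[OF X] and Y' = DualO_obj[OF Y] and XY = TensO_obj[OF X Y]
    note xy = pr_closed[OF X Y x y]
    obtain w where w: "w \<in> Hom C (?Y' \<boxtimes> ?X') (DualO D (X \<boxtimes> Y))"
      and ew: "\<And>\<psi> \<phi> x y. \<lbrakk>\<psi> \<in> carrier (FO F ?Y'); \<phi> \<in> carrier (FO F ?X'); x \<in> carrier (FO F X);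
        y \<in> carrier (FO F Y)\<rbrakk> \<Longrightarrow>
        ev (X \<boxtimes> Y) (FA F w (pr ?Y' ?X' \<psi> \<phi>)) (pr X Y x y) = ev X \<phi> x * ev Y \<psi> y"
      by (rule tensor_dual_pairing[OF X Y], rule that) simp_all
    show "act_pr X Y x y (tensor_lift H H HH (\<lambda>a b. tens H H (S b) (S a)) (\<Delta> h)) = ac (X \<boxtimes> Y) (S h) (pr X Y x y)"
    proof (rule pr_eqI_ev[OF X Y w ew lin_closed[OF act_pr_lin[OF X Y x y] lin_closed[OF L(1) D]] act_closed[OF XY Sh xy]])
      fix \<psi> \<phi> assume \<psi>: "\<psi> \<in> carrier (FO F ?Y')" and \<phi>: "\<phi> \<in> carrier (FO F ?X')"
      note ps = pr_closed[OF Y' X' \<psi> \<phi>]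
      note wp = FA_closed[OF w ps]
      \<comment> \<open>For a \<otimes> b in place of \<Delta> h: S b x pairs with \<phi> as x does
        with b \<phi>, and S a y pairs with \<psi> as y does with a \<psi>. Since \<psi> comes first
        in Y' \<otimes> X', the legs stand there in their original order.\<close>
      have "ev (X \<boxtimes> Y) (FA F w (pr ?Y' ?X' \<psi> \<phi>)) (act_pr X Y x y (tensor_lift H H HH (\<lambda>a b. tens H H (S b) (S a)) (\<Delta> h))) =
          ev (X \<boxtimes> Y) (FA F w (act_pr ?Y' ?X' \<psi> \<phi> (\<Delta> h))) (pr X Y x y)"
        by (rule lin_comp_lift[OF H_cspace H_cspace HH cspace_cunit b lin_comp[OF act_pr_lin[OF X Y x y] ev_lin(1)[OF XY wp]]
              lin_comp[OF act_pr_lin[OF Y' X' \<psi> \<phi>] lin_comp[OF FA_lin[OF w] ev_lin(2)[OF XY xy]]] D])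
          (simp add: act_pr_tens antipode X Y X' Y' x y \<psi> \<phi> ew act_closed)
      also have "\<dots> = ev (X \<boxtimes> Y) (ac (DualO D (X \<boxtimes> Y)) h (FA F w (pr ?Y' ?X' \<psi> \<phi>))) (pr X Y x y)"
        by (simp add: coproduct h X' Y' \<psi> \<phi> act_nat[OF w h ps])
      also have "\<dots> = ev (X \<boxtimes> Y) (FA F w (pr ?Y' ?X' \<psi> \<phi>)) (ac (X \<boxtimes> Y) (S h) (pr X Y x y))"
        by (simp add: antipode h XY wp xy)
      finally show "ev (X \<boxtimes> Y) (FA F w (pr ?Y' ?X' \<psi> \<phi>)) (act_pr X Y x y (tensor_lift H H HH (\<lambda>a b. tens H H (S b) (S a)) (\<Delta> h))) = \<dots>" .
    qed
  qed
qed

end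

section \<open>The bar structure\<close>

context bar_vfunctor
begin

abbreviation bo where "bo \<equiv> BarO C"

lemma FB_closed: "Y \<in> Obj C \<Longrightarrow> y \<in> carrier (FO F Y) \<Longrightarrow> FB F Y y \<in> carrier (FO F (bo Y))"
  using lin_closed[OF FB_lin, of Y y] by simp

lemma FB_add: "Y \<in> Obj C \<Longrightarrow> y \<in> carrier (FO F Y) \<Longrightarrow> y' \<in> carrier (FO F Y) \<Longrightarrow>
    FB F Y (y \<oplus>\<^bsub>FO F Y\<^esub> y') = FB F Y y \<oplus>\<^bsub>FO F (bo Y)\<^esub> FB F Y y'"
  using lin_add[OF FB_lin, of Y y y'] by simp

lemma FB_smult: "Y \<in> Obj C \<Longrightarrow> y \<in> carrier (FO F Y) \<Longrightarrow>
    FB F Y (c \<odot>\<^bsub>FO F Y\<^esub> y) = cnj c \<odot>\<^bsub>FO F (bo Y)\<^esub> FB F Y y"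
  using lin_smult[OF FB_lin, of Y y "cnj c"] by simp

lemma FB_finsum:
  assumes "Y \<in> Obj C" "finite I" "f \<in> I \<rightarrow> carrier (FO F Y)"
  shows "FB F Y (finsum (FO F Y) f I) = finsum (FO F (bo Y)) (\<lambda>i. FB F Y (f i)) I"
  using lin_finsum[OF cspace_conj_space[OF FO_cspace[OF assms(1)]] FO_cspace[OF BarO_obj[OF assms(1)]]
      FB_lin[OF assms(1)] assms(2), of f] assms(3) by simp

lemma FBinv_FB: "Y \<in> Obj C \<Longrightarrow> y \<in> carrier (FO F Y) \<Longrightarrow> FBinv F Y (FB F Y y) = y"
  unfolding FBinv_def by (rule inv_on_left[OF FB_bij]) simp_all

lemma FB_FBinv: "Y \<in> Obj C \<Longrightarrow> z \<in> carrier (FO F (bo Y)) \<Longrightarrow> FB F Y (FBinv F Y z) = z"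
  unfolding FBinv_def by (rule inv_on_right[OF FB_bij])

lemma FBinv_lin: "Y \<in> Obj C \<Longrightarrow> FBinv F Y \<in> lin (FO F (bo Y)) (conj_space (FO F Y))"
  unfolding FBinv_def by (rule lin_inv_on[OF cspace_conj_space[OF FO_cspace] FB_lin FB_bij])

lemma FBinv_closed: "Y \<in> Obj C \<Longrightarrow> z \<in> carrier (FO F (bo Y)) \<Longrightarrow> FBinv F Y z \<in> carrier (FO F Y)"
  using lin_closed[OF FBinv_lin, of Y z] by simp

lemma FB_cancel: "\<lbrakk>Y \<in> Obj C; y \<in> carrier (FO F Y); y' \<in> carrier (FO F Y); FB F Y y = FB F Y y'\<rbrakk> \<Longrightarrow> y = y'"
  using FBinv_FB by metis

lemma FB_natural: "u \<in> Hom C X Y \<Longrightarrow> x \<in> carrier (FO F X) \<Longrightarrow> FB F Y (FA F u x) = FA F (BarA C u) (FB F X x)"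
  using FB_nat[of u X Y x] by (simp add: conj_map_def)

lemma FA_BB_FB: "Y \<in> Obj C \<Longrightarrow> y \<in> carrier (FO F Y) \<Longrightarrow> FA F (BB C Y) y = FB F (bo Y) (FB F Y y)"
  using FA_BB[of Y y] by (simp add: conj_map_def vbb_def)

text \<open>The axiom relating fb, \<Upsilon> and f, read on vectors: \<Upsilon> exchanges the two
  factors. This exchange is what makes T reverse the coproduct.\<close>

lemma FA_Ups_pr:
  assumes X: "X \<in> Obj C" and Y: "Y \<in> Obj C" and x: "x \<in> carrier (FO F X)" and y: "y \<in> carrier (FO F Y)"
  shows "FA F (Ups C X Y) (FB F (X \<boxtimes> Y) (pr X Y x y)) = pr (bo Y) (bo X) (FB F Y y) (FB F X x)"
proof -
  note XY = TensO_obj[OF X Y] and X' = BarO_obj[OF X] and Y' = BarO_obj[OF Y]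
  have p: "pr X Y x y \<in> carrier (conj_space (FO F (X \<boxtimes> Y)))" using pr_closed[OF X Y x y] by simp
  have e: "tens (FO F (bo Y)) (FO F (bo X)) (FB F Y y) (FB F X x) =
      FTinv F (bo Y) (bo X) (FA F (Ups C X Y) (FB F (X \<boxtimes> Y) (pr X Y x y)))"
    using FB_Ups[OF X Y p] x y
    by (simp add: conj_map_def FTinv_pr X Y vups(2)[OF FO_cspace FO_cspace]
        tensor_map(2)[OF cspace_conj_space[OF FO_cspace[OF Y]] cspace_conj_space[OF FO_cspace[OF X]]
          FO_cspace[OF Y'] FO_cspace[OF X'] FB_lin[OF Y] FB_lin[OF X]])
  have "FA F (Ups C X Y) (FB F (X \<boxtimes> Y) (pr X Y x y)) \<in> carrier (FO F (bo Y \<boxtimes> bo X))"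
    by (rule FA_closed[OF Iso_Inv(1)[OF Ups_iso[OF X Y]] FB_closed[OF XY pr_closed[OF X Y x y]]])
  from FT_FTinv[OF Y' X' this, folded e] show ?thesis by (simp add: pr_def[of "bo Y"])
qed

lemma FA_Star_FU: "FA F (Star C) (FU F c) = FU F (cnj c)"
  using FA_Star[of c] by (simp add: conj_map_def vstar_def)

lemma FA_Inv_Star_FU: "FA F (Inv C (Star C)) (FU F c) = FU F (cnj c)"
  using FA_Inv(1)[OF Star_iso FU_closed, of "cnj c"] by (simp add: FA_Star_FU)

text \<open>The axioms fix \<open>FB F (Unit C)\<close> only up to a scalar \<open>\<lambda>\<close>; the compatibility of
  \<open>Ups\<close> with the left unit, read off at the unit object, gives \<open>\<lambda>\<^sup>2 = \<lambda>\<close>.\<close>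

lemma FB_FU: "FB F (Unit C) (FU F c) = FU F c"
proof -
  let ?I = "Unit C"
  note I = Unit_obj and I' = BarO_obj[OF Unit_obj]
  note U = FO_cspace[OF Unit_obj]
  define l where "l = scal (FB F ?I (FU F 1))"
  \<comment> \<open>F of the conjugate unit object is by hypothesis the conjugate of F(1), so both
    have one carrier and the coordinate \<open>scal\<close> applies to vectors of either.\<close>
  have carr: "carrier (FO F (bo ?I)) = carrier (FO F ?I)" by (simp add: FO_Bar_Unit)
  have l: "FB F ?I (FU F 1) = FU F l"
    using FU_scal[of "FB F ?I (FU F 1)"] FB_closed[OF I FU_closed, of 1] by (simp add: l_def carr)
  have FUl: "FU F a \<in> carrier (FO F (bo ?I))" for a using FU_closed by (simp add: carr)
  note h1 = BarA_hom[OF Iso_Inv(1)[OF LUnit_iso[OF I]]] and h2 = Iso_Inv(1)[OF Ups_iso[OF I I]]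
    and h3 = TensA_hom[OF Iso_Inv(2)[OF Star_iso] Id_hom[OF I']]
  have "pr ?I (bo ?I) (FU F 1) (FU F l) = FA F (RUnit C (bo ?I)) (FU F l)"
    by (simp add: FA_RUnit_pr I' FUl)
  also have "\<dots> = FA F (Inv C (Star C) \<boxdot> Id C (bo ?I)) (FA F (Ups C ?I ?I) (FA F (BarA C (LUnit C ?I)) (FU F l)))"
    unfolding Ups_LUnit[OF I, symmetric] by (rule FA_Comp3[OF h1 h2 h3 FUl])
  also have "FA F (BarA C (LUnit C ?I)) (FU F l) = FB F (?I \<boxtimes> ?I) (pr ?I ?I (FU F 1) (FU F 1))"
    using FB_natural[OF Iso_Inv(1)[OF LUnit_iso[OF I]] FU_closed, of 1] by (simp add: l FA_LUnit_pr I FU_closed)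
  also have "FA F (Ups C ?I ?I) \<dots> = pr (bo ?I) (bo ?I) (FU F l) (FU F l)"
    by (simp add: FA_Ups_pr I FU_closed l)
  also have "FA F (Inv C (Star C) \<boxdot> Id C (bo ?I)) \<dots> = pr ?I (bo ?I) (FU F (cnj l)) (FU F l)"
    by (simp add: FA_pr[OF Iso_Inv(2)[OF Star_iso] Id_hom[OF I']] FUl FA_Id I' FA_Inv_Star_FU)
  also have "\<dots> = pr ?I (bo ?I) (FU F 1) (cnj l \<odot>\<^bsub>FO F (bo ?I)\<^esub> FU F l)"
    by (rule pr_FU(2)[OF I' FUl])
  finally have "FU F l = cnj l \<odot>\<^bsub>FO F (bo ?I)\<^esub> FU F l"
    by (rule pr_unit_cancel(2)[OF I' FUl cspaceD(2)[OF FO_cspace[OF I'] FUl]])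
  \<comment> \<open>Scalar multiplication is conjugated in this space, so \<open>cnj l\<close> acts
    as multiplication by l.\<close>
  also have "\<dots> = FU F (l * l)" using lin_smult[OF FU_lin, of l l] by (simp add: FO_Bar_Unit)
  finally have "scal (FU F l) = scal (FU F (l * l))" by simp
  then have ll: "l = l * l" by (simp add: scal_FU)
  have FBc: "FB F ?I (FU F c) = c \<odot>\<^bsub>FO F ?I\<^esub> FU F l" for c
    unfolding FU_eq[of c] FB_smult[OF I FU_closed] l by (simp add: FO_Bar_Unit)
  \<comment> \<open>For l = 0 the map \<open>FB F ?I\<close> would send \<open>FU F 0\<close> and
    \<open>FU F 1\<close> to the same vector, against injectivity.\<close>
  have "l \<noteq> 0"
  proof
    assume "l = 0"
    then have "FB F ?I (FU F 1) = FB F ?I (FU F 0)"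
      using FBc[of 0] FBc[of 1] FU_eq[of 0] by (simp add: smult_zero_left[OF U] smult_zero_right[OF U] FU_closed cspaceD(6)[OF U])
    then have "scal (FU F 1) = scal (FU F 0)" using FB_cancel[OF I FU_closed FU_closed] by metis
    then show False by (simp add: scal_FU)
  qed
  then have "l = 1" using ll by simp
  then show ?thesis using FBc[of c] by (simp add: FU_eq[symmetric])
qed

end

section \<open>The antilinear map T\<close>

locale reconstructed_star_hopf_algebra =
  reconstructed_hopf_algebra C F H \<theta> D + bar_vfunctor C F
  for C :: "('o, 'm, 'z) bar_scheme" (structure) and F :: "('o, 'm, 'v) vfunctor"
    and H :: "'v cvs" and \<theta> and D :: "('o, 'm) duals"
begin

abbreviation T where "T \<equiv> rep_T C F H \<theta>"

abbreviation Sinv where "Sinv \<equiv> rep_antipode_inv C D F H \<theta>"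

abbreviation star where "star \<equiv> rep_star C D F H \<theta>"

text \<open>Applying fb to the definition of T removes the inverse of fb and leaves an intertwining
  relation. The bb of vector spaces is the identity function and disappears.\<close>

lemma T_act:
  assumes h: "h \<in> carrier H"
  shows "T h \<in> carrier H"
    and "X \<in> Obj C \<Longrightarrow> x \<in> carrier (FO F X) \<Longrightarrow> FB F X (ac X (T h) x) = ac (bo X) h (FB F X x)"
proof -
  have "inv_into UNIV (vbb :: 'v \<Rightarrow> 'v) = (\<lambda>x. x)"
    by (rule inv_equality) (simp_all add: vbb_def)
  then have Tr: "T h = rep_elt C F H \<theta> (\<lambda>X x. FBinv F X (ac (bo X) h (FB F X x)))"
    by (simp add: rep_T_def conj_map_def vbb_def)
  have 1: "(\<lambda>x. FBinv F X (ac (bo X) h (FB F X x))) \<in> lin (FO F X) (FO F X)" if X: "X \<in> Obj C" for X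
  proof -
    \<comment> \<open>fb and its inverse are both antilinear, so the composite is first seen as a
      linear map between conjugate spaces; conjugating once more gives a linear map of F(X).\<close>
    have "(\<lambda>x. FBinv F X (ac (bo X) h (FB F X x))) \<in> lin (conj_space (FO F X)) (conj_space (FO F X))"
      by (rule lin_comp[OF lin_comp[OF FB_lin[OF X] act_lin(1)[OF BarO_obj[OF X] h]] FBinv_lin[OF X]])
    from lin_conj_space[OF this] show ?thesis by simp
  qed
  have 2: "FBinv F Y (ac (bo Y) h (FB F Y (FA F u x))) = FA F u (FBinv F X (ac (bo X) h (FB F X x)))"
    if u: "u \<in> Hom C X Y" and x: "x \<in> carrier (FO F X)" for X Y u x
  proof -
    note X = HomD(1)[OF u] and Y = HomD(2)[OF u]
    note c = FBinv_closed[OF X act_closed[OF BarO_obj[OF X] h FB_closed[OF X x]]]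
    have "ac (bo Y) h (FB F Y (FA F u x)) = FB F Y (FA F u (FBinv F X (ac (bo X) h (FB F X x))))"
      by (simp add: FB_natural[OF u] x c act_nat[OF BarA_hom[OF u] h] FB_closed X FB_FBinv act_closed BarO_obj h)
    then show ?thesis by (simp add: FBinv_FB[OF Y FA_closed[OF u c]])
  qed
  note R = rep_elt[of "\<lambda>X x. FBinv F X (ac (bo X) h (FB F X x))", OF 1 2]
  show "T h \<in> carrier H" unfolding Tr by (rule R(1))
  show "FB F X (ac X (T h) x) = ac (bo X) h (FB F X x)" if "X \<in> Obj C" "x \<in> carrier (FO F X)"
    unfolding Tr using that by (subst R(2)) (simp_all add: FB_FBinv act_closed BarO_obj h FB_closed)
qed

lemma T_eqI:
  assumes h: "h \<in> carrier H" and k: "k \<in> carrier H"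
    and e: "\<And>X x. X \<in> Obj C \<Longrightarrow> x \<in> carrier (FO F X) \<Longrightarrow> FB F X (ac X k x) = ac (bo X) h (FB F X x)"
  shows "T h = k"
proof (rule act_eqI[OF T_act(1)[OF h] k])
  fix X x assume X: "X \<in> Obj C" and x: "x \<in> carrier (FO F X)"
  show "ac X (T h) x = ac X k x"
    by (rule FB_cancel[OF X act_closed[OF X T_act(1)[OF h] x] act_closed[OF X k x]])
      (simp only: T_act(2)[OF h X x] e[OF X x])
qed

text \<open>F(bb) is fb applied twice, and the action commutes with F(bb) by naturality.\<close>

lemma T_T:
  assumes h: "h \<in> carrier H" shows "T (T h) = h"
proof (rule T_eqI[OF T_act(1)[OF h] h])
  fix X x assume X: "X \<in> Obj C" and x: "x \<in> carrier (FO F X)"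
  note X' = BarO_obj[OF X] and Th = T_act(1)[OF h]
  show "FB F X (ac X h x) = ac (bo X) (T h) (FB F X x)"
  proof (rule FB_cancel[OF X'])
    show "FB F (bo X) (FB F X (ac X h x)) = FB F (bo X) (ac (bo X) (T h) (FB F X x))"
      using act_nat[OF Iso_Inv(1)[OF BB_iso[OF X]] h x]
      by (simp add: FA_BB_FB X x act_closed h T_act X' FB_closed)
  qed (use X X' x h Th in \<open>simp_all add: FB_closed act_closed\<close>)
qed

lemma T_antilinear: "T \<in> lin H (conj_space H)"
proof (rule linI)
  fix x assume x: "x \<in> carrier H"
  show "T x \<in> carrier (conj_space H)" using T_act(1)[OF x] by simp
  show "T (x \<oplus>\<^bsub>H\<^esub> y) = T x \<oplus>\<^bsub>conj_space H\<^esub> T y" if y: "y \<in> carrier H" for y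
    by (rule T_eqI) (simp_all add: x y cspace_add[OF H_cspace] T_act act_add_smult FB_add act_closed FB_closed BarO_obj)
  show "T (c \<odot>\<^bsub>H\<^esub> x) = c \<odot>\<^bsub>conj_space H\<^esub> T x" for c
    by (rule T_eqI) (simp_all add: x cspaceD(2)[OF H_cspace] T_act act_add_smult FB_smult act_closed FB_closed BarO_obj)
qed

lemma T_mult:
  assumes "a \<in> carrier H" "b \<in> carrier H"
  shows "T (a \<otimes>\<^bsub>A\<^esub> b) = T a \<otimes>\<^bsub>A\<^esub> T b"
  by (rule T_eqI) (simp_all add: assms mult_A T_act act_closed FB_closed BarO_obj)

lemma conj_tens_bilinear:
  assumes f: "f \<in> lin H (conj_space H)"
  shows "(\<lambda>a b. tens H H (f b) (f a)) \<in> bilinear_maps H H (conj_space HH)"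
    and "(\<lambda>a b. tens H H (f a) (f b)) \<in> bilinear_maps H H (conj_space HH)"
proof -
  have c: "f a \<in> carrier H" "f (k \<odot>\<^bsub>H\<^esub> a) = cnj k \<odot>\<^bsub>H\<^esub> f a" if "a \<in> carrier H" for a k
    using lin_closed[OF f that] lin_smult[OF f that] by simp_all
  have a: "f (a \<oplus>\<^bsub>H\<^esub> b) = f a \<oplus>\<^bsub>H\<^esub> f b" if "a \<in> carrier H" "b \<in> carrier H" for a b
    using lin_add[OF f that] by simp
  show "(\<lambda>a b. tens H H (f b) (f a)) \<in> bilinear_maps H H (conj_space HH)"
    "(\<lambda>a b. tens H H (f a) (f b)) \<in> bilinear_maps H H (conj_space HH)"
    by (rule bilinear_mapsI; simp add: c a tens_bilinear[OF H_cspace H_cspace] tens_closed[OF H_cspace H_cspace])+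
qed

text \<open>The map fb followed by F(\<Upsilon>) is injective and sends f(x \<otimes> y) to the
  product of fb y and fb x. Under it the action of T h becomes the action of h, by naturality along
  \<Upsilon>.\<close>

lemma coproduct_T:
  assumes h: "h \<in> carrier H"
  shows "\<Delta> (T h) = tensor_lift H H (conj_space HH) (\<lambda>a b. tens H H (T b) (T a)) (\<Delta> h)"
proof -
  note HH = cspace_tensor[OF H_cspace H_cspace] and D = coproduct(1)[OF h] and Th = T_act(1)[OF h]
  note b = conj_tens_bilinear(1)[OF T_antilinear]
  note L = tensor_lift[OF H_cspace H_cspace cspace_conj_space[OF HH] b]
  have LD: "tensor_lift H H (conj_space HH) (\<lambda>a b. tens H H (T b) (T a)) (\<Delta> h) \<in> carrier HH"
    using lin_closed[OF L(1) D] by simp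
  show ?thesis
  proof (rule coproduct_eqI[OF Th LD])
    fix X Y x y assume X: "X \<in> Obj C" and Y: "Y \<in> Obj C" and x: "x \<in> carrier (FO F X)" and y: "y \<in> carrier (FO F Y)"
    note X' = BarO_obj[OF X] and Y' = BarO_obj[OF Y] and XY = TensO_obj[OF X Y]
    note u = Ups_iso[OF X Y] and xy = pr_closed[OF X Y x y] and fx = FB_closed[OF X x] and fy = FB_closed[OF Y y]
    have "FA F (Ups C X Y) (FB F (X \<boxtimes> Y) (act_pr X Y x y (tensor_lift H H (conj_space HH) (\<lambda>a b. tens H H (T b) (T a)) (\<Delta> h)))) =
        act_pr (bo Y) (bo X) (FB F Y y) (FB F X x) (\<Delta> h)"
      by (rule lin_comp_lift[OF H_cspace H_cspace cspace_conj_space[OF HH] FO_cspace[OF TensO_obj[OF Y' X']] b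
            lin_comp[OF lin_conj_space[OF act_pr_lin[OF X Y x y]] lin_comp[OF FB_lin[OF XY] FA_lin[OF Iso_Inv(1)[OF u]]]]
            act_pr_lin[OF Y' X' fy fx] D])
        (simp add: act_pr_tens X Y x y T_act FA_Ups_pr act_closed X' Y' fx fy)
    also have "\<dots> = FA F (Ups C X Y) (FB F (X \<boxtimes> Y) (ac (X \<boxtimes> Y) (T h) (pr X Y x y)))"
      using act_nat[OF Iso_Inv(1)[OF u] h FB_closed[OF XY xy]]
      by (simp add: coproduct h X' Y' fx fy FA_Ups_pr X Y x y T_act XY xy)
    finally have "FB F (X \<boxtimes> Y) (act_pr X Y x y (tensor_lift H H (conj_space HH) (\<lambda>a b. tens H H (T b) (T a)) (\<Delta> h))) =
        FB F (X \<boxtimes> Y) (ac (X \<boxtimes> Y) (T h) (pr X Y x y))"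
      using FA_Inv(1)[OF u] FB_closed[OF XY] lin_closed[OF act_pr_lin[OF X Y x y] LD] act_closed[OF XY Th xy] by metis
    then show "act_pr X Y x y (tensor_lift H H (conj_space HH) (\<lambda>a b. tens H H (T b) (T a)) (\<Delta> h)) =
        ac (X \<boxtimes> Y) (T h) (pr X Y x y)"
      by (rule FB_cancel[OF XY lin_closed[OF act_pr_lin[OF X Y x y] LD] act_closed[OF XY Th xy]])
  qed
qed

section \<open>Right duals and the inverse antipode\<close>

lemma EvR_hom: "X \<in> Obj C \<Longrightarrow> EvR C D X \<in> Hom C (X \<boxtimes> RDualO C D X) (Unit C)"
  unfolding EvR_def RDualO_def
  by (intro Comp_hom[OF TensA_hom[OF Iso_Inv(1)[OF BB_iso] Id_hom]] Comp_hom[OF Iso_Inv(2)[OF Ups_iso]]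
      Comp_hom[OF BarA_hom[OF EvL_hom]] Iso_Inv(2)[OF Star_iso] BarO_obj DualO_obj)

lemma RDualO_obj: "X \<in> Obj C \<Longrightarrow> RDualO C D X \<in> Obj C"
  by (simp add: RDualO_def BarO_obj DualO_obj)

text \<open>The bb in \<open>EvR\<close> contributes fb twice, so the inverse of \<Upsilon> can undo
  the exchange of factors; naturality of fb then leads to the left evaluation, and the inverse of
  star conjugates the scalar. \<open>FB_FU\<close> ensures that no further factor enters.\<close>

lemma FA_EvR:
  assumes X: "X \<in> Obj C" and x: "x \<in> carrier (FO F X)" and \<psi>: "\<psi> \<in> carrier (FO F (DualO D (bo X)))"
  shows "FA F (EvR C D X) (pr X (RDualO C D X) x (FB F (DualO D (bo X)) \<psi>)) = FU F (cnj (ev (bo X) \<psi> (FB F X x)))"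
proof -
  let ?Y = "bo X" and ?Y' = "DualO D (bo X)"
  note Y = BarO_obj[OF X]
  note Y' = DualO_obj[OF Y] and fx = FB_closed[OF X x]
  note h1 = TensA_hom[OF Iso_Inv(1)[OF BB_iso[OF X]] Id_hom[OF BarO_obj[OF Y']]]
    and h2 = Iso_Inv(2)[OF Ups_iso[OF Y' Y]] and h3 = BarA_hom[OF EvL_hom[OF Y]] and h4 = Iso_Inv(2)[OF Star_iso]
  note p = pr_closed[OF Y' Y \<psi> fx]
  have "FA F (EvR C D X) (pr X (RDualO C D X) x (FB F ?Y' \<psi>)) =
      FA F (Inv C (Star C)) (FA F (BarA C (EvL D ?Y)) (FA F (Inv C (Ups C ?Y' ?Y))
        (FA F (BB C X \<boxdot> Id C (bo ?Y')) (pr X (bo ?Y') x (FB F ?Y' \<psi>)))))"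
    unfolding EvR_def RDualO_def
    by (rule FA_Comp4[OF h1 h2 h3 h4 pr_closed[OF X BarO_obj[OF Y'] x FB_closed[OF Y' \<psi>]]])
  also have "FA F (BB C X \<boxdot> Id C (bo ?Y')) (pr X (bo ?Y') x (FB F ?Y' \<psi>)) =
      FA F (Ups C ?Y' ?Y) (FB F (?Y' \<boxtimes> ?Y) (pr ?Y' ?Y \<psi> (FB F X x)))"
    by (simp add: FA_pr[OF Iso_Inv(1)[OF BB_iso[OF X]] Id_hom[OF BarO_obj[OF Y']]] x FB_closed Y' \<psi> FA_Id BarO_obj
        FA_BB_FB X FA_Ups_pr Y)
  also have "FA F (Inv C (Ups C ?Y' ?Y)) \<dots> = FB F (?Y' \<boxtimes> ?Y) (pr ?Y' ?Y \<psi> (FB F X x))"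
    by (rule FA_Inv(1)[OF Ups_iso[OF Y' Y] FB_closed[OF TensO_obj[OF Y' Y] p]])
  also have "FA F (BarA C (EvL D ?Y)) \<dots> = FU F (ev ?Y \<psi> (FB F X x))"
    using FB_natural[OF EvL_hom[OF Y] p] by (simp add: FA_EvL Y \<psi> fx FB_FU)
  also have "FA F (Inv C (Star C)) \<dots> = FU F (cnj (ev ?Y \<psi> (FB F X x)))" by (rule FA_Inv_Star_FU)
  finally show ?thesis .
qed

text \<open>Dual families p, q of the conjugate object yield the families of all fb q i for the
  right dual and all inverse images of p i under fb for X; their order is exchanged by
  \<Upsilon>.\<close>

lemma FA_CoevR:
  assumes X: "X \<in> Obj C" and db: "dual_bases (bo X) n p q"
  shows "FA F (CoevR C D X) (FU F 1) = finsum (FO F (RDualO C D X \<boxtimes> X))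
    (\<lambda>i. pr (RDualO C D X) X (FB F (DualO D (bo X)) (q i)) (FBinv F X (p i))) {..<n}"
proof -
  let ?Y = "bo X" and ?Y' = "DualO D (bo X)"
  note Y = BarO_obj[OF X]
  note Y' = DualO_obj[OF Y] and R = BarO_obj[OF DualO_obj[OF Y]]
  note YY' = TensO_obj[OF Y Y']
  note dc = dual_bases_closed[OF Y db]
  note h1 = Iso_Inv(1)[OF Star_iso] and h2 = BarA_hom[OF CoevL_hom[OF Y]] and h3 = Iso_Inv(1)[OF Ups_iso[OF Y Y']]
    and h4 = TensA_hom[OF Id_hom[OF R] Iso_Inv(2)[OF BB_iso[OF X]]]
  have c: "coev ?Y = finsum (FO F (?Y \<boxtimes> ?Y')) (\<lambda>i. pr ?Y ?Y' (p i) (q i)) {..<n}"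
    using db by (simp add: dual_bases_def)
  have "FA F (CoevR C D X) (FU F 1) = FA F (Id C (bo ?Y') \<boxdot> Inv C (BB C X)) (FA F (Ups C ?Y ?Y')
      (FA F (BarA C (CoevL D ?Y)) (FA F (Star C) (FU F 1))))"
    unfolding CoevR_def RDualO_def by (rule FA_Comp4[OF h1 h2 h3 h4 FU_closed])
  also have "FA F (BarA C (CoevL D ?Y)) (FA F (Star C) (FU F 1)) = FB F (?Y \<boxtimes> ?Y') (coev ?Y)"
    using FB_natural[OF CoevL_hom[OF Y] FU_closed, of 1] by (simp add: FA_Star_FU FB_FU coev_def)
  also have "\<dots> = finsum (FO F (bo (?Y \<boxtimes> ?Y'))) (\<lambda>i. FB F (?Y \<boxtimes> ?Y') (pr ?Y ?Y' (p i) (q i))) {..<n}"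
    unfolding c by (rule FB_finsum[OF YY']) (use dc in \<open>auto intro!: pr_closed Y Y'\<close>)
  also have "FA F (Ups C ?Y ?Y') \<dots> = finsum (FO F (bo ?Y' \<boxtimes> bo ?Y))
      (\<lambda>i. FA F (Ups C ?Y ?Y') (FB F (?Y \<boxtimes> ?Y') (pr ?Y ?Y' (p i) (q i)))) {..<n}"
    by (rule FA_finsum[OF h3]) (use dc in \<open>auto intro!: FB_closed[OF YY'] pr_closed Y Y'\<close>)
  also have "FA F (Id C (bo ?Y') \<boxdot> Inv C (BB C X)) \<dots> = finsum (FO F (bo ?Y' \<boxtimes> X)) (\<lambda>i. FA F (Id C (bo ?Y') \<boxdot> Inv C (BB C X))
      (FA F (Ups C ?Y ?Y') (FB F (?Y \<boxtimes> ?Y') (pr ?Y ?Y' (p i) (q i))))) {..<n}"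
    by (rule FA_finsum[OF h4]) (use dc in \<open>auto intro!: FA_closed[OF h3] FB_closed[OF YY'] pr_closed Y Y'\<close>)
  also have "\<dots> = finsum (FO F (bo ?Y' \<boxtimes> X)) (\<lambda>i. pr (bo ?Y') X (FB F ?Y' (q i)) (FBinv F X (p i))) {..<n}"
  proof (rule finsum_cong_on[OF FO_cspace[OF TensO_obj[OF R X]]])
    fix i assume "i \<in> {..<n}"
    then have pq: "p i \<in> carrier (FO F ?Y)" "q i \<in> carrier (FO F ?Y')" using dc by auto
    have "FA F (Inv C (BB C X)) (FB F ?Y (p i)) = FBinv F X (p i)"
      using FA_Inv(1)[OF BB_iso[OF X] FBinv_closed[OF X pq(1)]]
      by (simp add: FA_BB_FB X FBinv_closed pq FB_FBinv)
    then show "FA F (Id C (bo ?Y') \<boxdot> Inv C (BB C X)) (FA F (Ups C ?Y ?Y') (FB F (?Y \<boxtimes> ?Y') (pr ?Y ?Y' (p i) (q i)))) =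
        pr (bo ?Y') X (FB F ?Y' (q i)) (FBinv F X (p i))"
      using pq by (simp add: FA_Ups_pr Y Y' FA_pr[OF Id_hom[OF R] Iso_Inv(2)[OF BB_iso[OF X]]] FB_closed FA_Id R)
  qed (use dc in \<open>auto intro!: pr_closed R X FB_closed Y' FBinv_closed\<close>)
  finally show ?thesis by (simp only: RDualO_def)
qed

definition antipode_inv_action :: "'v \<Rightarrow> 'o \<Rightarrow> 'v \<Rightarrow> 'v" where
  "antipode_inv_action h = (\<lambda>X x.
     let X' = RDualO C D X; V = FO F X; V' = FO F X'; U = FO F (Unit C);
         x1 = tensor_map V cunit V U (\<lambda>v. v) (FU F) (vlunit V x);
         x2 = tensor_map V U V (FO F (X' \<boxtimes> X)) (\<lambda>v. v) (FA F (CoevR C D X)) x1;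
         x3 = tensor_map V (FO F (X' \<boxtimes> X)) V (V' \<otimes>\<^sub>v V) (\<lambda>v. v) (FTinv F X' X) x2;
         x4 = tensor_map V (V' \<otimes>\<^sub>v V) V (V' \<otimes>\<^sub>v V) (\<lambda>v. v)
                (tensor_map V' V V' V (ac X' h) (\<lambda>v. v)) x3;
         x5 = inv_on ((V \<otimes>\<^sub>v V') \<otimes>\<^sub>v V) (vassoc V V' V) x4;
         x6 = tensor_map (V \<otimes>\<^sub>v V') V (FO F (X \<boxtimes> X')) V (FT F X X') (\<lambda>v. v) x5;
         x7 = tensor_map (FO F (X \<boxtimes> X')) V U V (FA F (EvR C D X)) (\<lambda>v. v) x6;
         x8 = tensor_map U V cunit V (inv_on cunit (FU F)) (\<lambda>v. v) x7
     in inv_on V (vrunit V) x8)"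

lemma CoevR_hom: "X \<in> Obj C \<Longrightarrow> CoevR C D X \<in> Hom C (Unit C) (RDualO C D X \<boxtimes> X)"
  unfolding CoevR_def RDualO_def
  by (intro Comp_hom[OF Iso_Inv(1)[OF Star_iso]] Comp_hom[OF BarA_hom[OF CoevL_hom]]
      Comp_hom[OF Iso_Inv(1)[OF Ups_iso]] TensA_hom[OF Id_hom Iso_Inv(2)[OF BB_iso]] BarO_obj DualO_obj)

text \<open>Stated for an arbitrary expansion of the right coevaluation, because the one supplied by
  \<open>FA_CoevR\<close> is expressed through dual families of the conjugate object rather than of
  X.\<close>

lemma antipode_inv_action_sum:
  fixes n :: nat
  assumes X: "X \<in> Obj C" and h: "h \<in> carrier H" and x: "x \<in> carrier (FO F X)"
    and q: "\<And>i. i < n \<Longrightarrow> q i \<in> carrier (FO F (RDualO C D X))" and r: "\<And>i. i < n \<Longrightarrow> r i \<in> carrier (FO F X)"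
    and cR: "FA F (CoevR C D X) (FU F 1) =
      finsum (FO F (RDualO C D X \<boxtimes> X)) (\<lambda>i. pr (RDualO C D X) X (q i) (r i)) {..<n}"
  shows "antipode_inv_action h X x = finsum (FO F X)
    (\<lambda>i. scal (FA F (EvR C D X) (pr X (RDualO C D X) x (ac (RDualO C D X) h (q i)))) \<odot>\<^bsub>FO F X\<^esub> r i) {..<n}"
proof -
  define X' where "X' = RDualO C D X"
  define V V' U where VU: "V = FO F X" "V' = FO F X'" "U = FO F (Unit C)"
  have X': "X' \<in> Obj C" using RDualO_obj[OF X] by (simp add: X'_def)
  have V: "cspace V" and V': "cspace V'" and U: "cspace U"
    unfolding VU by (rule FO_cspace X X' Unit_obj)+
  have XX': "cspace (FO F (X \<boxtimes> X'))" and X'X: "cspace (FO F (X' \<boxtimes> X))"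
    by (simp_all add: FO_cspace TensO_obj X X')
  note VV' = cspace_tensor[OF V V'] and V'V = cspace_tensor[OF V' V]
  note I = lin_id[OF V]
  have fin: "finite {..<n}" by simp
  have xV: "x \<in> carrier V" using x by (simp add: VU)
  have rV: "r i \<in> carrier V" and qV: "q i \<in> carrier V'" if "i < n" for i
    using q r that by (auto simp: VU X'_def)
  have rP: "r \<in> {..<n} \<rightarrow> carrier V" using rV by auto
  have hq: "ac X' h (q i) \<in> carrier V'" if "i < n" for i
    using act_closed[OF X' h] qV[OF that] by (simp add: VU)
  let ?c = "FA F (CoevR C D X) (FU F 1)"
  have cc: "?c \<in> carrier (FO F (X' \<boxtimes> X))" unfolding X'_def by (rule FA_closed[OF CoevR_hom[OF X] FU_closed])
  have c: "FTinv F X' X ?c = finsum (V' \<otimes>\<^sub>v V) (\<lambda>i. tens V' V (q i) (r i)) {..<n}"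
  proof -
    have "FTinv F X' X ?c = finsum (V' \<otimes>\<^sub>v V) (\<lambda>i. FTinv F X' X (pr X' X (q i) (r i))) {..<n}"
      unfolding cR VU X'_def[symmetric]
      by (rule lin_finsum[OF X'X V'V[unfolded VU] FTinv_lin[OF X' X] fin])
        (use qV rV in \<open>auto simp: VU intro!: pr_closed X X'\<close>)
    also have "\<dots> = finsum (V' \<otimes>\<^sub>v V) (\<lambda>i. tens V' V (q i) (r i)) {..<n}"
      by (rule finsum_cong_on[OF V'V])
        (use qV rV tens_closed[OF V' V] in \<open>auto simp: VU FTinv_pr X X'\<close>)
    finally show ?thesis .
  qed
  let ?k1 = "tensor_map V' V V' V (ac X' h) (\<lambda>v. v)"
  have ach: "ac X' h \<in> lin V' V'" unfolding VU by (rule act_lin(1)[OF X' h])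
  note k1 = tensor_map[OF V' V V' V ach I]
  have U1: "FU F 1 \<in> carrier U" using FU_closed by (simp add: VU)
  have j2: "FT F X X' \<in> lin (V \<otimes>\<^sub>v V') (FO F (X \<boxtimes> X'))" unfolding VU by (rule FT_lin[OF X X'])
  have j3: "FA F (EvR C D X) \<in> lin (FO F (X \<boxtimes> X')) U" unfolding VU X'_def by (rule FA_lin[OF EvR_hom[OF X]])
  have j4: "inv_on cunit (FU F) \<in> lin U cunit" using scal_lin by (simp only: VU scal_def)
  let ?s = "\<lambda>i. tens V V' x (ac X' h (q i))"
  have s0: "?s \<in> {..<n} \<rightarrow> carrier (V \<otimes>\<^sub>v V')" using hq tens_closed[OF V V' xV] by auto
  have s2: "(\<lambda>i. FT F X X' (?s i)) \<in> {..<n} \<rightarrow> carrier (FO F (X \<boxtimes> X'))" using s0 lin_closed[OF j2] by auto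
  have s3: "(\<lambda>i. FA F (EvR C D X) (FT F X X' (?s i))) \<in> {..<n} \<rightarrow> carrier U" using s2 lin_closed[OF j3] by auto
  define e where "e i = scal (FA F (EvR C D X) (pr X X' x (ac X' h (q i))))" for i
  have val: "inv_on cunit (FU F) (FA F (EvR C D X) (FT F X X' (?s i))) = e i" for i
    by (simp only: e_def scal_def pr_def VU)
  have x1: "tensor_map V cunit V U (\<lambda>v. v) (FU F) (vlunit V x) = tens V U x (FU F 1)"
    unfolding vlunit_def by (rule tensor_map(2)[OF V cspace_cunit V U I _ xV]) (use FU_lin in \<open>auto simp: VU\<close>)
  have x2: "tensor_map V U V (FO F (X' \<boxtimes> X)) (\<lambda>v. v) (FA F (CoevR C D X)) (tens V U x (FU F 1)) =
      tens V (FO F (X' \<boxtimes> X)) x ?c"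
    by (rule tensor_map(2)[OF V U V X'X I _ xV U1]) (use FA_lin[OF CoevR_hom[OF X]] in \<open>auto simp: VU X'_def\<close>)
  have x3: "tensor_map V (FO F (X' \<boxtimes> X)) V (V' \<otimes>\<^sub>v V) (\<lambda>v. v) (FTinv F X' X) (tens V (FO F (X' \<boxtimes> X)) x ?c) =
      tens V (V' \<otimes>\<^sub>v V) x (finsum (V' \<otimes>\<^sub>v V) (\<lambda>i. tens V' V (q i) (r i)) {..<n})"
    unfolding c[symmetric] by (rule tensor_map(2)[OF V X'X V V'V I _ xV cc]) (use FTinv_lin[OF X' X] in \<open>auto simp: VU\<close>)
  have x4: "tensor_map V (V' \<otimes>\<^sub>v V) V (V' \<otimes>\<^sub>v V) (\<lambda>v. v) ?k1
        (tens V (V' \<otimes>\<^sub>v V) x (finsum (V' \<otimes>\<^sub>v V) (\<lambda>i. tens V' V (q i) (r i)) {..<n})) =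
      tens V (V' \<otimes>\<^sub>v V) x (finsum (V' \<otimes>\<^sub>v V) (\<lambda>i. tens V' V (ac X' h (q i)) (r i)) {..<n})"
  proof -
    have "?k1 (finsum (V' \<otimes>\<^sub>v V) (\<lambda>i. tens V' V (q i) (r i)) {..<n}) =
        finsum (V' \<otimes>\<^sub>v V) (\<lambda>i. tens V' V (ac X' h (q i)) (r i)) {..<n}"
      by (rule tensor_map_finsum[OF V' V V' V ach I fin _ rP]) (use qV in auto)
    moreover have "finsum (V' \<otimes>\<^sub>v V) (\<lambda>i. tens V' V (q i) (r i)) {..<n} \<in> carrier (V' \<otimes>\<^sub>v V)"
      by (rule finsum_in[OF V'V]) (use qV rV tens_closed[OF V' V] in auto)
    ultimately show ?thesis using tensor_map(2)[OF V V'V V V'V I k1(1) xV] by simp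
  qed
  \<comment> \<open>The inverse associator is evaluated backwards: \<open>vassoc\<close> maps the
    claimed result to the given vector, and \<open>vassoc_inverse\<close> cancels it.\<close>
  have x5: "inv_on ((V \<otimes>\<^sub>v V') \<otimes>\<^sub>v V) (vassoc V V' V)
        (tens V (V' \<otimes>\<^sub>v V) x (finsum (V' \<otimes>\<^sub>v V) (\<lambda>i. tens V' V (ac X' h (q i)) (r i)) {..<n})) =
      finsum ((V \<otimes>\<^sub>v V') \<otimes>\<^sub>v V) (\<lambda>i. tens (V \<otimes>\<^sub>v V') V (?s i) (r i)) {..<n}"
  proof -
    have in3: "(\<lambda>i. tens (V \<otimes>\<^sub>v V') V (?s i) (r i)) \<in> {..<n} \<rightarrow> carrier ((V \<otimes>\<^sub>v V') \<otimes>\<^sub>v V)"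
      using s0 rV tens_closed[OF VV' V] by auto
    have "vassoc V V' V (finsum ((V \<otimes>\<^sub>v V') \<otimes>\<^sub>v V) (\<lambda>i. tens (V \<otimes>\<^sub>v V') V (?s i) (r i)) {..<n}) =
        finsum (V \<otimes>\<^sub>v (V' \<otimes>\<^sub>v V)) (\<lambda>i. vassoc V V' V (tens (V \<otimes>\<^sub>v V') V (?s i) (r i))) {..<n}"
      by (rule lin_finsum[OF cspace_tensor[OF VV' V] cspace_tensor[OF V V'V] vassoc(1)[OF V V' V] fin in3])
    also have "\<dots> = finsum (V \<otimes>\<^sub>v (V' \<otimes>\<^sub>v V)) (\<lambda>i. tens V (V' \<otimes>\<^sub>v V) x (tens V' V (ac X' h (q i)) (r i))) {..<n}"
      by (rule finsum_cong_on[OF cspace_tensor[OF V V'V]])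
        (use hq rV xV vassoc(2)[OF V V' V] tens_closed[OF V V'V] tens_closed[OF V' V] in auto)
    also have "\<dots> = tens V (V' \<otimes>\<^sub>v V) x (finsum (V' \<otimes>\<^sub>v V) (\<lambda>i. tens V' V (ac X' h (q i)) (r i)) {..<n})"
      by (rule tens_finsum(1)[OF V V'V fin xV, symmetric]) (use hq rV tens_closed[OF V' V] in auto)
    finally show ?thesis
      using vassoc_inverse[OF V V' V finsum_in[OF cspace_tensor[OF VV' V] in3]] by simp
  qed
  have x6: "tensor_map (V \<otimes>\<^sub>v V') V (FO F (X \<boxtimes> X')) V (FT F X X') (\<lambda>v. v)
        (finsum ((V \<otimes>\<^sub>v V') \<otimes>\<^sub>v V) (\<lambda>i. tens (V \<otimes>\<^sub>v V') V (?s i) (r i)) {..<n}) =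
      finsum (FO F (X \<boxtimes> X') \<otimes>\<^sub>v V) (\<lambda>i. tens (FO F (X \<boxtimes> X')) V (FT F X X' (?s i)) (r i)) {..<n}"
    by (rule tensor_map_finsum[OF VV' V XX' V j2 I fin s0 rP])
  have x7: "tensor_map (FO F (X \<boxtimes> X')) V U V (FA F (EvR C D X)) (\<lambda>v. v)
        (finsum (FO F (X \<boxtimes> X') \<otimes>\<^sub>v V) (\<lambda>i. tens (FO F (X \<boxtimes> X')) V (FT F X X' (?s i)) (r i)) {..<n}) =
      finsum (U \<otimes>\<^sub>v V) (\<lambda>i. tens U V (FA F (EvR C D X) (FT F X X' (?s i))) (r i)) {..<n}"
    by (rule tensor_map_finsum[OF XX' V U V j3 I fin s2 rP])
  have x8: "tensor_map U V cunit V (inv_on cunit (FU F)) (\<lambda>v. v)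
        (finsum (U \<otimes>\<^sub>v V) (\<lambda>i. tens U V (FA F (EvR C D X) (FT F X X' (?s i))) (r i)) {..<n}) =
      finsum (cunit \<otimes>\<^sub>v V) (\<lambda>i. tens cunit V (e i) (r i)) {..<n}"
    unfolding val[symmetric] by (rule tensor_map_finsum[OF U V cspace_cunit V j4 I fin s3 rP])
  have x9: "\<dots> = vrunit V (finsum V (\<lambda>i. e i \<odot>\<^bsub>V\<^esub> r i) {..<n})"
  proof -
    have "finsum (cunit \<otimes>\<^sub>v V) (\<lambda>i. tens cunit V (e i) (r i)) {..<n} =
        finsum (cunit \<otimes>\<^sub>v V) (\<lambda>i. tens cunit V 1 (e i \<odot>\<^bsub>V\<^esub> r i)) {..<n}"
    proof (rule finsum_cong_on[OF cspace_tensor[OF cspace_cunit V]])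
      show "tens cunit V (e i) (r i) = tens cunit V 1 (e i \<odot>\<^bsub>V\<^esub> r i)" if "i \<in> {..<n}" for i
        using tens_bilinear(3,4)[OF cspace_cunit V _ rV[of i], of 1 "e i"] that by simp
    qed (use rV cspaceD(2)[OF V] tens_closed[OF cspace_cunit V] in auto)
    also have "\<dots> = vrunit V (finsum V (\<lambda>i. e i \<odot>\<^bsub>V\<^esub> r i) {..<n})"
      unfolding vrunit_def
      by (rule tens_finsum(1)[OF cspace_cunit V fin, symmetric]) (use rV cspaceD(2)[OF V] in auto)
    finally show ?thesis .
  qed
  have "antipode_inv_action h X x = inv_on V (vrunit V) (vrunit V (finsum V (\<lambda>i. e i \<odot>\<^bsub>V\<^esub> r i) {..<n}))"
    unfolding antipode_inv_action_def Let_def X'_def[symmetric] VU[symmetric] x1 x2 x3 x4 x5 x6 x7 x8 x9 ..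
  also have "\<dots> = finsum V (\<lambda>i. e i \<odot>\<^bsub>V\<^esub> r i) {..<n}"
    by (rule vrunit_inverse[OF V finsum_in[OF V]]) (use rV cspaceD(2)[OF V] in auto)
  finally show ?thesis by (simp only: VU X'_def e_def)
qed

text \<open>After the formulas for right evaluation and coevaluation are inserted, fb is applied:
  its antilinearity cancels the complex conjugates, and what remains is the expansion of S (T h) (fb
  x) in dual families of the conjugate object. By the intertwining property of T this is fb of T (S
  (T h)) x.\<close>

lemma antipode_inv_eq:
  assumes h: "h \<in> carrier H" shows "Sinv h = T (S (T h))"
proof -
  have Sr: "Sinv h = rep_elt C F H \<theta> (antipode_inv_action h)"
    by (simp add: rep_antipode_inv_def antipode_inv_action_def)
  note Th = T_act(1)[OF h]
  note STh = antipode(1)[OF Th]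
  show ?thesis
    unfolding Sr
  proof (rule rep_elt_eqI[OF T_act(1)[OF STh]])
    fix X x assume X: "X \<in> Obj C" and x: "x \<in> carrier (FO F X)"
    let ?Y = "bo X" and ?Y' = "DualO D (bo X)"
    note Y = BarO_obj[OF X]
    note Y' = DualO_obj[OF Y] and fx = FB_closed[OF X x]
    note V = FO_cspace[OF X] and W = FO_cspace[OF Y]
    obtain n p q where db: "dual_bases ?Y n p q" by (rule dual_bases_exist[OF Y])
    note dc = dual_bases_closed[OF Y db]
    have "antipode_inv_action h X x = finsum (FO F X) (\<lambda>i. scal (FA F (EvR C D X) (pr X (RDualO C D X) x
        (ac (RDualO C D X) h (FB F ?Y' (q i))))) \<odot>\<^bsub>FO F X\<^esub> FBinv F X (p i)) {..<n}"
      by (rule antipode_inv_action_sum[OF X h x _ _ FA_CoevR[OF X db]])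
        (use dc in \<open>auto simp: RDualO_def intro!: FB_closed Y' FBinv_closed X\<close>)
    also have "\<dots> = finsum (FO F X) (\<lambda>i. cnj (ev ?Y (ac ?Y' (T h) (q i)) (FB F X x)) \<odot>\<^bsub>FO F X\<^esub> FBinv F X (p i)) {..<n}"
    proof (rule finsum_cong_on[OF V])
      fix i assume "i \<in> {..<n}"
      then have qi: "q i \<in> carrier (FO F ?Y')" using dc by auto
      \<comment> \<open>The right dual is a conjugate object, so the action of h after fb is fb
        after the action of T h.\<close>
      have "ac (RDualO C D X) h (FB F ?Y' (q i)) = FB F ?Y' (ac ?Y' (T h) (q i))"
        by (simp add: T_act h Y' qi RDualO_def)
      then show "scal (FA F (EvR C D X) (pr X (RDualO C D X) x (ac (RDualO C D X) h (FB F ?Y' (q i))))) \<odot>\<^bsub>FO F X\<^esub> FBinv F X (p i) =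
          cnj (ev ?Y (ac ?Y' (T h) (q i)) (FB F X x)) \<odot>\<^bsub>FO F X\<^esub> FBinv F X (p i)"
        by (simp add: FA_EvR X x act_closed Y' Th qi scal_FU)
    qed (use dc in \<open>auto intro!: cspaceD(2)[OF V] FBinv_closed X\<close>)
    finally have a: "antipode_inv_action h X x =
      finsum (FO F X) (\<lambda>i. cnj (ev ?Y (ac ?Y' (T h) (q i)) (FB F X x)) \<odot>\<^bsub>FO F X\<^esub> FBinv F X (p i)) {..<n}" .
    have t: "(\<lambda>i. cnj (ev ?Y (ac ?Y' (T h) (q i)) (FB F X x)) \<odot>\<^bsub>FO F X\<^esub> FBinv F X (p i)) \<in> {..<n} \<rightarrow> carrier (FO F X)"
      using dc by (auto intro!: cspaceD(2)[OF V] FBinv_closed X)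
    have "FB F X (antipode_inv_action h X x) =
        finsum (FO F ?Y) (\<lambda>i. FB F X (cnj (ev ?Y (ac ?Y' (T h) (q i)) (FB F X x)) \<odot>\<^bsub>FO F X\<^esub> FBinv F X (p i))) {..<n}"
      unfolding a by (rule FB_finsum[OF X _ t]) simp
    also have "\<dots> = finsum (FO F ?Y) (\<lambda>i. ev ?Y (q i) (ac ?Y (S (T h)) (FB F X x)) \<odot>\<^bsub>FO F ?Y\<^esub> p i) {..<n}"
      by (rule finsum_cong_on[OF W])
        (use dc in \<open>auto simp: FB_smult X FBinv_closed FB_FBinv antipode Th Y fx intro!: cspaceD(2)[OF W]\<close>)
    also have "\<dots> = FB F X (ac X (T (S (T h))) x)"
      by (simp add: dual_bases_left[OF Y db] act_closed Y STh fx T_act X x)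
    finally have "FB F X (ac X (T (S (T h))) x) = FB F X (antipode_inv_action h X x)" ..
    then show "ac X (T (S (T h))) x = antipode_inv_action h X x"
      by (rule FB_cancel[OF X act_closed[OF X T_act(1)[OF STh] x] finsum_in[OF V t, folded a]])
  qed
qed

text \<open>The right evaluation makes \<open>X\<close> a left dual of its right dual \<open>X\<^sup>\<circ>\<close>: it factors through a
  morphism \<open>X \<rightarrow> (X\<^sup>\<circ>)'\<close>, and \<open>S\<close> can be evaluated on \<open>X\<^sup>\<circ>\<close>.\<close>

lemma T_S_T_S:
  assumes h: "h \<in> carrier H" shows "T (S (T (S h))) = h"
proof -
  note Sh = antipode(1)[OF h]
  note TSh = T_act(1)[OF Sh]
  note STSh = antipode(1)[OF TSh]
  show ?thesis
  proof (rule T_eqI[OF STSh h])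
    fix X x assume X: "X \<in> Obj C" and x: "x \<in> carrier (FO F X)"
    let ?Y = "bo X" and ?Y' = "DualO D (bo X)" and ?R = "RDualO C D X"
    note Y = BarO_obj[OF X]
    note Y' = DualO_obj[OF Y] and fx = FB_closed[OF X x] and R = RDualO_obj[OF X]
    note hx = act_closed[OF X h x]
    obtain w where w: "w \<in> Hom C X (DualO D ?R)"
      and ew: "\<And>v \<phi>. v \<in> carrier (FO F X) \<Longrightarrow> \<phi> \<in> carrier (FO F ?R) \<Longrightarrow>
        ev ?R (FA F w v) \<phi> = scal (FA F (EvR C D X) (pr X ?R v \<phi>))"
      by (rule pairing_factors_through_dual[OF X R EvR_hom[OF X]], rule that) simp_all
    \<comment> \<open>This is a left evaluation, that of the right dual, so the transposition
      formula for S applies to it.\<close>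
    have pair: "ev ?R (FA F w v) (FB F ?Y' \<psi>) = cnj (ev ?Y \<psi> (FB F X v))"
      if "v \<in> carrier (FO F X)" "\<psi> \<in> carrier (FO F ?Y')" for v \<psi>
      using that FB_closed[OF Y' that(2)] by (simp add: ew FA_EvR X scal_FU RDualO_def[symmetric])
    show "FB F X (ac X h x) = ac ?Y (S (T (S h))) (FB F X x)"
    proof (rule ev_nondegenerate[OF Y FB_closed[OF X hx] act_closed[OF Y STSh fx]])
      fix \<psi> assume \<psi>: "\<psi> \<in> carrier (FO F ?Y')"
      have f\<psi>: "FB F ?Y' \<psi> \<in> carrier (FO F ?R)" using FB_closed[OF Y' \<psi>] by (simp add: RDualO_def)
      have "cnj (ev ?Y \<psi> (ac ?Y (S (T (S h))) (FB F X x))) = cnj (ev ?Y (ac ?Y' (T (S h)) \<psi>) (FB F X x))"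
        by (simp add: antipode TSh Y \<psi> fx)
      also have "\<dots> = ev ?R (FA F w x) (FB F ?Y' (ac ?Y' (T (S h)) \<psi>))"
        by (simp add: pair x act_closed Y' TSh \<psi>)
      also have "\<dots> = ev ?R (FA F w x) (ac ?R (S h) (FB F ?Y' \<psi>))"
        by (simp add: T_act Sh Y' \<psi> RDualO_def)
      also have "\<dots> = ev ?R (FA F w (ac X h x)) (FB F ?Y' \<psi>)"
        by (simp add: antipode h R FA_closed[OF w x] f\<psi> act_nat[OF w h x])
      also have "\<dots> = cnj (ev ?Y \<psi> (FB F X (ac X h x)))" by (rule pair[OF hx \<psi>])
      finally show "ev ?Y \<psi> (FB F X (ac X h x)) = ev ?Y \<psi> (ac ?Y (S (T (S h))) (FB F X x))" by simp
    qed
  qed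
qed

text \<open>The involution T applied to the relation T S T S = id.\<close>

lemma S_T_S: "h \<in> carrier H \<Longrightarrow> S (T (S h)) = T h"
  using T_T[of "S (T (S h))"] T_S_T_S[of h] antipode(1) T_act(1) by metis

text \<open>With \<open>Sinv\<close> read as T S T, one composite is T S T S = id, and the other is
  (S T S) T = T T = id.\<close>

lemma antipode_inverse:
  assumes h: "h \<in> carrier H"
  shows "Sinv h \<in> carrier H" "Sinv (S h) = h" "S (Sinv h) = h"
  using h by (simp_all add: antipode_inv_eq antipode T_act T_S_T_S S_T_S T_T)

section \<open>The star operation\<close>

lemma star_eq: "h \<in> carrier H \<Longrightarrow> star h = S (T h)"
  by (simp add: rep_star_def antipode_inv_eq T_T antipode T_act)

lemma star_star_eq: "h \<in> carrier H \<Longrightarrow> star (star h) = h"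
  by (simp add: star_eq antipode T_act S_T_S T_T)

lemma star_mult:
  "a \<in> carrier H \<Longrightarrow> b \<in> carrier H \<Longrightarrow> star (a \<otimes>\<^bsub>A\<^esub> b) = star b \<otimes>\<^bsub>A\<^esub> star a"
  by (simp add: star_eq mult_A T_mult antipode_mult T_act)

text \<open>Both sides equal T h: the left one by \<open>S_T_S\<close>, the right one because
  \<open>Sinv\<close> cancels S in S (T h).\<close>

lemma star_antipode: "h \<in> carrier H \<Longrightarrow> star (S h) = Sinv (star h)"
  by (simp add: star_eq antipode_inv_eq antipode T_act S_T_S T_T)

lemma star_antilinear: "star \<in> lin H (conj_space H)"
  by (rule lin_cong[OF lin_comp[OF T_antilinear lin_conj_space[OF antipode_lin]] H_cspace]) (rule star_eq)

text \<open>The two exchanges of factors cancel. The linear map induced by S is regarded as linear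
  between conjugate spaces, so that it composes with the antilinear lift of T and the result can be
  compared on pure tensors.\<close>

lemma star_coproduct:
  assumes h: "h \<in> carrier H" shows "\<Delta> (star h) = tensor_star A star (\<Delta> h)"
proof -
  note HH = cspace_tensor[OF H_cspace H_cspace] and D = coproduct(1)[OF h]
  note s = tensor_lift[OF H_cspace H_cspace HH flip_map_bilinear[OF antipode_lin]]
  note t = tensor_lift[OF H_cspace H_cspace cspace_conj_space[OF HH] conj_tens_bilinear(2)[OF star_antilinear]]
  have "\<Delta> (star h) = tensor_lift H H HH (\<lambda>a b. tens H H (S b) (S a))
      (tensor_lift H H (conj_space HH) (\<lambda>a b. tens H H (T b) (T a)) (\<Delta> h))"
    by (simp add: star_eq h coproduct_antipode T_act coproduct_T)
  also have "\<dots> = tensor_lift H H (conj_space HH) (\<lambda>a b. tens H H (star a) (star b)) (\<Delta> h)"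
    by (rule lin_comp_lift[OF H_cspace H_cspace cspace_conj_space[OF HH] cspace_conj_space[OF HH]
          conj_tens_bilinear(1)[OF T_antilinear] lin_conj_space[OF s(1)] t(1) D])
      (simp add: s t T_act star_eq)
  finally show ?thesis by (simp add: tensor_star_def)
qed

lemma conj_space_A_lin: "lin H (conj_space A) = lin H (conj_space H)"
  by (simp add: lin_def)

lemma star_hopf_algebra: "star_hopf_algebra A \<Delta> \<epsilon> S star"
  by (rule star_hopf_algebra.intro[OF hopf_algebra], rule star_hopf_algebra_axioms.intro)
    (simp_all add: conj_space_A_lin star_antilinear star_mult star_star_eq star_coproduct)

end

theorem theoremA5:
  fixes C :: "('o, 'm, 'z) bar_scheme" and D :: "('o, 'm) duals" and F :: "('o, 'm, 'v) vfunctor"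
    and H :: "'v cvs" and \<theta> :: "'v cvs \<Rightarrow> ('v \<Rightarrow> 'v) \<Rightarrow> 'o \<Rightarrow> ('v, 'v) tensor \<Rightarrow> 'v"
  assumes "strong_bar_category C"
    and "left_duals C D"
    and "bar_vfunctor C F"
    and "represents C F H \<theta>"
    and "has_coproduct C F H \<theta>"
  shows "let A = rep_algebra C F H \<theta>; \<Delta> = rep_coproduct C F H \<theta>; \<epsilon> = rep_counit C F H \<theta>;
      S = rep_antipode C D F H \<theta>; Sinv = rep_antipode_inv C D F H \<theta>; star = rep_star C D F H \<theta>
    in (\<forall>a\<in>carrier A. \<forall>b\<in>carrier A. star (a \<otimes>\<^bsub>A\<^esub> b) = star b \<otimes>\<^bsub>A\<^esub> star a)
     \<and> (\<forall>a\<in>carrier A. star (star a) = a)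
     \<and> (\<forall>h\<in>carrier A. \<Delta> (star h) = tensor_star A star (\<Delta> h))
     \<and> (\<forall>h\<in>carrier A. Sinv h \<in> carrier A \<and> Sinv (S h) = h \<and> S (Sinv h) = h)
     \<and> (\<forall>h\<in>carrier A. star (S h) = Sinv (star h))
     \<and> star_hopf_algebra A \<Delta> \<epsilon> S star"
proof -
  interpret strong_bar_category C by fact
  interpret left_duals C D by fact
  interpret bar_vfunctor C F by fact
  interpret represents C F H \<theta> by fact
  interpret reconstructed_star_hopf_algebra C F H \<theta> D
    \<comment> \<open>The one locale axiom not supplied by the earlier interpretations is the
      existence of the coproduct.\<close>
    by unfold_locales fact
  show ?thesis
    unfolding Let_def
    using star_mult star_star_eq star_coproduct antipode_inverse star_antipode star_hopf_algebra by simp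
qed

end
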